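(* Let $\pi:\mathcal{X}\to\Delta$ be a holomorphic family of compact complex manifolds $X_t=\pi^{-1}(t)$ over a sufficiently small neighbourhood $\Delta\subset\mathbb{C}^m$ of $0$, with a fixed transversely holomorphic trivialization and associated Beltrami differential $\phi(t)\in A^{0,1}(X_0,T^{1,0}X_0)$. Let $P_t=(I_t^{p,q})^{-1}\circ e^{i_{\phi(t)}}\circ I_0^{p,q}:A^{p,q}(X_0)\to A^{p,q}(X_t)$. Then for all $t\in\Delta$, all $p,q$ and every $(p,q)$-form $s\in A^{p,q}(X_0)$, $$\bar\partial_t\circ P_t(s)=P_t\circ\left(\bar\partial-L^{1,0}_{\phi(t)}\right)s,$$ where $\bar\partial_t$ and $\bar\partial$ are the Dolbeault operators of $X_t$ and $X_0$ respectively, and $L^{1,0}_{\phi(t)}=i_{\phi(t)}\circ\partial-\partial\circ i_{\phi(t)}$.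
   Context: Family and trivialization. $\pi:\mathcal{X}\to\Delta$ is a holomorphic proper submersion and $n=\dim_{\mathbb{C}}X_0$. A transversely holomorphic trivialization is a diffeomorphism $(\sigma,\pi):\mathcal{X}\to X_0\times\Delta$ with $\sigma|_{X_0}=\mathrm{id}$ and such that each $\sigma^{-1}(x)$, $x\in X_0$, is a complex submanifold of $\mathcal{X}$ (it exists for small $\Delta$). Using $\sigma_t=\sigma|_{X_t}:X_t\to X_0$ we regard $X_t$ as the smooth manifold $X_0$ with another complex structure. $A^{p,q}(X_t,V)$ denotes smooth $V$-valued forms of type $(p,q)$ with respect to the complex structure of $X_t$. Beltrami differential. If $(z_t^k)$ are local holomorphic coordinates of $X_t$ (viewed as functions on $X_0$ via $\sigma_t$) and $z=z_0$, then $\phi(t)=\left(\frac{\partial z_t}{\partial z}\right)^{-1}_{ik}\frac{\partial z_t^k}{\partial\bar z^j}\,d\bar z^j\otimes\frac{\partial}{\partial z^i}$; write $\phi^i=\phi^i_jd\bar z^j$. It satisfies $\bar\partial\phi(t)=\frac12[\phi(t),\phi(t)]$, and the $(1,0)$-forms on $X_t$ are the forms $\alpha+i_{\phi(t)}\alpha$ with $\alpha$ of type $(1,0)$ on $X_0$. Operators. $i_\phi\beta=\sum_i\phi^i\wedge(\iota_{\partial/\partial z^i}\beta)$, extended to bundle-valued forms by acting on the form part; $e^{i_\phi}=\sum_{k\ge0}\frac1{k!}i_\phi^k$. The map $P_t$. $\Omega_t$ is the holomorphic cotangent bundle of $X_t$, $\Omega_t^p=\Lambda^p\Omega_t$, $K_t=\Omega_t^n$.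 For local holomorphic coordinates $(z^i)$ of $X_t$, with $\langle dz\rangle=dz^1\wedge\cdots\wedge dz^n$, the isomorphism $I_t^{p,q}:A^{p,q}(X_t)\to A^{n,q}(X_t,\Omega_t^p\otimes K_t^{-1})$ is $$I_t^{p,q}\Big(\sum_{I,J}s_{I,\bar J}\,d\bar z^J\wedge dz^I\Big)=\sum_{I,J}s_{I,\bar J}\,d\bar z^J\wedge\langle dz\rangle\otimes dz^I\otimes\tfrac{1}{\langle dz\rangle}.$$ The bundle $\Omega_t$ is identified smoothly with $\Omega_0$ by the isomorphism (for small $t$) $\pi^{1,0}:\Omega_t\to\Omega_0$, $dz_t^k\mapsto\frac{\partial z_t^k}{\partial z^j}dz^j$ (the $(1,0)$-part with respect to $X_0$); this induces identifications $\Omega_t^p\cong\Omega_0^p$, $K_t^{-1}\cong K_0^{-1}$. With these identifications of the coefficient bundles, $e^{i_{\phi(t)}}$, acting on the form part, is an isomorphism $A^{n,q}(X_0,\Omega_0^p\otimes K_0^{-1})\to A^{n,q}(X_t,\Omega_t^p\otimes K_t^{-1})$. *)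

theory Defs
  imports "HOL-Analysis.Analysis"
begin

section \<open>Smooth and holomorphic maps between open sets\<close>

primrec Ck_on :: "nat \<Rightarrow> 'a::real_normed_vector set \<Rightarrow> ('a \<Rightarrow> 'b::real_normed_vector) \<Rightarrow> bool" where
  "Ck_on 0 S f \<longleftrightarrow> continuous_on S f"
| "Ck_on (Suc k) S f \<longleftrightarrow> (\<forall>x\<in>S. f differentiable (at x)) \<and>
     (\<forall>v. Ck_on k S (\<lambda>x. frechet_derivative f (at x) v))"

text \<open>Only used for open \<open>S\<close>.\<close>

definition smooth_on :: "'a::real_normed_vector set \<Rightarrow> ('a \<Rightarrow> 'b::real_normed_vector) \<Rightarrow> bool" where
  "smooth_on S f \<longleftrightarrow> (\<forall>k. Ck_on k S f)"

text \<open>Holomorphic maps of several variables: smooth, with complex linear differential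
  (the Cauchy--Riemann equations).\<close>

definition holo_on ::
  "(complex^'a::finite) set \<Rightarrow> (complex^'a \<Rightarrow> complex^'b::finite) \<Rightarrow> bool" where
  "holo_on S f \<longleftrightarrow> smooth_on S f \<and>
     (\<forall>x\<in>S. \<forall>c v. frechet_derivative f (at x) (c *s v) = c *s frechet_derivative f (at x) v)"


section \<open>Complex manifolds\<close>

text \<open>A chart is its domain together with its coordinate map, whose values outside the domain are
  irrelevant. A manifold is a set in a topological space with an atlas; Hausdorffness and second
  countability come from the type class of the ambient space.\<close>

type_synonym ('x, 'e) chart = "'x set \<times> ('x \<Rightarrow> 'e)"

definition chart_inv :: "('x, 'e) chart \<Rightarrow> 'e \<Rightarrow> 'x" where
  "chart_inv c = inv_into (fst c) (snd c)"

definition chart_on :: "'x::topological_space set \<Rightarrow> ('x, 'e::topological_space) chart \<Rightarrow> bool" where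
  "chart_on M c \<longleftrightarrow> openin (top_of_set M) (fst c) \<and> open (snd c ` fst c) \<and>
     homeomorphism (fst c) (snd c ` fst c) (snd c) (chart_inv c)"

definition holo_compatible :: "('x, complex^'d) chart \<Rightarrow> ('x, complex^'d) chart \<Rightarrow> bool" where
  "holo_compatible c d \<longleftrightarrow>
     holo_on (snd c ` (fst c \<inter> fst d)) (snd d \<circ> chart_inv c) \<and>
     holo_on (snd d ` (fst c \<inter> fst d)) (snd c \<circ> chart_inv d)"

definition complex_manifold ::
  "'x::{t2_space,second_countable_topology} set \<Rightarrow> ('x, complex^'d) chart set \<Rightarrow> bool" where
  "complex_manifold M A \<longleftrightarrow> M = \<Union> (fst ` A) \<and> (\<forall>c\<in>A. chart_on M c) \<and>
     (\<forall>c\<in>A. \<forall>d\<in>A. holo_compatible c d)"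

definition max_atlas ::
  "'x::topological_space set \<Rightarrow> ('x, complex^'d) chart set \<Rightarrow> ('x, complex^'d) chart set" where
  "max_atlas M A = {c. chart_on M c \<and> (\<forall>d\<in>A. holo_compatible c d)}"

definition smooth_map ::
  "'x::topological_space set \<Rightarrow> ('x, 'e::real_normed_vector) chart set \<Rightarrow>
   'y::topological_space set \<Rightarrow> ('y, 'f::real_normed_vector) chart set \<Rightarrow> ('x \<Rightarrow> 'y) \<Rightarrow> bool" where
  "smooth_map M A N B f \<longleftrightarrow> f ` M \<subseteq> N \<and> continuous_on M f \<and>
     (\<forall>c\<in>A. \<forall>d\<in>B. smooth_on (snd c ` (fst c \<inter> f -` fst d)) (snd d \<circ> f \<circ> chart_inv c))"

definition holo_map ::
  "'x::topological_space set \<Rightarrow> ('x, complex^'a) chart set \<Rightarrow>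
   'y::topological_space set \<Rightarrow> ('y, complex^'b) chart set \<Rightarrow> ('x \<Rightarrow> 'y) \<Rightarrow> bool" where
  "holo_map M A N B f \<longleftrightarrow> f ` M \<subseteq> N \<and> continuous_on M f \<and>
     (\<forall>c\<in>A. \<forall>d\<in>B. holo_on (snd c ` (fst c \<inter> f -` fst d)) (snd d \<circ> f \<circ> chart_inv c))"

definition diffeo ::
  "'x::topological_space set \<Rightarrow> ('x, 'e::real_normed_vector) chart set \<Rightarrow>
   'y::topological_space set \<Rightarrow> ('y, 'f::real_normed_vector) chart set \<Rightarrow> ('x \<Rightarrow> 'y) \<Rightarrow> bool" where
  "diffeo M A N B f \<longleftrightarrow> bij_betw f M N \<and> smooth_map M A N B f \<and>
     smooth_map N B M A (inv_into M f)"

text \<open>Product of a manifold with an open set of a vector space.\<close>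

definition prod_charts :: "('x, 'e) chart set \<Rightarrow> 'f set \<Rightarrow> ('x \<times> 'f, 'e \<times> 'f) chart set" where
  "prod_charts B D = (\<lambda>(U, z). (U \<times> D, map_prod z id)) ` B"

definition complex_submanifold ::
  "'x::topological_space set \<Rightarrow> ('x, complex^'d) chart set \<Rightarrow> 'x set \<Rightarrow> bool" where
  "complex_submanifold M A S \<longleftrightarrow> S \<subseteq> M \<and>
     (\<forall>x\<in>S. \<exists>c\<in>max_atlas M A. \<exists>K. x \<in> fst c \<and>
        snd c ` (fst c \<inter> S) = snd c ` fst c \<inter> {v. \<forall>i\<in>K. v $ i = 0})"

text \<open>The complex structure induced on a complex submanifold \<open>S\<close> of codimension \<open>CARD('m)\<close>: the
  charts of \<open>M\<close> in which \<open>S\<close> is the locus where the last \<open>CARD('m)\<close> coordinates vanish, restricted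
  to \<open>S\<close>.\<close>

definition slice_charts ::
  "'x::topological_space set \<Rightarrow> ('x, complex^('n::finite + 'm::finite)) chart set \<Rightarrow> 'x set \<Rightarrow>
   ('x, complex^'n) chart set" where
  "slice_charts M A S = {(fst c \<inter> S, \<lambda>x. \<chi> i. snd c x $ Inl i) | c. c \<in> max_atlas M A \<and>
     snd c ` (fst c \<inter> S) = snd c ` fst c \<inter> {v. \<forall>j. v $ Inr j = 0}}"


section \<open>Families and trivializations\<close>

text \<open>The total space is a whole type, of dimension \<open>n + m\<close>; the fibres have dimension \<open>n\<close>.\<close>

definition holomorphic_family ::
  "('x::{t2_space,second_countable_topology}, complex^('n::finite + 'm::finite)) chart set \<Rightarrow>
   (complex^'m) set \<Rightarrow> ('x \<Rightarrow> complex^'m) \<Rightarrow> bool" where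
  "holomorphic_family A \<Delta> \<pi> \<longleftrightarrow> complex_manifold UNIV A \<and> open \<Delta> \<and>
     holo_map UNIV A \<Delta> {(\<Delta>, id)} \<pi> \<and>
     (\<forall>K\<subseteq>\<Delta>. compact K \<longrightarrow> compact (\<pi> -` K)) \<and>
     (\<forall>c\<in>A. \<forall>x\<in>fst c. surj (frechet_derivative (\<pi> \<circ> chart_inv c) (at (snd c x))))"

definition transversely_holomorphic_trivialization ::
  "('x::{t2_space,second_countable_topology}, complex^('n::finite + 'm::finite)) chart set \<Rightarrow>
   (complex^'m) set \<Rightarrow> ('x \<Rightarrow> complex^'m) \<Rightarrow> ('x \<Rightarrow> 'x) \<Rightarrow> bool" where
  "transversely_holomorphic_trivialization A \<Delta> \<pi> \<sigma> \<longleftrightarrow>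
     diffeo UNIV A (\<pi> -` {0} \<times> \<Delta>) (prod_charts (slice_charts UNIV A (\<pi> -` {0})) \<Delta>)
       (\<lambda>x. (\<sigma> x, \<pi> x)) \<and>
     (\<forall>x\<in>\<pi> -` {0}. \<sigma> x = x) \<and>
     (\<forall>x\<in>\<pi> -` {0}. complex_submanifold UNIV A (\<sigma> -` {x}))"

text \<open>Holomorphic charts of \<open>X\<^sub>t\<close>, transported to \<open>X\<^sub>0\<close> by \<open>\<sigma>\<^sub>t\<close>.\<close>

definition fibre_charts ::
  "('x::topological_space, complex^('n::finite + 'm::finite)) chart set \<Rightarrow>
   ('x \<Rightarrow> complex^'m) \<Rightarrow> ('x \<Rightarrow> 'x) \<Rightarrow> complex^'m \<Rightarrow> ('x, complex^'n) chart set" where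
  "fibre_charts A \<pi> \<sigma> t =
     (\<lambda>(U, z). (\<sigma> ` U, z \<circ> inv_into (\<pi> -` {t}) \<sigma>)) ` slice_charts UNIV A (\<pi> -` {t})"


section \<open>Exterior algebra at a point\<close>

text \<open>An element of the complex exterior algebra of the real vector space \<open>complex^'n\<close> is a
  function on lists of vectors; its restriction to lists of length \<open>k\<close> is its component of degree
  \<open>k\<close>, an alternating real multilinear complex valued map.\<close>

type_synonym 'n cvec = "(complex, 'n) vec"
type_synonym 'n cmat = "((complex, 'n) vec, 'n) vec"
type_synonym 'n ext = "'n cvec list \<Rightarrow> complex"

text \<open>The recursion is \<open>\<iota>\<^sub>v(\<alpha> \<and> \<beta>) = \<iota>\<^sub>v\<alpha> \<and> \<beta> + (-1)^|\<alpha>| \<alpha> \<and> \<iota>\<^sub>v\<beta>\<close>. Unrolled, it is the signed sum over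
  shuffles without factorials, so \<open>(\<alpha> \<and> \<beta>)(v, w) = \<alpha> v * \<beta> w - \<alpha> w * \<beta> v\<close> in degree one.\<close>

fun wedge :: "'n ext \<Rightarrow> 'n ext \<Rightarrow> 'n ext" where
  "wedge \<alpha> \<beta> [] = \<alpha> [] * \<beta> []"
| "wedge \<alpha> \<beta> (v # vs) = wedge (\<lambda>us. \<alpha> (v # us)) \<beta> vs
     + wedge (\<lambda>us. (-1) ^ length us * \<alpha> us) (\<lambda>us. \<beta> (v # us)) vs"

definition ext_one :: "'n ext" where
  "ext_one vs = (if vs = [] then 1 else 0)"

definition one_form :: "('n cvec \<Rightarrow> complex) \<Rightarrow> 'n ext" where
  "one_form \<theta> vs = (case vs of [v] \<Rightarrow> \<theta> v | _ \<Rightarrow> 0)"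

text \<open>A coframe \<open>w\<close> consists of the covectors \<open>w k\<close>, thought of as \<open>dw\<^sup>k\<close>; the following are
  \<open>dw\<^sup>I\<close>, its conjugate and \<open>\<langle>dw\<rangle>\<close>.\<close>

type_synonym 'n coframe = "'n \<Rightarrow> 'n cvec \<Rightarrow> complex"

definition dzI :: "'n::{finite,linorder} coframe \<Rightarrow> 'n set \<Rightarrow> 'n ext" where
  "dzI w I = foldr wedge (map (\<lambda>i. one_form (w i)) (sorted_list_of_set I)) ext_one"

definition dzbarJ :: "'n::{finite,linorder} coframe \<Rightarrow> 'n set \<Rightarrow> 'n ext" where
  "dzbarJ w J = dzI (\<lambda>k v. cnj (w k v)) J"

definition vol :: "'n::{finite,linorder} coframe \<Rightarrow> 'n ext" where
  "vol w = dzI w UNIV"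

definition comb ::
  "'n::{finite,linorder} coframe \<Rightarrow> nat \<Rightarrow> nat \<Rightarrow> ('n set \<Rightarrow> 'n set \<Rightarrow> complex) \<Rightarrow> 'n ext" where
  "comb w p q s = (\<lambda>vs. \<Sum>I | card I = p. \<Sum>J | card J = q.
     s I J * wedge (dzbarJ w J) (dzI w I) vs)"

text \<open>The space of covectors of type \<open>(p,q)\<close>.\<close>

definition Lam :: "'n::{finite,linorder} coframe \<Rightarrow> nat \<Rightarrow> nat \<Rightarrow> 'n ext set" where
  "Lam w p q = range (comb w p q)"

text \<open>The coefficients \<open>s\<^sub>I\<^sub>J\<close> of an element of \<open>Lam w p q\<close>; unique for \<open>card I = p\<close>, \<open>card J = q\<close>.\<close>

definition coeffs ::
  "'n::{finite,linorder} coframe \<Rightarrow> nat \<Rightarrow> nat \<Rightarrow> 'n ext \<Rightarrow> 'n set \<Rightarrow> 'n set \<Rightarrow> complex" where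
  "coeffs w p q \<alpha> = (SOME s. comb w p q s = \<alpha>)"

text \<open>The component of type \<open>(p,q)\<close> in the type decomposition.\<close>

definition type_part ::
  "'n::{finite,linorder} coframe \<Rightarrow> nat \<Rightarrow> nat \<Rightarrow> 'n ext \<Rightarrow> 'n ext" where
  "type_part w p q \<alpha> = (THE \<beta>. \<exists>a. (\<forall>i j. a i j \<in> Lam w i j) \<and>
     \<alpha> = (\<lambda>vs. \<Sum>i\<le>CARD('n). \<Sum>j\<le>CARD('n). a i j vs) \<and> \<beta> = a p q)"

text \<open>Values of the complex linear extension of a real linear map on
  \<open>\<partial>/\<partial>z\<^sup>j = (e\<^sub>j - \<i> (\<i> e\<^sub>j)) / 2\<close> and its conjugate, \<open>z\<close> being the standard coordinates.\<close>

definition on_dz :: "('n::finite cvec \<Rightarrow> complex) \<Rightarrow> 'n \<Rightarrow> complex" where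
  "on_dz \<theta> j = (\<theta> (axis j 1) - \<i> * \<theta> (axis j \<i>)) / 2"

definition on_dzbar :: "('n::finite cvec \<Rightarrow> complex) \<Rightarrow> 'n \<Rightarrow> complex" where
  "on_dzbar \<theta> j = (\<theta> (axis j 1) + \<i> * \<theta> (axis j \<i>)) / 2"

definition contract :: "'n::finite \<Rightarrow> 'n ext \<Rightarrow> 'n ext" where
  "contract i \<beta> = (\<lambda>vs. on_dz (\<lambda>v. \<beta> (v # vs)) i)"

text \<open>The contraction \<open>i\<^sub>\<phi>\<close> and \<open>e^{i\<^sub>\<phi>}\<close>, where \<open>\<phi>\<^sup>i = (\<Sum>j. \<phi> $ i $ j * dzbar\<^sup>j)\<close>. The series is finite
  on alternating forms.\<close>

definition ins :: "'n::finite cmat \<Rightarrow> 'n ext \<Rightarrow> 'n ext" where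
  "ins \<phi> \<beta> = (\<lambda>vs. \<Sum>i\<in>UNIV.
     wedge (one_form (\<lambda>v. \<Sum>j\<in>UNIV. \<phi> $ i $ j * cnj (v $ j))) (contract i \<beta>) vs)"

definition exp_ins :: "'n::finite cmat \<Rightarrow> 'n ext \<Rightarrow> 'n ext" where
  "exp_ins \<phi> \<beta> = (\<lambda>vs. \<Sum>k. (1 / fact k) * (ins \<phi> ^^ k) \<beta> vs)"

text \<open>The fibre \<open>\<Omega>\<^sup>p \<otimes> K\<^sup>-\<^sup>1\<close> is represented as \<open>Hom (K, \<Omega>\<^sup>p)\<close>, with homomorphisms extended by \<open>0\<close>
  outside the line \<open>K = Lam w n 0\<close>; covectors with values in it are functions on lists of vectors.\<close>

type_synonym 'n vfibre = "'n ext \<Rightarrow> 'n ext"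
type_synonym 'n vext = "'n cvec list \<Rightarrow> 'n vfibre"

text \<open>\<open>1/\<langle>dw\<rangle>\<close> as a linear functional on \<open>K\<close>.\<close>

definition dual_vol :: "'n::{finite,linorder} coframe \<Rightarrow> 'n ext \<Rightarrow> complex" where
  "dual_vol w \<kappa> = (if \<exists>a. \<kappa> = (\<lambda>vs. a * vol w vs) then THE a. \<kappa> = (\<lambda>vs. a * vol w vs) else 0)"

definition I_at :: "'n::{finite,linorder} coframe \<Rightarrow> nat \<Rightarrow> nat \<Rightarrow> 'n ext \<Rightarrow> 'n vext" where
  "I_at w p q \<alpha> = (\<lambda>vs \<kappa> us. \<Sum>I | card I = p. \<Sum>J | card J = q.
     coeffs w p q \<alpha> I J * wedge (dzbarJ w J) (vol w) vs * (dzI w I us * dual_vol w \<kappa>))"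

text \<open>\<open>\<pi>\<^sup>1\<^sup>,\<^sup>0\<close> and the map \<open>\<Omega>\<^sub>t\<^sup>p \<rightarrow> \<Omega>\<^sub>0\<^sup>p\<close> it induces; \<open>w\<close> is the coframe \<open>dz\<^sub>t\<close> and the standard coordinates
  of \<open>complex^'n\<close> are holomorphic coordinates of \<open>X\<^sub>0\<close>.\<close>

definition pi10 :: "('n::finite cvec \<Rightarrow> complex) \<Rightarrow> 'n cvec \<Rightarrow> complex" where
  "pi10 \<theta> = (\<lambda>v. \<Sum>j\<in>UNIV. on_dz \<theta> j * v $ j)"

definition pi_p :: "'n::{finite,linorder} coframe \<Rightarrow> nat \<Rightarrow> 'n ext \<Rightarrow> 'n ext" where
  "pi_p w p \<alpha> = (\<lambda>vs. \<Sum>I | card I = p. coeffs w p 0 \<alpha> I {} * dzI (\<lambda>k. pi10 (w k)) I vs)"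

text \<open>The induced identification \<open>Hom (K\<^sub>0, \<Omega>\<^sub>0\<^sup>p) \<rightarrow> Hom (K\<^sub>t, \<Omega>\<^sub>t\<^sup>p)\<close>.\<close>

definition ident_at :: "'n::{finite,linorder} coframe \<Rightarrow> nat \<Rightarrow> 'n vfibre \<Rightarrow> 'n vfibre" where
  "ident_at w p h = (\<lambda>\<kappa>. if \<kappa> \<in> Lam w CARD('n) 0
     then inv_into (Lam w p 0) (pi_p w p) (h (pi_p w CARD('n) \<kappa>)) else (\<lambda>_. 0))"

text \<open>\<open>e^{i\<^sub>\<phi>}\<close> on the form part, followed by the identification of the coefficients.\<close>

definition exp_vins ::
  "'n::{finite,linorder} coframe \<Rightarrow> nat \<Rightarrow> 'n cmat \<Rightarrow> 'n vext \<Rightarrow> 'n vext" where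
  "exp_vins w p \<phi> \<eta> = (\<lambda>vs. ident_at w p (\<lambda>\<kappa> us. exp_ins \<phi> (\<lambda>vs'. \<eta> vs' \<kappa> us) vs))"


section \<open>Differential forms and operators\<close>

text \<open>Throughout, \<open>B\<close> is the holomorphic atlas of \<open>X\<^sub>0\<close>, and \<open>C\<close> the holomorphic atlas of a second
  complex structure on the smooth manifold \<open>X\<^sub>0\<close> (possibly \<open>B\<close> itself). A form is given by its local
  representatives in the charts of \<open>B\<close>, which identify each tangent space with \<open>complex^'n\<close>; it is
  set to \<open>0\<close> off the domains, so that equality of forms is equality of functions.\<close>

type_synonym ('x, 'n) form = "('x, 'n cvec) chart \<Rightarrow> 'x \<Rightarrow> 'n ext"
type_synonym ('x, 'n) vform = "('x, 'n cvec) chart \<Rightarrow> 'x \<Rightarrow> 'n vext"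

text \<open>The coframe \<open>dz\<^sub>t\<close> at \<open>x\<close> of some coordinates in \<open>C\<close>, in the chart \<open>c\<close>. The operators below do
  not depend on the choice of coordinates.\<close>

definition dcoord ::
  "('x, 'n::finite cvec) chart \<Rightarrow> ('x, 'n cvec) chart \<Rightarrow> 'x \<Rightarrow> 'n coframe" where
  "dcoord c d x = (\<lambda>k. frechet_derivative (\<lambda>y. snd d (chart_inv c y) $ k) (at (snd c x)))"

definition coframe_at ::
  "('x, 'n::finite cvec) chart set \<Rightarrow> ('x, 'n cvec) chart \<Rightarrow> 'x \<Rightarrow> 'n coframe" where
  "coframe_at C c x = dcoord c (SOME d. d \<in> C \<and> x \<in> fst d) x"

text \<open>The space \<open>A\<^sup>p\<^sup>,\<^sup>q\<close> of the complex structure \<open>C\<close>.\<close>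

definition smooth_forms ::
  "('x, 'n::{finite,linorder} cvec) chart set \<Rightarrow> ('x, 'n cvec) chart set \<Rightarrow> nat \<Rightarrow> nat \<Rightarrow>
   ('x, 'n) form set" where
  "smooth_forms B C p q = {\<omega>.
     (\<forall>c\<in>B. \<forall>x\<in>fst c. \<omega> c x \<in> Lam (coframe_at C c x) p q) \<and>
     (\<forall>c\<in>B. \<forall>vs. smooth_on (snd c ` fst c) (\<lambda>y. \<omega> c (chart_inv c y) vs)) \<and>
     (\<forall>c\<in>B. \<forall>d\<in>B. \<forall>x\<in>fst c \<inter> fst d. \<forall>vs. \<omega> c x vs =
        \<omega> d x (map (frechet_derivative (snd d \<circ> chart_inv c) (at (snd c x))) vs)) \<and>
     (\<forall>c x vs. \<not> (c \<in> B \<and> x \<in> fst c) \<longrightarrow> \<omega> c x vs = 0)}"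

definition localize ::
  "('x, 'e) chart set \<Rightarrow> 'b \<Rightarrow> (('x, 'e) chart \<Rightarrow> 'x \<Rightarrow> 'b) \<Rightarrow> ('x, 'e) chart \<Rightarrow> 'x \<Rightarrow> 'b" where
  "localize B z f = (\<lambda>c x. if c \<in> B \<and> x \<in> fst c then f c x else z)"

definition ext_deriv :: "('n::finite cvec \<Rightarrow> 'n ext) \<Rightarrow> 'n cvec \<Rightarrow> 'n ext" where
  "ext_deriv \<eta> y = (\<lambda>vs. \<Sum>i<length vs. (-1) ^ i *
     frechet_derivative (\<lambda>u. \<eta> u (take i vs @ drop (Suc i) vs)) (at y) (vs ! i))"

definition exterior_d ::
  "('x, 'n::finite cvec) chart set \<Rightarrow> ('x, 'n) form \<Rightarrow> ('x, 'n) form" where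
  "exterior_d B \<omega> = localize B (\<lambda>_. 0)
     (\<lambda>c x. ext_deriv (\<lambda>y. \<omega> c (chart_inv c y)) (snd c x))"

definition type_proj ::
  "('x, 'n::{finite,linorder} cvec) chart set \<Rightarrow> ('x, 'n cvec) chart set \<Rightarrow> nat \<Rightarrow> nat \<Rightarrow>
   ('x, 'n) form \<Rightarrow> ('x, 'n) form" where
  "type_proj B C p q \<omega> = localize B (\<lambda>_. 0) (\<lambda>c x. type_part (coframe_at C c x) p q (\<omega> c x))"

definition del ::
  "('x, 'n::{finite,linorder} cvec) chart set \<Rightarrow> ('x, 'n cvec) chart set \<Rightarrow>
   ('x, 'n) form \<Rightarrow> ('x, 'n) form" where
  "del B C \<omega> = (\<lambda>c x vs. \<Sum>p\<le>CARD('n). \<Sum>q\<le>CARD('n).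
     type_proj B C (Suc p) q (exterior_d B (type_proj B C p q \<omega>)) c x vs)"

definition delbar ::
  "('x, 'n::{finite,linorder} cvec) chart set \<Rightarrow> ('x, 'n cvec) chart set \<Rightarrow>
   ('x, 'n) form \<Rightarrow> ('x, 'n) form" where
  "delbar B C \<omega> = (\<lambda>c x vs. \<Sum>p\<le>CARD('n). \<Sum>q\<le>CARD('n).
     type_proj B C p (Suc q) (exterior_d B (type_proj B C p q \<omega>)) c x vs)"

text \<open>For a coframe \<open>dz\<^sub>t\<close>: the matrices with entry \<open>(k, j)\<close> equal to
  \<open>\<partial>z\<^sub>t\<^sup>k/\<partial>z\<^sup>j\<close> and to its antiholomorphic analogue.\<close>

definition jac :: "'n::finite coframe \<Rightarrow> 'n cmat" where
  "jac w = (\<chi> k j. on_dz (w k) j)"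

definition jacbar :: "'n::finite coframe \<Rightarrow> 'n cmat" where
  "jacbar w = (\<chi> k j. on_dzbar (w k) j)"

text \<open>\<open>\<pi>\<^sup>1\<^sup>,\<^sup>0 : \<Omega>\<^sub>t \<rightarrow> \<Omega>\<^sub>0\<close> is an isomorphism of bundles.\<close>

definition pi10_iso ::
  "('x, 'n::finite cvec) chart set \<Rightarrow> ('x, 'n cvec) chart set \<Rightarrow> bool" where
  "pi10_iso B C \<longleftrightarrow> (\<forall>c\<in>B. \<forall>d\<in>C. \<forall>x\<in>fst c \<inter> fst d. invertible (jac (dcoord c d x)))"

definition beltrami ::
  "('x, 'n::finite cvec) chart set \<Rightarrow> ('x, 'n cvec) chart \<Rightarrow> 'x \<Rightarrow> 'n cmat" where
  "beltrami C c x = matrix_inv (jac (coframe_at C c x)) ** jacbar (coframe_at C c x)"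

definition i_phi ::
  "('x, 'n::finite cvec) chart set \<Rightarrow> (('x, 'n cvec) chart \<Rightarrow> 'x \<Rightarrow> 'n cmat) \<Rightarrow>
   ('x, 'n) form \<Rightarrow> ('x, 'n) form" where
  "i_phi B \<phi> \<omega> = localize B (\<lambda>_. 0) (\<lambda>c x. ins (\<phi> c x) (\<omega> c x))"

definition L10 ::
  "('x, 'n::{finite,linorder} cvec) chart set \<Rightarrow>
   (('x, 'n cvec) chart \<Rightarrow> 'x \<Rightarrow> 'n cmat) \<Rightarrow> ('x, 'n) form \<Rightarrow> ('x, 'n) form" where
  "L10 B \<phi> \<omega> = i_phi B \<phi> (del B B \<omega>) - del B B (i_phi B \<phi> \<omega>)"

definition I_iso ::
  "('x, 'n::{finite,linorder} cvec) chart set \<Rightarrow> ('x, 'n cvec) chart set \<Rightarrow> nat \<Rightarrow> nat \<Rightarrow>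
   ('x, 'n) form \<Rightarrow> ('x, 'n) vform" where
  "I_iso B C p q \<omega> = localize B (\<lambda>_ _ _. 0) (\<lambda>c x. I_at (coframe_at C c x) p q (\<omega> c x))"

definition exp_i_phi ::
  "('x, 'n::{finite,linorder} cvec) chart set \<Rightarrow> ('x, 'n cvec) chart set \<Rightarrow> nat \<Rightarrow>
   (('x, 'n cvec) chart \<Rightarrow> 'x \<Rightarrow> 'n cmat) \<Rightarrow> ('x, 'n) vform \<Rightarrow> ('x, 'n) vform" where
  "exp_i_phi B C p \<phi> \<eta> = localize B (\<lambda>_ _ _. 0)
     (\<lambda>c x. exp_vins (coframe_at C c x) p (\<phi> c x) (\<eta> c x))"

definition P_map ::
  "('x, 'n::{finite,linorder} cvec) chart set \<Rightarrow> ('x, 'n cvec) chart set \<Rightarrow> nat \<Rightarrow> nat \<Rightarrow>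
   ('x, 'n) form \<Rightarrow> ('x, 'n) form" where
  "P_map B C p q = inv_into (smooth_forms B C p q) (I_iso B C p q)
     \<circ> exp_i_phi B C p (beltrami C) \<circ> I_iso B B p q"

end

theory Submission
  imports Defs
begin

text \<open>In local terms \<open>P\<^sub>t\<close> is the algebra homomorphism that sends \<open>dz\<^sup>i\<close> to \<open>dz\<^sup>i + \<phi>\<^sup>i\<close>, which is of type
  \<open>(1,0)\<close> on \<open>X\<^sub>t\<close>, and the conjugate of \<open>dz\<^sup>i\<close> to its \<open>(0,1)\<close>-part on \<open>X\<^sub>t\<close>: the contributions of
  \<open>\<pi>\<^sup>1\<^sup>,\<^sup>0\<close> to the coefficient bundles and of \<open>e^{i\<^sub>\<phi>}\<close> to the factor \<open>\<langle>dz\<rangle>\<close> cancel. Hence \<open>d (P\<^sub>t s)\<close> can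
  be computed on generators, and by the integrability of \<open>\<phi>\<close> it agrees with
  \<open>P\<^sub>t\<close> applied to the derivative of \<open>s\<close> twisted by \<open>L\<^sup>1\<^sup>,\<^sup>0\<close>, up to types \<open>(p+1,q)\<close> and \<open>(p+2,q-1)\<close>; the
  \<open>(p,q+1)\<close>-part is the claim. That \<open>\<pi>\<^sup>1\<^sup>,\<^sup>0\<close> is an isomorphism for small \<open>t\<close> is an open condition which
  holds at \<open>t = 0\<close>, and \<open>X\<^sub>0\<close> is compact.\<close>

section \<open>Wedge products\<close>

text \<open>Covectors are functions on lists of vectors, so most algebraic identities are inductions
  over the argument list, one contraction at a time. The definitions leave choices open: coframes
  come from a chosen fibre chart, coefficients from a chosen representation, and
  \<open>P_map\<close> ends in \<open>inv_into\<close> on the space of smooth forms. The pointwise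
  formula therefore becomes a statement about \<open>P_map\<close> only once its values are known to
  be smooth, of the right type and compatible with the charts of X_0. For the right-hand side of the
  identity this compatibility is read off from the left-hand side, as a type component of an
  exterior derivative. The integrability of \<phi> is derived from the existence of holomorphic
  coordinates on X_t and the symmetry of second derivatives. Fibre charts for different t are
  unrelated, so no continuity in t is visible in them; nondegeneracy near t = 0 is tested in charts
  of the total space, where the trivialization is smooth jointly in the point and in t.\<close>

definition grade :: "'n ext \<Rightarrow> 'n ext" where
  "grade \<alpha> = (\<lambda>us. (-1) ^ length us * \<alpha> us)"

text \<open>Naming the sign of the recursion as the parity automorphism \<open>grade\<close> makes
  the rule an antiderivation law that can be iterated; the inductions below then only need that
  \<open>grade\<close> is linear, multiplicative and an involution.\<close>

lemma wedge_Cons: "wedge \<alpha> \<beta> (v # vs) = wedge (\<lambda>us. \<alpha> (v # us)) \<beta> vs + wedge (grade \<alpha>) (\<lambda>us. \<beta> (v # us)) vs"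
  by (simp add: grade_def)

declare wedge.simps(2)[simp del] wedge_Cons [simp]

lemma grade_Cons [simp]: "grade \<alpha> (v # us) = - grade (\<lambda>us. \<alpha> (v # us)) us"
  by (simp add: grade_def)

lemma grade_lin [simp]:
  "grade (\<lambda>us. \<alpha> us + \<alpha>' us) = (\<lambda>us. grade \<alpha> us + grade \<alpha>' us)"
  "grade (\<lambda>us. c * \<alpha> us) = (\<lambda>us. c * grade \<alpha> us)"
  "grade (\<lambda>us. - \<alpha> us) = (\<lambda>us. - grade \<alpha> us)"
  "grade (\<lambda>us. 0) = (\<lambda>us. 0)"
  "grade (grade \<alpha>) = \<alpha>"
  by (auto simp: grade_def algebra_simps fun_eq_iff simp flip: power_add mult.assoc mult_2)

lemma wedge_add_left: "wedge (\<lambda>us. \<alpha> us + \<alpha>' us) \<beta> vs = wedge \<alpha> \<beta> vs + wedge \<alpha>' \<beta> vs"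
  by (induction vs arbitrary: \<alpha> \<alpha>' \<beta>) (auto simp: algebra_simps)

lemma wedge_scale_left: "wedge (\<lambda>us. c * \<alpha> us) \<beta> vs = c * wedge \<alpha> \<beta> vs"
  by (induction vs arbitrary: \<alpha> \<beta>) (auto simp: algebra_simps)

lemma wedge_add_right: "wedge \<alpha> (\<lambda>us. \<beta> us + \<beta>' us) vs = wedge \<alpha> \<beta> vs + wedge \<alpha> \<beta>' vs"
  by (induction vs arbitrary: \<alpha> \<beta> \<beta>') (auto simp: algebra_simps)

lemma wedge_scale_right: "wedge \<alpha> (\<lambda>us. c * \<beta> us) vs = c * wedge \<alpha> \<beta> vs"
  by (induction vs arbitrary: \<alpha> \<beta>) (auto simp: algebra_simps)

lemma wedge_zero_left [simp]: "wedge (\<lambda>us. 0) \<beta> vs = 0"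
  using wedge_scale_left[of 0 "\<lambda>_. 0" \<beta> vs] by simp

lemma wedge_zero_right [simp]: "wedge \<alpha> (\<lambda>us. 0) vs = 0"
  using wedge_scale_right[of \<alpha> 0 "\<lambda>_. 0" vs] by simp

lemma wedge_minus_left: "wedge (\<lambda>us. - \<alpha> us) \<beta> vs = - wedge \<alpha> \<beta> vs"
  using wedge_scale_left[of "-1" \<alpha> \<beta> vs] by simp

lemma wedge_minus_right: "wedge \<alpha> (\<lambda>us. - \<beta> us) vs = - wedge \<alpha> \<beta> vs"
  using wedge_scale_right[of \<alpha> "-1" \<beta> vs] by simp

lemma wedge_diff_left: "wedge (\<lambda>us. \<alpha> us - \<alpha>' us) \<beta> vs = wedge \<alpha> \<beta> vs - wedge \<alpha>' \<beta> vs"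
  using wedge_add_left[of \<alpha> "\<lambda>us. - \<alpha>' us"] by (simp add: wedge_minus_left)

lemma wedge_diff_right: "wedge \<alpha> (\<lambda>us. \<beta> us - \<beta>' us) vs = wedge \<alpha> \<beta> vs - wedge \<alpha> \<beta>' vs"
  using wedge_add_right[of \<alpha> \<beta> "\<lambda>us. - \<beta>' us"] by (simp add: wedge_minus_right)

lemma wedge_sum_left: "wedge (\<lambda>us. \<Sum>i\<in>A. f i us) \<beta> vs = (\<Sum>i\<in>A. wedge (f i) \<beta> vs)"
  by (induction A rule: infinite_finite_induct) (auto simp: wedge_add_left)

lemma wedge_sum_right: "wedge \<alpha> (\<lambda>us. \<Sum>i\<in>A. f i us) vs = (\<Sum>i\<in>A. wedge \<alpha> (f i) vs)"
  by (induction A rule: infinite_finite_induct) (auto simp: wedge_add_right)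

lemmas wedge_linear = wedge_add_left wedge_add_right wedge_scale_left wedge_scale_right
  wedge_minus_left wedge_minus_right wedge_diff_left wedge_diff_right wedge_sum_left wedge_sum_right

lemma grade_wedge: "grade (wedge \<alpha> \<beta>) vs = wedge (grade \<alpha>) (grade \<beta>) vs"
proof (induction vs arbitrary: \<alpha> \<beta>)
  case (Cons v vs)
  have "grade (wedge \<alpha> \<beta>) (v # vs) =
      - grade (\<lambda>us. wedge (\<lambda>us. \<alpha> (v # us)) \<beta> us + wedge (grade \<alpha>) (\<lambda>us. \<beta> (v # us)) us) vs"
    by simp
  then show ?case by (simp add: Cons wedge_linear del: wedge_Cons grade_Cons) (simp add: wedge_linear)
qed (simp add: grade_def)

lemma grade_wedge': "grade (wedge \<alpha> \<beta>) = wedge (grade \<alpha>) (grade \<beta>)"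
  by (simp add: fun_eq_iff grade_wedge)

text \<open>Peeling the first vector off either side yields the same three terms, in which
  \<open>grade\<close> distributes over the inner product. This works for arbitrary functions on
  lists.\<close>

lemma wedge_assoc: "wedge (wedge \<alpha> \<beta>) \<gamma> vs = wedge \<alpha> (wedge \<beta> \<gamma>) vs"
  by (induction vs arbitrary: \<alpha> \<beta> \<gamma>) (simp_all add: wedge_linear grade_wedge' algebra_simps)

lemma wedge_assoc': "wedge (wedge \<alpha> \<beta>) \<gamma> = wedge \<alpha> (wedge \<beta> \<gamma>)"
  by (simp add: fun_eq_iff wedge_assoc)

lemma ext_one_simps [simp]: "ext_one [] = 1" "ext_one (v # vs) = 0" "grade ext_one = ext_one"
  by (auto simp: ext_one_def grade_def)

lemma wedge_ext_one_left [simp]: "wedge ext_one \<beta> = \<beta>"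
proof
  fix vs show "wedge ext_one \<beta> vs = \<beta> vs" by (induction vs arbitrary: \<beta>) auto
qed

lemma wedge_ext_one_right [simp]: "wedge \<alpha> ext_one = \<alpha>"
proof
  fix vs show "wedge \<alpha> ext_one vs = \<alpha> vs" by (induction vs arbitrary: \<alpha>) auto
qed

lemma one_form_simps [simp]:
  "one_form \<theta> [] = 0" "one_form \<theta> (v # vs) = \<theta> v * ext_one vs"
  "one_form \<theta> (map L vs) = one_form (\<lambda>v. \<theta> (L v)) vs"
  by (auto simp: one_form_def ext_one_def split: list.splits)

lemma grade_one_form [simp]: "grade (one_form \<theta>) = (\<lambda>us. - one_form \<theta> us)"
proof
  fix vs show "grade (one_form \<theta>) vs = - one_form \<theta> vs" by (cases vs) (auto simp: grade_def ext_one_def)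
qed

lemma one_form_linear:
  "one_form (\<lambda>v. \<theta> v + \<theta>' v) = (\<lambda>vs. one_form \<theta> vs + one_form \<theta>' vs)"
  "one_form (\<lambda>v. \<theta> v - \<theta>' v) = (\<lambda>vs. one_form \<theta> vs - one_form \<theta>' vs)"
  "one_form (\<lambda>v. - \<theta> v) = (\<lambda>vs. - one_form \<theta> vs)"
  "one_form (\<lambda>v. c * \<theta> v) = (\<lambda>vs. c * one_form \<theta> vs)"
  "one_form (\<lambda>v. 0) = (\<lambda>vs. 0)"
  by (auto simp: one_form_def fun_eq_iff split: list.splits)

lemma one_form_sum: "one_form (\<lambda>v. \<Sum>i\<in>A. f i v) = (\<lambda>vs. \<Sum>i\<in>A. one_form (f i) vs)"
  by (induction A rule: infinite_finite_induct) (auto simp: one_form_linear)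

lemma wedge_one_form_Cons:
  "wedge (one_form \<theta>) \<beta> (v # vs) = \<theta> v * \<beta> vs - wedge (one_form \<theta>) (\<lambda>us. \<beta> (v # us)) vs"
  by (simp add: wedge_linear)

text \<open>Peeling off the first vector leaves two scalar terms that change places with opposite
  signs, and a double product to which the induction applies with \<beta> replaced by its
  contraction.\<close>

lemma wedge_one_form_comm:
  "wedge (one_form \<theta>) (wedge (one_form \<theta>') \<beta>) vs = - wedge (one_form \<theta>') (wedge (one_form \<theta>) \<beta>) vs"
proof (induction vs arbitrary: \<beta>)
  case (Cons v vs)
  show ?case using Cons[of "\<lambda>us. \<beta> (v # us)"]
    by (simp only: wedge_one_form_Cons) (simp add: wedge_linear)
qed simp

lemma wedge_one_form_same [simp]: "wedge (one_form \<theta>) (wedge (one_form \<theta>) \<beta>) = (\<lambda>_. 0)"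
  using wedge_one_form_comm[of \<theta> \<theta> \<beta>] by (auto simp: fun_eq_iff)

lemmas scaleRc = scaleR_conv_of_real[where 'a=complex]

section \<open>Alternating forms\<close>

text \<open>Linearity is over the reals, because types live in the complexified cotangent space. The
  sign rule is stated for adjacent transpositions, which generate all permutations and fit
  inductions over lists.\<close>

definition alternating :: "'n::finite ext \<Rightarrow> bool" where
  "alternating \<alpha> \<longleftrightarrow> (\<forall>us vs. linear (\<lambda>v. \<alpha> (us @ v # vs))) \<and>
     (\<forall>us u v vs. \<alpha> (us @ u # v # vs) = - \<alpha> (us @ v # u # vs))"

lemma altmI:
  assumes "\<And>us vs. linear (\<lambda>v. \<alpha> (us @ v # vs))"
    and "\<And>us u v vs. \<alpha> (us @ u # v # vs) = - \<alpha> (us @ v # u # vs)"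
  shows "alternating \<alpha>"
  using assms unfolding alternating_def by blast

lemma alternating_linear: "alternating \<alpha> \<Longrightarrow> linear (\<lambda>v. \<alpha> (us @ v # vs))"
  by (simp add: alternating_def)

lemma alternating_linear_hd: "alternating \<alpha> \<Longrightarrow> linear (\<lambda>v. \<alpha> (v # vs))"
  using alternating_linear[of \<alpha> "[]"] by simp

lemma alternating_swap: "alternating \<alpha> \<Longrightarrow> \<alpha> (us @ u # v # vs) = - \<alpha> (us @ v # u # vs)"
  unfolding alternating_def by blast

lemma alternating_swap_hd: "alternating \<alpha> \<Longrightarrow> \<alpha> (u # v # vs) = - \<alpha> (v # u # vs)"
  using alternating_swap[of \<alpha> "[]" u v vs] unfolding append_Nil .

lemma alternating_Cons:
  assumes "alternating \<alpha>" shows "alternating (\<lambda>us. \<alpha> (v # us))"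
proof (rule altmI)
  show "linear (\<lambda>a. \<alpha> (v # us @ a # vs))" for us vs
    using alternating_linear[OF assms, of "v # us" vs] by simp
  show "\<alpha> (v # us @ a # b # vs) = - \<alpha> (v # us @ b # a # vs)" for us a b vs
    using alternating_swap[OF assms, of "v # us" a b vs] unfolding append_Cons .
qed

lemma linear_cmult: "linear f \<Longrightarrow> linear (\<lambda>v. (c::complex) * f v)"
  by (auto simp: linear_iff algebra_simps)

lemma alternating_zero [simp]: "alternating (\<lambda>_. 0)"
  by (auto simp: alternating_def linear_iff)

lemma alternating_add:
  assumes "alternating \<alpha>" "alternating \<beta>" shows "alternating (\<lambda>vs. \<alpha> vs + \<beta> vs)"
proof (rule altmI)
  show "\<alpha> (us @ u # v # vs) + \<beta> (us @ u # v # vs) = - (\<alpha> (us @ v # u # vs) + \<beta> (us @ v # u # vs))" for us u v vs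
    using alternating_swap[OF assms(1), of us u v vs] alternating_swap[OF assms(2), of us u v vs] by simp
qed (simp add: linear_compose_add alternating_linear assms)

lemma alternating_scale:
  assumes "alternating \<alpha>" shows "alternating (\<lambda>vs. c * \<alpha> vs)"
proof (rule altmI)
  show "c * \<alpha> (us @ u # v # vs) = - (c * \<alpha> (us @ v # u # vs))" for us u v vs
    using alternating_swap[OF assms, of us u v vs] by simp
qed (simp add: linear_cmult alternating_linear assms)

lemma alternating_sum: "(\<And>i. i \<in> A \<Longrightarrow> alternating (f i)) \<Longrightarrow> alternating (\<lambda>vs. \<Sum>i\<in>A. f i vs)"
  by (induction A rule: infinite_finite_induct) (auto intro: alternating_add)

lemma alternating_grade: "alternating \<alpha> \<Longrightarrow> alternating (grade \<alpha>)"
  unfolding grade_def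
proof (rule altmI)
  fix us vs assume "alternating \<alpha>"
  then show "linear (\<lambda>v. (-1) ^ length (us @ v # vs) * \<alpha> (us @ v # vs))"
    unfolding length_append length_Cons by (intro linear_cmult) (rule alternating_linear)
next
  fix us u v vs assume "alternating \<alpha>"
  from alternating_swap[OF this, of us u v vs] show "(-1) ^ length (us @ u # v # vs) * \<alpha> (us @ u # v # vs) =
      - ((-1) ^ length (us @ v # u # vs) * \<alpha> (us @ v # u # vs))"
    by simp
qed

lemma alternating_ext_one [simp]: "alternating ext_one"
  by (rule altmI) (auto simp: ext_one_def linear_iff)

lemma alternating_one_form: "linear \<theta> \<Longrightarrow> alternating (one_form \<theta>)"
proof (rule altmI)
  show "linear (\<lambda>v. one_form \<theta> (us @ v # vs))" if "linear \<theta>" for us vs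
    using that by (cases us; cases vs; cases "tl us") (auto simp: linear_iff one_form_def split: list.splits)
  show "one_form \<theta> (us @ u # v # vs) = - one_form \<theta> (us @ v # u # vs)" for us u v vs
    by (cases us; cases "tl us") (auto simp: one_form_def split: list.splits)
qed

lemma wedge_linear_slot:
  assumes "alternating \<alpha>" "alternating \<beta>"
  shows "linear (\<lambda>v. wedge \<alpha> \<beta> (us @ v # vs))"
  using assms
proof (induction us arbitrary: \<alpha> \<beta>)
  case Nil
  have "(\<lambda>v. wedge (\<lambda>us. \<alpha> (v # us)) \<beta> vs) = (\<lambda>v. wedge (\<lambda>us. \<alpha> (v # us)) \<beta> vs)" by simp
  have l: "\<alpha> ((a + b) # us) = \<alpha> (a # us) + \<alpha> (b # us)" "\<beta> ((a + b) # us) = \<beta> (a # us) + \<beta> (b # us)"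
    "\<alpha> ((r *\<^sub>R b) # us) = r * \<alpha> (b # us)" "\<beta> ((r *\<^sub>R b) # us) = r * \<beta> (b # us)" for a b us and r :: real
    using alternating_linear_hd[OF Nil(1), of us] alternating_linear_hd[OF Nil(2), of us]
    by (auto simp: linear_iff scaleRc)
  show ?case
    by (rule linearI) (simp_all add: l wedge_linear scaleRc algebra_simps)
next
  case (Cons u us)
  show ?case
    using Cons.IH[OF alternating_Cons[OF Cons.prems(1)] Cons.prems(2)]
      Cons.IH[OF alternating_grade[OF Cons.prems(1)] alternating_Cons[OF Cons.prems(2)]]
    by (auto intro: linear_compose_add)
qed

lemma wedge_swap_slot:
  assumes "alternating \<alpha>" "alternating \<beta>"
  shows "wedge \<alpha> \<beta> (us @ u # v # vs) = - wedge \<alpha> \<beta> (us @ v # u # vs)"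
  using assms
proof (induction us arbitrary: \<alpha> \<beta>)
  case Nil
  have l: "\<alpha> (u # v # us) = - \<alpha> (v # u # us)" "\<beta> (u # v # us) = - \<beta> (v # u # us)" for us
    using alternating_swap_hd[OF Nil(1)] alternating_swap_hd[OF Nil(2)] by blast+
  show ?case by (simp add: l wedge_linear)
next
  case (Cons a us)
  show ?case
    using Cons.IH[OF alternating_Cons[OF Cons.prems(1)] Cons.prems(2)]
      Cons.IH[OF alternating_grade[OF Cons.prems(1)] alternating_Cons[OF Cons.prems(2)]]
    by auto
qed

lemma alternating_wedge: "alternating \<alpha> \<Longrightarrow> alternating \<beta> \<Longrightarrow> alternating (wedge \<alpha> \<beta>)"
  by (rule altmI) (auto intro: wedge_linear_slot wedge_swap_slot)

section \<open>Complexified frames\<close>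

text \<open>The index \<open>(False, k)\<close> refers to \<open>dz\<^sup>k\<close>, and \<open>(True, k)\<close> to its conjugate.\<close>

definition coord :: "bool \<times> 'n \<Rightarrow> 'n::finite cvec \<Rightarrow> complex" where
  "coord g v = (if fst g then cnj (v $ snd g) else v $ snd g)"

text \<open>The coefficient of \<open>coord g\<close> in \<theta>, that is, the complex linear
  extension of \<theta> evaluated on the dual frame vector.\<close>

definition ccoef :: "bool \<times> 'n \<Rightarrow> ('n::finite cvec \<Rightarrow> complex) \<Rightarrow> complex" where
  "ccoef g \<theta> = (if fst g then on_dzbar \<theta> (snd g) else on_dz \<theta> (snd g))"

lemma ccoef_eq: "ccoef g \<theta> = (\<theta> (axis (snd g) 1) + (if fst g then \<i> else - \<i>) * \<theta> (axis (snd g) \<i>)) / 2"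
  by (simp add: ccoef_def on_dz_def on_dzbar_def)

definition contr :: "bool \<times> 'n \<Rightarrow> 'n::finite ext \<Rightarrow> 'n ext" where
  "contr g \<beta> = (\<lambda>vs. ccoef g (\<lambda>v. \<beta> (v # vs)))"

lemma contract_eq_contr: "contract j = contr (False, j)"
  by (simp add: contract_def contr_def ccoef_def fun_eq_iff)

lemma ccoef_linear:
  "ccoef g (\<lambda>v. \<theta> v + \<theta>' v) = ccoef g \<theta> + ccoef g \<theta>'"
  "ccoef g (\<lambda>v. \<theta> v - \<theta>' v) = ccoef g \<theta> - ccoef g \<theta>'"
  "ccoef g (\<lambda>v. c * \<theta> v) = c * ccoef g \<theta>"
  "ccoef g (\<lambda>v. \<theta> v * c) = ccoef g \<theta> * c"
  "ccoef g (\<lambda>v. - \<theta> v) = - ccoef g \<theta>"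
  "ccoef g (\<lambda>v. 0) = 0"
  by (simp_all add: ccoef_eq algebra_simps add_divide_distrib diff_divide_distrib)

lemma ccoef_sum: "ccoef g (\<lambda>v. \<Sum>i\<in>A. f i v) = (\<Sum>i\<in>A. ccoef g (f i))"
  by (induction A rule: infinite_finite_induct) (auto simp: ccoef_linear)

lemma sum_bool_prod: "(\<Sum>g\<in>UNIV. f g) = (\<Sum>j\<in>UNIV. f (False, j)) + (\<Sum>j\<in>UNIV. f (True, j::'n::finite))"
proof -
  have "(\<Sum>g\<in>UNIV. f g) = (\<Sum>b\<in>UNIV. \<Sum>j\<in>UNIV. f (b, j))"
    unfolding UNIV_Times_UNIV[symmetric] sum.cartesian_product by simp
  then show ?thesis by (simp add: UNIV_bool add.commute)
qed

lemma ccoef_coord [simp]: "ccoef g (coord h) = (if g = h then 1 else 0)"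
  by (cases g; cases h) (auto simp: ccoef_eq coord_def axis_def)

lemma linear_coord [simp]: "linear (coord g)"
  by (auto simp: linear_iff coord_def scaleRc)

text \<open>Splits v along the real basis \<open>axis j 1\<close>, \<open>axis j \<i>\<close> and
  recombines each pair of values into the dz-coefficient and the conjugate one.\<close>

lemma ccoef_expand:
  assumes "linear \<theta>"
  shows "\<theta> v = (\<Sum>g\<in>UNIV. ccoef g \<theta> * coord g v)"
proof -
  have "v = (\<Sum>j\<in>UNIV. Re (v $ j) *\<^sub>R axis j 1 + Im (v $ j) *\<^sub>R axis j \<i>)"
  proof (rule vec_eq_iff[THEN iffD2], intro allI)
    fix i
    have "(\<Sum>j\<in>UNIV. Re (v $ j) *\<^sub>R axis j 1 + Im (v $ j) *\<^sub>R axis j \<i>) $ i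
        = (\<Sum>j\<in>UNIV. if j = i then complex_of_real (Re (v $ j)) + complex_of_real (Im (v $ j)) * \<i> else 0)"
      unfolding sum_component by (intro sum.cong refl) (auto simp: axis_def scaleRc)
    then show "v $ i = (\<Sum>j\<in>UNIV. Re (v $ j) *\<^sub>R axis j 1 + Im (v $ j) *\<^sub>R axis j \<i>) $ i"
      by (simp add: complex_eq_iff)
  qed
  from arg_cong[OF this, of \<theta>] have "\<theta> v = (\<Sum>j\<in>UNIV. Re (v $ j) *\<^sub>R \<theta> (axis j 1) + Im (v $ j) *\<^sub>R \<theta> (axis j \<i>))"
    by (simp only: linear_sum[OF assms] linear_add[OF assms] linear_cmul[OF assms])
  also have "\<dots> = (\<Sum>j\<in>UNIV. ccoef (False, j) \<theta> * coord (False, j) v + ccoef (True, j) \<theta> * coord (True, j) v)"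
    by (intro sum.cong refl) (auto simp: ccoef_eq coord_def complex_eq_iff field_simps)
  finally show ?thesis by (simp add: sum_bool_prod sum.distrib)
qed

lemma contr_linear:
  "contr g (\<lambda>v. \<theta> v + \<theta>' v) = (\<lambda>vs. contr g \<theta> vs + contr g \<theta>' vs)"
  "contr g (\<lambda>v. \<theta> v - \<theta>' v) = (\<lambda>vs. contr g \<theta> vs - contr g \<theta>' vs)"
  "contr g (\<lambda>v. c * \<theta> v) = (\<lambda>vs. c * contr g \<theta> vs)"
  "contr g (\<lambda>v. - \<theta> v) = (\<lambda>vs. - contr g \<theta> vs)"
  "contr g (\<lambda>v. 0) = (\<lambda>vs. 0)"
  by (simp_all add: contr_def ccoef_linear)

lemma contr_sum: "contr g (\<lambda>v. \<Sum>i\<in>A. f i v) = (\<lambda>vs. \<Sum>i\<in>A. contr g (f i) vs)"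
  by (simp add: contr_def ccoef_sum)

text \<open>An alternating form is determined by its contractions with the frame. This is how an
  argument list is shortened in the inductions on substitutions and on powers of
  \<open>ins\<close>.\<close>

lemma contr_expand: "alternating \<alpha> \<Longrightarrow> \<alpha> (v # vs) = (\<Sum>g\<in>UNIV. coord g v * contr g \<alpha> vs)"
  unfolding contr_def by (subst ccoef_expand[OF alternating_linear_hd]) (auto simp: mult.commute)

lemma contr_grade [simp]: "contr g (grade \<alpha>) = (\<lambda>vs. - grade (contr g \<alpha>) vs)"
  by (simp add: contr_def fun_eq_iff grade_def ccoef_linear)

lemma alternating_contr:
  assumes "alternating \<alpha>" shows "alternating (contr g \<alpha>)"
proof (rule altmI)
  show "linear (\<lambda>v. contr g \<alpha> (us @ v # vs))" for us vs
    using alternating_linear[OF assms, of "u # us" vs for u]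
    by (auto simp: contr_def ccoef_eq linear_iff scaleRc field_simps)
  show "contr g \<alpha> (us @ u # v # vs) = - contr g \<alpha> (us @ v # u # vs)" for us u v vs
    using alternating_swap[OF assms, of "w # us" u v vs for w]
    by (auto simp: contr_def ccoef_eq field_simps)
qed

lemma contr_contr: "alternating \<alpha> \<Longrightarrow> contr g (contr h \<alpha>) vs = - contr h (contr g \<alpha>) vs"
  using alternating_swap_hd[of \<alpha> "axis (snd h) 1" "axis (snd g) 1" vs] alternating_swap_hd[of \<alpha> "axis (snd h) \<i>" "axis (snd g) 1" vs]
    alternating_swap_hd[of \<alpha> "axis (snd h) 1" "axis (snd g) \<i>" vs] alternating_swap_hd[of \<alpha> "axis (snd h) \<i>" "axis (snd g) \<i>" vs]
  by (simp add: contr_def ccoef_eq field_simps)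

lemma contr_ext_one [simp]: "contr g ext_one = (\<lambda>vs. 0)"
  by (simp add: contr_def ccoef_linear)

lemma contr_one_form [simp]: "contr g (one_form \<theta>) = (\<lambda>vs. ccoef g \<theta> * ext_one vs)"
  by (simp add: contr_def ccoef_linear fun_eq_iff)

text \<open>Contraction with a complexified vector is a complex combination of two insertions of
  real vectors, and for each of these the recursion of \<open>wedge\<close> already is the
  antiderivation rule.\<close>

lemma contr_wedge: "contr g (wedge \<alpha> \<beta>) = (\<lambda>vs. wedge (contr g \<alpha>) \<beta> vs + wedge (grade \<alpha>) (contr g \<beta>) vs)"
proof
  fix vs
  have *: "contr g \<alpha> = (\<lambda>us. (1/2) * (\<alpha> (axis (snd g) 1 # us) + (if fst g then \<i> else -\<i>) * \<alpha> (axis (snd g) \<i> # us)))" for \<alpha>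
    by (auto simp: contr_def ccoef_eq)
  show "contr g (wedge \<alpha> \<beta>) vs = wedge (contr g \<alpha>) \<beta> vs + wedge (grade \<alpha>) (contr g \<beta>) vs"
    unfolding * wedge_linear by (simp add: field_simps)
qed

lemma contr_wedge_one_form:
  "contr g (wedge (one_form \<theta>) \<beta>) = (\<lambda>vs. ccoef g \<theta> * \<beta> vs - wedge (one_form \<theta>) (contr g \<beta>) vs)"
  by (simp add: contr_wedge wedge_linear fun_eq_iff)

section \<open>Types\<close>

text \<open>The same spaces as \<open>Lam w p q\<close>, in a form suited to rule induction: closure
  under sums, scalars and wedging with the coframe replaces multi-index bookkeeping. The agreement
  is \<open>Lam_iff_has_type\<close>.\<close>

inductive has_type :: "'n::finite coframe \<Rightarrow> nat \<Rightarrow> nat \<Rightarrow> 'n ext \<Rightarrow> bool" for w where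
  has_type_one: "has_type w 0 0 ext_one"
| has_type_zero: "has_type w p q (\<lambda>_. 0)"
| has_type_add: "has_type w p q \<alpha> \<Longrightarrow> has_type w p q \<beta> \<Longrightarrow> has_type w p q (\<lambda>vs. \<alpha> vs + \<beta> vs)"
| has_type_scale: "has_type w p q \<alpha> \<Longrightarrow> has_type w p q (\<lambda>vs. c * \<alpha> vs)"
| has_type_dz: "has_type w p q \<alpha> \<Longrightarrow> has_type w (Suc p) q (wedge (one_form (w k)) \<alpha>)"
| has_type_dzb: "has_type w p q \<alpha> \<Longrightarrow> has_type w p (Suc q) (wedge (one_form (\<lambda>v. cnj (w k v))) \<alpha>)"

lemma has_type_minus: "has_type w p q \<alpha> \<Longrightarrow> has_type w p q (\<lambda>vs. - \<alpha> vs)"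
  using has_type_scale[of w p q \<alpha> "-1"] by simp

lemma has_type_diff: "has_type w p q \<alpha> \<Longrightarrow> has_type w p q \<beta> \<Longrightarrow> has_type w p q (\<lambda>vs. \<alpha> vs - \<beta> vs)"
  using has_type_add[OF _ has_type_minus, of w p q \<alpha> \<beta>] by simp

lemma has_type_sum: "(\<And>i. i \<in> A \<Longrightarrow> has_type w p q (f i)) \<Longrightarrow> has_type w p q (\<lambda>vs. \<Sum>i\<in>A. f i vs)"
  by (induction A rule: infinite_finite_induct) (auto intro: has_type_add has_type_zero)

lemma has_type_wedge_span:
  assumes "has_type w p q \<alpha>" "\<theta> = (\<lambda>v. \<Sum>k\<in>UNIV. c k * w k v)"
  shows "has_type w (Suc p) q (wedge (one_form \<theta>) \<alpha>)"
proof -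
  have "wedge (one_form \<theta>) \<alpha> = (\<lambda>vs. \<Sum>k\<in>UNIV. c k * wedge (one_form (w k)) \<alpha> vs)"
    unfolding assms(2) by (simp add: one_form_sum one_form_linear wedge_linear fun_eq_iff)
  then show ?thesis by (auto intro!: has_type_sum has_type_scale has_type_dz assms)
qed

lemma has_type_wedge_span_bar:
  assumes "has_type w p q \<alpha>" "\<theta> = (\<lambda>v. \<Sum>k\<in>UNIV. c k * cnj (w k v))"
  shows "has_type w p (Suc q) (wedge (one_form \<theta>) \<alpha>)"
proof -
  have "wedge (one_form \<theta>) \<alpha> = (\<lambda>vs. \<Sum>k\<in>UNIV. c k * wedge (one_form (\<lambda>v. cnj (w k v))) \<alpha> vs)"
    unfolding assms(2) by (simp add: one_form_sum one_form_linear wedge_linear fun_eq_iff)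
  then show ?thesis by (auto intro!: has_type_sum has_type_scale has_type_dzb assms)
qed

lemma alternating_has_type:
  assumes "has_type w p q \<alpha>" "\<And>k. linear (w k)"
  shows "alternating \<alpha>"
  using assms(1)
proof induction
  case (has_type_dzb p q \<alpha> k)
  have "linear (\<lambda>v. cnj (w k v))"
    using assms(2)[of k] by (auto simp: linear_iff)
  then show ?case using has_type_dzb by (auto intro: alternating_wedge alternating_one_form)
qed (auto intro: alternating_add alternating_scale alternating_wedge alternating_one_form assms)

lemma mult_if_01: "(if P then 1 else 0) * x = (if P then x else (0::complex))"
  "x * (if P then 1 else 0) = (if P then x else (0::complex))"
  by auto

section \<open>Ordered products of one-forms and the monomial description of types\<close>

definition wedges :: "('i \<Rightarrow> 'n cvec \<Rightarrow> complex) \<Rightarrow> 'i list \<Rightarrow> 'n ext" where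
  "wedges f xs = foldr wedge (map (\<lambda>i. one_form (f i)) xs) ext_one"

lemma wedges_simps [simp]: "wedges f [] = ext_one" "wedges f (x # xs) = wedge (one_form (f x)) (wedges f xs)"
  by (auto simp: wedges_def)

lemma wedges_append: "wedges f (xs @ ys) = wedge (wedges f xs) (wedges f ys)"
  by (induction xs) (auto simp: wedge_assoc')

lemma wedges_map: "wedges f (map h xs) = wedges (\<lambda>x. f (h x)) xs"
  by (induction xs) auto

lemma dzI_wedges: "dzI w I = wedges w (sorted_list_of_set I)"
  by (simp add: dzI_def wedges_def)

lemma dzbarJ_wedges: "dzbarJ w I = wedges (\<lambda>k v. cnj (w k v)) (sorted_list_of_set I)"
  by (simp add: dzbarJ_def dzI_wedges)

lemma dzI_empty [simp]: "dzI w {} = ext_one" "dzbarJ w {} = ext_one"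
  by (simp_all add: dzI_wedges dzbarJ_wedges)

lemma wedge_one_form_wedges:
  "wedge (one_form \<theta>) (wedge (wedges f xs) \<beta>) = (\<lambda>vs. (-1) ^ length xs * wedge (wedges f xs) (wedge (one_form \<theta>) \<beta>) vs)"
proof (induction xs)
  case (Cons x xs)
  have "wedge (one_form \<theta>) (wedge (wedges f (x # xs)) \<beta>) vs
      = - wedge (one_form (f x)) (wedge (one_form \<theta>) (wedge (wedges f xs) \<beta>)) vs" for vs
    by (simp add: wedge_assoc' wedge_one_form_comm[of \<theta>])
  then show ?case unfolding Cons.IH by (simp add: fun_eq_iff wedge_linear wedge_assoc')
qed simp

lemma wedge_one_form_wedges_mem:
  "k \<in> set xs \<Longrightarrow> wedge (one_form (f k)) (wedges f xs) = (\<lambda>vs. 0)"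
proof (induction xs)
  case (Cons x xs)
  show ?case
  proof (cases "k = x")
    case False
    have "wedge (one_form (f k)) (wedges f (x # xs)) vs = - wedge (one_form (f x)) (wedge (one_form (f k)) (wedges f xs)) vs" for vs
      by (simp add: wedge_one_form_comm[of "f k"])
    moreover have "wedge (one_form (f k)) (wedges f xs) = (\<lambda>vs. 0)" using Cons False by simp
    ultimately show ?thesis by (simp only: fun_eq_iff) simp
  qed simp
qed simp

text \<open>The new factor is moved into place by transpositions, and c is the resulting
  sign.\<close>

lemma wedges_insort:
  "\<exists>c. wedge (one_form (f k)) (wedges f xs) = (\<lambda>vs. c * wedges f (insort k xs) vs)"
proof (induction xs)
  case (Cons x xs)
  then obtain c where c: "wedge (one_form (f k)) (wedges f xs) = (\<lambda>vs. c * wedges f (insort k xs) vs)" by blast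
  show ?case
  proof (cases "k \<le> x")
    case False
    have "wedge (one_form (f k)) (wedges f (x # xs)) vs = - wedge (one_form (f x)) (wedge (one_form (f k)) (wedges f xs)) vs" for vs
      by (simp add: wedge_one_form_comm[of "f k"])
    also have "\<dots> vs = - c * wedges f (insort k (x # xs)) vs" for vs
      using False unfolding c by (simp add: wedge_linear)
    finally show ?thesis by blast
  qed (auto intro: exI[of _ 1])
qed (auto intro: exI[of _ 1])

text \<open>A repeated index makes the product vanish. Recording c = 0 in that case ensures that
  \<open>insert k I\<close> has one element more than I whenever the term counts.\<close>

lemma wedge_dzI_insert:
  obtains c where "wedge (one_form (w k)) (dzI w I) = (\<lambda>vs. c * dzI w (insert k I) vs)"
    "k \<in> I \<Longrightarrow> c = 0"
proof (cases "k \<in> I")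
  case True
  then have "wedge (one_form (w k)) (dzI w I) = (\<lambda>vs. 0 * dzI w (insert k I) vs)"
    by (simp add: dzI_wedges wedge_one_form_wedges_mem)
  with that show ?thesis by blast
next
  case False
  have "sorted_list_of_set (insert k I) = insort k (sorted_list_of_set I)"
    using False by (simp add: sorted_list_of_set_insert)
  with wedges_insort[of w k "sorted_list_of_set I"] that False show ?thesis by (auto simp: dzI_wedges)
qed

lemma comb_linear:
  "(\<lambda>vs. comb w p q s vs + comb w p q s' vs) = comb w p q (\<lambda>I J. s I J + s' I J)"
  "(\<lambda>vs. c * comb w p q s vs) = comb w p q (\<lambda>I J. c * s I J)"
  "comb w p q (\<lambda>I J. 0) = (\<lambda>vs. 0)"
  by (simp_all add: comb_def sum.distrib sum_distrib_left algebra_simps)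

lemma Lam_zero [simp]: "(\<lambda>_. 0) \<in> Lam w p q"
  unfolding Lam_def using comb_linear(3)[of w p q] by (metis rangeI)

lemma Lam_add: "\<alpha> \<in> Lam w p q \<Longrightarrow> \<beta> \<in> Lam w p q \<Longrightarrow> (\<lambda>vs. \<alpha> vs + \<beta> vs) \<in> Lam w p q"
  by (auto simp: Lam_def comb_linear)

lemma Lam_scale: "\<alpha> \<in> Lam w p q \<Longrightarrow> (\<lambda>vs. c * \<alpha> vs) \<in> Lam w p q"
  by (auto simp: Lam_def comb_linear)

lemma Lam_sum: "(\<And>i. i \<in> A \<Longrightarrow> f i \<in> Lam w p q) \<Longrightarrow> (\<lambda>vs. \<Sum>i\<in>A. f i vs) \<in> Lam w p q"
  by (induction A rule: infinite_finite_induct) (auto intro: Lam_add)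

lemma Lam_basis:
  assumes "card I = p" "card J = q"
  shows "wedge (dzbarJ w J) (dzI w I) \<in> Lam w p q"
proof -
  have "comb w p q (\<lambda>I' J'. if I' = I then (if J' = J then 1 else 0) else 0) vs
      = (\<Sum>I' | card I' = p. if I' = I then
          (\<Sum>J' | card J' = q. if J' = J then wedge (dzbarJ w J') (dzI w I') vs else 0) else 0)" for vs
    unfolding comb_def by (intro sum.cong refl) (auto simp: mult_if_01)
  then have "wedge (dzbarJ w J) (dzI w I) = comb w p q (\<lambda>I' J'. if I' = I then (if J' = J then 1 else 0) else 0)"
    using assms by (simp add: fun_eq_iff)
  then show ?thesis by (simp add: Lam_def)
qed

lemma has_type_wedges:
  assumes "has_type w p q \<beta>" shows "has_type w (p + length xs) q (wedge (wedges w xs) \<beta>)"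
  by (induction xs) (auto simp: wedge_assoc' intro: has_type_dz assms)

lemma has_type_wedges_bar:
  assumes "has_type w p q \<beta>" shows "has_type w p (q + length xs) (wedge (wedges (\<lambda>k v. cnj (w k v)) xs) \<beta>)"
  by (induction xs) (auto simp: wedge_assoc' intro: has_type_dzb assms)

text \<open>From right to left, a new factor is sorted into its multi-index, so the span of the
  ordered monomials is closed under all constructors.\<close>

lemma Lam_iff_has_type: "\<alpha> \<in> Lam w p q \<longleftrightarrow> has_type w p q \<alpha>"
proof
  assume "\<alpha> \<in> Lam w p q"
  then obtain s where s: "\<alpha> = comb w p q s" by (auto simp: Lam_def)
  have "has_type w p q (wedge (dzbarJ w J) (dzI w I))" if "card I = p" "card J = q" for I J
    using has_type_wedges_bar[OF has_type_wedges[OF has_type_one, of w "sorted_list_of_set I"], of "sorted_list_of_set J"] that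
    by (simp add: dzI_wedges dzbarJ_wedges)
  then show "has_type w p q \<alpha>"
    unfolding s comb_def by (auto intro!: has_type_sum has_type_scale)
next
  assume "has_type w p q \<alpha>"
  then show "\<alpha> \<in> Lam w p q"
  proof induction
    case has_type_one
    show ?case using Lam_basis[of "{}" 0 "{}" 0 w] by simp
  next
    case (has_type_dz p q \<alpha> k)
    then obtain s where s: "\<alpha> = comb w p q s" by (auto simp: Lam_def)
    have b: "wedge (one_form (w k)) (wedge (dzbarJ w J) (dzI w I)) \<in> Lam w (Suc p) q"
      if IJ: "card I = p" "card J = q" for I J
    proof -
      obtain c where c: "wedge (one_form (w k)) (dzI w I) = (\<lambda>vs. c * dzI w (insert k I) vs)"
          "k \<in> I \<Longrightarrow> c = 0" using wedge_dzI_insert by blast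
      \<comment> \<open>An unbarred factor has to pass the conjugate block before it reaches its own
        multi-index, which costs the sign (-1)^|J|.\<close>
      have e: "wedge (one_form (w k)) (wedge (dzbarJ w J) (dzI w I))
        = (\<lambda>vs. (-1) ^ length (sorted_list_of_set J) * c * wedge (dzbarJ w J) (dzI w (insert k I)) vs)"
        unfolding dzbarJ_wedges wedge_one_form_wedges c(1) by (simp add: wedge_linear mult.assoc)
      show ?thesis
      proof (cases "k \<in> I")
        case True then show ?thesis unfolding e by (simp add: c(2))
      next
        case False
        then have "card (insert k I) = Suc p" using IJ by simp
        then show ?thesis unfolding e by (intro Lam_scale Lam_basis) (use IJ in auto)
      qed
    qed
    have e: "wedge (one_form (w k)) \<alpha> = (\<lambda>vs. \<Sum>I | card I = p. \<Sum>J | card J = q.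
        s I J * wedge (one_form (w k)) (wedge (dzbarJ w J) (dzI w I)) vs)"
      unfolding s comb_def by (simp add: wedge_linear fun_eq_iff)
    show ?case unfolding e by (intro Lam_sum Lam_scale b) auto
  next
    case (has_type_dzb p q \<alpha> k)
    then obtain s where s: "\<alpha> = comb w p q s" by (auto simp: Lam_def)
    have b: "wedge (one_form (\<lambda>v. cnj (w k v))) (wedge (dzbarJ w J) (dzI w I)) \<in> Lam w p (Suc q)"
      if IJ: "card I = p" "card J = q" for I J
    proof -
      obtain c where c: "wedge (one_form (\<lambda>v. cnj (w k v))) (dzbarJ w J) = (\<lambda>vs. c * dzbarJ w (insert k J) vs)"
          "k \<in> J \<Longrightarrow> c = 0"
        using wedge_dzI_insert[of "\<lambda>k v. cnj (w k v)"] unfolding dzbarJ_def by blast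
      have e: "wedge (one_form (\<lambda>v. cnj (w k v))) (wedge (dzbarJ w J) (dzI w I))
        = (\<lambda>vs. c * wedge (dzbarJ w (insert k J)) (dzI w I) vs)"
        unfolding wedge_assoc'[symmetric] c(1) by (simp add: wedge_linear fun_eq_iff)
      show ?thesis
      proof (cases "k \<in> J")
        case True then show ?thesis unfolding e by (simp add: c(2))
      next
        case False
        then have "card (insert k J) = Suc q" using IJ by simp
        then show ?thesis unfolding e by (intro Lam_scale Lam_basis) (use IJ in auto)
      qed
    qed
    have e: "wedge (one_form (\<lambda>v. cnj (w k v))) \<alpha> = (\<lambda>vs. \<Sum>I | card I = p. \<Sum>J | card J = q.
        s I J * wedge (one_form (\<lambda>v. cnj (w k v))) (wedge (dzbarJ w J) (dzI w I)) vs)"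
      unfolding s comb_def by (simp add: wedge_linear fun_eq_iff)
    show ?case unfolding e by (intro Lam_sum Lam_scale b) auto
  qed (auto intro: Lam_add Lam_scale)
qed

section \<open>Coefficients\<close>

text \<open>The value on a list of complexified frame vectors, computed by successive contractions.
  On the lists \<open>frame_idx\<close> these are the coefficient functionals dual to the ordered
  monomials.\<close>

primrec frame_eval :: "(bool \<times> 'n) list \<Rightarrow> 'n::finite ext \<Rightarrow> complex" where
  "frame_eval [] \<alpha> = \<alpha> []"
| "frame_eval (g # gs) \<alpha> = frame_eval gs (contr g \<alpha>)"

lemma frame_eval_linear:
  "frame_eval gs (\<lambda>vs. \<alpha> vs + \<beta> vs) = frame_eval gs \<alpha> + frame_eval gs \<beta>"
  "frame_eval gs (\<lambda>vs. c * \<alpha> vs) = c * frame_eval gs \<alpha>"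
  "frame_eval gs (\<lambda>vs. 0) = 0"
  by (induction gs arbitrary: \<alpha> \<beta>) (auto simp: contr_linear)

lemma frame_eval_sum: "frame_eval gs (\<lambda>vs. \<Sum>i\<in>A. f i vs) = (\<Sum>i\<in>A. frame_eval gs (f i))"
  by (induction A rule: infinite_finite_induct) (auto simp: frame_eval_linear)

definition frame_idx :: "'n::{finite,linorder} set \<Rightarrow> 'n set \<Rightarrow> (bool \<times> 'n) list" where
  "frame_idx J I = map (Pair True) (sorted_list_of_set J) @ map (Pair False) (sorted_list_of_set I)"

definition std_coframe :: "'n::finite coframe" where "std_coframe = (\<lambda>k v. v $ k)"

lemma coord_std_coframe: "coord (False, k) = std_coframe k" "coord (True, k) = (\<lambda>v. cnj (std_coframe k v))"
  by (auto simp: coord_def std_coframe_def)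

lemma wedge_frame_idx: "wedge (dzbarJ std_coframe J) (dzI std_coframe I) = wedges coord (frame_idx J I)"
  by (simp add: frame_idx_def wedges_append wedges_map dzI_wedges dzbarJ_wedges coord_std_coframe)

lemma alternating_wedges: "(\<And>i. linear (f i)) \<Longrightarrow> alternating (wedges f xs)"
  by (induction xs) (auto intro: alternating_wedge alternating_one_form)

lemma contr_wedges_notin: "g \<notin> set hs \<Longrightarrow> contr g (wedges coord hs) = (\<lambda>_. 0)"
proof (induction hs)
  case (Cons h hs)
  then have "contr g (wedges coord hs) = (\<lambda>_. 0)" "g \<noteq> h" by auto
  then show ?case by (simp add: contr_wedge_one_form)
qed simp

text \<open>Each contraction meets its own factor at the head of the product, and by distinctness it
  annihilates the rest.\<close>

lemma frame_eval_wedges_same: "distinct hs \<Longrightarrow> frame_eval hs (wedges coord hs) = 1"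
  by (induction hs) (auto simp: contr_wedge_one_form contr_wedges_notin)

lemma frame_eval_contr_zero: "alternating \<alpha> \<Longrightarrow> contr h \<alpha> = (\<lambda>_. 0) \<Longrightarrow> h \<in> set hs \<Longrightarrow> frame_eval hs \<alpha> = 0"
proof (induction hs arbitrary: \<alpha>)
  case (Cons g gs)
  show ?case
  proof (cases "h = g")
    case False
    have "contr h (contr g \<alpha>) = (\<lambda>vs. - contr g (contr h \<alpha>) vs)"
      by (rule ext) (rule contr_contr[OF Cons.prems(1)])
    then have "contr h (contr g \<alpha>) = (\<lambda>_. 0)" using Cons.prems(2) by (simp add: contr_linear)
    with Cons False show ?thesis by (auto intro: alternating_contr)
  qed (use Cons.prems in \<open>simp add: frame_eval_linear\<close>)
qed simp

lemma frame_eval_degree: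
  "(\<And>vs. length vs \<noteq> k \<Longrightarrow> \<alpha> vs = 0) \<Longrightarrow> length gs \<noteq> k \<Longrightarrow> frame_eval gs \<alpha> = 0"
proof (induction gs arbitrary: \<alpha> k)
  case (Cons g gs)
  show ?case
  proof (cases k)
    case 0
    then have "contr g \<alpha> = (\<lambda>_. 0)" using Cons.prems(1) by (simp add: contr_def fun_eq_iff ccoef_linear)
    then show ?thesis by (simp add: frame_eval_linear)
  next
    case (Suc m)
    have "contr g \<alpha> vs = 0" if "length vs \<noteq> m" for vs
      using that Cons.prems(1) Suc by (simp add: contr_def ccoef_linear)
    then show ?thesis using Cons.IH[of m "contr g \<alpha>"] Cons.prems(2) Suc by simp
  qed
qed simp

lemma wedge_one_form_degree:
  assumes "\<And>vs. length vs \<noteq> k \<Longrightarrow> \<beta> vs = 0" "length vs \<noteq> Suc k"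
  shows "wedge (one_form \<theta>) \<beta> vs = 0"
  using assms
proof (induction vs arbitrary: \<beta> k)
  case (Cons v vs)
  have "wedge (one_form \<theta>) (\<lambda>us. \<beta> (v # us)) vs = 0"
  proof (cases k)
    case 0
    then have "(\<lambda>us. \<beta> (v # us)) = (\<lambda>_. 0)" using Cons.prems(1) by (simp add: fun_eq_iff)
    then show ?thesis by simp
  next
    case (Suc m)
    show ?thesis by (rule Cons.IH[of m]) (use Cons.prems Suc in auto)
  qed
  then show ?case using Cons.prems by (simp add: wedge_linear)
qed simp

lemma wedges_degree: "length vs \<noteq> length xs \<Longrightarrow> wedges f xs vs = 0"
proof (induction xs arbitrary: vs)
  case Nil then show ?case by (cases vs) auto
next
  case (Cons x xs)
  show ?case unfolding wedges_simps
    by (rule wedge_one_form_degree[where k="length xs"]) (use Cons in auto)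
qed

text \<open>Either the multi-indices agree, or the lengths of the index lists differ, or some index
  of the evaluation is missing from the monomial and its contraction is zero. All questions about
  coefficients reduce to this duality.\<close>

lemma frame_eval_frame_idx: "frame_eval (frame_idx J' I') (wedges coord (frame_idx J I)) = (if I = I' \<and> J = J' then 1 else 0)"
proof -
  have d: "distinct (frame_idx J I)" for J I :: "'a set" by (auto simp: frame_idx_def distinct_map inj_on_def)
  have s: "set (frame_idx J I) = Pair True ` J \<union> Pair False ` I" for J I :: "'a set" by (auto simp: frame_idx_def)
  have l: "length (frame_idx J I) = card (Pair True ` J \<union> Pair False ` I)" for J I :: "'a set"
    using distinct_card[OF d] s by metis
  consider "I = I' \<and> J = J'" | "length (frame_idx J I) \<noteq> length (frame_idx J' I')"
    | h where "h \<in> set (frame_idx J' I')" "h \<notin> set (frame_idx J I)"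
  proof -
    have "set (frame_idx J I) = set (frame_idx J' I') \<Longrightarrow> I = I' \<and> J = J'" unfolding s by auto
    moreover have "set (frame_idx J I) = set (frame_idx J' I')"
      if "set (frame_idx J' I') \<subseteq> set (frame_idx J I)" "length (frame_idx J I) = length (frame_idx J' I')"
      using that card_subset_eq[OF _ that(1)] by (simp add: distinct_card d)
    ultimately show ?thesis using that by blast
  qed
  then show ?thesis
  proof cases
    case 1 then show ?thesis using d by (simp add: frame_eval_wedges_same)
  next
    case 2
    then have "frame_eval (frame_idx J' I') (wedges coord (frame_idx J I)) = 0"
      by (intro frame_eval_degree[where k="length (frame_idx J I)"]) (auto simp: wedges_degree)
    then show ?thesis using 2 by auto
  next
    case (3 h)
    then have "frame_eval (frame_idx J' I') (wedges coord (frame_idx J I)) = 0"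
      by (intro frame_eval_contr_zero[where h=h] contr_wedges_notin alternating_wedges) auto
    then show ?thesis using 3 by auto
  qed
qed

lemma frame_eval_comb:
  "frame_eval (frame_idx J I) (comb std_coframe p q s) = (if card I = p \<and> card J = q then s I J else 0)"
proof -
  have "frame_eval (frame_idx J I) (comb std_coframe p q s) = (\<Sum>I' | card I' = p. \<Sum>J' | card J' = q.
      s I' J' * (if I' = I \<and> J' = J then 1 else 0))"
    by (simp add: comb_def frame_eval_sum frame_eval_linear wedge_frame_idx frame_eval_frame_idx)
  also have "\<dots> = (\<Sum>I' | card I' = p. if I' = I then (\<Sum>J' | card J' = q. if J' = J then s I' J' else 0) else 0)"
    by (intro sum.cong refl) (auto simp: mult_if_01)
  also have "\<dots> = (if card I = p \<and> card J = q then s I J else 0)"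
    by (simp add: sum.delta)
  finally show ?thesis .
qed

lemma comb_cong: "(\<And>I J. card I = p \<Longrightarrow> card J = q \<Longrightarrow> s I J = s' I J) \<Longrightarrow> comb w p q s = comb w p q s'"
  by (auto simp: comb_def fun_eq_iff intro!: sum.cong)

lemma Lam_frame_eval: "\<alpha> \<in> Lam std_coframe p q \<Longrightarrow> \<alpha> = comb std_coframe p q (\<lambda>I J. frame_eval (frame_idx J I) \<alpha>)"
  by (auto simp: Lam_def frame_eval_comb intro: comb_cong)

lemma Lam_ev0: "\<alpha> \<in> Lam std_coframe p q \<Longrightarrow> \<not> (card I = p \<and> card J = q) \<Longrightarrow> frame_eval (frame_idx J I) \<alpha> = 0"
  by (auto simp: Lam_def frame_eval_comb)

lemma coeffs_works: "\<alpha> \<in> Lam w p q \<Longrightarrow> comb w p q (coeffs w p q \<alpha>) = \<alpha>"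
  unfolding coeffs_def Lam_def by (rule someI_ex[of "\<lambda>s. comb w p q s = \<alpha>"]) auto

text \<open>Replaces the coefficients selected by choice in \<open>coeffs\<close> by a functional
  free of choices.\<close>

lemma coeffs_frame_eval: "\<alpha> \<in> Lam std_coframe p q \<Longrightarrow> card I = p \<Longrightarrow> card J = q \<Longrightarrow> coeffs std_coframe p q \<alpha> I J = frame_eval (frame_idx J I) \<alpha>"
  using frame_eval_comb[of J I p q "coeffs std_coframe p q \<alpha>"] by (simp add: coeffs_works)

section \<open>Pullback\<close>

definition pull :: "('n cvec \<Rightarrow> 'n cvec) \<Rightarrow> 'n ext \<Rightarrow> 'n ext" where
  "pull L \<alpha> = (\<lambda>vs. \<alpha> (map L vs))"

text \<open>A coframe dz_t consists of the components of the differential L of a coordinate change.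
  It is the standard coframe pulled back by L, so for surjective L uniqueness and independence
  reduce to \<open>std_coframe\<close>.\<close>

definition coframe_of :: "('n::finite cvec \<Rightarrow> 'n cvec) \<Rightarrow> 'n coframe" where
  "coframe_of L = (\<lambda>k v. L v $ k)"

lemma pull_wedge: "pull L (wedge \<alpha> \<beta>) = wedge (pull L \<alpha>) (pull L \<beta>)"
proof
  fix vs
  have g: "grade (pull L \<alpha>) = pull L (grade \<alpha>)" for \<alpha> by (simp add: grade_def pull_def)
  show "pull L (wedge \<alpha> \<beta>) vs = wedge (pull L \<alpha>) (pull L \<beta>) vs"
  proof (induction vs arbitrary: \<alpha> \<beta>)
    case (Cons v vs)
    have c: "(\<lambda>us. pull L \<alpha> (v # us)) = pull L (\<lambda>us. \<alpha> (L v # us))" for \<alpha> by (simp add: pull_def)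
    show ?case using Cons by (simp add: g c) (simp add: pull_def)
  qed (simp add: pull_def)
qed

lemma pull_wedges: "pull L (wedges f xs) = wedges (\<lambda>i v. f i (L v)) xs"
proof (induction xs)
  case Nil then show ?case by (auto simp: pull_def ext_one_def)
next
  case (Cons x xs) then show ?case by (simp add: pull_wedge) (simp add: pull_def)
qed

lemma pull_dzI: "pull L (dzI (coframe_of M) I) = dzI (coframe_of (\<lambda>v. M (L v))) I"
    "pull L (dzbarJ (coframe_of M) I) = dzbarJ (coframe_of (\<lambda>v. M (L v))) I"
    "pull L (vol (coframe_of M)) = vol (coframe_of (\<lambda>v. M (L v)))"
  by (simp_all add: dzI_wedges dzbarJ_wedges vol_def pull_wedges coframe_of_def)

lemma std_coframe_coframe_of: "std_coframe = coframe_of (\<lambda>v. v)" by (simp add: std_coframe_def coframe_of_def)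

lemma pull_comb: "comb (coframe_of L) p q s = pull L (comb std_coframe p q s)"
proof
  fix vs
  have "wedge (dzbarJ (coframe_of L) J) (dzI (coframe_of L) I) vs = wedge (dzbarJ std_coframe J) (dzI std_coframe I) (map L vs)" for I J
    using pull_wedge[of L "dzbarJ std_coframe J" "dzI std_coframe I"] unfolding std_coframe_coframe_of pull_dzI
    by (metis pull_def)
  then show "comb (coframe_of L) p q s vs = pull L (comb std_coframe p q s) vs"
    by (simp add: comb_def pull_def)
qed

lemma pull_eq_iff: "surj L \<Longrightarrow> pull L \<alpha> = pull L \<beta> \<longleftrightarrow> \<alpha> = \<beta>"
proof
  assume L: "surj L" "pull L \<alpha> = pull L \<beta>"
  have "\<exists>us. vs = map L us" for vs
    using L(1) by (metis ex_map_conv surjD)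
  then show "\<alpha> = \<beta>" using L(2) by (metis ext pull_def)
qed simp

lemma Lam_pull: "\<alpha> \<in> Lam (coframe_of L) p q \<longleftrightarrow> (\<exists>\<beta>\<in>Lam std_coframe p q. \<alpha> = pull L \<beta>)"
  by (auto simp: Lam_def pull_comb)

lemma coeffs_pull: "surj L \<Longrightarrow> coeffs (coframe_of L) p q (pull L \<alpha>) = coeffs std_coframe p q \<alpha>"
  unfolding coeffs_def pull_comb by (simp add: pull_eq_iff)

lemma Lam_empty: "\<not> (p \<le> CARD('n) \<and> q \<le> CARD('n)) \<Longrightarrow> \<alpha> \<in> Lam w p q \<Longrightarrow> \<alpha> = (\<lambda>_. 0)"
  for w :: "'n::{finite,linorder} coframe"
proof -
  assume *: "\<not> (p \<le> CARD('n) \<and> q \<le> CARD('n))" "\<alpha> \<in> Lam w p q"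
  have "card I \<le> CARD('n)" for I :: "'n set" by (simp add: card_mono)
  then have "{I :: 'n set. card I = p} = {} \<or> {I :: 'n set. card I = q} = {}" using *(1) by auto
  then show ?thesis using *(2) by (auto simp: Lam_def comb_def)
qed

text \<open>A frame evaluation at multi-indices of one type kills every summand of another
  type.\<close>

lemma Lam_independent:
  assumes "finite F" "\<And>k. k \<in> F \<Longrightarrow> f k \<in> Lam std_coframe (fst k) (snd k)" "(\<lambda>vs. \<Sum>k\<in>F. f k vs) = (\<lambda>_. 0)" "k \<in> F"
  shows "f k = (\<lambda>_. 0)"
proof -
  have "frame_eval (frame_idx J I) (f k) = 0" if c: "card I = fst k" "card J = snd k" for I J
  proof -
    have "0 = frame_eval (frame_idx J I) (\<lambda>vs. \<Sum>k\<in>F. f k vs)" using assms(3) by (simp add: frame_eval_linear)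
    also have "\<dots> = (\<Sum>k'\<in>F. frame_eval (frame_idx J I) (f k'))" by (rule frame_eval_sum)
    also have "\<dots> = (\<Sum>k'\<in>F. if k' = k then frame_eval (frame_idx J I) (f k) else 0)"
      by (intro sum.cong refl) (use c assms(2) in \<open>auto intro!: Lam_ev0 simp: prod_eq_iff\<close>)
    also have "\<dots> = frame_eval (frame_idx J I) (f k)" using assms by simp
    finally show ?thesis by simp
  qed
  then have "comb std_coframe (fst k) (snd k) (\<lambda>I J. frame_eval (frame_idx J I) (f k)) = comb std_coframe (fst k) (snd k) (\<lambda>I J. 0)"
    by (intro comb_cong) auto
  then show ?thesis using Lam_frame_eval[OF assms(2)[OF assms(4)]] by (simp add: comb_linear)
qed

lemma Lam_independent_coframe_of:
  assumes "surj L" "finite F" "\<And>k. k \<in> F \<Longrightarrow> f k \<in> Lam (coframe_of L) (fst k) (snd k)"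
    "(\<lambda>vs. \<Sum>k\<in>F. f k vs) = (\<lambda>_. 0)" "k \<in> F"
  shows "f k = (\<lambda>_. 0)"
proof -
  obtain g where g: "\<And>k. k \<in> F \<Longrightarrow> g k \<in> Lam std_coframe (fst k) (snd k) \<and> f k = pull L (g k)"
    using assms(3) unfolding Lam_pull by metis
  have "pull L (\<lambda>vs. \<Sum>k\<in>F. g k vs) = pull L (\<lambda>_. 0)"
    using assms(4) g by (simp add: pull_def fun_eq_iff)
  then have "g k = (\<lambda>_. 0)"
    using assms g by (intro Lam_independent[OF assms(2), of g]) (auto simp: pull_eq_iff)
  then show ?thesis using g[OF assms(5)] by (simp add: pull_def)
qed

text \<open>Any finite decomposition into pure types computes the projection, even one that lists
  types beyond the dimension: those components are zero, so the sum can be rewritten over the square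
  of types used by \<open>type_part\<close>.\<close>

lemma type_part_eq:
  fixes L :: "'n::{finite,linorder} cvec \<Rightarrow> 'n cvec"
  assumes "surj L" "finite F" "\<And>k. k \<in> F \<Longrightarrow> f k \<in> Lam (coframe_of L) (fst k) (snd k)"
    "\<alpha> = (\<lambda>vs. \<Sum>k\<in>F. f k vs)"
  shows "type_part (coframe_of L) p q \<alpha> = (if (p, q) \<in> F then f (p, q) else (\<lambda>_. 0))"
proof -
  define N where "N = {..CARD('n)} \<times> {..CARD('n)}"
  define f' where "f' k = (if k \<in> F then f k else (\<lambda>_. 0))" for k
  have f': "f' k \<in> Lam (coframe_of L) (fst k) (snd k)" for k using assms(3) by (auto simp: f'_def)
  have f0: "f' k = (\<lambda>_. 0)" if "k \<notin> N" for k
    using Lam_empty[OF _ f'[of k]] that by (auto simp: N_def mem_Times_iff)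
  have a: "\<alpha> = (\<lambda>vs. \<Sum>k\<in>N. f' k vs)"
  proof
    fix vs
    have "\<alpha> vs = (\<Sum>k\<in>F \<union> N. f' k vs)" unfolding assms(4)
      by (rule sum.mono_neutral_cong_left) (auto simp: f'_def assms N_def)
    also have "\<dots> = (\<Sum>k\<in>N. f' k vs)"
      by (rule sum.mono_neutral_cong_right) (auto simp: assms f0 N_def) 
    finally show "\<alpha> vs = (\<Sum>k\<in>N. f' k vs)" .
  qed
  have N: "(\<lambda>vs. \<Sum>i\<le>CARD('n). \<Sum>j\<le>CARD('n). a i j vs) = (\<lambda>vs. \<Sum>k\<in>N. a (fst k) (snd k) vs)"
    for a :: "nat \<Rightarrow> nat \<Rightarrow> 'n ext"
    by (simp add: N_def sum.cartesian_product case_prod_unfold)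
  have "type_part (coframe_of L) p q \<alpha> = f' (p, q)"
    unfolding type_part_def
  proof (rule the_equality)
    show "\<exists>a. (\<forall>i j. a i j \<in> Lam (coframe_of L) i j) \<and>
        \<alpha> = (\<lambda>vs. \<Sum>i\<le>CARD('n). \<Sum>j\<le>CARD('n). a i j vs) \<and> f' (p, q) = a p q"
      by (rule exI[of _ "\<lambda>i j. f' (i, j)"]) (use f' a N[of "\<lambda>i j. f' (i, j)"] in force)
  next
    fix \<beta> assume "\<exists>a. (\<forall>i j. a i j \<in> Lam (coframe_of L) i j) \<and>
        \<alpha> = (\<lambda>vs. \<Sum>i\<le>CARD('n). \<Sum>j\<le>CARD('n). a i j vs) \<and> \<beta> = a p q"
    then obtain b where b: "\<And>i j. b i j \<in> Lam (coframe_of L) i j"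
        "\<alpha> = (\<lambda>vs. \<Sum>k\<in>N. b (fst k) (snd k) vs)" "\<beta> = b p q"
      unfolding N by blast
    show "\<beta> = f' (p, q)"
    proof (cases "(p, q) \<in> N")
      case False
      then have "b p q = (\<lambda>_. 0)" using Lam_empty[OF _ b(1)[of p q]] by (auto simp: N_def)
      then show ?thesis using f0 False b(3) by simp
    next
      case True
      \<comment> \<open>The differences of the components of two decompositions are pure types with
        sum zero.\<close>
      have "(\<lambda>vs. b (fst (p, q)) (snd (p, q)) vs + (-1) * f' (p, q) vs) = (\<lambda>_. 0)"
      proof (rule Lam_independent_coframe_of[OF assms(1), of N "\<lambda>k vs. b (fst k) (snd k) vs + (-1) * f' k vs"])
        show "(\<lambda>vs. \<Sum>k\<in>N. b (fst k) (snd k) vs + (-1) * f' k vs) = (\<lambda>_. 0)"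
          using b(2) a by (simp add: sum_subtractf fun_eq_iff)
      next
        show "(\<lambda>vs. b (fst k) (snd k) vs + (-1) * f' k vs) \<in> Lam (coframe_of L) (fst k) (snd k)" for k
          by (intro Lam_add Lam_scale b f')
      qed (use True in \<open>auto simp: N_def\<close>)
      then show ?thesis using b(3) by (simp add: fun_eq_iff)
    qed
  qed
  then show ?thesis by (simp add: f'_def)
qed

section \<open>Substitution of one-forms\<close>

text \<open>On alternating forms, the algebra homomorphism replacing each \<open>coord g\<close> by \<open>a g\<close>.\<close>

fun form_subst :: "(bool \<times> 'n \<Rightarrow> 'n::finite cvec \<Rightarrow> complex) \<Rightarrow> 'n ext \<Rightarrow> 'n ext" where
  "form_subst a \<alpha> [] = \<alpha> []"
| "form_subst a \<alpha> (v # vs) = (\<Sum>g\<in>UNIV. a g v * form_subst a (contr g \<alpha>) vs)"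

lemma form_subst_add: "form_subst a (\<lambda>us. \<alpha> us + \<beta> us) vs = form_subst a \<alpha> vs + form_subst a \<beta> vs"
  by (induction vs arbitrary: \<alpha> \<beta>) (auto simp: contr_linear sum.distrib algebra_simps)

lemma form_subst_scale: "form_subst a (\<lambda>us. c * \<alpha> us) vs = c * form_subst a \<alpha> vs"
  by (induction vs arbitrary: \<alpha>) (auto simp: contr_linear sum_distrib_left algebra_simps)

lemma form_subst_zero [simp]: "form_subst a (\<lambda>us. 0) vs = 0"
  using form_subst_scale[of a 0 "\<lambda>_. 0" vs] by simp

lemma form_subst_minus: "form_subst a (\<lambda>us. - \<alpha> us) vs = - form_subst a \<alpha> vs"
  using form_subst_scale[of a "-1" \<alpha> vs] by simp

lemma form_subst_diff: "form_subst a (\<lambda>us. \<alpha> us - \<beta> us) vs = form_subst a \<alpha> vs - form_subst a \<beta> vs"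
  using form_subst_add[of a \<alpha> "\<lambda>us. - \<beta> us" vs] by (simp add: form_subst_minus)

lemma form_subst_sum: "form_subst a (\<lambda>us. \<Sum>i\<in>A. f i us) vs = (\<Sum>i\<in>A. form_subst a (f i) vs)"
  by (induction A rule: infinite_finite_induct) (auto simp: form_subst_add)

lemmas form_subst_linear = form_subst_add form_subst_scale form_subst_minus form_subst_diff form_subst_sum

lemma form_subst_grade: "form_subst a (grade \<alpha>) vs = grade (form_subst a \<alpha>) vs"
proof (induction vs arbitrary: \<alpha>)
  case (Cons v vs)
  show ?case by (simp add: form_subst_minus Cons) (simp add: grade_def sum_distrib_left sum_negf algebra_simps)
qed (simp add: grade_def)

text \<open>Both sides obey the same recursion in the argument list, since contraction is an
  antiderivation and substitution commutes with \<open>grade\<close>.\<close>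

lemma form_subst_wedge: "form_subst a (wedge \<alpha> \<beta>) vs = wedge (form_subst a \<alpha>) (form_subst a \<beta>) vs"
proof (induction vs arbitrary: \<alpha> \<beta>)
  case (Cons v vs)
  have g: "form_subst a (grade \<alpha>) = grade (form_subst a \<alpha>)" by (simp add: fun_eq_iff form_subst_grade)
  show ?case
    by (simp add: contr_wedge form_subst_linear Cons g wedge_linear sum.distrib algebra_simps)
qed simp

lemma form_subst_wedge': "form_subst a (wedge \<alpha> \<beta>) = wedge (form_subst a \<alpha>) (form_subst a \<beta>)"
  by (simp add: fun_eq_iff form_subst_wedge)

lemma form_subst_ext_one [simp]: "form_subst a ext_one = ext_one"
proof
  fix vs :: "'a cvec list" show "form_subst a ext_one vs = ext_one vs" by (cases vs) auto
qed

lemma form_subst_one_form: "form_subst a (one_form \<theta>) = one_form (\<lambda>v. \<Sum>g\<in>UNIV. ccoef g \<theta> * a g v)"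
proof
  fix vs
  show "form_subst a (one_form \<theta>) vs = one_form (\<lambda>v. \<Sum>g\<in>UNIV. ccoef g \<theta> * a g v) vs"
    by (cases vs) (simp_all add: form_subst_linear sum_distrib_right mult.assoc mult.left_commute)
qed

lemma form_subst_coord: "form_subst a (one_form (coord g)) = one_form (a g)"
  by (simp add: form_subst_one_form mult_if_01)

lemma form_subst_wedges: "form_subst a (wedges f xs) = wedges (\<lambda>i v. \<Sum>g\<in>UNIV. ccoef g (f i) * a g v) xs"
  by (induction xs) (auto simp: form_subst_wedge' form_subst_one_form)

lemma contr_pull:
  assumes "alternating \<alpha>" "linear D"
  shows "contr g (pull D \<alpha>) = (\<lambda>vs. \<Sum>h\<in>UNIV. ccoef g (\<lambda>v. coord h (D v)) * pull D (contr h \<alpha>) vs)"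
proof
  fix vs
  have "contr g (pull D \<alpha>) vs = ccoef g (\<lambda>v. \<Sum>h\<in>UNIV. coord h (D v) * contr h \<alpha> (map D vs))"
    by (simp add: contr_def[of g] pull_def contr_expand[OF assms(1)])
  then show "contr g (pull D \<alpha>) vs = (\<Sum>h\<in>UNIV. ccoef g (\<lambda>v. coord h (D v)) * pull D (contr h \<alpha>) vs)"
    by (simp add: ccoef_sum ccoef_linear pull_def)
qed

text \<open>Naturality of substitutions: the hypothesis compares both sides on generators, and the
  rest follows by contracting one argument at a time. It yields the compatibility of P_t with chart
  changes on X_0.\<close>

lemma form_subst_pull:
  assumes "alternating \<alpha>" "linear D" "\<And>h v. (\<Sum>g\<in>UNIV. ccoef g (\<lambda>v. coord h (D v)) * a g v) = b h (D v)"
  shows "form_subst a (pull D \<alpha>) vs = form_subst b \<alpha> (map D vs)"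
  using assms(1)
proof (induction vs arbitrary: \<alpha>)
  case (Cons v vs)
  have "form_subst a (pull D \<alpha>) (v # vs)
      = (\<Sum>g\<in>UNIV. a g v * (\<Sum>h\<in>UNIV. ccoef g (\<lambda>v. coord h (D v)) * form_subst b (contr h \<alpha>) (map D vs)))"
    by (simp add: contr_pull[OF Cons.prems assms(2)] form_subst_linear Cons.IH alternating_contr Cons.prems)
  also have "\<dots> = (\<Sum>h\<in>UNIV. (\<Sum>g\<in>UNIV. ccoef g (\<lambda>v. coord h (D v)) * a g v) * form_subst b (contr h \<alpha>) (map D vs))"
    by (simp add: sum_distrib_left sum_distrib_right algebra_simps) (rule sum.swap)
  finally show ?case by (simp add: assms(3))
qed (simp add: pull_def)

lemma form_subst_id: "alternating \<alpha> \<Longrightarrow> form_subst coord \<alpha> vs = \<alpha> vs"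
proof (induction vs arbitrary: \<alpha>)
  case (Cons v vs)
  then show ?case by (simp add: alternating_contr contr_expand[OF Cons.prems])
qed simp

text \<open>Pullback is itself a substitution of one-forms, which makes the product rule for
  substitutions available for the exterior derivative of a pullback.\<close>

lemma pull_form_subst:
  assumes "alternating \<alpha>" "linear D" shows "pull D \<alpha> vs = form_subst (\<lambda>g v. coord g (D v)) \<alpha> vs"
  using assms(1)
proof (induction vs arbitrary: \<alpha>)
  case (Cons v vs)
  then show ?case by (simp add: pull_def alternating_contr contr_expand[OF Cons.prems] flip: Cons.IH)
qed (simp add: pull_def)

text \<open>The substitution is a homomorphism, so only generators matter. With w = dz_t this says
  that P_t takes type (p,q) on X_0 to type (p,q) on X_t.\<close>

lemma has_type_form_subst:
  assumes "has_type std_coframe p q \<alpha>" "\<And>j. \<exists>c. a (False, j) = (\<lambda>v. \<Sum>k\<in>UNIV. c k * w k v)"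
    "\<And>j. \<exists>c. a (True, j) = (\<lambda>v. \<Sum>k\<in>UNIV. c k * cnj (w k v))"
  shows "has_type w p q (form_subst a \<alpha>)"
  using assms(1)
proof induction
  case (has_type_add p q \<alpha> \<beta>)
  then show ?case using has_type.has_type_add by (simp add: form_subst_add[abs_def])
next
  case (has_type_scale p q \<alpha> c)
  then show ?case using has_type.has_type_scale by (simp add: form_subst_scale[abs_def])
next
  case (has_type_dz p q \<alpha> k)
  show ?case unfolding coord_std_coframe[symmetric] form_subst_wedge' form_subst_coord
    using assms(2)[of k] has_type_dz.IH by (auto intro: has_type_wedge_span)
next
  case (has_type_dzb p q \<alpha> k)
  show ?case unfolding coord_std_coframe(2)[symmetric] form_subst_wedge' form_subst_coord
    using assms(3)[of k] has_type_dzb.IH by (auto intro: has_type_wedge_span_bar)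
qed (use has_type_one has_type_zero in \<open>auto simp: form_subst_zero[abs_def]\<close>)

text \<open>The two cases of p avoid the subtraction p - 1: a form without dz-factors is
  annihilated, otherwise one such factor is removed.\<close>

lemma has_type_contr:
  assumes "has_type std_coframe p q \<alpha>"
  shows "(p = 0 \<longrightarrow> contr (False, j) \<alpha> = (\<lambda>_. 0)) \<and> (\<forall>p'. p = Suc p' \<longrightarrow> has_type std_coframe p' q (contr (False, j) \<alpha>))"
  using assms
proof induction
  case (has_type_dz p q \<alpha> k)
  have "has_type std_coframe p q (wedge (one_form (std_coframe k)) (contr (False, j) \<alpha>))"
    using has_type_dz.IH by (cases p) (auto intro: has_type.has_type_dz has_type.has_type_zero simp: wedge_zero_right[abs_def])
  then show ?case using has_type_dz.hyps by (auto simp: contr_wedge_one_form intro: has_type_diff has_type.has_type_scale)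
next
  case (has_type_dzb p q \<alpha> k)
  have "ccoef (False, j) (\<lambda>v. cnj (std_coframe k v)) = 0" using ccoef_coord[of "(False, j)" "(True, k)"] by (simp add: coord_std_coframe)
  then show ?case using has_type_dzb.IH
    by (auto simp: contr_wedge_one_form intro: has_type.has_type_dzb has_type_minus simp: wedge_zero_right[abs_def])
qed (auto simp: contr_linear intro: has_type.intros)

lemma has_type_contr_bar:
  assumes "has_type std_coframe p q \<alpha>"
  shows "(q = 0 \<longrightarrow> contr (True, j) \<alpha> = (\<lambda>_. 0)) \<and> (\<forall>q'. q = Suc q' \<longrightarrow> has_type std_coframe p q' (contr (True, j) \<alpha>))"
  using assms
proof induction
  case (has_type_dzb p q \<alpha> k)
  have "has_type std_coframe p q (wedge (one_form (\<lambda>v. cnj (std_coframe k v))) (contr (True, j) \<alpha>))"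
    using has_type_dzb.IH by (cases q) (auto intro: has_type.has_type_dzb has_type.has_type_zero simp: wedge_zero_right[abs_def])
  then show ?case using has_type_dzb.hyps by (auto simp: contr_wedge_one_form intro: has_type_diff has_type.has_type_scale)
next
  case (has_type_dz p q \<alpha> k)
  have "ccoef (True, j) (std_coframe k) = 0" using ccoef_coord[of "(True, j)" "(False, k)"] by (simp add: coord_std_coframe)
  then show ?case using has_type_dz.IH
    by (auto simp: contr_wedge_one_form intro: has_type.has_type_dz has_type_minus simp: wedge_zero_right[abs_def])
qed (auto simp: contr_linear intro: has_type.intros)

lemma alternating_Lam: "\<alpha> \<in> Lam (coframe_of L) p q \<Longrightarrow> linear L \<Longrightarrow> alternating \<alpha>"
  by (auto simp: Lam_iff_has_type coframe_of_def linear_iff intro!: alternating_has_type)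

section \<open>Contraction with a Beltrami differential\<close>

definition belt :: "'n::finite cmat \<Rightarrow> 'n \<Rightarrow> 'n cvec \<Rightarrow> complex" where
  "belt \<phi> i v = (\<Sum>l\<in>UNIV. \<phi> $ i $ l * cnj (v $ l))"

lemma ins_eq: "ins \<phi> \<beta> = (\<lambda>vs. \<Sum>i\<in>UNIV. wedge (one_form (belt \<phi> i)) (contr (False, i) \<beta>) vs)"
  by (simp add: ins_def belt_def[abs_def] contract_eq_contr)

lemma belt_coord: "belt \<phi> i = (\<lambda>v. \<Sum>l\<in>UNIV. \<phi> $ i $ l * coord (True, l) v)"
  by (simp add: belt_def coord_def fun_eq_iff)

lemma linear_belt [simp]: "linear (belt \<phi> i)"
  by (auto simp: linear_iff belt_def scaleRc sum.distrib sum_distrib_left algebra_simps)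

lemma ccoef_belt [simp]: "ccoef (False, j) (belt \<phi> i) = 0" "ccoef (True, j) (belt \<phi> i) = \<phi> $ i $ j"
  by (simp_all add: belt_coord ccoef_sum ccoef_linear mult_if_01)

lemma ins_linear:
  "ins \<phi> (\<lambda>vs. \<alpha> vs + \<beta> vs) = (\<lambda>vs. ins \<phi> \<alpha> vs + ins \<phi> \<beta> vs)"
  "ins \<phi> (\<lambda>vs. c * \<alpha> vs) = (\<lambda>vs. c * ins \<phi> \<alpha> vs)"
  "ins \<phi> (\<lambda>vs. 0) = (\<lambda>vs. 0)"
  by (simp_all add: ins_eq contr_linear wedge_linear sum.distrib sum_distrib_left)

lemma ins_sum: "ins \<phi> (\<lambda>vs. \<Sum>i\<in>A. f i vs) = (\<lambda>vs. \<Sum>i\<in>A. ins \<phi> (f i) vs)"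
  by (induction A rule: infinite_finite_induct) (auto simp: ins_linear)

lemma alternating_ins: "alternating \<alpha> \<Longrightarrow> alternating (ins \<phi> \<alpha>)"
  unfolding ins_eq by (intro alternating_sum alternating_wedge alternating_one_form alternating_contr) auto

text \<open>The forms \<phi>^i contain no dz^j, so the contraction only passes through them; the
  signs from passing \<phi>^i and from exchanging two contractions cancel.\<close>

lemma contr_ins_unbarred:
  assumes "alternating \<alpha>" shows "contr (False, j) (ins \<phi> \<alpha>) = ins \<phi> (contr (False, j) \<alpha>)"
proof -
  have s: "contr (False, j) (contr (False, i) \<alpha>) = (\<lambda>vs. - contr (False, i) (contr (False, j) \<alpha>) vs)" for i
    by (rule ext) (rule contr_contr[OF assms])
  show ?thesis by (simp add: ins_eq contr_sum contr_wedge_one_form s wedge_linear)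
qed

text \<open>Here the contraction also meets \<phi>^i itself. These extra terms are the source of the
  summand \<phi>^i in \<open>exp_frame\<close>.\<close>

lemma contr_ins_barred:
  assumes "alternating \<alpha>"
  shows "contr (True, l) (ins \<phi> \<alpha>) = (\<lambda>vs. (\<Sum>i\<in>UNIV. \<phi> $ i $ l * contr (False, i) \<alpha> vs) + ins \<phi> (contr (True, l) \<alpha>) vs)"
proof -
  have s: "contr (True, l) (contr (False, i) \<alpha>) = (\<lambda>vs. - contr (False, i) (contr (True, l) \<alpha>) vs)" for i
    by (rule ext) (rule contr_contr[OF assms])
  show ?thesis by (simp add: ins_eq contr_sum contr_wedge_one_form s wedge_linear sum.distrib)
qed

lemma alternating_ins_pow: "alternating \<alpha> \<Longrightarrow> alternating ((ins \<phi> ^^ k) \<alpha>)"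
  by (induction k) (auto intro: alternating_ins)

lemma contr_ins_pow_unbarred:
  "alternating \<alpha> \<Longrightarrow> contr (False, j) ((ins \<phi> ^^ k) \<alpha>) = (ins \<phi> ^^ k) (contr (False, j) \<alpha>)"
  by (induction k) (auto simp: contr_ins_unbarred alternating_ins_pow)

lemma contr_ins_pow_barred:
  "alternating \<alpha> \<Longrightarrow> contr (True, l) ((ins \<phi> ^^ k) \<alpha>) = (\<lambda>vs. (ins \<phi> ^^ k) (contr (True, l) \<alpha>) vs
     + of_nat k * (\<Sum>i\<in>UNIV. \<phi> $ i $ l * (ins \<phi> ^^ (k - 1)) (contr (False, i) \<alpha>) vs))"
proof (induction k)
  case (Suc k)
  have 1: "contr (True, l) ((ins \<phi> ^^ Suc k) \<alpha>) = (\<lambda>vs. (\<Sum>i\<in>UNIV. \<phi> $ i $ l * (ins \<phi> ^^ k) (contr (False, i) \<alpha>) vs)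
      + (ins \<phi> ^^ Suc k) (contr (True, l) \<alpha>) vs
      + of_nat k * (\<Sum>i\<in>UNIV. \<phi> $ i $ l * ins \<phi> ((ins \<phi> ^^ (k - 1)) (contr (False, i) \<alpha>)) vs))"
    using Suc by (simp add: contr_ins_barred alternating_ins_pow contr_ins_pow_unbarred ins_linear ins_sum add.assoc)
  have 2: "of_nat k * (\<Sum>i\<in>UNIV. \<phi> $ i $ l * ins \<phi> ((ins \<phi> ^^ (k - 1)) (contr (False, i) \<alpha>)) vs)
      = of_nat k * (\<Sum>i\<in>UNIV. \<phi> $ i $ l * (ins \<phi> ^^ k) (contr (False, i) \<alpha>) vs)" for vs
    by (cases k) auto
  show ?case unfolding 1 2 by (simp add: algebra_simps)
qed simp

definition exp_frame :: "'n::finite cmat \<Rightarrow> bool \<times> 'n \<Rightarrow> 'n cvec \<Rightarrow> complex" where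
  "exp_frame \<phi> g v = (if fst g then coord g v else coord g v + belt \<phi> (snd g) v)"

lemma ins_pow_Nil: "(ins \<phi> ^^ k) \<alpha> [] = (if k = 0 then \<alpha> [] else 0)"
  by (cases k) (simp_all add: ins_eq)

text \<open>The factor k counts at which of the k applications of \<open>ins\<close> the head factor
  dz^i is replaced by \<phi>^i; it turns 1/k! into 1/(k-1)! in the exponential series.\<close>

lemma ins_pow_Cons:
  assumes "alternating \<alpha>"
  shows "(ins \<phi> ^^ k) \<alpha> (v # vs) = (\<Sum>g\<in>UNIV. coord g v * (ins \<phi> ^^ k) (contr g \<alpha>) vs)
    + of_nat k * (\<Sum>i\<in>UNIV. belt \<phi> i v * (ins \<phi> ^^ (k - 1)) (contr (False, i) \<alpha>) vs)"
proof -
  have "(\<Sum>l\<in>UNIV. coord (True, l) v * (of_nat k * (\<Sum>i\<in>UNIV. \<phi> $ i $ l * (ins \<phi> ^^ (k - 1)) (contr (False, i) \<alpha>) vs)))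
      = of_nat k * (\<Sum>i\<in>UNIV. belt \<phi> i v * (ins \<phi> ^^ (k - 1)) (contr (False, i) \<alpha>) vs)"
    unfolding belt_coord sum_distrib_left sum_distrib_right
    by (subst sum.swap) (simp add: algebra_simps)
  then show ?thesis
    unfolding contr_expand[OF alternating_ins_pow[OF assms]] sum_bool_prod
    by (simp add: contr_ins_pow_unbarred[OF assms] contr_ins_pow_barred[OF assms] sum.distrib distrib_left)
qed

text \<open>By \<open>ins_pow_Cons\<close>, shortening the argument list by one lowers the power by
  at most one. Hence the exponential series terminates.\<close>

lemma ins_pow_zero: "alternating \<alpha> \<Longrightarrow> length vs < k \<Longrightarrow> (ins \<phi> ^^ k) \<alpha> vs = 0"
proof (induction vs arbitrary: \<alpha> k)
  case Nil then show ?case by (auto simp: ins_pow_Nil)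
next
  case (Cons v vs)
  then show ?case by (simp add: ins_pow_Cons alternating_contr)
qed

lemma exp_ins_finite:
  assumes "alternating \<alpha>" "length vs \<le> m"
  shows "exp_ins \<phi> \<alpha> vs = (\<Sum>k\<le>m. (1 / fact k) * (ins \<phi> ^^ k) \<alpha> vs)"
  unfolding exp_ins_def using assms by (intro suminf_finite) (auto simp: ins_pow_zero)

text \<open>The exponential of a derivation is an algebra homomorphism, and
  \<open>ins \<phi>\<close> sends dz^i to \<phi>^i and \<phi>^i to 0, so on generators the series
  stops at dz^i + \<phi>^i. The proof verifies this one argument at a time.\<close>

lemma exp_ins_eq_form_subst: "alternating \<alpha> \<Longrightarrow> exp_ins \<phi> \<alpha> vs = form_subst (exp_frame \<phi>) \<alpha> vs"
proof (induction vs arbitrary: \<alpha>)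
  case Nil then show ?case using exp_ins_finite[of \<alpha> "[]" 0] by simp
next
  case (Cons v vs)
  let ?m = "length vs"
  \<comment> \<open>Two truncations of the same series: \<open>e\<close> has one term more than
    required, matching the range before the index shift, and \<open>e'\<close> matches the range
    after it.\<close>
  have e: "exp_ins \<phi> (contr g \<alpha>) vs = (\<Sum>k\<le>Suc ?m. (1 / fact k) * (ins \<phi> ^^ k) (contr g \<alpha>) vs)" for g
    by (rule exp_ins_finite) (auto intro: alternating_contr Cons.prems)
  have e': "exp_ins \<phi> (contr g \<alpha>) vs = (\<Sum>k\<le>?m. (1 / fact k) * (ins \<phi> ^^ k) (contr g \<alpha>) vs)" for g
    by (rule exp_ins_finite) (auto intro: alternating_contr Cons.prems)
  \<comment> \<open>The term k = 0 vanishes because of the factor k, and k/k! = 1/(k-1)! for the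
    others.\<close>
  have s: "(\<Sum>k\<le>Suc ?m. (1 / fact k) * (of_nat k * c (k - 1))) = (\<Sum>k\<le>?m. (1 / fact k) * (c k :: complex))" for c
  proof -
    have "(1 / fact (Suc k)) * (of_nat (Suc k) * c k) = (1 / fact k) * c k" for k
      unfolding fact_Suc of_nat_mult by (simp del: of_nat_Suc)
    then show ?thesis by (subst sum.atMost_Suc_shift) (simp del: of_nat_Suc fact_Suc)
  qed
  have "exp_ins \<phi> \<alpha> (v # vs) = (\<Sum>k\<le>Suc ?m. (1 / fact k) * (ins \<phi> ^^ k) \<alpha> (v # vs))"
    by (rule exp_ins_finite) (auto intro: Cons.prems)
  also have "\<dots> = (\<Sum>k\<le>Suc ?m. (1 / fact k) * (\<Sum>g\<in>UNIV. coord g v * (ins \<phi> ^^ k) (contr g \<alpha>) vs))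
     + (\<Sum>k\<le>Suc ?m. (1 / fact k) * (of_nat k * (\<Sum>i\<in>UNIV. belt \<phi> i v * (ins \<phi> ^^ (k - 1)) (contr (False, i) \<alpha>) vs)))"
    unfolding ins_pow_Cons[OF Cons.prems] by (simp only: distrib_left sum.distrib)
  also have "(\<Sum>k\<le>Suc ?m. (1 / fact k) * (\<Sum>g\<in>UNIV. coord g v * (ins \<phi> ^^ k) (contr g \<alpha>) vs))
      = (\<Sum>g\<in>UNIV. coord g v * exp_ins \<phi> (contr g \<alpha>) vs)"
    unfolding e sum_distrib_left by (subst sum.swap) (simp only: mult.left_commute)
  also have "(\<Sum>k\<le>Suc ?m. (1 / fact k) * (of_nat k * (\<Sum>i\<in>UNIV. belt \<phi> i v * (ins \<phi> ^^ (k - 1)) (contr (False, i) \<alpha>) vs)))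
      = (\<Sum>i\<in>UNIV. belt \<phi> i v * exp_ins \<phi> (contr (False, i) \<alpha>) vs)"
    unfolding s[of "\<lambda>k. \<Sum>i\<in>UNIV. belt \<phi> i v * (ins \<phi> ^^ k) (contr (False, i) \<alpha>) vs"]
    unfolding e' sum_distrib_left by (subst sum.swap) (simp only: mult.left_commute)
  also have "(\<Sum>g\<in>UNIV. coord g v * exp_ins \<phi> (contr g \<alpha>) vs) + (\<Sum>i\<in>UNIV. belt \<phi> i v * exp_ins \<phi> (contr (False, i) \<alpha>) vs)
      = (\<Sum>g\<in>UNIV. exp_frame \<phi> g v * exp_ins \<phi> (contr g \<alpha>) vs)"
    unfolding sum_bool_prod by (simp add: exp_frame_def distrib_right sum.distrib)
  finally show ?case by (simp add: Cons.IH alternating_contr Cons.prems)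
qed


section \<open>The map on covectors\<close>

lemma dual_vol_vol:
  assumes "vol w \<noteq> (\<lambda>_. 0)"
  shows "dual_vol w (\<lambda>vs. a * vol w vs) = a"
proof -
  obtain vs0 where v: "vol w vs0 \<noteq> 0" using assms by auto
  have u: "b = a" if "(\<lambda>vs. a * vol w vs) = (\<lambda>vs. b * vol w vs)" for b
    using fun_cong[OF that, of vs0] v by simp
  have "(THE b. (\<lambda>vs. a * vol w vs) = (\<lambda>vs. b * vol w vs)) = a"
    by (rule the_equality) (use u in auto)
  then show ?thesis unfolding dual_vol_def by auto
qed

lemma dual_vol_notin: "\<nexists>a. \<kappa> = (\<lambda>vs. a * vol w vs) \<Longrightarrow> dual_vol w \<kappa> = 0"
  by (simp add: dual_vol_def)

lemma card_eq_univ: "card I = CARD('n) \<longleftrightarrow> I = (UNIV :: 'n::finite set)"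
  using card_subset_eq[of UNIV I] by auto

lemma Lam_top: "\<kappa> \<in> Lam w CARD('n) 0 \<longleftrightarrow> (\<exists>a. \<kappa> = (\<lambda>vs. a * vol w vs))"
  for w :: "'n::{finite,linorder} coframe"
proof -
  have "comb w CARD('n) 0 s = (\<lambda>vs. s UNIV {} * vol w vs)" for s
    by (simp add: comb_def card_eq_univ vol_def)
  then show ?thesis unfolding Lam_def by (auto intro: exI[of _ "\<lambda>_ _. a" for a])
qed

lemma vol_std_coframe_nonzero: "vol (std_coframe :: 'n::{finite,linorder} coframe) \<noteq> (\<lambda>_. 0)"
proof
  assume *: "vol (std_coframe :: 'n coframe) = (\<lambda>_. 0)"
  have "frame_eval (frame_idx {} UNIV) (wedges coord (frame_idx {} (UNIV :: 'n set))) = 1" by (simp add: frame_eval_frame_idx)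
  moreover have "wedges coord (frame_idx {} (UNIV :: 'n set)) = (\<lambda>_. 0)"
    using * by (simp add: vol_def flip: wedge_frame_idx)
  ultimately show False by (simp add: frame_eval_linear)
qed

lemma pull_std_coframe: "pull L (dzI std_coframe I) = dzI (coframe_of L) I" "pull L (dzbarJ std_coframe J) = dzbarJ (coframe_of L) J"
    "pull L (vol std_coframe) = vol (coframe_of L)"
  by (simp_all add: std_coframe_coframe_of pull_dzI)

lemma vol_coframe_of: "vol (coframe_of L) = pull L (vol std_coframe)"
  by (simp add: std_coframe_coframe_of pull_dzI)

lemma vol_coframe_of_nonzero: "surj L \<Longrightarrow> vol (coframe_of L) \<noteq> (\<lambda>_. 0)"
  using vol_std_coframe_nonzero pull_eq_iff[of L "vol std_coframe" "\<lambda>_. 0"] by (simp add: vol_coframe_of pull_def)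

lemma I_at_pull:
  assumes "surj L" "\<beta> \<in> Lam std_coframe p q"
  shows "I_at (coframe_of L) p q (pull L \<beta>) vs \<kappa> us = (\<Sum>I | card I = p. \<Sum>J | card J = q.
    frame_eval (frame_idx J I) \<beta> * (wedge (dzbarJ std_coframe J) (vol std_coframe) (map L vs) * dzI std_coframe I (map L us) * dual_vol (coframe_of L) \<kappa>))"
proof -
  have "wedge (dzbarJ (coframe_of L) J) (vol (coframe_of L)) vs = wedge (dzbarJ std_coframe J) (vol std_coframe) (map L vs)" for J
    using fun_cong[OF pull_wedge[of L "dzbarJ std_coframe J" "vol std_coframe"], of vs] unfolding std_coframe_coframe_of pull_dzI by (simp add: pull_def)
  moreover have "dzI (coframe_of L) I us = dzI std_coframe I (map L us)" for I
    using fun_cong[OF pull_dzI(1)[of L "\<lambda>v. v" I], of us] by (simp add: std_coframe_coframe_of pull_def)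
  ultimately show ?thesis unfolding I_at_def
    by (intro sum.cong refl) (simp add: coeffs_pull assms coeffs_frame_eval mult.assoc)
qed

text \<open>On the product of a (0,q)-form and a (p,0)-form the isomorphism is visible without
  coefficients: the first factor is wedged with the volume form, the second becomes the value in the
  bundle.\<close>

lemma I_at_decomposable:
  assumes "surj L" "X \<in> Lam std_coframe 0 q" "Y \<in> Lam std_coframe p 0"
  shows "wedge X Y \<in> Lam std_coframe p q"
    and "I_at (coframe_of L) p q (pull L (wedge X Y)) vs \<kappa> us
      = wedge X (vol std_coframe) (map L vs) * Y (map L us) * dual_vol (coframe_of L) \<kappa>"
proof -
  obtain x y where x: "X = comb std_coframe 0 q x" and y: "Y = comb std_coframe p 0 y" using assms by (auto simp: Lam_def)
  have X: "X = (\<lambda>vs. \<Sum>J | card J = q. x {} J * dzbarJ std_coframe J vs)"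
    unfolding x comb_def by simp
  have Y: "Y = (\<lambda>vs. \<Sum>I | card I = p. y I {} * dzI std_coframe I vs)"
    unfolding y comb_def by simp
  have XY: "wedge X Y = comb std_coframe p q (\<lambda>I J. x {} J * y I {})"
    unfolding comb_def by (subst X, subst Y, rule ext)
      (simp add: wedge_linear sum_distrib_left mult_ac, rule sum.swap)
  show L: "wedge X Y \<in> Lam std_coframe p q" unfolding XY Lam_def by simp
  have "I_at (coframe_of L) p q (pull L (wedge X Y)) vs \<kappa> us = (\<Sum>I | card I = p. \<Sum>J | card J = q.
    (x {} J * y I {}) * (wedge (dzbarJ std_coframe J) (vol std_coframe) (map L vs) * dzI std_coframe I (map L us) * dual_vol (coframe_of L) \<kappa>))"
    unfolding I_at_pull[OF assms(1) L] by (intro sum.cong refl) (simp add: XY frame_eval_comb)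
  also have "\<dots> = (\<Sum>J | card J = q. x {} J * wedge (dzbarJ std_coframe J) (vol std_coframe) (map L vs)) *
     (\<Sum>I | card I = p. y I {} * dzI std_coframe I (map L us)) * dual_vol (coframe_of L) \<kappa>"
    by (subst sum.swap) (simp add: sum_product sum_distrib_right sum_distrib_left mult_ac)
  finally show "I_at (coframe_of L) p q (pull L (wedge X Y)) vs \<kappa> us
      = wedge X (vol std_coframe) (map L vs) * Y (map L us) * dual_vol (coframe_of L) \<kappa>"
    by (subst X, subst Y) (simp add: wedge_linear)
qed

lemma I_at_sum:
  assumes "surj L" "\<And>i. i \<in> A \<Longrightarrow> f i \<in> Lam std_coframe p q"
  shows "I_at (coframe_of L) p q (pull L (\<lambda>vs. \<Sum>i\<in>A. c i * f i vs)) vs \<kappa> us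
    = (\<Sum>i\<in>A. c i * I_at (coframe_of L) p q (pull L (f i)) vs \<kappa> us)"
proof -
  have "(\<lambda>vs. \<Sum>i\<in>A. c i * f i vs) \<in> Lam std_coframe p q" by (intro Lam_sum Lam_scale assms)
  then have "I_at (coframe_of L) p q (pull L (\<lambda>vs. \<Sum>i\<in>A. c i * f i vs)) vs \<kappa> us
    = (\<Sum>I | card I = p. \<Sum>J | card J = q. \<Sum>i\<in>A. c i * (frame_eval (frame_idx J I) (f i) *
       (wedge (dzbarJ std_coframe J) (vol std_coframe) (map L vs) * dzI std_coframe I (map L us) * dual_vol (coframe_of L) \<kappa>)))"
    by (simp add: I_at_pull assms(1) frame_eval_sum frame_eval_linear sum_distrib_right sum_distrib_left mult_ac)
  also have "\<dots> = (\<Sum>i\<in>A. \<Sum>I | card I = p. \<Sum>J | card J = q. c i * (frame_eval (frame_idx J I) (f i) *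
       (wedge (dzbarJ std_coframe J) (vol std_coframe) (map L vs) * dzI std_coframe I (map L us) * dual_vol (coframe_of L) \<kappa>)))"
    by (simp add: sum.swap[of _ A])
  finally show ?thesis
    by (simp add: I_at_pull assms sum_distrib_left)
qed

text \<open>The bundle argument us separates the multi-indices I. After that the conjugate monomials
  wedged with the volume form, which are basis monomials of type (n,q), separate the J.\<close>

lemma I_at_inj:
  assumes "surj L" "\<alpha> \<in> Lam (coframe_of L) p q" "\<beta> \<in> Lam (coframe_of L) p q" "I_at (coframe_of L) p q \<alpha> = I_at (coframe_of L) p q \<beta>"
  shows "\<alpha> = \<beta>"
proof -
  obtain a b where a: "a \<in> Lam std_coframe p q" "\<alpha> = pull L a" and b: "b \<in> Lam std_coframe p q" "\<beta> = pull L b"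
    using assms(2,3) unfolding Lam_pull by blast
  define c where "c I J = frame_eval (frame_idx J I) a - frame_eval (frame_idx J I) b" for I J
  have dv: "dual_vol (coframe_of L) (vol (coframe_of L)) = 1"
    using dual_vol_vol[OF vol_coframe_of_nonzero[OF assms(1)], of 1] by simp
  have z: "(\<Sum>I | card I = p. \<Sum>J | card J = q. c I J * (wedge (dzbarJ std_coframe J) (vol std_coframe) vs * dzI std_coframe I us)) = 0" for vs us
  proof -
    obtain vs' us' where e: "vs = map L vs'" "us = map L us'"
      using assms(1) by (metis ex_map_conv surjD)
    have "I_at (coframe_of L) p q \<alpha> vs' (vol (coframe_of L)) us' - I_at (coframe_of L) p q \<beta> vs' (vol (coframe_of L)) us' = 0"
      using assms(4) by simp
    then show ?thesis
      unfolding a(2) b(2) I_at_pull[OF assms(1) a(1)] I_at_pull[OF assms(1) b(1)] dv e[symmetric]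
      by (simp add: c_def algebra_simps sum_subtractf)
  qed
  have z1: "(\<Sum>J | card J = q. c I J * wedge (dzbarJ std_coframe J) (vol std_coframe) vs) = 0" if I: "card I = p" for I vs
  proof -
    have "comb std_coframe p 0 (\<lambda>I _. \<Sum>J | card J = q. c I J * wedge (dzbarJ std_coframe J) (vol std_coframe) vs) = (\<lambda>_. 0)"
      using z[of vs] by (simp add: comb_def sum_distrib_right sum_distrib_left mult_ac fun_eq_iff)
    then have "frame_eval (frame_idx {} I) (comb std_coframe p 0 (\<lambda>I _. \<Sum>J | card J = q. c I J * wedge (dzbarJ std_coframe J) (vol std_coframe) vs)) = 0"
      by (simp add: frame_eval_linear)
    then show ?thesis using I by (simp add: frame_eval_comb)
  qed
  have z2: "c I J = 0" if IJ: "card I = p" "card J = q" for I J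
  proof -
    have "comb std_coframe CARD('a) q (\<lambda>_ J. c I J) = (\<lambda>_. 0)"
      using z1[OF IJ(1)] by (simp add: comb_def card_eq_univ vol_def fun_eq_iff)
    then have "frame_eval (frame_idx J UNIV) (comb std_coframe CARD('a) q (\<lambda>_ J. c I J)) = 0" by (simp add: frame_eval_linear)
    then show ?thesis using IJ by (simp add: frame_eval_comb)
  qed
  have "comb std_coframe p q (\<lambda>I J. frame_eval (frame_idx J I) a) = comb std_coframe p q (\<lambda>I J. frame_eval (frame_idx J I) b)"
    by (rule comb_cong) (use z2 in \<open>simp add: c_def\<close>)
  then have "a = b" using Lam_frame_eval[OF a(1)] Lam_frame_eval[OF b(1)] by metis
  then show ?thesis using a b by simp
qed

lemma has_type_wedges_span:
  assumes "\<And>i. \<exists>c. f i = (\<lambda>v. \<Sum>k\<in>UNIV. c k * w k v)"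
  shows "has_type w (length xs) 0 (wedges f xs)"
proof (induction xs)
  case (Cons x xs)
  then show ?case using assms[of x] by (auto intro: has_type_wedge_span)
qed (auto intro: has_type_one)

lemma has_type_wedges_span_bar:
  assumes "\<And>i. \<exists>c. f i = (\<lambda>v. \<Sum>k\<in>UNIV. c k * cnj (w k v))"
  shows "has_type w 0 (length xs) (wedges f xs)"
proof (induction xs)
  case (Cons x xs)
  then show ?case using assms[of x] by (auto intro: has_type_wedge_span_bar)
qed (auto intro: has_type_one)

lemma matrix_vector_nth: "(M *v v) $ k = (\<Sum>j\<in>UNIV. M $ k $ j * v $ j)"
  by (simp add: matrix_vector_mult_def)

lemma dzI_matrix: "dzI (coframe_of ((*v) M)) I \<in> Lam std_coframe (card I) 0"
  unfolding Lam_iff_has_type dzI_wedges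
  using has_type_wedges_span[of "coframe_of ((*v) M)" std_coframe "sorted_list_of_set I"]
  by (force simp: coframe_of_def std_coframe_def matrix_vector_nth)

lemma dzbarJ_matrix: "dzbarJ (coframe_of ((*v) M)) J \<in> Lam std_coframe 0 (card J)"
proof -
  have "\<exists>c. (\<lambda>v. cnj (coframe_of ((*v) M) i v)) = (\<lambda>v. \<Sum>k\<in>UNIV. c k * cnj (std_coframe k v))" for i
    by (rule exI[of _ "\<lambda>j. cnj (M $ i $ j)"]) (simp add: coframe_of_def std_coframe_def matrix_vector_nth)
  from has_type_wedges_span_bar[of "\<lambda>k v. cnj (coframe_of ((*v) M) k v)" std_coframe "sorted_list_of_set J", OF this]
  show ?thesis unfolding Lam_iff_has_type dzbarJ_wedges by simp
qed

text \<open>Modulo \<open>w\<close> one-forms may be replaced under \<open>\<and> \<langle>dw\<rangle>\<close>.\<close>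

lemma wedge_wedges_vol_cong:
  assumes "\<And>i. \<exists>c. f i = (\<lambda>v. f' i v + (\<Sum>k\<in>UNIV. c k * w k v))"
  shows "wedge (wedges f xs) (vol w) = wedge (wedges f' xs) (vol w)"
proof (induction xs)
  case (Cons x xs)
  obtain c where c: "f x = (\<lambda>v. f' x v + (\<Sum>k\<in>UNIV. c k * w k v))" using assms by blast
  have z: "wedge (one_form (w k)) (wedge (wedges f' xs) (vol w)) = (\<lambda>_. 0)" for k
    unfolding wedge_one_form_wedges vol_def dzI_wedges by (simp add: wedge_one_form_wedges_mem)
  show ?case
    by (simp add: wedge_assoc' Cons.IH)
      (simp add: c one_form_linear one_form_sum wedge_linear z fun_eq_iff)
qed simp

text \<open>Taking the (1,0)-part of each component of L leaves its complex linear part, so on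
  pulled-back forms \<pi>^{1,0} exchanges L for the matrix \<open>jac\<close>.\<close>

lemma pi_p_pull:
  assumes "surj L" "\<beta> \<in> Lam std_coframe p 0"
  shows "pi_p (coframe_of L) p (pull L \<beta>) = pull ((*v) (jac (coframe_of L))) \<beta>"
proof -
  have A: "(\<lambda>k. pi10 (coframe_of L k)) = coframe_of ((*v) (jac (coframe_of L)))"
    by (auto simp: pi10_def jac_def coframe_of_def matrix_vector_nth)
  have \<beta>: "\<beta> = (\<lambda>vs. \<Sum>I | card I = p. frame_eval (frame_idx {} I) \<beta> * dzI std_coframe I vs)"
    by (subst Lam_frame_eval[OF assms(2)]) (simp add: comb_def)
  have "pi_p (coframe_of L) p (pull L \<beta>) = (\<lambda>vs. \<Sum>I | card I = p. frame_eval (frame_idx {} I) \<beta> * pull ((*v) (jac (coframe_of L))) (dzI std_coframe I) vs)"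
    unfolding pi_p_def A coeffs_pull[OF assms(1)] pull_std_coframe
    by (intro ext sum.cong refl) (simp add: coeffs_frame_eval[OF assms(2)])
  also have "\<dots> = pull ((*v) (jac (coframe_of L))) \<beta>"
    by (subst (2) \<beta>) (simp add: pull_def)
  finally show ?thesis .
qed


lemma matrix_inv_works:
  assumes "invertible A" shows "A ** matrix_inv A = mat 1" "matrix_inv A ** A = mat 1"
  using someI_ex[OF assms[unfolded invertible_def]] unfolding matrix_inv_def by auto

text \<open>Put G = D A^{-1}. The exponential sends the coframe w0 = D v of X_0 to G L, hence its
  volume form to \<gamma> times that of dz_t for a scalar \<gamma>; the functional dual to the
  volume form of w0, transported by \<pi>^{1,0}, contributes 1/\<gamma>. In the values, the inverse
  of \<pi>^{1,0} likewise sends w0 to G L. The conjugate factors may be exchanged for their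
  (0,1)-parts on X_t because the difference lies in the span of dz_t and dies under the volume
  form.\<close>

lemma exp_vins_I_at:
  fixes L :: "'n::{finite,linorder} cvec \<Rightarrow> 'n cvec" and D A' :: "'n cmat"
  defines "A \<equiv> jac (coframe_of L)" and "Ai \<equiv> matrix_inv (jac (coframe_of L))"
  assumes L: "linear L" "surj L" and A: "invertible A" and D: "invertible D"
    and a: "\<And>j v. a (False, j) v = (Ai *v L v) $ j" "\<And>j v. a (True, j) v = cnj ((A' *v L v) $ j)"
    and N: "\<And>j. \<exists>c. coord (True, j) = (\<lambda>v. a (True, j) v + (\<Sum>k\<in>UNIV. c k * L v $ k))"
    and \<alpha>: "\<alpha> \<in> Lam std_coframe p q"
  shows "exp_vins (coframe_of L) p (Ai ** jacbar (coframe_of L)) (I_at (coframe_of ((*v) D)) p q \<alpha>) = I_at (coframe_of L) p q (form_subst a \<alpha>)"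
    and "form_subst a \<alpha> \<in> Lam (coframe_of L) p q"
proof -
  define \<phi> where "\<phi> = Ai ** jacbar (coframe_of L)"
  define w w0 where "w = coframe_of L" and "w0 = coframe_of ((*v) D)"
  \<comment> \<open>D relates the chosen holomorphic coframe of X_0 to the standard coordinates of
    the chart; G and G' express the images of that coframe and of its conjugate through L.\<close>
  define G G' where "G = D ** Ai" and "G' = D ** A'"
  have AiA: "Ai ** A = mat 1" "A ** Ai = mat 1"
    using A unfolding Ai_def A_def by (auto simp: matrix_inv_works)
  have cs: "surj ((*v) M)" "inj ((*v) M)" if "invertible M" for M :: "'n cmat"
    using that unfolding invertible_def
    by (metis matrix_vector_mul_assoc matrix_vector_mul_lid surjI, metis inj_on_inverseI matrix_vector_mul_assoc matrix_vector_mul_lid)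
  have lin: "linear (\<lambda>v. L v $ k)" for k using L(1) by (auto simp: linear_iff)
  have LAB: "L v $ k = (A *v v) $ k + (\<Sum>l\<in>UNIV. jacbar (coframe_of L) $ k $ l * cnj (v $ l))" for v k
    using ccoef_expand[OF lin[of k], of v]
    by (simp add: sum_bool_prod A_def jac_def jacbar_def matrix_vector_nth coframe_of_def ccoef_def coord_def)
  have bphi: "belt \<phi> j v = (Ai *v (\<chi> k. \<Sum>l\<in>UNIV. jacbar (coframe_of L) $ k $ l * cnj (v $ l))) $ j" for j v
    unfolding belt_def \<phi>_def matrix_matrix_mult_def matrix_vector_nth
    by (simp add: sum_distrib_left sum_distrib_right mult.assoc) (rule sum.swap)
  \<comment> \<open>Multiplication by A^{-1} normalizes the complex linear part of L to the identity
    and turns its antilinear part into \<phi>; hence dz^j + \<phi>^j is a combination of the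
    components of L.\<close>
  have R: "coord (False, j) v + belt \<phi> j v = (Ai *v L v) $ j" for j v
  proof -
    have "L v = A *v v + (\<chi> k. \<Sum>l\<in>UNIV. jacbar (coframe_of L) $ k $ l * cnj (v $ l))"
      using LAB by (simp add: vec_eq_iff)
    then have "Ai *v L v = (Ai ** A) *v v + Ai *v (\<chi> k. \<Sum>l\<in>UNIV. jacbar (coframe_of L) $ k $ l * cnj (v $ l))"
      by (simp add: matrix_vector_right_distrib matrix_vector_mul_assoc)
    then show ?thesis by (simp add: AiA bphi coord_def)
  qed
  have ii: "\<i> * (x * \<i>) = - x" for x by (simp add: complex_eq_iff)
  have cvw: "ccoef g (coframe_of ((*v) M) k) = (if fst g then 0 else M $ k $ snd g)" for g k and M :: "'n cmat"
    by (simp add: ccoef_eq coframe_of_def matrix_vector_nth axis_def if_distrib ii cong: if_cong)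
  have cvwb: "ccoef g (\<lambda>v. cnj (coframe_of ((*v) M) k v)) = (if fst g then cnj (M $ k $ snd g) else 0)" for g k and M :: "'n cmat"
    by (simp add: ccoef_eq coframe_of_def matrix_vector_nth axis_def if_distrib ii cong: if_cong)
  define c where "c = coeffs w0 p q \<alpha>"
  have "\<alpha> \<in> Lam w0 p q"
  proof -
    have "\<exists>c. std_coframe k = (\<lambda>v. \<Sum>j\<in>UNIV. c j * w0 j v)" "\<exists>c. (\<lambda>v. cnj (std_coframe k v)) = (\<lambda>v. \<Sum>j\<in>UNIV. c j * cnj (w0 j v))" for k
    proof -
      have z: "std_coframe k v = (\<Sum>j\<in>UNIV. matrix_inv D $ k $ j * w0 j v)" for v
        unfolding w0_def coframe_of_def matrix_vector_nth[of "matrix_inv D", symmetric]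
        by (simp add: std_coframe_def D matrix_vector_mul_assoc matrix_inv_works)
      show "\<exists>c. std_coframe k = (\<lambda>v. \<Sum>j\<in>UNIV. c j * w0 j v)" using z by blast
      have "cnj (std_coframe k v) = (\<Sum>j\<in>UNIV. cnj (matrix_inv D $ k $ j) * cnj (w0 j v))" for v
        by (simp add: z)
      then show "\<exists>c. (\<lambda>v. cnj (std_coframe k v)) = (\<lambda>v. \<Sum>j\<in>UNIV. c j * cnj (w0 j v))"
        by (intro exI[of _ "\<lambda>j. cnj (matrix_inv D $ k $ j)"]) auto
    qed
    then have "has_type w0 p q (form_subst coord \<alpha>)"
      using \<alpha> by (intro has_type_form_subst) (auto simp: Lam_iff_has_type coord_std_coframe)
    moreover have "alternating \<alpha>" using \<alpha> alternating_Lam[of \<alpha> "\<lambda>v. v"] by (simp add: std_coframe_coframe_of linear_iff)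
    then have "form_subst coord \<alpha> = \<alpha>" by (simp add: fun_eq_iff form_subst_id)
    ultimately show ?thesis by (simp add: Lam_iff_has_type)
  qed
  from coeffs_works[OF this] have \<alpha>c: "\<alpha> = comb w0 p q c" unfolding c_def by simp
  have lw: "linear (coframe_of ((*v) M) k)" "linear (\<lambda>v. cnj (coframe_of ((*v) M) k v))" for k and M :: "'n cmat"
    by (auto simp: linear_iff coframe_of_def scaleRc matrix_vector_nth sum.distrib sum_distrib_left algebra_simps)
  have sub: "form_subst b (dzI (coframe_of ((*v) M)) I) = dzI (\<lambda>k v. \<Sum>j\<in>UNIV. M $ k $ j * b (False, j) v) I"
    "form_subst b (dzbarJ (coframe_of ((*v) M)) I) = dzI (\<lambda>k v. \<Sum>j\<in>UNIV. cnj (M $ k $ j) * b (True, j) v) I" for b I and M :: "'n cmat"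
    by (simp_all add: dzI_wedges dzbarJ_wedges form_subst_wedges sum_bool_prod cvw cvwb)
  have subE: "form_subst (exp_frame \<phi>) (dzI w0 I) = dzI (coframe_of (\<lambda>v. G *v L v)) I" "form_subst (exp_frame \<phi>) (dzbarJ w0 I) = dzbarJ w0 I" for I
  proof -
    have "(\<Sum>j\<in>UNIV. D $ k $ j * exp_frame \<phi> (False, j) v) = (G *v L v) $ k" for k v
      unfolding G_def matrix_vector_mul_assoc[symmetric]
      by (simp add: exp_frame_def R matrix_vector_nth[of D])
    then show "form_subst (exp_frame \<phi>) (dzI w0 I) = dzI (coframe_of (\<lambda>v. G *v L v)) I"
      unfolding w0_def sub by (simp add: coframe_of_def)
    show "form_subst (exp_frame \<phi>) (dzbarJ w0 I) = dzbarJ w0 I"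
      unfolding w0_def sub by (simp add: exp_frame_def coframe_of_def coord_def matrix_vector_nth dzbarJ_def)
  qed
  have suba: "form_subst a (dzI w0 I) = dzI (coframe_of (\<lambda>v. G *v L v)) I" "form_subst a (dzbarJ w0 I) = dzbarJ (coframe_of (\<lambda>v. G' *v L v)) I" for I
  proof -
    have "(\<Sum>j\<in>UNIV. D $ k $ j * a (False, j) v) = (G *v L v) $ k" for k v
      unfolding G_def matrix_vector_mul_assoc[symmetric]
      by (simp add: a matrix_vector_nth[of D])
    then show "form_subst a (dzI w0 I) = dzI (coframe_of (\<lambda>v. G *v L v)) I"
      unfolding w0_def sub by (simp add: coframe_of_def)
    have "(\<Sum>j\<in>UNIV. cnj (D $ k $ j) * a (True, j) v) = cnj ((G' *v L v) $ k)" for k v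
      unfolding G'_def matrix_vector_mul_assoc[symmetric]
      by (simp add: a matrix_vector_nth[of D])
    then show "form_subst a (dzbarJ w0 I) = dzbarJ (coframe_of (\<lambda>v. G' *v L v)) I"
      unfolding w0_def sub by (simp add: coframe_of_def dzbarJ_def)
  qed
  define IJ where "IJ = {I :: 'n set. card I = p} \<times> {J :: 'n set. card J = q}"
  have pba: "form_subst a \<alpha> = pull L (\<lambda>vs. \<Sum>k\<in>IJ. c (fst k) (snd k) * wedge (dzbarJ (coframe_of ((*v) G')) (snd k)) (dzI (coframe_of ((*v) G)) (fst k)) vs)"
    (is "_ = pull L (\<lambda>vs. \<Sum>k\<in>IJ. c (fst k) (snd k) * ?X k vs)")
  proof
    fix vs
    have "form_subst a \<alpha> vs = (\<Sum>k\<in>IJ. c (fst k) (snd k) * wedge (dzbarJ (coframe_of (\<lambda>v. G' *v L v)) (snd k)) (dzI (coframe_of (\<lambda>v. G *v L v)) (fst k)) vs)"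
      unfolding \<alpha>c comb_def IJ_def
      by (simp add: form_subst_linear form_subst_wedge suba sum.cartesian_product case_prod_unfold)
    moreover have "wedge (dzbarJ (coframe_of (\<lambda>v. G' *v L v)) J) (dzI (coframe_of (\<lambda>v. G *v L v)) I) vs
        = wedge (dzbarJ (coframe_of ((*v) G')) J) (dzI (coframe_of ((*v) G)) I) (map L vs)" for I J
      using fun_cong[OF pull_wedge[of L "dzbarJ (coframe_of ((*v) G')) J" "dzI (coframe_of ((*v) G)) I"], of vs]
      unfolding pull_dzI by (simp add: pull_def)
    ultimately show "form_subst a \<alpha> vs = pull L (\<lambda>vs. \<Sum>k\<in>IJ. c (fst k) (snd k) * ?X k vs) vs"
      by (simp add: pull_def)
  qed
  have X: "?X k \<in> Lam std_coframe p q" if "k \<in> IJ" for k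
    using that I_at_decomposable(1)[OF L(2) dzbarJ_matrix dzI_matrix] by (auto simp: IJ_def)
  show "form_subst a \<alpha> \<in> Lam (coframe_of L) p q"
    unfolding pba Lam_pull by (auto intro!: Lam_sum Lam_scale X)
  have rhs: "I_at w p q (form_subst a \<alpha>) vs \<kappa> us = (\<Sum>k\<in>IJ. c (fst k) (snd k) *
      (wedge (dzbarJ w0 (snd k)) (vol w) vs * dzI (coframe_of (\<lambda>v. G *v L v)) (fst k) us * dual_vol w \<kappa>))" for vs \<kappa> us
  proof -
    have "I_at w p q (form_subst a \<alpha>) vs \<kappa> us = (\<Sum>k\<in>IJ. c (fst k) (snd k) * I_at w p q (pull L (?X k)) vs \<kappa> us)"
      unfolding pba w_def by (rule I_at_sum[OF L(2) X])
    also have "\<dots> = (\<Sum>k\<in>IJ. c (fst k) (snd k) *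
      (wedge (dzbarJ w0 (snd k)) (vol w) vs * dzI (coframe_of (\<lambda>v. G *v L v)) (fst k) us * dual_vol w \<kappa>))"
    proof (rule sum.cong[OF refl])
      fix k assume k: "k \<in> IJ"
      have "wedge (dzbarJ w0 J) (vol w) = wedge (dzbarJ (coframe_of (\<lambda>v. G' *v L v)) J) (vol w)" for J
        unfolding dzbarJ_wedges
      proof (rule wedge_wedges_vol_cong)
        fix i
        have "\<exists>c. \<forall>v. coord (True, j) v = a (True, j) v + (\<Sum>k\<in>UNIV. c k * w k v)" for j
        proof -
          obtain c where "coord (True, j) = (\<lambda>v. a (True, j) v + (\<Sum>k\<in>UNIV. c k * L v $ k))" using N[of j] by blast
          then show ?thesis by (intro exI[of _ c]) (simp add: w_def coframe_of_def)
        qed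
        then obtain d where d: "\<And>j v. coord (True, j) v = a (True, j) v + (\<Sum>k\<in>UNIV. d j k * w k v)"
          using choice[of "\<lambda>j c. \<forall>v. coord (True, j) v = a (True, j) v + (\<Sum>k\<in>UNIV. c k * w k v)"] by blast
        have "cnj (w0 i v) = cnj ((G' *v L v) $ i) + (\<Sum>k\<in>UNIV. (\<Sum>j\<in>UNIV. cnj (D $ i $ j) * d j k) * w k v)" for v
        proof -
          have "cnj (w0 i v) = (\<Sum>j\<in>UNIV. cnj (D $ i $ j) * coord (True, j) v)"
            by (simp add: w0_def coframe_of_def matrix_vector_nth coord_def)
          also have "\<dots> = (\<Sum>j\<in>UNIV. cnj (D $ i $ j) * a (True, j) v) + (\<Sum>j\<in>UNIV. cnj (D $ i $ j) * (\<Sum>k\<in>UNIV. d j k * w k v))"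
            by (simp add: d distrib_left sum.distrib)
          also have "(\<Sum>j\<in>UNIV. cnj (D $ i $ j) * a (True, j) v) = cnj ((G' *v L v) $ i)"
            unfolding G'_def matrix_vector_mul_assoc[symmetric]
            by (simp add: a matrix_vector_nth[of D])
          also have "(\<Sum>j\<in>UNIV. cnj (D $ i $ j) * (\<Sum>k\<in>UNIV. d j k * w k v)) = (\<Sum>k\<in>UNIV. (\<Sum>j\<in>UNIV. cnj (D $ i $ j) * d j k) * w k v)"
            unfolding sum_distrib_left sum_distrib_right by (subst sum.swap) (simp add: mult.assoc)
          finally show ?thesis .
        qed
        then show "\<exists>c. (\<lambda>v. cnj (w0 i v)) = (\<lambda>v. cnj (coframe_of (\<lambda>v. G' *v L v) i v) + (\<Sum>k\<in>UNIV. c k * w k v))"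
          unfolding coframe_of_def by (intro exI[of _ "\<lambda>k. \<Sum>j\<in>UNIV. cnj (D $ i $ j) * d j k"]) auto
      qed
      moreover have "I_at w p q (pull L (?X k)) vs \<kappa> us =
        wedge (dzbarJ (coframe_of ((*v) G')) (snd k)) (vol std_coframe) (map L vs) * dzI (coframe_of ((*v) G)) (fst k) (map L us) * dual_vol w \<kappa>"
        unfolding w_def using k I_at_decomposable(2)[OF L(2) dzbarJ_matrix dzI_matrix] by (auto simp: IJ_def)
      moreover have "wedge (dzbarJ (coframe_of ((*v) G')) J) (vol std_coframe) (map L vs) = wedge (dzbarJ (coframe_of (\<lambda>v. G' *v L v)) J) (vol w) vs" for J
        using fun_cong[OF pull_wedge[of L "dzbarJ (coframe_of ((*v) G')) J" "vol std_coframe"], of vs]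
        unfolding pull_dzI pull_std_coframe w_def by (simp add: pull_def)
      moreover have "dzI (coframe_of ((*v) G)) I (map L us) = dzI (coframe_of (\<lambda>v. G *v L v)) I us" for I
        using fun_cong[OF pull_dzI(1)[of L "(*v) G" I], of us] by (simp add: pull_def)
      ultimately show "c (fst k) (snd k) * I_at w p q (pull L (?X k)) vs \<kappa> us = c (fst k) (snd k) *
        (wedge (dzbarJ w0 (snd k)) (vol w) vs * dzI (coframe_of (\<lambda>v. G *v L v)) (fst k) us * dual_vol w \<kappa>)"
        by simp
    qed
    finally show ?thesis .
  qed
  have E: "exp_ins \<phi> (\<lambda>vs'. I_at w0 p q \<alpha> vs' \<kappa> us) vs = (\<Sum>k\<in>IJ. c (fst k) (snd k) *
      (wedge (dzbarJ w0 (snd k)) (vol (coframe_of (\<lambda>v. G *v L v))) vs * dzI w0 (fst k) us * dual_vol w0 \<kappa>))" for vs \<kappa> us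
  proof -
    have aw: "alternating (wedge (dzbarJ w0 J) (vol w0))" for J
      unfolding w0_def vol_def dzI_wedges dzbarJ_wedges by (intro alternating_wedge alternating_wedges lw)
    have I: "(\<lambda>vs'. I_at w0 p q \<alpha> vs' \<kappa> us) = (\<lambda>vs'. \<Sum>k\<in>IJ. (c (fst k) (snd k) * dzI w0 (fst k) us * dual_vol w0 \<kappa>) *
       wedge (dzbarJ w0 (snd k)) (vol w0) vs')"
      unfolding I_at_def c_def[symmetric] IJ_def by (simp add: sum.cartesian_product case_prod_unfold mult_ac)
    have "alternating (\<lambda>vs'. I_at w0 p q \<alpha> vs' \<kappa> us)"
      unfolding I by (intro alternating_sum alternating_scale aw)
    then show ?thesis
      unfolding exp_ins_eq_form_subst[OF \<open>alternating (\<lambda>vs'. I_at w0 p q \<alpha> vs' \<kappa> us)\<close>] unfolding I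
      by (simp add: form_subst_linear form_subst_wedge subE vol_def mult_ac)
  qed
  \<comment> \<open>\<gamma> exists because a top form is a multiple of the volume form. It is
    nonzero since the volume form of w0, a \<gamma>-multiple of another form, is nonzero for
    invertible D.\<close>
  obtain \<gamma> where \<gamma>: "vol (coframe_of ((*v) G)) = (\<lambda>vs. \<gamma> * vol std_coframe vs)"
    using dzI_matrix[of G UNIV] unfolding Lam_top vol_def[symmetric] by blast
  have \<gamma>': "vol (coframe_of (\<lambda>v. G *v M v)) = (\<lambda>vs. \<gamma> * vol (coframe_of M) vs)" for M
    using arg_cong[OF \<gamma>, of "pull M"] unfolding pull_dzI by (simp add: pull_def vol_coframe_of)
  have GA: "G *v (A *v v) = D *v v" for v
    by (simp add: G_def matrix_vector_mul_assoc AiA flip: matrix_mul_assoc)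
  have volw0: "vol w0 = (\<lambda>vs. \<gamma> * vol (coframe_of ((*v) A)) vs)"
    using \<gamma>'[of "(*v) A"] unfolding GA w0_def by simp
  have w0nz: "vol w0 \<noteq> (\<lambda>_. 0)" unfolding w0_def by (rule vol_coframe_of_nonzero) (rule cs[OF D])
  then have g0: "\<gamma> \<noteq> 0" using volw0 by auto
  show "exp_vins (coframe_of L) p (Ai ** jacbar (coframe_of L)) (I_at (coframe_of ((*v) D)) p q \<alpha>) = I_at (coframe_of L) p q (form_subst a \<alpha>)"
    unfolding exp_vins_def \<phi>_def[symmetric] unfolding w_def[symmetric] w0_def[symmetric]
  proof (rule ext, rule ext)
    fix vs \<kappa>
    show "ident_at w p (\<lambda>\<kappa> us. exp_ins \<phi> (\<lambda>vs'. I_at w0 p q \<alpha> vs' \<kappa> us) vs) \<kappa> = I_at w p q (form_subst a \<alpha>) vs \<kappa>"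
    proof (cases "\<kappa> \<in> Lam w CARD('n) 0")
      case False
      then have "dual_vol w \<kappa> = 0" unfolding Lam_top by (rule dual_vol_notin)
      then show ?thesis using False by (simp add: ident_at_def rhs fun_eq_iff)
    next
      case True
      then obtain k where k: "\<kappa> = (\<lambda>vs. k * vol w vs)" unfolding Lam_top by blast
      have dk: "dual_vol w \<kappa> = k"
        unfolding k w_def by (rule dual_vol_vol[OF vol_coframe_of_nonzero[OF L(2)]])
      have "\<kappa> = pull L (\<lambda>vs. k * vol std_coframe vs)" unfolding k w_def vol_coframe_of by (simp add: pull_def)
      moreover have "(\<lambda>vs. k * vol std_coframe vs) \<in> Lam (std_coframe :: 'n coframe) CARD('n) 0" unfolding Lam_top by blast
      ultimately have "pi_p w CARD('n) \<kappa> = pull ((*v) A) (\<lambda>vs. k * vol std_coframe vs)"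
        unfolding w_def A_def by (simp add: pi_p_pull[OF L(2)])
      also have "\<dots> = (\<lambda>vs. (k / \<gamma>) * vol w0 vs)"
        using g0 by (simp add: volw0 pull_def vol_coframe_of)
      finally have dk0: "dual_vol w0 (pi_p w CARD('n) \<kappa>) = k / \<gamma>"
        by (simp only: dual_vol_vol[OF w0nz])
      \<comment> \<open>Y is the common value before pullback: along L it gives the right-hand side,
        along A the exponential side, so \<open>pi_p\<close> maps the former to the latter.\<close>
      define Y where "Y us = (\<Sum>m\<in>IJ. (c (fst m) (snd m) * wedge (dzbarJ w0 (snd m)) (vol w) vs * k) *
         dzI (coframe_of ((*v) G)) (fst m) us)" for us
      have Y: "Y \<in> Lam std_coframe p 0"
        unfolding Y_def[abs_def]
        by (intro Lam_sum Lam_scale) (use dzI_matrix in \<open>auto simp: IJ_def\<close>)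
      have GAI: "dzI (coframe_of ((*v) G)) I (map ((*v) A) us) = dzI w0 I us" for I us
        using fun_cong[OF pull_dzI(1)[of "(*v) A" "(*v) G" I], of us] by (simp add: pull_def GA w0_def)
      have GLI: "dzI (coframe_of ((*v) G)) I (map L us) = dzI (coframe_of (\<lambda>v. G *v L v)) I us" for I us
        using fun_cong[OF pull_dzI(1)[of L "(*v) G" I], of us] by (simp add: pull_def)
      have "(\<lambda>us. exp_ins \<phi> (\<lambda>vs'. I_at w0 p q \<alpha> vs' (pi_p w CARD('n) \<kappa>) us) vs) = pull ((*v) A) Y"
        unfolding E dk0 \<gamma>' w_def[symmetric] Y_def[abs_def] pull_def GAI
        using g0 by (simp add: wedge_linear mult_ac)
      also have "\<dots> = pi_p w p (pull L Y)"
        unfolding w_def A_def by (rule pi_p_pull[OF L(2) Y, symmetric])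
      finally have e: "(\<lambda>us. exp_ins \<phi> (\<lambda>vs'. I_at w0 p q \<alpha> vs' (pi_p w CARD('n) \<kappa>) us) vs) = pi_p w p (pull L Y)" .
      have inj: "inj_on (pi_p w p) (Lam w p 0)"
      proof (rule inj_onI)
        fix x y assume "x \<in> Lam w p 0" "y \<in> Lam w p 0" "pi_p w p x = pi_p w p y"
        then show "x = y"
          unfolding w_def Lam_pull by (auto simp: pi_p_pull[OF L(2)] A_def[symmetric] pull_eq_iff[OF cs(1)[OF A]])
      qed
      have "ident_at w p (\<lambda>\<kappa> us. exp_ins \<phi> (\<lambda>vs'. I_at w0 p q \<alpha> vs' \<kappa> us) vs) \<kappa> = pull L Y"
        using True unfolding ident_at_def e
        by (simp add: inv_into_f_f[OF inj] Lam_pull Y w_def) (use Y Lam_pull inv_into_f_f[OF inj] w_def in blast)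
      also have "\<dots> = I_at w p q (form_subst a \<alpha>) vs \<kappa>"
        unfolding rhs dk by (simp add: pull_def Y_def GLI mult_ac fun_eq_iff)
      finally show ?thesis .
    qed
  qed
qed

section \<open>Smooth functions\<close>

lemma Ck_on_subset: "Ck_on k S f \<Longrightarrow> T \<subseteq> S \<Longrightarrow> Ck_on k T f"
  by (induction k arbitrary: f) (auto intro: continuous_on_subset)

lemma Ck_on_cong:
  assumes "open S" "\<And>x. x \<in> S \<Longrightarrow> f x = g x" "Ck_on k S f"
  shows "Ck_on k S g"
  using assms(2,3)
proof (induction k arbitrary: f g)
  case (Suc k)
  have "frechet_derivative f (at x) = frechet_derivative g (at x)" if "x \<in> S" for x
    using Suc.prems that assms(1) by (intro frechet_derivative_transform_within_open[of f x S g]) auto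
  moreover have "g differentiable at x" if "x \<in> S" for x
  proof -
    have "f differentiable at x" using Suc.prems(2) that by auto
    then show ?thesis
      using has_derivative_transform_within_open[OF _ assms(1) that, of f _ UNIV g] Suc.prems(1)
      unfolding differentiable_def by blast
  qed
  moreover have "Ck_on k S (\<lambda>x. frechet_derivative g (at x) v)" for v
    by (rule Suc.IH[of "\<lambda>x. frechet_derivative f (at x) v"]) (use Suc.prems calculation(1) in auto)
  ultimately show ?case by simp
qed (use continuous_on_cong in auto)

text \<open>Lets any explicit formula for the derivative stand in for
  \<open>frechet_derivative\<close>.\<close>

lemma Ck_on_SucI:
  assumes "open S" "\<And>x. x \<in> S \<Longrightarrow> (f has_derivative f' x) (at x)" "\<And>v. Ck_on k S (\<lambda>x. f' x v)"
  shows "Ck_on (Suc k) S f"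
proof -
  have "f' x = frechet_derivative f (at x)" if "x \<in> S" for x
    using assms(2)[OF that] by (rule frechet_derivative_at)
  then have "Ck_on k S (\<lambda>x. frechet_derivative f (at x) v)" for v
    by (intro Ck_on_cong[OF assms(1) _ assms(3)[of v]]) simp
  then show ?thesis using assms(2) by (auto simp: differentiable_def)
qed

lemma Ck_on_SucD:
  assumes "Ck_on (Suc k) S f"
  shows "\<And>x. x \<in> S \<Longrightarrow> (f has_derivative frechet_derivative f (at x)) (at x)"
    and "\<And>v. Ck_on k S (\<lambda>x. frechet_derivative f (at x) v)"
  using assms by (auto simp: frechet_derivative_works)

lemma Ck_on_Suc: "Ck_on (Suc k) S f \<Longrightarrow> Ck_on k S f"
proof (induction k arbitrary: f)
  case 0
  then show ?case by (auto intro!: continuous_at_imp_continuous_on differentiable_imp_continuous_within)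
qed auto

lemma Ck_on_local:
  assumes "open S" "\<And>x. x \<in> S \<Longrightarrow> \<exists>T. open T \<and> x \<in> T \<and> Ck_on k T f"
  shows "Ck_on k S f"
  using assms(2)
proof (induction k arbitrary: f)
  case 0
  then show ?case
    by (metis Ck_on.simps(1) at_within_open continuous_at_imp_continuous_on continuous_on_eq_continuous_within)
next
  case (Suc k)
  have "f differentiable at x" if "x \<in> S" for x using Suc.prems[OF that] by auto
  moreover have "Ck_on k S (\<lambda>x. frechet_derivative f (at x) v)" for v
    by (rule Suc.IH) (use Suc.prems in force)
  ultimately show ?case by auto
qed

lemma Ck_on_const: "open S \<Longrightarrow> Ck_on k S (\<lambda>x. c)"
  by (induction k arbitrary: c) (auto intro!: continuous_on_const)

lemma Ck_on_linear:
  assumes "open S" "bounded_linear L" shows "Ck_on k S L"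
proof (cases k)
  case 0 then show ?thesis using assms by (auto intro: linear_continuous_on)
next
  case (Suc m)
  show ?thesis unfolding Suc
    by (rule Ck_on_SucI[where f'="\<lambda>_. L"]) (use assms in \<open>auto intro: bounded_linear_imp_has_derivative Ck_on_const\<close>)
qed

lemma Ck_on_linear_compose:
  assumes "open S" "bounded_linear L" "Ck_on k S f" shows "Ck_on k S (\<lambda>x. L (f x))"
  using assms(3)
proof (induction k arbitrary: f)
  case 0 then show ?case using bounded_linear.continuous_on[OF assms(2)] by auto
next
  case (Suc k)
  show ?case
    by (rule Ck_on_SucI[OF assms(1) bounded_linear.has_derivative[OF assms(2) Ck_on_SucD(1)[OF Suc.prems]]])
      (auto intro: Suc.IH Ck_on_SucD(2)[OF Suc.prems])
qed

lemma Ck_on_add: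
  assumes "open S" "Ck_on k S f" "Ck_on k S g" shows "Ck_on k S (\<lambda>x. f x + g x)"
  using assms(2,3)
proof (induction k arbitrary: f g)
  case 0 then show ?case by (auto intro: continuous_on_add)
next
  case (Suc k)
  show ?case
    by (rule Ck_on_SucI[OF assms(1) has_derivative_add[OF Ck_on_SucD(1)[OF Suc.prems(1)] Ck_on_SucD(1)[OF Suc.prems(2)]]])
      (auto intro!: Suc.IH Ck_on_SucD(2) Suc.prems)
qed

lemma Ck_on_sum:
  assumes "open S" "\<And>i. i \<in> A \<Longrightarrow> Ck_on k S (f i)" shows "Ck_on k S (\<lambda>x. \<Sum>i\<in>A. f i x)"
  using assms(2)
  by (induction A rule: infinite_finite_induct) (auto intro: Ck_on_add Ck_on_const assms(1))

lemma Ck_on_bilinear: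
  assumes "open S" "bounded_bilinear pr" "Ck_on k S f" "Ck_on k S g"
  shows "Ck_on k S (\<lambda>x. pr (f x) (g x))"
  using assms(3,4)
proof (induction k arbitrary: f g)
  case 0 then show ?case using bounded_bilinear.continuous_on[OF assms(2)] by auto
next
  case (Suc k)
  show ?case
    by (rule Ck_on_SucI[OF assms(1) bounded_bilinear.FDERIV[OF assms(2) Ck_on_SucD(1)[OF Suc.prems(1)] Ck_on_SucD(1)[OF Suc.prems(2)]]], assumption, assumption)
      (rule Ck_on_add[OF assms(1) Suc.IH[OF Ck_on_Suc[OF Suc.prems(1)] Ck_on_SucD(2)[OF Suc.prems(2)]]
          Suc.IH[OF Ck_on_SucD(2)[OF Suc.prems(1)] Ck_on_Suc[OF Suc.prems(2)]]])
qed

text \<open>The derivative of 1/f is a product of 1/f, 1/f and a derivative of f, all of which are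
  of class C^k by the induction hypothesis when f is of class C^{k+1}.\<close>

lemma Ck_on_inverse:
  fixes f :: "'a::real_normed_vector \<Rightarrow> complex"
  assumes "open S" "Ck_on k S f" "\<And>x. x \<in> S \<Longrightarrow> f x \<noteq> 0"
  shows "Ck_on k S (\<lambda>x. inverse (f x))"
  using assms(2)
proof (induction k)
  case 0 then show ?case using assms by (auto intro: continuous_on_inverse)
next
  case (Suc k)
  have "Ck_on k S (\<lambda>x. inverse (f x))" by (rule Suc.IH[OF Ck_on_Suc[OF Suc.prems]])
  then have "Ck_on k S (\<lambda>x. (-1) * (inverse (f x) * frechet_derivative f (at x) v * inverse (f x)))" for v
    by (intro Ck_on_bilinear[OF assms(1) bounded_bilinear_mult] Ck_on_const assms(1) Ck_on_SucD(2)[OF Suc.prems])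
  then show ?case
    by (intro Ck_on_SucI[OF assms(1) Deriv.has_derivative_inverse[OF _ Ck_on_SucD(1)[OF Suc.prems]]])
      (use assms in auto)
qed

text \<open>\<open>Ck_on\<close> speaks of derivatives in fixed directions, while the chain rule
  differentiates g in the moving direction Df(x) v. Expanding that direction in a basis of the
  intermediate space restores fixed directions.\<close>

lemma Ck_on_compose:
  fixes f :: "'a::real_normed_vector \<Rightarrow> 'b::euclidean_space"
  assumes "open S" "open T" "f ` S \<subseteq> T" "Ck_on k S f" "Ck_on k T g"
  shows "Ck_on k S (\<lambda>x. g (f x))"
  using assms(4,5)
proof (induction k arbitrary: g)
  case 0 then show ?case using assms(3) by (auto intro: continuous_on_compose2)
next
  case (Suc k)
  have fx: "x \<in> S \<Longrightarrow> f x \<in> T" for x using assms(3) by auto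
  have d: "((\<lambda>x. g (f x)) has_derivative (\<lambda>v. \<Sum>b\<in>Basis. (frechet_derivative f (at x) v \<bullet> b) *\<^sub>R frechet_derivative g (at (f x)) b)) (at x)"
    if "x \<in> S" for x
  proof -
    have g: "(g has_derivative frechet_derivative g (at (f x))) (at (f x))"
      using Ck_on_SucD(1)[OF Suc.prems(2) fx[OF that]] .
    have "frechet_derivative g (at (f x)) w = (\<Sum>b\<in>Basis. (w \<bullet> b) *\<^sub>R frechet_derivative g (at (f x)) b)" for w
    proof -
      have "frechet_derivative g (at (f x)) (\<Sum>b\<in>Basis. (w \<bullet> b) *\<^sub>R b) = (\<Sum>b\<in>Basis. (w \<bullet> b) *\<^sub>R frechet_derivative g (at (f x)) b)"
        using has_derivative_linear[OF g] by (simp add: linear_sum linear_cmul)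
      then show ?thesis by (simp add: euclidean_representation)
    qed
    then show ?thesis
      using has_derivative_compose[OF Ck_on_SucD(1)[OF Suc.prems(1) that] g] by (metis (no_types, lifting) has_derivative_eq_rhs ext)
  qed
  show ?case
  proof (rule Ck_on_SucI[OF assms(1) d])
    fix v
    have "Ck_on k S (\<lambda>x. frechet_derivative f (at x) v \<bullet> b)" for b
      by (rule Ck_on_linear_compose[OF assms(1) bounded_linear_inner_left Ck_on_SucD(2)[OF Suc.prems(1)]])
    moreover have "Ck_on k S (\<lambda>x. frechet_derivative g (at (f x)) b)" for b
      by (rule Suc.IH[OF Ck_on_Suc[OF Suc.prems(1)] Ck_on_SucD(2)[OF Suc.prems(2)]])
    ultimately show "Ck_on k S (\<lambda>x. \<Sum>b\<in>Basis. (frechet_derivative f (at x) v \<bullet> b) *\<^sub>R frechet_derivative g (at (f x)) b)"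
      by (intro Ck_on_sum Ck_on_bilinear[OF assms(1) bounded_bilinear_scaleR] assms(1))
  qed
qed

section \<open>Closure properties of smooth functions\<close>

lemma smooth_on_subset: "smooth_on S f \<Longrightarrow> T \<subseteq> S \<Longrightarrow> smooth_on T f"
  by (auto simp: smooth_on_def intro: Ck_on_subset)

lemma smooth_on_cong: "open S \<Longrightarrow> smooth_on S f \<Longrightarrow> (\<And>x. x \<in> S \<Longrightarrow> f x = g x) \<Longrightarrow> smooth_on S g"
  by (auto simp: smooth_on_def intro: Ck_on_cong)

lemma smooth_on_local:
  "open S \<Longrightarrow> (\<And>x. x \<in> S \<Longrightarrow> \<exists>T. open T \<and> x \<in> T \<and> smooth_on T f) \<Longrightarrow> smooth_on S f"
  unfolding smooth_on_def by (meson Ck_on_local)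

lemma smooth_on_const: "open S \<Longrightarrow> smooth_on S (\<lambda>x. c)"
  by (simp add: smooth_on_def Ck_on_const)

lemma smooth_on_linear: "open S \<Longrightarrow> bounded_linear L \<Longrightarrow> smooth_on S L"
  by (simp add: smooth_on_def Ck_on_linear)

lemma smooth_on_linear_compose: "open S \<Longrightarrow> bounded_linear L \<Longrightarrow> smooth_on S f \<Longrightarrow> smooth_on S (\<lambda>x. L (f x))"
  by (simp add: smooth_on_def Ck_on_linear_compose)

lemma smooth_on_add: "open S \<Longrightarrow> smooth_on S f \<Longrightarrow> smooth_on S g \<Longrightarrow> smooth_on S (\<lambda>x. f x + g x)"
  by (simp add: smooth_on_def Ck_on_add)

lemma smooth_on_sum: "open S \<Longrightarrow> (\<And>i. i \<in> A \<Longrightarrow> smooth_on S (f i)) \<Longrightarrow> smooth_on S (\<lambda>x. \<Sum>i\<in>A. f i x)"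
  by (simp add: smooth_on_def Ck_on_sum)

lemma smooth_on_mult:
  fixes f :: "'a::real_normed_vector \<Rightarrow> 'b::real_normed_algebra"
  shows "open S \<Longrightarrow> smooth_on S f \<Longrightarrow> smooth_on S g \<Longrightarrow> smooth_on S (\<lambda>x. f x * g x)"
  by (simp add: smooth_on_def Ck_on_bilinear bounded_bilinear_mult)

lemma smooth_on_minus: "open S \<Longrightarrow> smooth_on S f \<Longrightarrow> smooth_on S (\<lambda>x. - f x)"
  by (rule smooth_on_linear_compose) (auto intro: bounded_linear_minus bounded_linear_ident)

lemma smooth_on_diff: "open S \<Longrightarrow> smooth_on S f \<Longrightarrow> smooth_on S g \<Longrightarrow> smooth_on S (\<lambda>x. f x - g x)"
  using smooth_on_add[of S f "\<lambda>x. - g x"] by (simp add: smooth_on_minus)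

lemma smooth_on_prod:
  fixes f :: "'i \<Rightarrow> 'a::real_normed_vector \<Rightarrow> complex"
  shows "open S \<Longrightarrow> (\<And>i. i \<in> A \<Longrightarrow> smooth_on S (f i)) \<Longrightarrow> smooth_on S (\<lambda>x. \<Prod>i\<in>A. f i x)"
  by (induction A rule: infinite_finite_induct) (auto intro: smooth_on_mult smooth_on_const)

lemma smooth_on_divide:
  fixes f :: "'a::real_normed_vector \<Rightarrow> complex"
  shows "open S \<Longrightarrow> smooth_on S f \<Longrightarrow> smooth_on S g \<Longrightarrow> (\<And>x. x \<in> S \<Longrightarrow> g x \<noteq> 0) \<Longrightarrow> smooth_on S (\<lambda>x. f x / g x)"
  unfolding divide_inverse by (rule smooth_on_mult) (auto simp: smooth_on_def Ck_on_inverse)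

lemma smooth_on_compose:
  fixes f :: "'a::real_normed_vector \<Rightarrow> 'b::euclidean_space"
  shows "open S \<Longrightarrow> open T \<Longrightarrow> f ` S \<subseteq> T \<Longrightarrow> smooth_on S f \<Longrightarrow> smooth_on T g \<Longrightarrow> smooth_on S (\<lambda>x. g (f x))"
  by (auto simp: smooth_on_def intro: Ck_on_compose)

lemma smooth_on_differentiable: "smooth_on S f \<Longrightarrow> x \<in> S \<Longrightarrow> f differentiable (at x)"
  unfolding smooth_on_def by (metis Ck_on.simps(2))

lemma smooth_on_has_derivative:
  "smooth_on S f \<Longrightarrow> x \<in> S \<Longrightarrow> (f has_derivative frechet_derivative f (at x)) (at x)"
  using smooth_on_differentiable frechet_derivative_works by blast

lemma smooth_on_derivative: "smooth_on S f \<Longrightarrow> smooth_on S (\<lambda>x. frechet_derivative f (at x) v)"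
  unfolding smooth_on_def by (metis Ck_on.simps(2))

lemma smooth_on_continuous: "smooth_on S f \<Longrightarrow> continuous_on S f"
  unfolding smooth_on_def by (metis Ck_on.simps(1))

lemma smooth_on_vec:
  fixes f :: "'a::real_normed_vector \<Rightarrow> complex ^ 'n"
  assumes "open S" "\<And>i. smooth_on S (\<lambda>x. f x $ i)" shows "smooth_on S f"
proof -
  have l: "bounded_linear (axis i :: complex \<Rightarrow> complex ^ 'n)" for i
    by (rule linear_conv_bounded_linear[THEN iffD1]) (auto simp: linear_iff axis_def vec_eq_iff)
  have "smooth_on S (\<lambda>x. \<Sum>i\<in>UNIV. axis i (f x $ i))"
    by (intro smooth_on_sum smooth_on_linear_compose[OF assms(1) l] assms)
  moreover have "(\<lambda>x. \<Sum>i\<in>UNIV. axis i (f x $ i)) = f"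
    by (auto simp: fun_eq_iff vec_eq_iff sum_component axis_def if_distrib cong: if_cong)
  ultimately show ?thesis by simp
qed

lemma smooth_on_component: "open S \<Longrightarrow> smooth_on S f \<Longrightarrow> smooth_on S (\<lambda>x. (f x :: complex ^ 'n) $ i)"
  by (rule smooth_on_linear_compose[OF _ bounded_linear_vec_nth])

lemma smooth_on_Pair:
  assumes "open S" "smooth_on S f" "smooth_on S g" shows "smooth_on S (\<lambda>x. (f x, g x))"
proof -
  have "smooth_on S (\<lambda>x. (f x, 0) + (0, g x))"
    by (intro smooth_on_add assms smooth_on_linear_compose[OF assms(1), of "\<lambda>a. (a, 0)"]
        smooth_on_linear_compose[OF assms(1), of "\<lambda>a. (0, a)"] bounded_linear_Pair bounded_linear_ident bounded_linear_zero)
  then show ?thesis by simp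
qed

lemma smooth_on_cnj: "open S \<Longrightarrow> smooth_on S f \<Longrightarrow> smooth_on S (\<lambda>x. cnj (f x))"
  by (rule smooth_on_linear_compose[OF _ bounded_linear_cnj])

lemma smooth_on_det:
  fixes M :: "'a::real_normed_vector \<Rightarrow> complex ^ 'n ^ 'n"
  assumes "open S" "\<And>i j. smooth_on S (\<lambda>x. M x $ i $ j)" shows "smooth_on S (\<lambda>x. det (M x))"
  unfolding det_def by (intro smooth_on_sum smooth_on_mult smooth_on_prod smooth_on_const assms)

text \<open>By Cramer's rule the entries of the inverse are quotients of determinants.\<close>

lemma smooth_on_matrix_inv:
  fixes M :: "'a::real_normed_vector \<Rightarrow> complex ^ 'n ^ 'n"
  assumes "open S" "\<And>i j. smooth_on S (\<lambda>x. M x $ i $ j)" "\<And>x. x \<in> S \<Longrightarrow> invertible (M x)"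
  shows "smooth_on S (\<lambda>x. matrix_inv (M x) $ i $ j)"
proof -
  let ?C = "\<lambda>x. \<chi> k l. if l = i then axis j 1 $ k else M x $ k $ l"
  have "smooth_on S (\<lambda>x. det (?C x) / det (M x))"
  proof (intro smooth_on_divide smooth_on_det assms(1,2))
    show "smooth_on S (\<lambda>x. ?C x $ k $ l)" for k l
      using assms by (cases "l = i") (auto intro: smooth_on_const)
  qed (use assms(3) invertible_det_nz in blast)
  moreover have "det (?C x) / det (M x) = matrix_inv (M x) $ i $ j" if "x \<in> S" for x
  proof -
    have "M x *v (matrix_inv (M x) *v axis j 1) = axis j 1"
      by (simp add: matrix_vector_mul_assoc matrix_inv_works assms(3) that)
    then have "matrix_inv (M x) *v axis j 1 = (\<chi> k. det (\<chi> r l. if l = k then axis j 1 $ r else M x $ r $ l) / det (M x))"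
      using cramer[of "M x" "matrix_inv (M x) *v axis j 1" "axis j 1"] invertible_det_nz assms(3)[OF that] by blast
    then have "(matrix_inv (M x) *v axis j 1) $ i = det (?C x) / det (M x)" by simp
    then show ?thesis by (simp add: matrix_vector_nth axis_def if_distrib cong: if_cong)
  qed
  ultimately show ?thesis by (rule smooth_on_cong[OF assms(1)])
qed

section \<open>Symmetry of second derivatives\<close>

text \<open>The mean value theorem in s for the increment of f along v, followed by the mean value
  theorem in t for the derivative of f along u.\<close>

lemma second_difference:
  fixes f :: "'a::real_normed_vector \<Rightarrow> real"
  assumes "open S" "Ck_on 2 S f" "h > 0" "\<And>s t. 0 \<le> s \<Longrightarrow> s \<le> h \<Longrightarrow> 0 \<le> t \<Longrightarrow> t \<le> h \<Longrightarrow> x + s *\<^sub>R u + t *\<^sub>R v \<in> S"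
  obtains s t where "0 < s" "s < h" "0 < t" "t < h"
    "f (x + h *\<^sub>R u + h *\<^sub>R v) - f (x + h *\<^sub>R u) - f (x + h *\<^sub>R v) + f x
      = h * h * frechet_derivative (\<lambda>y. frechet_derivative f (at y) u) (at (x + s *\<^sub>R u + t *\<^sub>R v)) v"
proof -
  have C: "Ck_on (Suc 1) S f" using assms(2) by (simp add: numeral_2_eq_2)
  have C': "Ck_on (Suc 0) S (\<lambda>y. frechet_derivative f (at y) u)" using Ck_on_SucD(2)[OF C] by simp
  have 1: "((\<lambda>s. f (x + s *\<^sub>R u + t *\<^sub>R v)) has_field_derivative frechet_derivative f (at (x + s *\<^sub>R u + t *\<^sub>R v)) u) (at s)"
    if "0 \<le> s" "s \<le> h" "0 \<le> t" "t \<le> h" for s t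
  proof -
    have d: "(f has_derivative frechet_derivative f (at (x + s *\<^sub>R u + t *\<^sub>R v))) (at (x + s *\<^sub>R u + t *\<^sub>R v))"
      using Ck_on_SucD(1)[OF C] assms(4) that by blast
    have "((\<lambda>s. f (x + s *\<^sub>R u + t *\<^sub>R v)) has_derivative (\<lambda>r. frechet_derivative f (at (x + s *\<^sub>R u + t *\<^sub>R v)) (r *\<^sub>R u))) (at s)"
      by (rule has_derivative_compose[of "\<lambda>s. x + s *\<^sub>R u + t *\<^sub>R v" "\<lambda>r. r *\<^sub>R u" s UNIV, OF _ d])
        (auto intro!: derivative_eq_intros)
    then show ?thesis
      by (rule has_derivative_imp_has_field_derivative) (simp add: linear_cmul[OF has_derivative_linear[OF d]])
  qed
  have 2: "((\<lambda>t. frechet_derivative f (at (x + s *\<^sub>R u + t *\<^sub>R v)) u) has_field_derivative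
      frechet_derivative (\<lambda>y. frechet_derivative f (at y) u) (at (x + s *\<^sub>R u + t *\<^sub>R v)) v) (at t)"
    if "0 \<le> s" "s \<le> h" "0 \<le> t" "t \<le> h" for s t
  proof -
    let ?g = "\<lambda>y. frechet_derivative f (at y) u"
    have d: "(?g has_derivative frechet_derivative ?g (at (x + s *\<^sub>R u + t *\<^sub>R v))) (at (x + s *\<^sub>R u + t *\<^sub>R v))"
      using Ck_on_SucD(1)[OF C'] assms(4) that by blast
    have "((\<lambda>t. ?g (x + s *\<^sub>R u + t *\<^sub>R v)) has_derivative (\<lambda>r. frechet_derivative ?g (at (x + s *\<^sub>R u + t *\<^sub>R v)) (r *\<^sub>R v))) (at t)"
      by (rule has_derivative_compose[of "\<lambda>t. x + s *\<^sub>R u + t *\<^sub>R v" "\<lambda>r. r *\<^sub>R v" t UNIV, OF _ d])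
        (auto intro!: derivative_eq_intros)
    then show ?thesis
      by (rule has_derivative_imp_has_field_derivative) (simp add: linear_cmul[OF has_derivative_linear[OF d]])
  qed
  have "\<exists>s>0. s < h \<and> (f (x + h *\<^sub>R u + h *\<^sub>R v) - f (x + h *\<^sub>R u + 0 *\<^sub>R v)) - (f (x + 0 *\<^sub>R u + h *\<^sub>R v) - f (x + 0 *\<^sub>R u + 0 *\<^sub>R v)) =
     (h - 0) * (frechet_derivative f (at (x + s *\<^sub>R u + h *\<^sub>R v)) u - frechet_derivative f (at (x + s *\<^sub>R u + 0 *\<^sub>R v)) u)"
    using assms(3) by (intro MVT2) (auto intro!: DERIV_diff 1 1[of _ 0, simplified])
  then obtain s where s: "0 < s" "s < h"
    "f (x + h *\<^sub>R u + h *\<^sub>R v) - f (x + h *\<^sub>R u) - f (x + h *\<^sub>R v) + f x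
      = h * (frechet_derivative f (at (x + s *\<^sub>R u + h *\<^sub>R v)) u - frechet_derivative f (at (x + s *\<^sub>R u + 0 *\<^sub>R v)) u)"
    by (auto simp: algebra_simps)
  have "\<exists>t>0. t < h \<and> frechet_derivative f (at (x + s *\<^sub>R u + h *\<^sub>R v)) u - frechet_derivative f (at (x + s *\<^sub>R u + 0 *\<^sub>R v)) u
      = (h - 0) * frechet_derivative (\<lambda>y. frechet_derivative f (at y) u) (at (x + s *\<^sub>R u + t *\<^sub>R v)) v"
    using assms(3) s by (intro MVT2) (auto intro!: 2)
  then obtain t where t: "0 < t" "t < h" "frechet_derivative f (at (x + s *\<^sub>R u + h *\<^sub>R v)) u - frechet_derivative f (at (x + s *\<^sub>R u + 0 *\<^sub>R v)) u
      = h * frechet_derivative (\<lambda>y. frechet_derivative f (at y) u) (at (x + s *\<^sub>R u + t *\<^sub>R v)) v"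
    by auto
  show ?thesis by (rule that[OF s(1,2) t(1,2)]) (simp only: s(3) t(3) mult.assoc)
qed

text \<open>The second difference over a small parallelogram is symmetric in u and v, and it equals
  h^2 times either mixed derivative at some nearby point; continuity forces the two to agree at
  x.\<close>

lemma second_derivative_symmetric_real:
  fixes f :: "'a::real_normed_vector \<Rightarrow> real"
  assumes "open S" "Ck_on 2 S f" "x \<in> S"
  shows "frechet_derivative (\<lambda>y. frechet_derivative f (at y) u) (at x) v
    = frechet_derivative (\<lambda>y. frechet_derivative f (at y) v) (at x) u"
proof (rule ccontr)
  define A B where "A y = frechet_derivative (\<lambda>y. frechet_derivative f (at y) u) (at y) v"
    and "B y = frechet_derivative (\<lambda>y. frechet_derivative f (at y) v) (at y) u" for y
  assume "\<not> ?thesis"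
  then have ne: "A x \<noteq> B x" by (simp add: A_def B_def)
  have C: "Ck_on (Suc (Suc 0)) S f" using assms(2) by (simp add: numeral_2_eq_2)
  have "continuous_on S A" "continuous_on S B"
    unfolding A_def B_def using Ck_on_SucD(2)[OF Ck_on_SucD(2)[OF C]] by auto
  then have cA: "isCont A x" and cB: "isCont B x"
    using assms by (auto simp: continuous_on_eq_continuous_at)
  \<comment> \<open>Half the gap: a value within e of A x cannot equal a value within e of B
    x.\<close>
  define e where "e = \<bar>A x - B x\<bar> / 2"
  have e: "e > 0" using ne by (simp add: e_def)
  obtain d1 where d1: "d1 > 0" "\<And>y. dist y x < d1 \<Longrightarrow> dist (A y) (A x) < e"
    using cA e unfolding continuous_at_eps_delta by blast
  obtain d2 where d2: "d2 > 0" "\<And>y. dist y x < d2 \<Longrightarrow> dist (B y) (B x) < e"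
    using cB e unfolding continuous_at_eps_delta by blast
  obtain d3 where d3: "d3 > 0" "ball x d3 \<subseteq> S" using assms openE by blast
  define d where "d = min d1 (min d2 d3)"
  have d: "d > 0" using d1 d2 d3 by (simp add: d_def)
  define K where "K = norm u + norm v + 1"
  have K: "K > 0" by (simp add: K_def add_nonneg_pos)
  \<comment> \<open>With this h the parallelogram stays within d/2 of x.\<close>
  define h where "h = d / (2 * K)"
  have h: "h > 0" using d K by (simp add: h_def)
  have near: "dist (x + s *\<^sub>R u + t *\<^sub>R v) x < d" if "0 \<le> s" "s \<le> h" "0 \<le> t" "t \<le> h" for s t
  proof -
    have "dist (x + s *\<^sub>R u + t *\<^sub>R v) x = norm (s *\<^sub>R u + t *\<^sub>R v)" by (simp add: dist_norm algebra_simps)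
    also have "\<dots> \<le> s * norm u + t * norm v" using that by (metis abs_of_nonneg norm_scaleR norm_triangle_ineq)
    also have "\<dots> \<le> h * norm u + h * norm v" using that by (intro add_mono mult_right_mono) auto
    also have "\<dots> \<le> h * K" using h by (simp add: algebra_simps K_def)
    also have "\<dots> = d / 2" unfolding h_def using K by simp
    finally show ?thesis using d by simp
  qed
  have inS: "x + s *\<^sub>R u + t *\<^sub>R v \<in> S" "x + s *\<^sub>R v + t *\<^sub>R u \<in> S"
    if "0 \<le> s" "s \<le> h" "0 \<le> t" "t \<le> h" for s t
    using near[OF that] near[OF that(3,4,1,2)] d3 by (auto simp: d_def dist_commute mem_ball subset_iff algebra_simps)
  obtain s t where st: "0 < s" "s < h" "0 < t" "t < h"
    "f (x + h *\<^sub>R u + h *\<^sub>R v) - f (x + h *\<^sub>R u) - f (x + h *\<^sub>R v) + f x = h * h * A (x + s *\<^sub>R u + t *\<^sub>R v)"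
    using second_difference[OF assms(1,2) h inS(1)] unfolding A_def by blast
  obtain s' t' where st': "0 < s'" "s' < h" "0 < t'" "t' < h"
    "f (x + h *\<^sub>R v + h *\<^sub>R u) - f (x + h *\<^sub>R v) - f (x + h *\<^sub>R u) + f x = h * h * B (x + s' *\<^sub>R v + t' *\<^sub>R u)"
    using second_difference[OF assms(1,2) h inS(2)] unfolding B_def by blast
  have "x + h *\<^sub>R v + h *\<^sub>R u = x + h *\<^sub>R u + h *\<^sub>R v" by (simp add: algebra_simps)
  then have "h * h * A (x + s *\<^sub>R u + t *\<^sub>R v) = h * h * B (x + s' *\<^sub>R v + t' *\<^sub>R u)"
    using st(5) st'(5) by (simp only:)
  then have "A (x + s *\<^sub>R u + t *\<^sub>R v) = B (x + t' *\<^sub>R u + s' *\<^sub>R v)" using h by (simp add: algebra_simps)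
  moreover have "dist (A (x + s *\<^sub>R u + t *\<^sub>R v)) (A x) < e"
    by (rule d1(2)) (use near[of s t] st in \<open>auto simp: d_def\<close>)
  moreover have "dist (B (x + t' *\<^sub>R u + s' *\<^sub>R v)) (B x) < e"
    by (rule d2(2)) (use near[of t' s'] st' in \<open>auto simp: d_def\<close>)
  ultimately show False by (auto simp: e_def dist_real_def abs_if split: if_splits)
qed

lemma second_derivative_symmetric:
  fixes f :: "'a::real_normed_vector \<Rightarrow> 'b::euclidean_space"
  assumes "open S" "smooth_on S f" "x \<in> S"
  shows "frechet_derivative (\<lambda>y. frechet_derivative f (at y) u) (at x) v
    = frechet_derivative (\<lambda>y. frechet_derivative f (at y) v) (at x) u"
proof (rule euclidean_eqI)
  fix b :: 'b assume "b \<in> Basis"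
  have D1: "frechet_derivative (\<lambda>y. f y \<bullet> b) (at y) = (\<lambda>v. frechet_derivative f (at y) v \<bullet> b)" if "y \<in> S" for y
    by (rule frechet_derivative_at[symmetric])
      (rule bounded_linear.has_derivative[OF bounded_linear_inner_left smooth_on_has_derivative[OF assms(2) that]])
  have D2: "frechet_derivative (\<lambda>y. frechet_derivative (\<lambda>y. f y \<bullet> b) (at y) u) (at x) v
      = frechet_derivative (\<lambda>y. frechet_derivative f (at y) u) (at x) v \<bullet> b" for u v
  proof -
    have "((\<lambda>y. frechet_derivative f (at y) u \<bullet> b) has_derivative
        (\<lambda>v. frechet_derivative (\<lambda>y. frechet_derivative f (at y) u) (at x) v \<bullet> b)) (at x)"
      by (rule bounded_linear.has_derivative[OF bounded_linear_inner_left
            smooth_on_has_derivative[OF smooth_on_derivative[OF assms(2)] assms(3)]])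
    then have "((\<lambda>y. frechet_derivative (\<lambda>y. f y \<bullet> b) (at y) u) has_derivative
        (\<lambda>v. frechet_derivative (\<lambda>y. frechet_derivative f (at y) u) (at x) v \<bullet> b)) (at x)"
      by (rule has_derivative_transform_within_open[OF _ assms(1,3)]) (simp add: D1)
    from frechet_derivative_at[OF this] show ?thesis by metis
  qed
  have "smooth_on S (\<lambda>y. f y \<bullet> b)"
    by (rule smooth_on_linear_compose[OF assms(1) bounded_linear_inner_left assms(2)])
  then have "Ck_on 2 S (\<lambda>y. f y \<bullet> b)" by (simp only: smooth_on_def)
  from second_derivative_symmetric_real[OF assms(1) this assms(3)]
  show "frechet_derivative (\<lambda>y. frechet_derivative f (at y) u) (at x) v \<bullet> b
    = frechet_derivative (\<lambda>y. frechet_derivative f (at y) v) (at x) u \<bullet> b"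
    unfolding D2 .
qed

section \<open>Wirtinger derivatives\<close>

definition wirt :: "bool \<times> 'n \<Rightarrow> ('n::finite cvec \<Rightarrow> complex) \<Rightarrow> 'n cvec \<Rightarrow> complex" where
  "wirt g f y = ccoef g (frechet_derivative f (at y))"

lemma wirt_eq: "wirt g f y = (frechet_derivative f (at y) (axis (snd g) 1)
    + (if fst g then \<i> else - \<i>) * frechet_derivative f (at y) (axis (snd g) \<i>)) / 2"
  by (simp add: wirt_def ccoef_eq)

lemma fd_eq: "(f has_derivative f') (at y) \<Longrightarrow> frechet_derivative f (at y) = f'"
  using frechet_derivative_at by metis

lemma fd_works: "f differentiable (at y) \<Longrightarrow> (f has_derivative frechet_derivative f (at y)) (at y)"
  using frechet_derivative_works by blast

lemma fd_expand:
  "f differentiable (at y) \<Longrightarrow> frechet_derivative f (at y) v = (\<Sum>g\<in>UNIV. wirt g f y * coord g v)"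
  unfolding wirt_def by (rule ccoef_expand) (rule linear_frechet_derivative)

lemma wirt_const [simp]: "wirt g (\<lambda>y. c) y = 0"
  by (simp add: wirt_def ccoef_linear)

lemma wirt_add:
  assumes "f differentiable (at y)" "h differentiable (at y)"
  shows "wirt g (\<lambda>y. f y + h y) y = wirt g f y + wirt g h y"
  unfolding wirt_def fd_eq[OF has_derivative_add[OF assms[THEN fd_works]]] by (simp add: ccoef_linear)

lemma wirt_diff:
  assumes "f differentiable (at y)" "h differentiable (at y)"
  shows "wirt g (\<lambda>y. f y - h y) y = wirt g f y - wirt g h y"
  unfolding wirt_def fd_eq[OF has_derivative_diff[OF assms[THEN fd_works]]] by (simp add: ccoef_linear)

lemma wirt_minus:
  assumes "f differentiable (at y)"
  shows "wirt g (\<lambda>y. - f y) y = - wirt g f y"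
  unfolding wirt_def fd_eq[OF has_derivative_minus[OF assms[THEN fd_works]]] by (simp add: ccoef_linear)

lemma wirt_mult:
  assumes "f differentiable (at y)" "h differentiable (at y)"
  shows "wirt g (\<lambda>y. f y * h y) y = f y * wirt g h y + wirt g f y * h y"
  unfolding wirt_def fd_eq[OF has_derivative_mult[OF assms[THEN fd_works]]] by (simp add: ccoef_linear)

lemma wirt_cmult:
  assumes "f differentiable (at y)"
  shows "wirt g (\<lambda>y. c * f y) y = c * wirt g f y"
  using wirt_mult[of "\<lambda>_. c" y f g] assms by simp

lemma wirt_sum:
  assumes "\<And>i. i \<in> A \<Longrightarrow> f i differentiable (at y)"
  shows "wirt g (\<lambda>y. \<Sum>i\<in>A. f i y) y = (\<Sum>i\<in>A. wirt g (f i) y)"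
  using assms
proof (induction A rule: infinite_finite_induct)
  case (insert x F)
  then have "wirt g (\<lambda>y. f x y + (\<Sum>i\<in>F. f i y)) y = wirt g (f x) y + wirt g (\<lambda>y. \<Sum>i\<in>F. f i y) y"
    by (intro wirt_add differentiable_sum) auto
  then show ?case using insert by simp
qed auto

lemma wirt_cong:
  assumes "open S" "y \<in> S" "\<And>x. x \<in> S \<Longrightarrow> f x = h x" "f differentiable (at y)"
  shows "wirt g f y = wirt g h y"
  unfolding wirt_def using frechet_derivative_transform_within_open[OF assms(4,1,2,3)] by simp

lemma smooth_on_wirt:
  assumes "open S" "smooth_on S f" shows "smooth_on S (wirt g f)"
  unfolding wirt_eq[abs_def] divide_inverse
  by (intro smooth_on_mult smooth_on_add smooth_on_const smooth_on_derivative assms)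

lemma wirt_commute:
  assumes "open S" "smooth_on S f" "y \<in> S"
  shows "wirt g (wirt h f) y = wirt h (wirt g f) y"
proof -
  have d: "(\<lambda>y. frechet_derivative f (at y) v) differentiable (at y)" for v
    using smooth_on_differentiable[OF smooth_on_derivative[OF assms(2)] assms(3)] .
  have e: "wirt g (wirt h f) y = (1/2) * (wirt g (\<lambda>y. frechet_derivative f (at y) (axis (snd h) 1)) y
     + (if fst h then \<i> else - \<i>) * wirt g (\<lambda>y. frechet_derivative f (at y) (axis (snd h) \<i>)) y)" for g h
  proof -
    have "wirt h f = (\<lambda>y. (1/2) * (frechet_derivative f (at y) (axis (snd h) 1)
       + (if fst h then \<i> else - \<i>) * frechet_derivative f (at y) (axis (snd h) \<i>)))"
      by (simp add: wirt_eq fun_eq_iff)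
    then show ?thesis
      by (simp only: wirt_cmult wirt_add d differentiable_add differentiable_mult differentiable_const)
  qed
  note s = second_derivative_symmetric[OF assms]
  have r: "(1/2) * ((a + p * b) / 2 + q * ((c + p * d) / 2)) = (1/2) * ((a + q * c) / 2 + p * ((b + q * d) / 2))"
    for a b c d p q :: complex by (simp add: field_simps)
  show ?thesis unfolding e unfolding wirt_eq s[of "axis (snd g) 1" "axis (snd h) 1"]
      s[of "axis (snd g) 1" "axis (snd h) \<i>"] s[of "axis (snd g) \<i>" "axis (snd h) 1"]
      s[of "axis (snd g) \<i>" "axis (snd h) \<i>"] by (rule r)
qed

section \<open>Families of covectors\<close>

definition diff_fam :: "('n::finite cvec \<Rightarrow> 'n ext) \<Rightarrow> 'n cvec \<Rightarrow> bool" where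
  "diff_fam \<eta> y \<longleftrightarrow> (\<forall>vs. (\<lambda>y. \<eta> y vs) differentiable (at y))"

text \<open>The argument vectors are held constant, so that in a chart d becomes the sum of
  \<open>coord g\<close> wedged with \<open>dwirt g\<close>.\<close>

definition dwirt :: "bool \<times> 'n \<Rightarrow> ('n::finite cvec \<Rightarrow> 'n ext) \<Rightarrow> 'n cvec \<Rightarrow> 'n ext" where
  "dwirt g \<eta> y = (\<lambda>vs. wirt g (\<lambda>y. \<eta> y vs) y)"

definition smooth_fam :: "'n::finite cvec set \<Rightarrow> ('n cvec \<Rightarrow> 'n ext) \<Rightarrow> bool" where
  "smooth_fam U \<eta> \<longleftrightarrow> (\<forall>vs. smooth_on U (\<lambda>y. \<eta> y vs))"

lemma smooth_fam_diff_fam: "smooth_fam U \<eta> \<Longrightarrow> y \<in> U \<Longrightarrow> diff_fam \<eta> y"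
  by (auto simp: smooth_fam_def diff_fam_def intro: smooth_on_differentiable)

lemma smooth_fam_dwirt: "open U \<Longrightarrow> smooth_fam U \<eta> \<Longrightarrow> smooth_fam U (dwirt g \<eta>)"
  by (auto simp: smooth_fam_def dwirt_def intro: smooth_on_wirt)

lemma diff_fam_Cons: "diff_fam \<eta> y \<Longrightarrow> diff_fam (\<lambda>y us. \<eta> y (v # us)) y"
  by (auto simp: diff_fam_def)

lemma diff_fam_grade: "diff_fam \<eta> y \<Longrightarrow> diff_fam (\<lambda>y. grade (\<eta> y)) y"
  unfolding diff_fam_def grade_def by (intro allI differentiable_mult) auto

lemma diff_fam_contr: "diff_fam \<eta> y \<Longrightarrow> diff_fam (\<lambda>y. contr g (\<eta> y)) y"
  unfolding diff_fam_def contr_def ccoef_eq divide_inverse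
  by (intro allI differentiable_mult differentiable_add) auto

lemma diff_fam_wedge: "diff_fam \<eta> y \<Longrightarrow> diff_fam \<zeta> y \<Longrightarrow> diff_fam (\<lambda>y. wedge (\<eta> y) (\<zeta> y)) y"
proof -
  have "(\<lambda>y. wedge (\<eta> y) (\<zeta> y) vs) differentiable (at y)" if "diff_fam \<eta> y" "diff_fam \<zeta> y" for vs
    using that
  proof (induction vs arbitrary: \<eta> \<zeta>)
    case Nil then show ?case by (auto simp: diff_fam_def intro: differentiable_mult)
  next
    case (Cons v vs) then show ?case by (auto intro!: differentiable_add diff_fam_Cons diff_fam_grade)
  qed
  then show "diff_fam \<eta> y \<Longrightarrow> diff_fam \<zeta> y \<Longrightarrow> ?thesis" by (simp add: diff_fam_def)
qed

lemma diff_fam_one_form: "(\<And>v. (\<lambda>y. \<theta> y v) differentiable (at y)) \<Longrightarrow> diff_fam (\<lambda>y. one_form (\<theta> y)) y"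
  unfolding diff_fam_def one_form_def
proof
  fix vs assume d: "\<And>v. (\<lambda>y. \<theta> y v) differentiable (at y)"
  show "(\<lambda>y. case vs of [] \<Rightarrow> 0 | [v] \<Rightarrow> \<theta> y v | v # a # us \<Rightarrow> 0) differentiable (at y)"
    by (cases vs rule: remdups_adj.cases) (auto simp: d)
qed

lemma diff_fam_sum: "(\<And>i. i \<in> A \<Longrightarrow> diff_fam (f i) y) \<Longrightarrow> diff_fam (\<lambda>y vs. \<Sum>i\<in>A. f i y vs) y"
  unfolding diff_fam_def by (cases "finite A") (auto intro: differentiable_sum)

lemma diff_fam_form_subst:
  assumes "\<And>h v. (\<lambda>y. a y h v) differentiable (at y)" "diff_fam \<eta> y"
  shows "diff_fam (\<lambda>y. form_subst (a y) (\<eta> y)) y"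
  unfolding diff_fam_def
proof
  fix vs show "(\<lambda>y. form_subst (a y) (\<eta> y) vs) differentiable (at y)"
    using assms(2)
  proof (induction vs arbitrary: \<eta>)
    case (Cons v vs)
    then show ?case by (auto intro!: differentiable_sum differentiable_mult assms(1) diff_fam_contr)
  qed (auto simp: diff_fam_def)
qed

lemma dwirt_contr: "diff_fam \<eta> y \<Longrightarrow> dwirt g (\<lambda>y. contr h (\<eta> y)) y = contr h (dwirt g \<eta> y)"
proof
  fix vs assume "diff_fam \<eta> y"
  then have d: "(\<lambda>y. \<eta> y us) differentiable (at y)" for us by (simp add: diff_fam_def)
  have e: "(\<lambda>y. contr h (\<eta> y) vs) = (\<lambda>y. (1/2) * (\<eta> y (axis (snd h) 1 # vs) + (if fst h then \<i> else - \<i>) * \<eta> y (axis (snd h) \<i> # vs)))"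
    by (simp add: contr_def ccoef_eq)
  have "dwirt g (\<lambda>y. contr h (\<eta> y)) y vs = (1/2) * (wirt g (\<lambda>y. \<eta> y (axis (snd h) 1 # vs)) y
      + (if fst h then \<i> else - \<i>) * wirt g (\<lambda>y. \<eta> y (axis (snd h) \<i> # vs)) y)"
    unfolding dwirt_def e
    by (simp only: wirt_cmult wirt_add d differentiable_add differentiable_mult differentiable_const)
  then show "dwirt g (\<lambda>y. contr h (\<eta> y)) y vs = contr h (dwirt g \<eta> y) vs"
    by (simp add: dwirt_def contr_def ccoef_eq)
qed

lemma dwirt_sum: "(\<And>i. i \<in> A \<Longrightarrow> diff_fam (f i) y) \<Longrightarrow> dwirt g (\<lambda>y us. \<Sum>i\<in>A. f i y us) y = (\<lambda>us. \<Sum>i\<in>A. dwirt g (f i) y us)"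
  by (auto simp: dwirt_def diff_fam_def intro!: wirt_sum)

lemma dwirt_wedge:
  assumes "diff_fam \<eta> y" "diff_fam \<zeta> y"
  shows "dwirt g (\<lambda>y. wedge (\<eta> y) (\<zeta> y)) y vs = wedge (dwirt g \<eta> y) (\<zeta> y) vs + wedge (\<eta> y) (dwirt g \<zeta> y) vs"
  using assms
proof (induction vs arbitrary: \<eta> \<zeta>)
  case Nil then show ?case by (simp add: dwirt_def wirt_mult diff_fam_def)
next
  case (Cons v vs)
  have gr: "dwirt g (\<lambda>y. grade (\<eta> y)) y = grade (dwirt g \<eta> y)"
    using Cons.prems(1) by (simp add: dwirt_def grade_def wirt_cmult diff_fam_def)
  have c: "dwirt g (\<lambda>y us. \<zeta> y (v # us)) y = (\<lambda>us. dwirt g \<zeta> y (v # us))" for \<zeta> :: "'a cvec \<Rightarrow> 'a ext" 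
    by (simp add: dwirt_def)
  have "dwirt g (\<lambda>y. wedge (\<eta> y) (\<zeta> y)) y (v # vs) = dwirt g (\<lambda>y. wedge (\<lambda>us. \<eta> y (v # us)) (\<zeta> y)) y vs
      + dwirt g (\<lambda>y. wedge (grade (\<eta> y)) (\<lambda>us. \<zeta> y (v # us))) y vs"
    using diff_fam_wedge[OF diff_fam_Cons[OF Cons.prems(1), of v] Cons.prems(2)]
      diff_fam_wedge[OF diff_fam_grade[OF Cons.prems(1)] diff_fam_Cons[OF Cons.prems(2), of v]]
    by (simp add: dwirt_def wirt_add diff_fam_def)
  then show ?case
    using Cons.IH[OF diff_fam_Cons[OF Cons.prems(1), of v] Cons.prems(2)]
      Cons.IH[OF diff_fam_grade[OF Cons.prems(1)] diff_fam_Cons[OF Cons.prems(2), of v]]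
    by (simp add: gr c)
qed

lemma dwirt_one_form: "dwirt g (\<lambda>y. one_form (\<theta> y)) y = one_form (\<lambda>v. wirt g (\<lambda>y. \<theta> y v) y)"
proof
  fix vs show "dwirt g (\<lambda>y. one_form (\<theta> y)) y vs = one_form (\<lambda>v. wirt g (\<lambda>y. \<theta> y v) y) vs"
    by (cases vs; cases "tl vs") (auto simp: dwirt_def one_form_def)
qed

text \<open>The substitution is an algebra homomorphism, so its derivative is a derivation along it.\<close>

lemma dwirt_form_subst:
  assumes "\<And>h v. (\<lambda>y. a y h v) differentiable (at y)" "diff_fam \<eta> y" "alternating (\<eta> y)"
  shows "dwirt g (\<lambda>y. form_subst (a y) (\<eta> y)) y vs =
    (\<Sum>h\<in>UNIV. wedge (one_form (\<lambda>v. wirt g (\<lambda>y. a y h v) y)) (form_subst (a y) (contr h (\<eta> y))) vs) + form_subst (a y) (dwirt g \<eta> y) vs"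
  using assms(2,3)
proof (induction vs arbitrary: \<eta>)
  case Nil then show ?case by (simp add: dwirt_def)
next
  case (Cons v vs)
  let ?d = "\<lambda>h v. wirt g (\<lambda>y. a y h v) y"
  have dp: "(\<lambda>y. form_subst (a y) (contr h (\<eta> y)) vs) differentiable (at y)" for h
    using diff_fam_form_subst[OF assms(1) diff_fam_contr[OF Cons.prems(1), of h]] by (simp add: diff_fam_def)
  have s: "contr h' (contr h (\<eta> y)) = (\<lambda>us. - contr h (contr h' (\<eta> y)) us)" for h h'
    by (rule ext) (rule contr_contr[OF Cons.prems(2)])
  have "dwirt g (\<lambda>y. form_subst (a y) (\<eta> y)) y (v # vs)
    = (\<Sum>h\<in>UNIV. a y h v * dwirt g (\<lambda>y. form_subst (a y) (contr h (\<eta> y))) y vs + ?d h v * form_subst (a y) (contr h (\<eta> y)) vs)"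
    by (simp add: dwirt_def wirt_sum wirt_mult assms(1) dp differentiable_mult)
  also have "\<dots> = (\<Sum>h\<in>UNIV. a y h v * (\<Sum>h'\<in>UNIV. wedge (one_form (?d h')) (form_subst (a y) (contr h' (contr h (\<eta> y)))) vs))
      + (\<Sum>h\<in>UNIV. a y h v * form_subst (a y) (contr h (dwirt g \<eta> y)) vs) + (\<Sum>h\<in>UNIV. ?d h v * form_subst (a y) (contr h (\<eta> y)) vs)"
    using Cons.prems by (simp add: Cons.IH diff_fam_contr alternating_contr dwirt_contr sum.distrib distrib_left)
  \<comment> \<open>Exchanging the two contractions produces the minus sign with which a one-form
    passes the head of the argument list.\<close>
  also have "(\<Sum>h\<in>UNIV. a y h v * (\<Sum>h'\<in>UNIV. wedge (one_form (?d h')) (form_subst (a y) (contr h' (contr h (\<eta> y)))) vs))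
      = - (\<Sum>h'\<in>UNIV. wedge (one_form (?d h')) (\<lambda>us. \<Sum>h\<in>UNIV. a y h v * form_subst (a y) (contr h (contr h' (\<eta> y))) us) vs)"
  proof -
    have "wedge (one_form (?d h')) (form_subst (a y) (contr h' (contr h (\<eta> y)))) vs = - wedge (one_form (?d h')) (form_subst (a y) (contr h (contr h' (\<eta> y)))) vs" for h h'
    proof -
      have "form_subst (a y) (contr h' (contr h (\<eta> y))) = (\<lambda>us. - form_subst (a y) (contr h (contr h' (\<eta> y))) us)"
        by (rule ext, subst s) (rule form_subst_minus)
      then show ?thesis by (simp only: wedge_minus_right)
    qed
    then show ?thesis
      by (simp add: wedge_linear sum_distrib_left sum_negf) (rule sum.swap)
  qed
  finally show ?case
    by (simp add: wedge_linear sum_subtractf sum.distrib)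
qed

text \<open>The recursion unrolled into the alternating sum over omitted arguments, which is the
  shape of \<open>ext_deriv\<close>.\<close>

lemma wedge_one_form_expand:
  "wedge (one_form \<theta>) \<beta> vs = (\<Sum>i<length vs. (-1) ^ i * (\<theta> (vs ! i) * \<beta> (take i vs @ drop (Suc i) vs)))"
proof (induction vs arbitrary: \<beta>)
  case (Cons v vs)
  show ?case
    by (simp add: wedge_one_form_Cons Cons sum.lessThan_Suc_shift sum_negf del: wedge_Cons sum.lessThan_Suc)
qed simp

lemma ext_deriv_eq:
  assumes "diff_fam \<eta> y"
  shows "ext_deriv \<eta> y = (\<lambda>vs. \<Sum>g\<in>UNIV. wedge (one_form (coord g)) (dwirt g \<eta> y) vs)"
proof
  fix vs
  have d: "(\<lambda>y. \<eta> y us) differentiable (at y)" for us using assms by (simp add: diff_fam_def)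
  show "ext_deriv \<eta> y vs = (\<Sum>g\<in>UNIV. wedge (one_form (coord g)) (dwirt g \<eta> y) vs)"
    unfolding ext_deriv_def wedge_one_form_expand dwirt_def
    by (subst sum.swap) (simp add: fd_expand[OF d] sum_distrib_left mult_ac)
qed

lemma smooth_fam_Cons: "smooth_fam U \<eta> \<Longrightarrow> smooth_fam U (\<lambda>y us. \<eta> y (v # us))"
  by (simp add: smooth_fam_def)

lemma smooth_fam_add: "open U \<Longrightarrow> smooth_fam U \<eta> \<Longrightarrow> smooth_fam U \<zeta> \<Longrightarrow> smooth_fam U (\<lambda>y us. \<eta> y us + \<zeta> y us)"
  by (simp add: smooth_fam_def smooth_on_add)

lemma smooth_fam_diff: "open U \<Longrightarrow> smooth_fam U \<eta> \<Longrightarrow> smooth_fam U \<zeta> \<Longrightarrow> smooth_fam U (\<lambda>y us. \<eta> y us - \<zeta> y us)"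
  by (simp add: smooth_fam_def smooth_on_diff)

lemma smooth_fam_sum: "open U \<Longrightarrow> (\<And>i. i \<in> A \<Longrightarrow> smooth_fam U (f i)) \<Longrightarrow> smooth_fam U (\<lambda>y us. \<Sum>i\<in>A. f i y us)"
  by (simp add: smooth_fam_def smooth_on_sum)

lemma smooth_fam_contr: "open U \<Longrightarrow> smooth_fam U \<eta> \<Longrightarrow> smooth_fam U (\<lambda>y. contr g (\<eta> y))"
  unfolding smooth_fam_def contr_def ccoef_eq divide_inverse
  by (intro allI smooth_on_mult smooth_on_add smooth_on_const) auto

lemma smooth_fam_wedge: "open U \<Longrightarrow> smooth_fam U \<eta> \<Longrightarrow> smooth_fam U \<zeta> \<Longrightarrow> smooth_fam U (\<lambda>y. wedge (\<eta> y) (\<zeta> y))"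
proof -
  assume U: "open U"
  have "smooth_on U (\<lambda>y. wedge (\<eta> y) (\<zeta> y) vs)" if "smooth_fam U \<eta>" "smooth_fam U \<zeta>" for vs
    using that
  proof (induction vs arbitrary: \<eta> \<zeta>)
    case Nil then show ?case by (auto simp: smooth_fam_def intro: smooth_on_mult U)
  next
    case (Cons v vs)
    have "smooth_fam U (\<lambda>y. grade (\<eta> y))" using Cons.prems(1) unfolding grade_def smooth_fam_def by (auto intro!: smooth_on_mult smooth_on_const U)
    then show ?case using Cons by (auto intro!: smooth_on_add U smooth_fam_Cons)
  qed
  then show "smooth_fam U \<eta> \<Longrightarrow> smooth_fam U \<zeta> \<Longrightarrow> ?thesis" by (simp add: smooth_fam_def)
qed

lemma smooth_fam_one_form: "open U \<Longrightarrow> (\<And>v. smooth_on U (\<lambda>y. \<theta> y v)) \<Longrightarrow> smooth_fam U (\<lambda>y. one_form (\<theta> y))"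
  unfolding smooth_fam_def one_form_def
proof
  fix vs assume d: "open U" "\<And>v. smooth_on U (\<lambda>y. \<theta> y v)"
  show "smooth_on U (\<lambda>y. case vs of [] \<Rightarrow> 0 | [v] \<Rightarrow> \<theta> y v | v # a # us \<Rightarrow> 0)"
    by (cases vs rule: remdups_adj.cases) (auto simp: d smooth_on_const)
qed

lemma smooth_fam_form_subst:
  assumes "open U" "\<And>h v. smooth_on U (\<lambda>y. a y h v)" "smooth_fam U \<eta>"
  shows "smooth_fam U (\<lambda>y. form_subst (a y) (\<eta> y))"
  unfolding smooth_fam_def
proof
  fix vs show "smooth_on U (\<lambda>y. form_subst (a y) (\<eta> y) vs)"
    using assms(3)
  proof (induction vs arbitrary: \<eta>)
    case Nil then show ?case by (simp add: smooth_fam_def)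
  next
    case (Cons v vs)
    then show ?case by (auto intro!: smooth_on_sum smooth_on_mult assms smooth_fam_contr)
  qed
qed

lemma smooth_fam_ins:
  assumes "open U" "\<And>i j. smooth_on U (\<lambda>y. \<phi> y $ i $ j)" "smooth_fam U \<eta>"
  shows "smooth_fam U (\<lambda>y. ins (\<phi> y) (\<eta> y))"
  unfolding ins_eq belt_def
  by (intro smooth_fam_sum smooth_fam_wedge smooth_fam_one_form smooth_fam_contr smooth_on_sum smooth_on_mult smooth_on_const assms)

lemma ins_eq_dwirt:
  assumes "\<And>i j. (\<lambda>y. \<phi> y $ i $ j) differentiable (at y)" "diff_fam \<eta> y"
  shows "dwirt g (\<lambda>y. ins (\<phi> y) (\<eta> y)) y =
    (\<lambda>vs. ins (\<chi> i j. wirt g (\<lambda>y. \<phi> y $ i $ j) y) (\<eta> y) vs + ins (\<phi> y) (dwirt g \<eta> y) vs)"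
    and "diff_fam (\<lambda>y. ins (\<phi> y) (\<eta> y)) y"
proof -
  have db: "(\<lambda>y. belt (\<phi> y) i v) differentiable (at y)" for i v
    unfolding belt_def by (intro differentiable_sum ballI differentiable_mult assms(1) differentiable_const finite)
  have wb: "wirt g (\<lambda>y. belt (\<phi> y) i v) y = belt (\<chi> i j. wirt g (\<lambda>y. \<phi> y $ i $ j) y) i v" for i v
  proof -
    have d1: "(\<lambda>y. \<phi> y $ i $ l * c) differentiable (at y)" for l c
      by (intro differentiable_mult assms differentiable_const)
    show ?thesis unfolding belt_def by (simp add: wirt_sum[OF d1] wirt_mult assms(1))
  qed
  have dw: "diff_fam (\<lambda>y. wedge (one_form (belt (\<phi> y) i)) (contr (False, i) (\<eta> y))) y" for i
    by (intro diff_fam_wedge diff_fam_one_form db diff_fam_contr assms)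
  show "diff_fam (\<lambda>y. ins (\<phi> y) (\<eta> y)) y" unfolding ins_eq by (intro diff_fam_sum dw)
  show "dwirt g (\<lambda>y. ins (\<phi> y) (\<eta> y)) y =
    (\<lambda>vs. ins (\<chi> i j. wirt g (\<lambda>y. \<phi> y $ i $ j) y) (\<eta> y) vs + ins (\<phi> y) (dwirt g \<eta> y) vs)"
    unfolding ins_eq dwirt_sum[OF dw]
    by (rule ext) (simp add: dwirt_wedge diff_fam_one_form db diff_fam_contr assms dwirt_one_form dwirt_contr wb sum.distrib)
qed

lemma alternating_dwirt:
  assumes "diff_fam \<eta> y" "open U" "y \<in> U" "\<And>x. x \<in> U \<Longrightarrow> alternating (\<eta> x)"
  shows "alternating (dwirt g \<eta> y)"
proof (rule altmI)
  have d: "(\<lambda>y. \<eta> y us) differentiable (at y)" for us using assms(1) by (simp add: diff_fam_def)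
  show "linear (\<lambda>v. dwirt g \<eta> y (us @ v # vs))" for us vs
  proof (rule linearI)
    fix a b :: "'a cvec" and r :: real
    have "wirt g (\<lambda>y. \<eta> y (us @ (a + b) # vs)) y = wirt g (\<lambda>y. \<eta> y (us @ a # vs) + \<eta> y (us @ b # vs)) y"
      by (rule wirt_cong[OF assms(2,3) _ d]) (use alternating_linear[OF assms(4), of _ us vs] in \<open>auto simp: linear_iff\<close>)
    then show "dwirt g \<eta> y (us @ (a + b) # vs) = dwirt g \<eta> y (us @ a # vs) + dwirt g \<eta> y (us @ b # vs)"
      by (simp add: dwirt_def wirt_add d)
    have "wirt g (\<lambda>y. \<eta> y (us @ (r *\<^sub>R a) # vs)) y = wirt g (\<lambda>y. of_real r * \<eta> y (us @ a # vs)) y"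
      by (rule wirt_cong[OF assms(2,3) _ d]) (use alternating_linear[OF assms(4), of _ us vs] in \<open>auto simp: linear_iff scaleRc\<close>)
    then show "dwirt g \<eta> y (us @ (r *\<^sub>R a) # vs) = r *\<^sub>R dwirt g \<eta> y (us @ a # vs)"
      by (simp add: dwirt_def wirt_cmult d scaleRc)
  qed
  show "dwirt g \<eta> y (us @ u # v # vs) = - dwirt g \<eta> y (us @ v # u # vs)" for us u v vs
  proof -
    have "wirt g (\<lambda>y. \<eta> y (us @ u # v # vs)) y = wirt g (\<lambda>y. - \<eta> y (us @ v # u # vs)) y"
      by (rule wirt_cong[OF assms(2,3) _ d]) (rule alternating_swap[OF assms(4)])
    then show ?thesis by (simp add: dwirt_def wirt_minus d)
  qed
qed

text \<open>The standard coframe is constant, so differentiation acts on the coefficients alone;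
  these are frame evaluations of the family and hence differentiable.\<close>

lemma dwirt_Lam:
  assumes "diff_fam \<eta> y" "open U" "y \<in> U" "\<And>x. x \<in> U \<Longrightarrow> \<eta> x \<in> Lam std_coframe p q"
  shows "dwirt g \<eta> y \<in> Lam std_coframe p q"
proof -
  have de: "(\<lambda>x. frame_eval gs (\<zeta> x)) differentiable (at y)" if "diff_fam \<zeta> y" for gs and \<zeta> :: "'a cvec \<Rightarrow> 'a ext"
    using that
  proof (induction gs arbitrary: \<zeta>)
    case (Cons h gs) then show ?case by (auto intro: diff_fam_contr)
  qed (simp add: diff_fam_def)
  have "dwirt g \<eta> y vs = comb std_coframe p q (\<lambda>I J. wirt g (\<lambda>x. frame_eval (frame_idx J I) (\<eta> x)) y) vs" for vs
  proof -
    have "dwirt g \<eta> y vs = wirt g (\<lambda>x. comb std_coframe p q (\<lambda>I J. frame_eval (frame_idx J I) (\<eta> x)) vs) y"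
      unfolding dwirt_def
      by (rule wirt_cong[OF assms(2,3)]) (use Lam_frame_eval[OF assms(4)] assms(1) in \<open>auto simp: diff_fam_def dest: fun_cong\<close>)
    also have "\<dots> = comb std_coframe p q (\<lambda>I J. wirt g (\<lambda>x. frame_eval (frame_idx J I) (\<eta> x)) y) vs"
      unfolding comb_def by (simp add: wirt_sum wirt_mult de[OF assms(1)] differentiable_mult differentiable_sum)
    finally show ?thesis .
  qed
  then show ?thesis unfolding Lam_def by (auto simp: fun_eq_iff)
qed

section \<open>The exterior derivative of a substituted form\<close>

text \<open>The admissible error terms, of types (p+1,q) and (p+2,q-1), neither of which contributes
  to the (p,q+1)-part. The case split drops the second type when q = 0.\<close>

definition mod_type :: "'n::finite coframe \<Rightarrow> nat \<Rightarrow> nat \<Rightarrow> 'n ext \<Rightarrow> bool" where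
  "mod_type w p q R \<longleftrightarrow> (\<exists>R1 R2. R = (\<lambda>vs. R1 vs + R2 vs) \<and> has_type w (Suc p) q R1 \<and>
     (case q of 0 \<Rightarrow> R2 = (\<lambda>_. 0) | Suc q' \<Rightarrow> has_type w (Suc (Suc p)) q' R2))"

lemma mod_type_has_type: "has_type w (Suc p) q R \<Longrightarrow> mod_type w p q R"
  unfolding mod_type_def by (intro exI[of _ R] exI[of _ "\<lambda>_. 0"]) (auto intro: has_type_zero split: nat.split)

lemma mod_type_has_type': "has_type w (Suc (Suc p)) q R \<Longrightarrow> mod_type w p (Suc q) R"
  unfolding mod_type_def by (intro exI[of _ "\<lambda>_. 0"] exI[of _ R]) (auto intro: has_type_zero)

lemma mod_type_add: "mod_type w p q R \<Longrightarrow> mod_type w p q R' \<Longrightarrow> mod_type w p q (\<lambda>vs. R vs + R' vs)"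
  unfolding mod_type_def
proof (elim exE conjE)
  fix R1 R2 R1' R2'
  assume *: "R = (\<lambda>vs. R1 vs + R2 vs)" "R' = (\<lambda>vs. R1' vs + R2' vs)" "has_type w (Suc p) q R1" "has_type w (Suc p) q R1'"
    "case q of 0 \<Rightarrow> R2 = (\<lambda>_. 0) | Suc q' \<Rightarrow> has_type w (Suc (Suc p)) q' R2"
    "case q of 0 \<Rightarrow> R2' = (\<lambda>_. 0) | Suc q' \<Rightarrow> has_type w (Suc (Suc p)) q' R2'"
  show "\<exists>R1 R2. (\<lambda>vs. R vs + R' vs) = (\<lambda>vs. R1 vs + R2 vs) \<and> has_type w (Suc p) q R1 \<and>
     (case q of 0 \<Rightarrow> R2 = (\<lambda>_. 0) | Suc q' \<Rightarrow> has_type w (Suc (Suc p)) q' R2)"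
    by (rule exI[of _ "\<lambda>vs. R1 vs + R1' vs"], rule exI[of _ "\<lambda>vs. R2 vs + R2' vs"])
      (use * in \<open>auto intro: has_type_add split: nat.splits\<close>)
qed

lemma mod_type_scale: "mod_type w p q R \<Longrightarrow> mod_type w p q (\<lambda>vs. c * R vs)"
  unfolding mod_type_def
proof (elim exE conjE)
  fix R1 R2
  assume *: "R = (\<lambda>vs. R1 vs + R2 vs)" "has_type w (Suc p) q R1"
    "case q of 0 \<Rightarrow> R2 = (\<lambda>_. 0) | Suc q' \<Rightarrow> has_type w (Suc (Suc p)) q' R2"
  show "\<exists>R1 R2. (\<lambda>vs. c * R vs) = (\<lambda>vs. R1 vs + R2 vs) \<and> has_type w (Suc p) q R1 \<and>
     (case q of 0 \<Rightarrow> R2 = (\<lambda>_. 0) | Suc q' \<Rightarrow> has_type w (Suc (Suc p)) q' R2)"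
    by (rule exI[of _ "\<lambda>vs. c * R1 vs"], rule exI[of _ "\<lambda>vs. c * R2 vs"])
      (use * in \<open>auto intro: has_type_scale simp: distrib_left split: nat.splits\<close>)
qed

lemma mod_type_minus: "mod_type w p q R \<Longrightarrow> mod_type w p q (\<lambda>vs. - R vs)"
  using mod_type_scale[of w p q R "-1"] by simp

lemma mod_type_sum: "(\<And>i. i \<in> A \<Longrightarrow> mod_type w p q (f i)) \<Longrightarrow> mod_type w p q (\<lambda>vs. \<Sum>i\<in>A. f i vs)"
  by (induction A rule: infinite_finite_induct) (auto intro: mod_type_add mod_type_has_type has_type_zero)

text \<open>The coordinate expression of \<open>dbar s - L\<^sup>1\<^sup>,\<^sup>0 s\<close>.\<close>

definition twisted_dbar :: "('n::finite cvec \<Rightarrow> 'n cmat) \<Rightarrow> ('n cvec \<Rightarrow> 'n ext) \<Rightarrow> 'n cvec \<Rightarrow> 'n ext" where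
  "twisted_dbar \<phi> s y = (\<lambda>vs. (\<Sum>l\<in>UNIV. wedge (one_form (coord (True, l))) (dwirt (True, l) s y) vs)
     - (\<Sum>j\<in>UNIV. wedge (one_form (belt (\<phi> y) j)) (dwirt (False, j) s y) vs)
     + (\<Sum>k\<in>UNIV. wedge (one_form (coord (False, k))) (ins (\<chi> i l. wirt (False, k) (\<lambda>y. \<phi> y $ i $ l) y) (s y)) vs))"

text \<open>Exchanging the two summation indices changes the sign of the sum.\<close>

lemma wedge_symmetric_zero:
  fixes x :: "'i::finite \<Rightarrow> 'i \<Rightarrow> complex"
  assumes "\<And>m l. x m l = x l m"
  shows "(\<Sum>m\<in>UNIV. \<Sum>l\<in>UNIV. x m l * wedge (one_form (\<theta> m)) (wedge (one_form (\<theta> l)) \<beta>) vs) = (0::complex)" (is "?S = 0")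
proof -
  have "?S = (\<Sum>l\<in>UNIV. \<Sum>m\<in>UNIV. x m l * wedge (one_form (\<theta> m)) (wedge (one_form (\<theta> l)) \<beta>) vs)"
    by (rule sum.swap)
  also have "\<dots> = (\<Sum>l\<in>UNIV. \<Sum>m\<in>UNIV. - (x l m * wedge (one_form (\<theta> l)) (wedge (one_form (\<theta> m)) \<beta>) vs))"
  proof (intro sum.cong refl)
    fix l m
    show "x m l * wedge (one_form (\<theta> m)) (wedge (one_form (\<theta> l)) \<beta>) vs
      = - (x l m * wedge (one_form (\<theta> l)) (wedge (one_form (\<theta> m)) \<beta>) vs)"
      unfolding wedge_one_form_comm[of "\<theta> m" "\<theta> l"] assms[of m l] by simp
  qed
  also have "\<dots> = - ?S" by (simp add: sum_negf)
  finally show ?thesis by simp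
qed

text \<open>The product rule gives three groups: derivatives of the images of dz^i
  (\<open>D2\<close>), of the images of their conjugates (\<open>D3\<close>), and of s itself
  (\<open>Q\<close>). By integrability the differential of dz^i + \<phi>^i lies in the ideal
  generated by the forms a(False, k), and so does that of a(True, i), which differs from a constant
  form by a combination of these. Whatever is not part of the substituted
  \<open>twisted_dbar\<close> therefore carries an additional (1,0)-factor and falls under
  \<open>mod_type\<close>.\<close>

lemma ext_deriv_form_subst:
  fixes \<phi> N :: "'n::{finite,linorder} cvec \<Rightarrow> 'n cmat"
  assumes y: "open V" "y \<in> V"
    and sm: "smooth_fam V s" "\<And>x. x \<in> V \<Longrightarrow> s x \<in> Lam std_coframe p q"
      "\<And>i j. smooth_on V (\<lambda>y. \<phi> y $ i $ j)" "\<And>i j. smooth_on V (\<lambda>y. N y $ i $ j)"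
      "\<And>g v. smooth_on V (\<lambda>y. a y g v)"
    and aF: "\<And>x j v. x \<in> V \<Longrightarrow> a x (False, j) v = coord (False, j) v + belt (\<phi> x) j v"
    and aT: "\<And>x j v. x \<in> V \<Longrightarrow> coord (True, j) v = a x (True, j) v + (\<Sum>k\<in>UNIV. N x $ j $ k * a x (False, k) v)"
    and int: "\<And>i m l. wirt (True, m) (\<lambda>y. \<phi> y $ i $ l) y - (\<Sum>k\<in>UNIV. \<phi> y $ k $ m * wirt (False, k) (\<lambda>y. \<phi> y $ i $ l) y)
       = wirt (True, l) (\<lambda>y. \<phi> y $ i $ m) y - (\<Sum>k\<in>UNIV. \<phi> y $ k $ l * wirt (False, k) (\<lambda>y. \<phi> y $ i $ m) y)"
    and w: "\<And>j. \<exists>c. a y (False, j) = (\<lambda>v. \<Sum>k\<in>UNIV. c k * w k v)"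
      "\<And>j. \<exists>c. a y (True, j) = (\<lambda>v. \<Sum>k\<in>UNIV. c k * cnj (w k v))"
  shows "mod_type w p q (\<lambda>vs. ext_deriv (\<lambda>y. form_subst (a y) (s y)) y vs - form_subst (a y) (twisted_dbar \<phi> s y) vs)"
proof -
  have diff_fam: "diff_fam s y" "\<And>i j. (\<lambda>y. \<phi> y $ i $ j) differentiable (at y)" "\<And>i j. (\<lambda>y. N y $ i $ j) differentiable (at y)"
     "\<And>g v. (\<lambda>y. a y g v) differentiable (at y)"
    by (rule smooth_fam_diff_fam[OF sm(1) y(2)], (rule smooth_on_differentiable[OF _ y(2)], rule sm)+)
  define W where "W \<theta> \<beta> = wedge (one_form \<theta>) \<beta>" for \<theta> and \<beta> :: "'n ext"
  define ph where "ph g i l = wirt g (\<lambda>y. \<phi> y $ i $ l) y" for g i l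
  define a0 where "a0 = a y"
  define \<phi>0 where "\<phi>0 = \<phi> y"
  define N0 where "N0 = N y"
  have s0: "has_type std_coframe p q (s y)" using sm(2)[OF y(2)] by (simp add: Lam_iff_has_type)
  have alts: "alternating (s y)" using alternating_Lam[of "s y" "\<lambda>v. v"] sm(2)[OF y(2)] by (simp add: std_coframe_coframe_of linear_iff)
  have typb: "has_type std_coframe p' q' \<beta> \<Longrightarrow> has_type w p' q' (form_subst a0 \<beta>)" for p' q' \<beta>
    unfolding a0_def by (rule has_type_form_subst) (use w in auto)
  have aF0: "coord (False, j) v = a0 (False, j) v - (\<Sum>m\<in>UNIV. \<phi>0 $ j $ m * coord (True, m) v)" for j v
    using aF[OF y(2), of j v] by (simp add: a0_def \<phi>0_def belt_coord)
  have aT0: "coord (True, j) v = a0 (True, j) v + (\<Sum>k\<in>UNIV. N0 $ j $ k * a0 (False, k) v)" for j v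
    using aT[OF y(2), of j v] by (simp add: a0_def N0_def)
  have Wl: "W (\<lambda>v. \<theta> v + \<theta>' v) \<beta> vs = W \<theta> \<beta> vs + W \<theta>' \<beta> vs"
    "W (\<lambda>v. \<theta> v - \<theta>' v) \<beta> vs = W \<theta> \<beta> vs - W \<theta>' \<beta> vs"
    "W (\<lambda>v. c * \<theta> v) \<beta> vs = c * W \<theta> \<beta> vs" "W (\<lambda>v. - \<theta> v) \<beta> vs = - W \<theta> \<beta> vs"
    "W (\<lambda>v. \<Sum>i\<in>I. f i v) \<beta> vs = (\<Sum>i\<in>I. W (f i) \<beta> vs)"
    "W \<theta> (\<lambda>vs. \<beta> vs + \<beta>' vs) vs = W \<theta> \<beta> vs + W \<theta> \<beta>' vs"
    "W \<theta> (\<lambda>vs. \<beta> vs - \<beta>' vs) vs = W \<theta> \<beta> vs - W \<theta> \<beta>' vs"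
    "W \<theta> (\<lambda>vs. - \<beta> vs) vs = - W \<theta> \<beta> vs"
    "W \<theta> (\<lambda>vs. c * \<beta> vs) vs = c * W \<theta> \<beta> vs"
    "W \<theta> (\<lambda>vs. \<Sum>i\<in>I. h i vs) vs = (\<Sum>i\<in>I. W \<theta> (h i) vs)"
    for \<theta> \<theta>' \<beta> \<beta>' vs c and f :: "'i \<Rightarrow> _" and h :: "'i \<Rightarrow> _" and I :: "'i set"
    by (simp_all add: W_def one_form_linear one_form_sum wedge_linear)
  have Wl': "W (\<lambda>v. \<Sum>i\<in>I. f i v) \<beta> vs = (\<Sum>i\<in>I. W (f i) \<beta> vs)"
    for \<beta> vs and f :: "'n \<Rightarrow> _" and I :: "'n set"
    by (simp_all add: W_def one_form_linear one_form_sum wedge_linear)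
  have Wl'': "W \<theta> (\<lambda>vs. \<Sum>i\<in>I. h i vs) vs = (\<Sum>i\<in>I. W \<theta> (h i) vs)"
    for \<theta> vs and h :: "'n \<Rightarrow> _" and I :: "'n set"
    by (simp_all add: W_def one_form_linear one_form_sum wedge_linear)
  have tF: "has_type w (Suc p') q' (W (a0 (False, k)) \<beta>)" if "has_type w p' q' \<beta>" for k p' q' \<beta>
    using w(1)[of k] has_type_wedge_span[OF that] unfolding W_def a0_def by blast
  have tT: "has_type w p' (Suc q') (W (a0 (True, k)) \<beta>)" if "has_type w p' q' \<beta>" for k p' q' \<beta>
    using w(2)[of k] has_type_wedge_span_bar[OF that] unfolding W_def a0_def by blast
  have gT: "W (coord (True, j)) \<beta> = (\<lambda>vs. W (a0 (True, j)) \<beta> vs + (\<Sum>k\<in>UNIV. N0 $ j $ k * W (a0 (False, k)) \<beta> vs))" for j \<beta>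
  proof -
    have e: "coord (True, j) = (\<lambda>v. a0 (True, j) v + (\<Sum>k\<in>UNIV. N0 $ j $ k * a0 (False, k) v))"
      using aT0 by blast
    show ?thesis by (rule ext, subst e) (simp only: Wl Wl')
  qed
  have gF: "W (coord (False, j)) \<beta> = (\<lambda>vs. W (a0 (False, j)) \<beta> vs - (\<Sum>m\<in>UNIV. \<phi>0 $ j $ m * W (coord (True, m)) \<beta> vs))" for j \<beta>
  proof -
    have e: "coord (False, j) = (\<lambda>v. a0 (False, j) v - (\<Sum>m\<in>UNIV. \<phi>0 $ j $ m * coord (True, m) v))"
      using aF0 by blast
    show ?thesis by (rule ext, subst e) (simp only: Wl Wl')
  qed
  define X where "X i = form_subst a0 (contr (False, i) (s y))" for i
  define Y where "Y i = form_subst a0 (contr (True, i) (s y))" for i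
  define Q where "Q g = form_subst a0 (dwirt g s y)" for g
  have Qty: "has_type w p q (Q g)" for g
    unfolding Q_def by (intro typb, unfold Lam_iff_has_type[symmetric], rule dwirt_Lam[OF diff_fam(1) y sm(2)])
  have Xty: "X i = (\<lambda>_. 0) \<or> (\<exists>p'. p = Suc p' \<and> has_type w p' q (X i))" for i
    using has_type_contr[OF s0, of i] typb unfolding X_def by (cases p) (auto simp: form_subst_zero[abs_def])
  have Yty: "Y i = (\<lambda>_. 0) \<or> (\<exists>q'. q = Suc q' \<and> has_type w p q' (Y i))" for i
    using has_type_contr_bar[OF s0, of i] typb unfolding Y_def by (cases q) (auto simp: form_subst_zero[abs_def])
  have W0: "W \<theta> (\<lambda>_. 0) = (\<lambda>_. 0)" for \<theta> by (simp add: W_def fun_eq_iff)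
  have wdF: "wirt g (\<lambda>y. a y (False, i) v) y = (\<Sum>l\<in>UNIV. ph g i l * coord (True, l) v)" for g i v
  proof -
    have d1: "(\<lambda>y. \<phi> y $ i $ l * c) differentiable (at y)" for l c
      by (intro differentiable_mult diff_fam differentiable_const)
    have d2: "(\<lambda>y. \<Sum>l\<in>UNIV. \<phi> y $ i $ l * coord (True, l) v) differentiable (at y)"
      by (intro differentiable_sum ballI d1 finite)
    have "wirt g (\<lambda>y. a y (False, i) v) y = wirt g (\<lambda>y. coord (False, i) v + (\<Sum>l\<in>UNIV. \<phi> y $ i $ l * coord (True, l) v)) y"
      by (rule wirt_cong[OF y _ diff_fam(4)]) (simp add: aF belt_coord)
    also have "\<dots> = (\<Sum>l\<in>UNIV. ph g i l * coord (True, l) v)"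
      by (simp add: wirt_add[OF differentiable_const d2] wirt_sum[OF d1] wirt_mult diff_fam ph_def)
    finally show ?thesis .
  qed
  have wdT: "wirt g (\<lambda>y. a y (True, i) v) y = - (\<Sum>k\<in>UNIV. N0 $ i $ k * wirt g (\<lambda>y. a y (False, k) v) y
      + wirt g (\<lambda>y. N y $ i $ k) y * a0 (False, k) v)" for g i v
  proof -
    have d1: "(\<lambda>y. N y $ i $ k * a y (False, k) v) differentiable (at y)" for k
      by (intro differentiable_mult diff_fam)
    have d2: "(\<lambda>y. \<Sum>k\<in>UNIV. N y $ i $ k * a y (False, k) v) differentiable (at y)"
      by (intro differentiable_sum ballI d1 finite)
    have "wirt g (\<lambda>y. a y (True, i) v) y = wirt g (\<lambda>y. coord (True, i) v - (\<Sum>k\<in>UNIV. N y $ i $ k * a y (False, k) v)) y"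
      by (rule wirt_cong[OF y _ diff_fam(4)]) (simp add: aT)
    also have "\<dots> = - (\<Sum>k\<in>UNIV. N0 $ i $ k * wirt g (\<lambda>y. a y (False, k) v) y + wirt g (\<lambda>y. N y $ i $ k) y * a0 (False, k) v)"
      by (simp add: wirt_diff[OF differentiable_const d2] wirt_sum[OF d1] wirt_mult diff_fam a0_def N0_def)
    finally show ?thesis .
  qed
  \<comment> \<open>The differential of dz^i + \<phi>^i, wedged with \<beta>; \<open>D3\<close> is
    its analogue for the image of the conjugate of dz^i.\<close>
  define D2 where "D2 i \<beta> vs = (\<Sum>g\<in>UNIV. W (coord g) (W (\<lambda>v. wirt g (\<lambda>y. a y (False, i) v) y) \<beta>) vs)" for i \<beta> vs
  have D2: "D2 i \<beta> vs = (\<Sum>k\<in>UNIV. \<Sum>l\<in>UNIV. ph (False, k) i l * W (a0 (False, k)) (W (coord (True, l)) \<beta>) vs)" for i \<beta> vs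
  proof -
    let ?G = "\<lambda>m l. W (coord (True, m)) (W (coord (True, l)) \<beta>) vs"
    have "D2 i \<beta> vs = (\<Sum>g\<in>UNIV. \<Sum>l\<in>UNIV. ph g i l * W (coord g) (W (coord (True, l)) \<beta>) vs)"
      unfolding D2_def wdF by (simp add: Wl[abs_def] Wl'[abs_def] Wl'' Wl)
    also have "\<dots> = (\<Sum>k\<in>UNIV. \<Sum>l\<in>UNIV. ph (False, k) i l * W (coord (False, k)) (W (coord (True, l)) \<beta>) vs)
       + (\<Sum>m\<in>UNIV. \<Sum>l\<in>UNIV. ph (True, m) i l * ?G m l)"
      by (simp add: sum_bool_prod)
    also have "(\<Sum>k\<in>UNIV. \<Sum>l\<in>UNIV. ph (False, k) i l * W (coord (False, k)) (W (coord (True, l)) \<beta>) vs)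
      = (\<Sum>k\<in>UNIV. \<Sum>l\<in>UNIV. ph (False, k) i l * W (a0 (False, k)) (W (coord (True, l)) \<beta>) vs)
       - (\<Sum>k\<in>UNIV. \<Sum>l\<in>UNIV. \<Sum>m\<in>UNIV. ph (False, k) i l * (\<phi>0 $ k $ m * ?G m l))"
      by (simp add: gF right_diff_distrib sum_subtractf sum_distrib_left)
    also have "(\<Sum>k\<in>UNIV. \<Sum>l\<in>UNIV. \<Sum>m\<in>UNIV. ph (False, k) i l * (\<phi>0 $ k $ m * ?G m l))
      = (\<Sum>m\<in>UNIV. \<Sum>l\<in>UNIV. (\<Sum>k\<in>UNIV. \<phi>0 $ k $ m * ph (False, k) i l) * ?G m l)"
    proof -
      have "(\<Sum>k\<in>UNIV. \<Sum>l\<in>UNIV. \<Sum>m\<in>UNIV. ph (False, k) i l * (\<phi>0 $ k $ m * ?G m l))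
        = (\<Sum>k\<in>UNIV. \<Sum>m\<in>UNIV. \<Sum>l\<in>UNIV. ph (False, k) i l * (\<phi>0 $ k $ m * ?G m l))"
        by (rule sum.cong[OF refl]) (rule sum.swap)
      also have "\<dots> = (\<Sum>m\<in>UNIV. \<Sum>k\<in>UNIV. \<Sum>l\<in>UNIV. ph (False, k) i l * (\<phi>0 $ k $ m * ?G m l))"
        by (rule sum.swap)
      also have "\<dots> = (\<Sum>m\<in>UNIV. \<Sum>l\<in>UNIV. \<Sum>k\<in>UNIV. ph (False, k) i l * (\<phi>0 $ k $ m * ?G m l))"
        by (rule sum.cong[OF refl]) (rule sum.swap)
      finally show ?thesis by (simp add: sum_distrib_left sum_distrib_right mult_ac)
    qed
    finally have "D2 i \<beta> vs = (\<Sum>k\<in>UNIV. \<Sum>l\<in>UNIV. ph (False, k) i l * W (a0 (False, k)) (W (coord (True, l)) \<beta>) vs)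
      + (\<Sum>m\<in>UNIV. \<Sum>l\<in>UNIV. (ph (True, m) i l - (\<Sum>k\<in>UNIV. \<phi>0 $ k $ m * ph (False, k) i l)) * ?G m l)"
      by (simp add: left_diff_distrib sum_subtractf)
    \<comment> \<open>Writing dz^k as a(False, k) - \<phi>^k has left terms with two conjugate
      factors. Integrability says that their coefficients are symmetric in l and m.\<close>
    moreover have "(\<Sum>m\<in>UNIV. \<Sum>l\<in>UNIV. (ph (True, m) i l - (\<Sum>k\<in>UNIV. \<phi>0 $ k $ m * ph (False, k) i l)) * ?G m l) = 0"
      unfolding W_def by (rule wedge_symmetric_zero) (use int[of _ i] in \<open>simp add: ph_def \<phi>0_def\<close>)
    ultimately show ?thesis by simp
  qed
  define D3 where "D3 i \<beta> vs = (\<Sum>g\<in>UNIV. W (coord g) (W (\<lambda>v. wirt g (\<lambda>y. a y (True, i) v) y) \<beta>) vs)" for i \<beta> vs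
  \<comment> \<open>Since a(True, i) is a constant form minus N times the forms a(False, k), each
    term contains some a(False, k), either through \<open>D2\<close> or undifferentiated.\<close>
  have D3: "D3 i \<beta> vs = - ((\<Sum>k\<in>UNIV. N0 $ i $ k * D2 k \<beta> vs)
      + (\<Sum>g\<in>UNIV. \<Sum>k\<in>UNIV. - wirt g (\<lambda>y. N y $ i $ k) y * W (a0 (False, k)) (W (coord g) \<beta>) vs))" for i \<beta> vs
  proof -
    have sw: "W (coord g) (W (a0 (False, k)) \<beta>) vs = - W (a0 (False, k)) (W (coord g) \<beta>) vs" for g k
      unfolding W_def by (rule wedge_one_form_comm)
    have "D3 i \<beta> vs = - ((\<Sum>g\<in>UNIV. \<Sum>k\<in>UNIV. N0 $ i $ k * W (coord g) (W (\<lambda>v. wirt g (\<lambda>y. a y (False, k) v) y) \<beta>) vs)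
      + (\<Sum>g\<in>UNIV. \<Sum>k\<in>UNIV. wirt g (\<lambda>y. N y $ i $ k) y * W (coord g) (W (a0 (False, k)) \<beta>) vs))"
      unfolding D3_def wdT by (simp add: Wl[abs_def] Wl'[abs_def] Wl'' Wl sum.distrib sum_negf sum_subtractf)
    also have "(\<Sum>g\<in>UNIV. \<Sum>k\<in>UNIV. N0 $ i $ k * W (coord g) (W (\<lambda>v. wirt g (\<lambda>y. a y (False, k) v) y) \<beta>) vs)
      = (\<Sum>k\<in>UNIV. N0 $ i $ k * D2 k \<beta> vs)"
      unfolding D2_def sum_distrib_left by (rule sum.swap)
    finally show ?thesis by (simp add: sw)
  qed
  have E1: "ext_deriv (\<lambda>y. form_subst (a y) (s y)) y vs
      = (\<Sum>i\<in>UNIV. D2 i (X i) vs) + (\<Sum>i\<in>UNIV. D3 i (Y i) vs) + (\<Sum>g\<in>UNIV. W (coord g) (Q g) vs)" for vs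
  proof -
    have dp: "dwirt g (\<lambda>y. form_subst (a y) (s y)) y = (\<lambda>vs. (\<Sum>h\<in>UNIV. W (\<lambda>v. wirt g (\<lambda>y. a y h v) y) (form_subst a0 (contr h (s y))) vs) + Q g vs)" for g
      unfolding W_def a0_def Q_def by (rule ext) (rule dwirt_form_subst[OF diff_fam(4,1) alts])
    have "ext_deriv (\<lambda>y. form_subst (a y) (s y)) y vs = (\<Sum>g\<in>UNIV. W (coord g) (dwirt g (\<lambda>y. form_subst (a y) (s y)) y) vs)"
      unfolding W_def by (subst ext_deriv_eq) (auto intro: diff_fam_form_subst diff_fam)
    also have "\<dots> = (\<Sum>g\<in>UNIV. \<Sum>h\<in>UNIV. W (coord g) (W (\<lambda>v. wirt g (\<lambda>y. a y h v) y) (form_subst a0 (contr h (s y)))) vs)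
        + (\<Sum>g\<in>UNIV. W (coord g) (Q g) vs)"
      unfolding dp by (simp add: Wl sum.distrib)
    also have "(\<Sum>g\<in>UNIV. \<Sum>h\<in>UNIV. W (coord g) (W (\<lambda>v. wirt g (\<lambda>y. a y h v) y) (form_subst a0 (contr h (s y)))) vs)
       = (\<Sum>h\<in>UNIV. \<Sum>g\<in>UNIV. W (coord g) (W (\<lambda>v. wirt g (\<lambda>y. a y h v) y) (form_subst a0 (contr h (s y)))) vs)"
      by (rule sum.swap)
    finally show ?thesis unfolding D2_def D3_def X_def Y_def by (simp only: sum_bool_prod[of "\<lambda>h. \<Sum>g\<in>UNIV. _ h g"])
  qed
  have pbW: "form_subst a0 (wedge (one_form \<theta>) \<beta>) vs = W (\<lambda>v. \<Sum>g\<in>UNIV. ccoef g \<theta> * a0 g v) (form_subst a0 \<beta>) vs" for \<theta> \<beta> vs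
    by (simp add: form_subst_wedge' form_subst_one_form W_def)
  have pbg: "form_subst a0 (wedge (one_form (coord g)) \<beta>) vs = W (a0 g) (form_subst a0 \<beta>) vs" for g \<beta> vs
    by (simp add: form_subst_wedge' form_subst_coord W_def)
  have pbb: "form_subst a0 (wedge (one_form (belt f j)) \<beta>) vs = (\<Sum>l\<in>UNIV. f $ j $ l * W (a0 (True, l)) (form_subst a0 \<beta>) vs)" for f j \<beta> vs
    unfolding pbW sum_bool_prod by (simp add: Wl Wl')
  have E2: "form_subst a0 (twisted_dbar \<phi> s y) vs = (\<Sum>l\<in>UNIV. W (a0 (True, l)) (Q (True, l)) vs)
     - (\<Sum>j\<in>UNIV. \<Sum>l\<in>UNIV. \<phi>0 $ j $ l * W (a0 (True, l)) (Q (False, j)) vs)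
     + (\<Sum>k\<in>UNIV. \<Sum>i\<in>UNIV. \<Sum>l\<in>UNIV. ph (False, k) i l * W (a0 (False, k)) (W (a0 (True, l)) (X i)) vs)" for vs
  proof -
    have i: "form_subst a0 (ins (\<chi> i l. wirt (False, k) (\<lambda>y. \<phi> y $ i $ l) y) (s y))
        = (\<lambda>vs. \<Sum>i\<in>UNIV. \<Sum>l\<in>UNIV. ph (False, k) i l * W (a0 (True, l)) (X i) vs)" for k
      by (simp add: fun_eq_iff ins_eq form_subst_linear pbb ph_def X_def)
    show ?thesis unfolding twisted_dbar_def
      by (simp add: form_subst_linear pbg pbb Wl Wl'' i Q_def[symmetric] \<phi>0_def[symmetric])
  qed
  \<comment> \<open>What remains when a conjugate coordinate form is replaced by a(True, l) plus a
    combination of the a(False, m): terms with one more (1,0)-factor.\<close>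
  define R1 where "R1 vs = (\<Sum>i\<in>UNIV. \<Sum>k\<in>UNIV. \<Sum>l\<in>UNIV. ph (False, k) i l *
     (\<Sum>m\<in>UNIV. N0 $ l $ m * W (a0 (False, k)) (W (a0 (False, m)) (X i)) vs))" for vs
  define R3 where "R3 vs = (\<Sum>l\<in>UNIV. \<Sum>k\<in>UNIV. N0 $ l $ k * W (a0 (False, k)) (Q (True, l)) vs)
     + (\<Sum>j\<in>UNIV. W (a0 (False, j)) (Q (False, j)) vs
         - (\<Sum>m\<in>UNIV. \<phi>0 $ j $ m * (\<Sum>k\<in>UNIV. N0 $ m $ k * W (a0 (False, k)) (Q (False, j)) vs)))" for vs
  have D2X: "(\<Sum>i\<in>UNIV. D2 i (X i) vs) = (\<Sum>k\<in>UNIV. \<Sum>i\<in>UNIV. \<Sum>l\<in>UNIV. ph (False, k) i l * W (a0 (False, k)) (W (a0 (True, l)) (X i)) vs) + R1 vs" for vs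
  proof -
    have "(\<Sum>i\<in>UNIV. D2 i (X i) vs) = (\<Sum>i\<in>UNIV. \<Sum>k\<in>UNIV. \<Sum>l\<in>UNIV. ph (False, k) i l * W (a0 (False, k)) (W (a0 (True, l)) (X i)) vs) + R1 vs"
      unfolding D2 R1_def gT by (simp add: Wl Wl'' distrib_left sum.distrib)
    also have "(\<Sum>i\<in>UNIV. \<Sum>k\<in>UNIV. \<Sum>l\<in>UNIV. ph (False, k) i l * W (a0 (False, k)) (W (a0 (True, l)) (X i)) vs)
        = (\<Sum>k\<in>UNIV. \<Sum>i\<in>UNIV. \<Sum>l\<in>UNIV. ph (False, k) i l * W (a0 (False, k)) (W (a0 (True, l)) (X i)) vs)"
      by (rule sum.swap)
    finally show ?thesis .
  qed
  have QQ: "(\<Sum>g\<in>UNIV. W (coord g) (Q g) vs) = (\<Sum>l\<in>UNIV. W (a0 (True, l)) (Q (True, l)) vs)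
     - (\<Sum>j\<in>UNIV. \<Sum>l\<in>UNIV. \<phi>0 $ j $ l * W (a0 (True, l)) (Q (False, j)) vs) + R3 vs" for vs
    unfolding sum_bool_prod gF R3_def unfolding gT
    by (simp add: sum.distrib sum_subtractf distrib_left)
  have main: "(\<lambda>vs. ext_deriv (\<lambda>y. form_subst (a y) (s y)) y vs - form_subst (a y) (twisted_dbar \<phi> s y) vs)
      = (\<lambda>vs. R1 vs + (\<Sum>i\<in>UNIV. D3 i (Y i) vs) + R3 vs)"
    unfolding E1 a0_def[symmetric] E2 D2X QQ by (simp add: algebra_simps)
  have m1: "mod_type w p q R1"
    unfolding R1_def[abs_def]
  proof (intro mod_type_sum mod_type_scale)
    fix i k l m
    show "mod_type w p q (W (a0 (False, k)) (W (a0 (False, m)) (X i)))"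
      using Xty[of i] by (auto simp: W0 intro!: mod_type_has_type tF has_type_zero)
  qed
  have m3: "mod_type w p q R3"
    unfolding R3_def[abs_def] diff_conv_add_uminus
    by (intro mod_type_add mod_type_sum mod_type_minus mod_type_scale mod_type_has_type tF Qty)
  \<comment> \<open>Y i has type (p, q-1), so two unbarred factors lead to type (p+2, q-1) and a
    mixed pair to type (p+1, q).\<close>
  have FY: "mod_type w p q (W (a0 (False, k)) (W (a0 g) (Y i)))" for g k i
  proof (cases "Y i = (\<lambda>_. 0)")
    case True then show ?thesis by (auto simp: W0 intro: mod_type_has_type has_type_zero)
  next
    case False
    then obtain q' where q': "q = Suc q'" "has_type w p q' (Y i)" using Yty[of i] by blast
    show ?thesis
    proof (cases g)
      case (Pair b j)
      show ?thesis
      proof (cases b)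
        case True
        show ?thesis using tF[OF tT[OF q'(2)]] Pair True q'(1) by (auto intro: mod_type_has_type)
      next
        case b: False
        show ?thesis using tF[OF tF[OF q'(2)]] Pair b q'(1) by (auto intro: mod_type_has_type')
      qed
    qed
  qed
  have FgT: "mod_type w p q (W (a0 (False, k)) (W (coord (True, j)) (Y i)))" for j k i
  proof -
    have e: "W (a0 (False, k)) (W (coord (True, j)) (Y i)) = (\<lambda>vs. W (a0 (False, k)) (W (a0 (True, j)) (Y i)) vs
        + (\<Sum>m\<in>UNIV. N0 $ j $ m * W (a0 (False, k)) (W (a0 (False, m)) (Y i)) vs))"
      by (rule ext) (simp only: gT Wl Wl'')
    show ?thesis unfolding e by (intro mod_type_add mod_type_sum mod_type_scale FY)
  qed
  have Fg: "mod_type w p q (W (a0 (False, k)) (W (coord g) (Y i)))" for g k i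
  proof (cases g)
    case (Pair b j)
    show ?thesis
    proof (cases b)
      case True then show ?thesis using FgT Pair by simp
    next
      case False
      have e: "W (a0 (False, k)) (W (coord (False, j)) (Y i)) = (\<lambda>vs. W (a0 (False, k)) (W (a0 (False, j)) (Y i)) vs
         + - (\<Sum>m\<in>UNIV. \<phi>0 $ j $ m * W (a0 (False, k)) (W (coord (True, m)) (Y i)) vs))"
        by (rule ext) (simp only: gF Wl Wl'' diff_conv_add_uminus)
      have "mod_type w p q (W (a0 (False, k)) (W (coord (False, j)) (Y i)))"
        unfolding e by (intro mod_type_add mod_type_minus mod_type_sum mod_type_scale FgT FY)
      then show ?thesis using Pair False by simp
    qed
  qed
  have m2: "mod_type w p q (\<lambda>vs. \<Sum>i\<in>UNIV. D3 i (Y i) vs)"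
    unfolding D3[abs_def] D2 by (intro mod_type_sum mod_type_minus mod_type_add mod_type_scale FgT Fg)
  show ?thesis unfolding main by (intro mod_type_add m1 m2 m3)
qed

lemma matrix_kernel:
  fixes M :: "complex ^ 'n ^ 'n"
  assumes "invertible M" "M *v u = 0" shows "u = 0"
proof -
  have "u = matrix_inv M *v (M *v u)"
    by (simp add: matrix_vector_mul_assoc matrix_inv_works assms(1))
  then show ?thesis using assms(2) by simp
qed

text \<open>Hypothesis B is the Beltrami equation for each coordinate z^k of X_t. Applying D m, the
  m-th conjugate derivative minus the sum of \<phi>^j_m times the j-th unbarred one, and
  antisymmetrizing in l and m, all second derivatives of z^k cancel. What is left is the matrix A
  applied to D_m \<phi>_l - D_l \<phi>_m, and A is invertible. In invariant form this is the
  equation dbar \<phi> = [\<phi>, \<phi>]/2.\<close>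

lemma beltrami_integrable:
  fixes z :: "'n::finite cvec \<Rightarrow> 'n cvec" and \<phi> :: "'n cvec \<Rightarrow> 'n cmat"
  assumes y: "open V" "y \<in> V" and z: "smooth_on V z"
    and \<phi>: "\<And>i j. smooth_on V (\<lambda>y. \<phi> y $ i $ j)"
    and A: "invertible (\<chi> k j. wirt (False, j) (\<lambda>y. z y $ k) y)"
    and B: "\<And>x k l. x \<in> V \<Longrightarrow> wirt (True, l) (\<lambda>y. z y $ k) x = (\<Sum>i\<in>UNIV. wirt (False, i) (\<lambda>y. z y $ k) x * \<phi> x $ i $ l)"
  shows "wirt (True, m) (\<lambda>y. \<phi> y $ i $ l) y - (\<Sum>k\<in>UNIV. \<phi> y $ k $ m * wirt (False, k) (\<lambda>y. \<phi> y $ i $ l) y)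
       = wirt (True, l) (\<lambda>y. \<phi> y $ i $ m) y - (\<Sum>k\<in>UNIV. \<phi> y $ k $ l * wirt (False, k) (\<lambda>y. \<phi> y $ i $ m) y)"
proof -
  define zk where "zk k x = z x $ k" for k x
  have zk: "smooth_on V (zk k)" for k unfolding zk_def[abs_def] by (rule smooth_on_component[OF y(1) z])
  define D where "D m f = wirt (True, m) f y - (\<Sum>j\<in>UNIV. \<phi> y $ j $ m * wirt (False, j) f y)" for m f
  define z2 where "z2 k g h = wirt g (wirt h (zk k)) y" for k g h
  have z2: "z2 k g h = z2 k h g" for k g h unfolding z2_def by (rule wirt_commute[OF y(1) zk y(2)])
  have dw: "wirt g (zk k) differentiable (at y)" for g k
    by (rule smooth_on_differentiable[OF smooth_on_wirt[OF y(1) zk] y(2)])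
  have d\<phi>: "(\<lambda>y. \<phi> y $ i $ j) differentiable (at y)" for i j
    by (rule smooth_on_differentiable[OF \<phi> y(2)])
  have B1: "z2 k g (True, l) = (\<Sum>i\<in>UNIV. wirt (False, i) (zk k) y * wirt g (\<lambda>y. \<phi> y $ i $ l) y + z2 k g (False, i) * \<phi> y $ i $ l)" for k g l
  proof -
    have d1: "(\<lambda>x. wirt (False, i) (zk k) x * \<phi> x $ i $ l) differentiable (at y)" for i
      by (intro differentiable_mult dw d\<phi>)
    have "z2 k g (True, l) = wirt g (\<lambda>x. \<Sum>i\<in>UNIV. wirt (False, i) (zk k) x * \<phi> x $ i $ l) y"
      unfolding z2_def by (rule wirt_cong[OF y _ dw]) (use B in \<open>simp add: zk_def[abs_def]\<close>)
    then show ?thesis by (simp add: wirt_sum[OF d1] wirt_mult dw d\<phi> z2_def)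
  qed
  define A0 where "A0 k i = wirt (False, i) (zk k) y" for k i
  have DB: "(\<Sum>i\<in>UNIV. A0 k i * D m (\<lambda>y. \<phi> y $ i $ l)) = z2 k (True, m) (True, l) - (\<Sum>j\<in>UNIV. \<phi> y $ j $ m * z2 k (False, j) (True, l))
     - (\<Sum>i\<in>UNIV. z2 k (True, m) (False, i) * \<phi> y $ i $ l) + (\<Sum>i\<in>UNIV. \<Sum>j\<in>UNIV. \<phi> y $ j $ m * z2 k (False, j) (False, i) * \<phi> y $ i $ l)" for k m l
  proof -
    have "(\<Sum>j\<in>UNIV. \<phi> y $ j $ m * z2 k (False, j) (True, l)) = (\<Sum>j\<in>UNIV. \<Sum>i\<in>UNIV. \<phi> y $ j $ m * (A0 k i * wirt (False, j) (\<lambda>y. \<phi> y $ i $ l) y))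
       + (\<Sum>j\<in>UNIV. \<Sum>i\<in>UNIV. \<phi> y $ j $ m * z2 k (False, j) (False, i) * \<phi> y $ i $ l)"
      unfolding B1 A0_def by (simp add: sum.distrib sum_distrib_left distrib_left mult.assoc)
    moreover have "(\<Sum>j\<in>UNIV. \<Sum>i\<in>UNIV. \<phi> y $ j $ m * z2 k (False, j) (False, i) * \<phi> y $ i $ l)
        = (\<Sum>i\<in>UNIV. \<Sum>j\<in>UNIV. \<phi> y $ j $ m * z2 k (False, j) (False, i) * \<phi> y $ i $ l)" by (rule sum.swap)
    moreover have "(\<Sum>j\<in>UNIV. \<Sum>i\<in>UNIV. \<phi> y $ j $ m * (A0 k i * wirt (False, j) (\<lambda>y. \<phi> y $ i $ l) y))
        = (\<Sum>i\<in>UNIV. \<Sum>j\<in>UNIV. \<phi> y $ j $ m * (A0 k i * wirt (False, j) (\<lambda>y. \<phi> y $ i $ l) y))" by (rule sum.swap)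
    moreover have "z2 k (True, m) (True, l) = (\<Sum>i\<in>UNIV. A0 k i * wirt (True, m) (\<lambda>y. \<phi> y $ i $ l) y) + (\<Sum>i\<in>UNIV. z2 k (True, m) (False, i) * \<phi> y $ i $ l)"
      unfolding B1 A0_def by (simp add: sum.distrib)
    moreover have "(\<Sum>i\<in>UNIV. A0 k i * D m (\<lambda>y. \<phi> y $ i $ l)) = (\<Sum>i\<in>UNIV. A0 k i * wirt (True, m) (\<lambda>y. \<phi> y $ i $ l) y)
       - (\<Sum>i\<in>UNIV. \<Sum>j\<in>UNIV. \<phi> y $ j $ m * (A0 k i * wirt (False, j) (\<lambda>y. \<phi> y $ i $ l) y))"
      unfolding D_def by (simp add: right_diff_distrib sum_subtractf sum_distrib_left mult_ac)
    ultimately show ?thesis by simp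
  qed
  have "(\<Sum>i\<in>UNIV. A0 k i * (D m (\<lambda>y. \<phi> y $ i $ l) - D l (\<lambda>y. \<phi> y $ i $ m))) = 0" for k
  proof -
    have 1: "(\<Sum>i\<in>UNIV. \<Sum>j\<in>UNIV. \<phi> y $ j $ m * z2 k (False, j) (False, i) * \<phi> y $ i $ l)
       = (\<Sum>i\<in>UNIV. \<Sum>j\<in>UNIV. \<phi> y $ j $ l * z2 k (False, j) (False, i) * \<phi> y $ i $ m)"
      by (subst sum.swap) (simp add: z2[of k "(False, i)" "(False, j)" for i j] mult_ac)
    have 2: "(\<Sum>j\<in>UNIV. \<phi> y $ j $ m * z2 k (False, j) (True, l)) = (\<Sum>i\<in>UNIV. z2 k (True, l) (False, i) * \<phi> y $ i $ m)" for m l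
      by (simp add: z2[of k "(False, i)" "(True, l)" for i] mult_ac)
    show ?thesis
      unfolding right_diff_distrib sum_subtractf DB using 1 2[of m l] 2[of l m] z2[of k "(True, m)" "(True, l)"] by simp
  qed
  then have "(\<chi> k j. wirt (False, j) (\<lambda>y. z y $ k) y) *v (\<chi> i. D m (\<lambda>y. \<phi> y $ i $ l) - D l (\<lambda>y. \<phi> y $ i $ m)) = 0"
    by (simp add: vec_eq_iff matrix_vector_nth A0_def zk_def[abs_def])
  then have "(\<chi> i. D m (\<lambda>y. \<phi> y $ i $ l) - D l (\<lambda>y. \<phi> y $ i $ m)) = 0"
    by (rule matrix_kernel[OF A])
  then have "D m (\<lambda>y. \<phi> y $ i $ l) = D l (\<lambda>y. \<phi> y $ i $ m)" by (simp add: vec_eq_iff)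
  then show ?thesis by (simp add: D_def)
qed

section \<open>Real linear maps and their types\<close>

definition cnjv :: "complex ^ 'n \<Rightarrow> complex ^ 'n" where
  "cnjv v = (\<chi> j. cnj (v $ j))"

lemma cnjv_matrix: "cnjv (M *v v) = (\<chi> i j. cnj (M $ i $ j)) *v cnjv v"
  by (simp add: cnjv_def vec_eq_iff matrix_vector_nth)

lemma linear_split: "linear L \<Longrightarrow> L v = jac (coframe_of L) *v v + jacbar (coframe_of L) *v cnjv v"
proof -
  assume L: "linear L"
  have "linear (\<lambda>v. L v $ k)" for k using L by (auto simp: linear_iff)
  from ccoef_expand[OF this, of v] show ?thesis
    by (simp add: vec_eq_iff sum_bool_prod jac_def jacbar_def matrix_vector_nth coframe_of_def ccoef_def coord_def cnjv_def)
qed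

lemma jac_split:
  assumes "\<And>v. L v = M *v v + N *v cnjv v"
  shows "jac (coframe_of L) = M" "jacbar (coframe_of L) = N"
proof -
  have e: "coframe_of L k = (\<lambda>v. \<Sum>g\<in>UNIV. (if fst g then N $ k $ snd g else M $ k $ snd g) * coord g v)" for k
    by (rule ext) (simp add: coframe_of_def assms matrix_vector_nth cnjv_def sum_bool_prod coord_def)
  have "ccoef g (coframe_of L k) = (if fst g then N $ k $ snd g else M $ k $ snd g)" for g k
    unfolding e by (simp add: ccoef_sum ccoef_linear mult_if_01)
  from this[of "(False, _)"] this[of "(True, _)"]
  show "jac (coframe_of L) = M" "jacbar (coframe_of L) = N"
    by (simp_all add: jac_def jacbar_def vec_eq_iff ccoef_def)
qed

lemma jac_left:
  assumes "linear L"
  shows "jac (coframe_of (\<lambda>v. H *v L v)) = H ** jac (coframe_of L)" "jacbar (coframe_of (\<lambda>v. H *v L v)) = H ** jacbar (coframe_of L)"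
  by (rule jac_split, subst linear_split[OF assms], simp add: matrix_vector_right_distrib matrix_vector_mul_assoc)+

lemma jac_right:
  assumes "linear L"
  shows "jac (coframe_of (\<lambda>v. L (D *v v))) = jac (coframe_of L) ** D"
    "jacbar (coframe_of (\<lambda>v. L (D *v v))) = jacbar (coframe_of L) ** (\<chi> i j. cnj (D $ i $ j))"
  by (rule jac_split, subst linear_split[OF assms], simp add: cnjv_matrix matrix_vector_mul_assoc)+

lemma complex_linear_matrix:
  assumes "linear L" "\<And>c v. L (c *s v) = c *s L v"
  shows "L v = jac (coframe_of L) *v v"
proof -
  have "axis j \<i> = \<i> *s axis j 1" for j :: 'a by (simp add: vec_eq_iff axis_def)
  then have "L (axis j \<i>) = \<i> *s L (axis j 1)" for j by (simp only: assms(2))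
  then have "jacbar (coframe_of L) = 0"
    by (simp add: jacbar_def vec_eq_iff on_dzbar_def coframe_of_def)
  then show ?thesis using linear_split[OF assms(1), of v] by simp
qed

lemma matrix_inv_unique:
  fixes A B :: "complex ^ 'n ^ 'n"
  assumes "A ** B = mat 1" "B ** A = mat 1" shows "matrix_inv A = B" "invertible A"
proof -
  show i: "invertible A" using assms unfolding invertible_def by blast
  have "matrix_inv A = matrix_inv A ** (A ** B)" by (simp add: assms)
  also have "\<dots> = B" by (simp add: matrix_mul_assoc matrix_inv_works(2)[OF i])
  finally show "matrix_inv A = B" .
qed

text \<open>Here L is the differential of coordinates of X_t and Li its inverse; the values are the
  images of dz and of its conjugate under P_t. The unbarred one is dz + \<phi>. The barred one is
  the part of the conjugate of v = Li (L v) that is antilinear in L v, that is, its (0,1)-part on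
  X_t.\<close>

definition frame_of :: "('n::finite cvec \<Rightarrow> 'n cvec) \<Rightarrow> ('n cvec \<Rightarrow> 'n cvec) \<Rightarrow> bool \<times> 'n \<Rightarrow> 'n cvec \<Rightarrow> complex" where
  "frame_of L Li g v = (if fst g then cnj ((jac (coframe_of Li) *v L v) $ snd g)
     else (matrix_inv (jac (coframe_of L)) *v L v) $ snd g)"

text \<open>A holomorphic change H of the coordinates of X_t multiplies \<open>jac\<close> and
  \<open>jacbar\<close> by H from the left, and H cancels. Hence neither the frame nor \<phi>
  depends on the fibre chart.\<close>

lemma frame_of_left:
  assumes "linear L" "linear Li" "invertible (jac (coframe_of L))" "H ** Hi = mat 1" "Hi ** H = mat 1"
  shows "frame_of (\<lambda>v. H *v L v) (\<lambda>u. Li (Hi *v u)) = frame_of L Li"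
    and "matrix_inv (jac (coframe_of (\<lambda>v. H *v L v))) ** jacbar (coframe_of (\<lambda>v. H *v L v)) = matrix_inv (jac (coframe_of L)) ** jacbar (coframe_of L)"
proof -
  let ?A = "jac (coframe_of L)"
  have A: "?A ** matrix_inv ?A = mat 1" "matrix_inv ?A ** ?A = mat 1"
    using matrix_inv_works[OF assms(3)] by auto
  have "(H ** ?A) ** (matrix_inv ?A ** Hi) = H ** (?A ** matrix_inv ?A) ** Hi" by (simp add: matrix_mul_assoc)
  then have 1: "(H ** ?A) ** (matrix_inv ?A ** Hi) = mat 1" by (simp add: A assms)
  have "(matrix_inv ?A ** Hi) ** (H ** ?A) = matrix_inv ?A ** (Hi ** H) ** ?A" by (simp add: matrix_mul_assoc)
  then have 2: "(matrix_inv ?A ** Hi) ** (H ** ?A) = mat 1" by (simp add: A assms)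
  have inv: "matrix_inv (H ** ?A) = matrix_inv ?A ** Hi" by (rule matrix_inv_unique(1)[OF 1 2])
  have 3: "(M ** Hi) *v (H *v u) = M *v u" for M :: "'a cmat" and u
    by (simp add: matrix_vector_mul_assoc matrix_mul_assoc[symmetric] assms)
  show "frame_of (\<lambda>v. H *v L v) (\<lambda>u. Li (Hi *v u)) = frame_of L Li"
    by (intro ext) (simp add: frame_of_def jac_left[OF assms(1)] jac_right[OF assms(2)] inv 3)
  have "(matrix_inv ?A ** Hi) ** (H ** jacbar (coframe_of L)) = matrix_inv ?A ** (Hi ** H) ** jacbar (coframe_of L)" by (simp add: matrix_mul_assoc)
  then show "matrix_inv (jac (coframe_of (\<lambda>v. H *v L v))) ** jacbar (coframe_of (\<lambda>v. H *v L v)) = matrix_inv (jac (coframe_of L)) ** jacbar (coframe_of L)"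
    by (simp add: jac_left[OF assms(1)] inv assms)
qed

text \<open>The transformation law under a holomorphic change D of the coordinates of X_0, in the
  form that \<open>form_subst_pull\<close> requires.\<close>

lemma frame_of_right:
  assumes "linear L" "linear Li" "invertible (jac (coframe_of L))" "D ** Di = mat 1" "Di ** D = mat 1"
  shows "(\<Sum>g\<in>UNIV. ccoef g (\<lambda>v. coord h (D *v v)) * frame_of (\<lambda>v. L (D *v v)) (\<lambda>u. Di *v Li u) g v) = frame_of L Li h (D *v v)"
proof -
  let ?A = "jac (coframe_of L)"
  have A: "?A ** matrix_inv ?A = mat 1" "matrix_inv ?A ** ?A = mat 1"
    using matrix_inv_works[OF assms(3)] by auto
  have "(?A ** D) ** (Di ** matrix_inv ?A) = ?A ** (D ** Di) ** matrix_inv ?A" by (simp add: matrix_mul_assoc)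
  then have 1: "(?A ** D) ** (Di ** matrix_inv ?A) = mat 1" by (simp add: A assms)
  have "(Di ** matrix_inv ?A) ** (?A ** D) = Di ** (matrix_inv ?A ** ?A) ** D" by (simp add: matrix_mul_assoc)
  then have 2: "(Di ** matrix_inv ?A) ** (?A ** D) = mat 1" by (simp add: A assms)
  have inv: "matrix_inv (?A ** D) = Di ** matrix_inv ?A" by (rule matrix_inv_unique(1)[OF 1 2])
  have D3: "D *v ((Di ** M) *v u) = M *v u" for M :: "'a cmat" and u
    by (simp add: matrix_vector_mul_assoc matrix_mul_assoc assms)
  have "ccoef g (\<lambda>v. coord h (D *v v)) = (if fst g = fst h then (if fst h then cnj (D $ snd h $ snd g) else D $ snd h $ snd g) else 0)" for g
  proof -
    have "(\<lambda>v. coord h (D *v v)) = (\<lambda>v. \<Sum>j\<in>UNIV. (if fst h then cnj (D $ snd h $ j) else D $ snd h $ j) * coord (fst h, j) v)"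
      by (rule ext) (simp add: coord_def matrix_vector_nth)
    then show ?thesis by (cases g) (simp add: ccoef_sum ccoef_linear mult_if_01 if_distrib cong: if_cong)
  qed
  then have "(\<Sum>g\<in>UNIV. ccoef g (\<lambda>v. coord h (D *v v)) * frame_of (\<lambda>v. L (D *v v)) (\<lambda>u. Di *v Li u) g v)
     = (\<Sum>j\<in>UNIV. (if fst h then cnj (D $ snd h $ j) else D $ snd h $ j) * frame_of (\<lambda>v. L (D *v v)) (\<lambda>u. Di *v Li u) (fst h, j) v)"
    by (cases h; cases "fst h") (simp_all add: sum_bool_prod)
  also have "\<dots> = frame_of L Li h (D *v v)"
  proof (cases "fst h")
    case True
    have "(\<Sum>j\<in>UNIV. cnj (D $ snd h $ j) * cnj (((Di ** jac (coframe_of Li)) *v L (D *v v)) $ j))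
       = cnj ((D *v ((Di ** jac (coframe_of Li)) *v L (D *v v))) $ snd h)" by (simp add: matrix_vector_nth[of D])
    then show ?thesis using True by (simp add: frame_of_def jac_left[OF assms(2)] D3)
  next
    case False
    have "(\<Sum>j\<in>UNIV. D $ snd h $ j * (((Di ** matrix_inv ?A) *v L (D *v v)) $ j))
       = (D *v ((Di ** matrix_inv ?A) *v L (D *v v))) $ snd h" by (simp add: matrix_vector_nth[of D])
    then show ?thesis using False by (simp add: frame_of_def jac_right[OF assms(1)] inv D3)
  qed
  finally show ?thesis .
qed

text \<open>Conjugate v = Li (L v) after splitting Li into its complex linear and antilinear
  parts.\<close>

lemma frame_of_barred:
  assumes "linear L" "linear Li" "\<And>v. Li (L v) = v"
  shows "coord (True, j) v = frame_of L Li (True, j) v + (\<Sum>k\<in>UNIV. cnj (jacbar (coframe_of Li) $ j $ k) * L v $ k)"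
proof -
  have "Li (L v) $ j = (jac (coframe_of Li) *v L v) $ j + (jacbar (coframe_of Li) *v cnjv (L v)) $ j"
    by (subst linear_split[OF assms(2)]) simp
  then have "v $ j = (jac (coframe_of Li) *v L v) $ j + (jacbar (coframe_of Li) *v cnjv (L v)) $ j"
    by (simp only: assms(3))
  then show ?thesis by (simp add: coord_def frame_of_def matrix_vector_nth[of "jacbar _"] cnjv_def)
qed

lemma frame_of_unbarred:
  assumes "linear L" "invertible (jac (coframe_of L))"
  shows "frame_of L Li (False, j) v = coord (False, j) v + belt (matrix_inv (jac (coframe_of L)) ** jacbar (coframe_of L)) j v"
proof -
  have "matrix_inv (jac (coframe_of L)) *v L v = matrix_inv (jac (coframe_of L)) *v (jac (coframe_of L) *v v + jacbar (coframe_of L) *v cnjv v)"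
    by (rule arg_cong[OF linear_split[OF assms(1)]])
  also have "\<dots> = (matrix_inv (jac (coframe_of L)) ** jac (coframe_of L)) *v v
     + (matrix_inv (jac (coframe_of L)) ** jacbar (coframe_of L)) *v cnjv v"
    by (simp add: matrix_vector_right_distrib matrix_vector_mul_assoc)
  finally have "matrix_inv (jac (coframe_of L)) *v L v = (matrix_inv (jac (coframe_of L)) ** jac (coframe_of L)) *v v
     + (matrix_inv (jac (coframe_of L)) ** jacbar (coframe_of L)) *v cnjv v" .
  then have "matrix_inv (jac (coframe_of L)) *v L v = v + (matrix_inv (jac (coframe_of L)) ** jacbar (coframe_of L)) *v cnjv v"
    by (simp add: matrix_inv_works[OF assms(2)])
  then show ?thesis by (simp add: frame_of_def coord_def belt_def matrix_vector_nth[of "_ ** _"] cnjv_def)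
qed

text \<open>Expresses the deviation through the unbarred images; its coefficients form the matrix N
  of \<open>ext_deriv_form_subst\<close>.\<close>

lemma frame_of_barred':
  assumes "linear L" "linear Li" "\<And>v. Li (L v) = v" "invertible (jac (coframe_of L))"
  shows "coord (True, j) v = frame_of L Li (True, j) v
    + (\<Sum>k\<in>UNIV. (\<Sum>i\<in>UNIV. cnj (jacbar (coframe_of Li) $ j $ i) * jac (coframe_of L) $ i $ k) * frame_of L Li (False, k) v)"
proof -
  have "L v = jac (coframe_of L) *v (matrix_inv (jac (coframe_of L)) *v L v)"
    by (simp add: matrix_vector_mul_assoc matrix_inv_works[OF assms(4)])
  then have "L v $ i = (jac (coframe_of L) *v (matrix_inv (jac (coframe_of L)) *v L v)) $ i" for i by simp
  then have "L v $ i = (\<Sum>k\<in>UNIV. jac (coframe_of L) $ i $ k * frame_of L Li (False, k) v)" for i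
    unfolding matrix_vector_nth[of "jac (coframe_of L)"] by (simp only: frame_of_def fst_conv snd_conv if_False)
  then show ?thesis
    unfolding frame_of_barred[OF assms(1-3)] sum_distrib_left sum_distrib_right
    by (subst sum.swap) (simp add: sum_distrib_left mult.assoc)
qed

lemma frame_of_span:
  "\<exists>c. frame_of L Li (False, j) = (\<lambda>v. \<Sum>k\<in>UNIV. c k * coframe_of L k v)"
  "\<exists>c. frame_of L Li (True, j) = (\<lambda>v. \<Sum>k\<in>UNIV. c k * cnj (coframe_of L k v))"
  by (rule exI[of _ "\<lambda>k. matrix_inv (jac (coframe_of L)) $ j $ k"], simp add: frame_of_def matrix_vector_nth coframe_of_def fun_eq_iff)
    (rule exI[of _ "\<lambda>k. cnj (jac (coframe_of Li) $ j $ k)"], simp add: frame_of_def matrix_vector_nth coframe_of_def fun_eq_iff)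

lemma has_type_change:
  assumes "has_type w p q \<alpha>" "\<And>k. \<exists>c. w k = (\<lambda>v. \<Sum>j\<in>UNIV. c j * w' j v)"
  shows "has_type w' p q \<alpha>"
  using assms(1)
proof induction
  case (has_type_dz p q \<alpha> k)
  then show ?case using assms(2)[of k] has_type_wedge_span[of w' p q \<alpha>] by metis
next
  case (has_type_dzb p q \<alpha> k)
  obtain c where c: "w k = (\<lambda>v. \<Sum>j\<in>UNIV. c j * w' j v)" using assms(2) by blast
  show ?case
    by (rule has_type_wedge_span_bar[OF has_type_dzb.IH, of _ "\<lambda>j. cnj (c j)"]) (simp add: c)
qed (auto intro: has_type.intros)

lemma Lam_matrix:
  assumes "D ** Di = mat 1" "Di ** D = mat (1::complex)"
  shows "Lam (coframe_of ((*v) D)) p q = Lam std_coframe p q"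
proof -
  have "\<exists>c. coframe_of ((*v) D) k = (\<lambda>v. \<Sum>j\<in>UNIV. c j * std_coframe j v)" for k
    by (rule exI[of _ "\<lambda>j. D $ k $ j"]) (simp add: coframe_of_def std_coframe_def matrix_vector_nth fun_eq_iff)
  moreover have "\<exists>c. std_coframe k = (\<lambda>v. \<Sum>j\<in>UNIV. c j * coframe_of ((*v) D) j v)" for k
  proof (rule exI[of _ "\<lambda>j. Di $ k $ j"], rule ext)
    fix v
    have "v = Di *v (D *v v)" by (simp add: matrix_vector_mul_assoc assms)
    then show "std_coframe k v = (\<Sum>j\<in>UNIV. Di $ k $ j * coframe_of ((*v) D) j v)"
      by (simp only: coframe_of_def std_coframe_def flip: matrix_vector_nth)
  qed
  ultimately show ?thesis unfolding set_eq_iff Lam_iff_has_type using has_type_change by blast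
qed

section \<open>Two atlases on one smooth manifold\<close>

definition transition :: "('x, 'e) chart \<Rightarrow> ('x, 'f) chart \<Rightarrow> 'e \<Rightarrow> 'f" where
  "transition c d = snd d \<circ> chart_inv c"

definition Dtransition :: "('x, 'e::real_normed_vector) chart \<Rightarrow> ('x, 'f::real_normed_vector) chart \<Rightarrow> 'x \<Rightarrow> 'e \<Rightarrow> 'f" where
  "Dtransition c d x = frechet_derivative (transition c d) (at (snd c x))"

lemma smooth_forms_Lam: "\<omega> \<in> smooth_forms B C p q \<Longrightarrow> c \<in> B \<Longrightarrow> x \<in> fst c \<Longrightarrow> \<omega> c x \<in> Lam (coframe_at C c x) p q"
  unfolding smooth_forms_def by blast

lemma smooth_forms_smooth_fam: "\<omega> \<in> smooth_forms B C p q \<Longrightarrow> c \<in> B \<Longrightarrow> smooth_fam (snd c ` fst c) (\<lambda>y. \<omega> c (chart_inv c y))"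
  unfolding smooth_forms_def smooth_fam_def by blast

lemma smooth_forms_pull: "\<omega> \<in> smooth_forms B C p q \<Longrightarrow> c \<in> B \<Longrightarrow> d \<in> B \<Longrightarrow> x \<in> fst c \<Longrightarrow> x \<in> fst d \<Longrightarrow>
    \<omega> c x = pull (Dtransition c d x) (\<omega> d x)"
  unfolding smooth_forms_def pull_def Dtransition_def transition_def by blast

lemma smooth_forms_zero: "\<omega> \<in> smooth_forms B C p q \<Longrightarrow> \<not> (c \<in> B \<and> x \<in> fst c) \<Longrightarrow> \<omega> c x = (\<lambda>_. 0)"
  unfolding smooth_forms_def by blast

lemma smooth_formsI:
  assumes "\<And>c x. c \<in> B \<Longrightarrow> x \<in> fst c \<Longrightarrow> \<omega> c x \<in> Lam (coframe_at C c x) p q"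
    "\<And>c. c \<in> B \<Longrightarrow> smooth_fam (snd c ` fst c) (\<lambda>y. \<omega> c (chart_inv c y))"
    "\<And>c d x. c \<in> B \<Longrightarrow> d \<in> B \<Longrightarrow> x \<in> fst c \<Longrightarrow> x \<in> fst d \<Longrightarrow> \<omega> c x = pull (Dtransition c d x) (\<omega> d x)"
    "\<And>c x. \<not> (c \<in> B \<and> x \<in> fst c) \<Longrightarrow> \<omega> c x = (\<lambda>_. 0)"
  shows "\<omega> \<in> smooth_forms B C p q"
  unfolding smooth_forms_def mem_Collect_eq
proof (intro conjI ballI allI impI)
  fix c x vs d
  show "smooth_on (snd c ` fst c) (\<lambda>y. \<omega> c (chart_inv c y) vs)" if "c \<in> B"
    using assms(2)[OF that] by (simp add: smooth_fam_def)
  show "\<omega> c x vs = \<omega> d x (map (frechet_derivative (snd d \<circ> chart_inv c) (at (snd c x))) vs)"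
    if "c \<in> B" "d \<in> B" "x \<in> fst c \<inter> fst d"
    using assms(3)[of c d x] that by (simp add: pull_def Dtransition_def transition_def)
qed (use assms(1,4) in simp_all)

text \<open>Isolates what is used of the atlases of X_0 and X_t, without reference to a family. The
  pair consisting of B and itself is covered too, so results on two complex structures also describe
  the Dolbeault operators of X_0.\<close>

locale atlas_pair =
  fixes B C :: "('x, 'n::{finite,linorder} cvec) chart set"
  assumes inj: "c \<in> B \<union> C \<Longrightarrow> inj_on (snd c) (fst c)"
    and op: "c \<in> B \<union> C \<Longrightarrow> d \<in> B \<union> C \<Longrightarrow> open (snd c ` (fst c \<inter> fst d))"
    and sm: "c \<in> B \<union> C \<Longrightarrow> d \<in> B \<union> C \<Longrightarrow> smooth_on (snd c ` (fst c \<inter> fst d)) (transition c d)"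
    and holB: "c \<in> B \<Longrightarrow> d \<in> B \<Longrightarrow> x \<in> fst c \<Longrightarrow> x \<in> fst d \<Longrightarrow> Dtransition c d x (k *s v) = k *s Dtransition c d x v"
    and holC: "c \<in> C \<Longrightarrow> d \<in> C \<Longrightarrow> x \<in> fst c \<Longrightarrow> x \<in> fst d \<Longrightarrow> Dtransition c d x (k *s v) = k *s Dtransition c d x v"
    and cover: "c \<in> B \<Longrightarrow> x \<in> fst c \<Longrightarrow> \<exists>d\<in>C. x \<in> fst d"
begin

lemma chart_inv_id: "c \<in> B \<union> C \<Longrightarrow> x \<in> fst c \<Longrightarrow> chart_inv c (snd c x) = x"
  using inj by (simp add: chart_inv_def)

lemma open_dom: "c \<in> B \<union> C \<Longrightarrow> open (snd c ` fst c)"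
  using op[of c c] by simp

lemma transition_at: "c \<in> B \<union> C \<Longrightarrow> x \<in> fst c \<Longrightarrow> transition c d (snd c x) = snd d x"
  by (simp add: transition_def chart_inv_id)

lemma transition_derivative:
  assumes "c \<in> B \<union> C" "d \<in> B \<union> C" "x \<in> fst c" "x \<in> fst d"
  shows "(transition c d has_derivative Dtransition c d x) (at (snd c x))"
  unfolding Dtransition_def by (rule smooth_on_has_derivative[OF sm]) (use assms in auto)

lemma linear_Dtransition: "c \<in> B \<union> C \<Longrightarrow> d \<in> B \<union> C \<Longrightarrow> x \<in> fst c \<Longrightarrow> x \<in> fst d \<Longrightarrow> linear (Dtransition c d x)"
  using transition_derivative has_derivative_linear by blast

lemma Dtransition_chain:
  assumes "c \<in> B \<union> C" "d \<in> B \<union> C" "e \<in> B \<union> C" "x \<in> fst c" "x \<in> fst d" "x \<in> fst e"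
  shows "Dtransition c e x v = Dtransition d e x (Dtransition c d x v)"
proof -
  have de: "(transition d e has_derivative Dtransition d e x) (at (transition c d (snd c x)))"
    using transition_derivative[of d e x] assms by (simp add: transition_at)
  have "((\<lambda>y. transition d e (transition c d y)) has_derivative (\<lambda>v. Dtransition d e x (Dtransition c d x v))) (at (snd c x))"
    by (rule has_derivative_compose[OF transition_derivative de]) (use assms in auto)
  moreover have "snd c x \<in> snd c ` (fst c \<inter> fst d)" "open (snd c ` (fst c \<inter> fst d))"
    using assms op by auto
  moreover have "transition d e (transition c d y) = transition c e y" if "y \<in> snd c ` (fst c \<inter> fst d)" for y
    using that assms chart_inv_id[of c] chart_inv_id[of d] by (auto simp: transition_def)
  ultimately have "(transition c e has_derivative (\<lambda>v. Dtransition d e x (Dtransition c d x v))) (at (snd c x))"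
    using has_derivative_transform_within_open by blast
  then show ?thesis unfolding Dtransition_def[of c e] using frechet_derivative_at by metis
qed

lemma Dtransition_same:
  assumes "c \<in> B \<union> C" "x \<in> fst c" shows "Dtransition c c x v = v"
proof -
  have "((\<lambda>y. y) has_derivative (\<lambda>v. v)) (at (snd c x))" by simp
  then have "(transition c c has_derivative (\<lambda>v. v)) (at (snd c x))"
    by (rule has_derivative_transform_within_open[OF _ open_dom[OF assms(1)]])
      (use assms in \<open>auto simp: transition_at\<close>)
  then show ?thesis unfolding Dtransition_def using frechet_derivative_at by metis
qed

lemma Dtransition_inverse:
  assumes "c \<in> B \<union> C" "d \<in> B \<union> C" "x \<in> fst c" "x \<in> fst d"
  shows "Dtransition d c x (Dtransition c d x v) = v"
  using Dtransition_chain[of c d c x v] Dtransition_same[of c x v] assms by simp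

lemma surj_Dtransition:
  assumes "c \<in> B \<union> C" "d \<in> B \<union> C" "x \<in> fst c" "x \<in> fst d"
  shows "surj (Dtransition c d x)"
  using Dtransition_inverse[of d c x] assms by (metis surjI)

definition Jac :: "('x, 'n cvec) chart \<Rightarrow> ('x, 'n cvec) chart \<Rightarrow> 'x \<Rightarrow> 'n cmat" where
  "Jac c d x = jac (coframe_of (Dtransition c d x))"

lemma Jac_matrix:
  assumes "c \<in> B \<and> d \<in> B \<or> c \<in> C \<and> d \<in> C" "x \<in> fst c" "x \<in> fst d"
  shows "Dtransition c d x = (\<lambda>v. Jac c d x *v v)" "Jac c d x ** Jac d c x = mat 1" "Jac d c x ** Jac c d x = mat 1"
proof -
  have 1: "Dtransition c d x v = Jac c d x *v v" if "c \<in> B \<and> d \<in> B \<or> c \<in> C \<and> d \<in> C" "x \<in> fst c" "x \<in> fst d" for c d v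
    unfolding Jac_def
  proof (rule complex_linear_matrix)
    show "linear (Dtransition c d x)" by (rule linear_Dtransition) (use that in blast)+
    show "Dtransition c d x (k *s u) = k *s Dtransition c d x u" for k u
      using holB[of c d x k u] holC[of c d x k u] that by blast
  qed
  show "Dtransition c d x = (\<lambda>v. Jac c d x *v v)" by (rule ext) (rule 1[OF assms])
  have 2: "Jac c d x ** Jac d c x = mat 1" if "c \<in> B \<and> d \<in> B \<or> c \<in> C \<and> d \<in> C" "x \<in> fst c" "x \<in> fst d" for c d
  proof -
    have "(Jac c d x ** Jac d c x) *v v = mat 1 *v v" for v
    proof -
      have "Dtransition c d x (Dtransition d c x v) = v" by (rule Dtransition_inverse) (use that in blast)+
      moreover have "Dtransition c d x u = Jac c d x *v u" for u by (rule 1[OF that])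
      moreover have "Dtransition d c x u = Jac d c x *v u" for u by (rule 1) (use that in blast)+
      ultimately show ?thesis by (simp flip: matrix_vector_mul_assoc)
    qed
    then show ?thesis using matrix_eq by blast
  qed
  show "Jac c d x ** Jac d c x = mat 1" by (rule 2[OF assms])
  show "Jac d c x ** Jac c d x = mat 1" by (rule 2) (use assms in blast)+
qed

lemma dcoord_coframe_of:
  assumes "c \<in> B \<union> C" "d \<in> B \<union> C" "x \<in> fst c" "x \<in> fst d"
  shows "dcoord c d x = coframe_of (Dtransition c d x)"
proof -
  have "((\<lambda>y. transition c d y $ k) has_derivative (\<lambda>v. Dtransition c d x v $ k)) (at (snd c x))" for k
    by (rule bounded_linear.has_derivative[OF bounded_linear_vec_nth transition_derivative[OF assms]])
  from frechet_derivative_at[OF this] show ?thesis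
    by (simp add: dcoord_def coframe_of_def transition_def fun_eq_iff)
qed

text \<open>The same choice as in \<open>coframe_at\<close>, so that the chosen coframe belongs to
  this chart.\<close>

definition fibre_chart_at :: "'x \<Rightarrow> ('x, 'n cvec) chart" where
  "fibre_chart_at x = (SOME d. d \<in> C \<and> x \<in> fst d)"

lemma fibre_chart_at: "c \<in> B \<Longrightarrow> x \<in> fst c \<Longrightarrow> fibre_chart_at x \<in> C \<and> x \<in> fst (fibre_chart_at x)"
  unfolding fibre_chart_at_def using someI_ex[of "\<lambda>d. d \<in> C \<and> x \<in> fst d"] cover[of c x] by blast

lemma coframe_C: "c \<in> B \<Longrightarrow> x \<in> fst c \<Longrightarrow> coframe_at C c x = coframe_of (Dtransition c (fibre_chart_at x) x)"
  unfolding coframe_at_def fibre_chart_at_def[symmetric] using fibre_chart_at[of c x] dcoord_coframe_of[of c "fibre_chart_at x" x] by blast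

end

locale two_atlases = atlas_pair B C
  for B C :: "('x, 'n::{finite,linorder} cvec) chart set" +
  assumes iso: "pi10_iso B C"
begin

lemma jac_invertible:
  assumes "c \<in> B" "d \<in> C" "x \<in> fst c" "x \<in> fst d" shows "invertible (jac (coframe_of (Dtransition c d x)))"
proof -
  have "invertible (jac (dcoord c d x))" using iso assms unfolding pi10_iso_def by blast
  then show ?thesis using dcoord_coframe_of[of c d x] assms by simp
qed

lemma coframe_B:
  assumes "c \<in> B" "x \<in> fst c"
  obtains D Di where "coframe_at B c x = coframe_of ((*v) D)" "D ** Di = mat 1" "Di ** D = mat 1"
proof -
  define d where "d = (SOME d. d \<in> B \<and> x \<in> fst d)"
  have d: "d \<in> B \<and> x \<in> fst d" unfolding d_def using someI_ex[of "\<lambda>d. d \<in> B \<and> x \<in> fst d"] assms by blast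
  have "coframe_at B c x = coframe_of (Dtransition c d x)"
    unfolding coframe_at_def d_def[symmetric] using dcoord_coframe_of[of c d x] d assms by auto
  then show ?thesis using that[of "Jac c d x" "Jac d c x"] Jac_matrix[of c d x] d assms by auto
qed

lemma Lam_B: "c \<in> B \<Longrightarrow> x \<in> fst c \<Longrightarrow> Lam (coframe_at B c x) p q = Lam std_coframe p q"
  using coframe_B Lam_matrix by metis

definition frame_at :: "('x, 'n cvec) chart \<Rightarrow> 'x \<Rightarrow> bool \<times> 'n \<Rightarrow> 'n cvec \<Rightarrow> complex" where
  "frame_at c x = frame_of (Dtransition c (fibre_chart_at x) x) (Dtransition (fibre_chart_at x) c x)"

text \<open>Frees the frame and \<phi> from the chosen fibre chart. The choice may jump from point
  to point, so smoothness and derivatives are accessible only with one fixed chart near a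
  point.\<close>

lemma frame_at_eq:
  assumes "c \<in> B" "d \<in> C" "x \<in> fst c" "x \<in> fst d"
  shows "frame_at c x = frame_of (Dtransition c d x) (Dtransition d c x)"
    and "beltrami C c x = matrix_inv (jac (coframe_of (Dtransition c d x))) ** jacbar (coframe_of (Dtransition c d x))"
proof -
  let ?d = "fibre_chart_at x"
  have s: "?d \<in> C" "x \<in> fst ?d" using fibre_chart_at assms by auto
  have 1: "Dtransition c ?d x = (\<lambda>v. Jac d ?d x *v Dtransition c d x v)"
    using Dtransition_chain[of c d ?d x] Jac_matrix(1)[of d ?d x] s assms by (auto simp: fun_eq_iff)
  have 2: "Dtransition ?d c x = (\<lambda>u. Dtransition d c x (Jac ?d d x *v u))"
    using Dtransition_chain[of ?d d c x] Jac_matrix(1)[of ?d d x] s assms by (auto simp: fun_eq_iff)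
  have l: "linear (Dtransition c d x)" "linear (Dtransition d c x)" using linear_Dtransition assms by auto
  have m: "Jac d ?d x ** Jac ?d d x = mat 1" "Jac ?d d x ** Jac d ?d x = mat 1" using Jac_matrix s assms by auto
  show "frame_at c x = frame_of (Dtransition c d x) (Dtransition d c x)"
    unfolding frame_at_def 1 2 by (rule frame_of_left(1)[OF l jac_invertible m]) (use assms in auto)
  show "beltrami C c x = matrix_inv (jac (coframe_of (Dtransition c d x))) ** jacbar (coframe_of (Dtransition c d x))"
    unfolding beltrami_def coframe_C[OF assms(1,3)] 1
    by (rule frame_of_left(2)[OF l jac_invertible m]) (use assms in auto)
qed

lemma frame_at_natural:
  assumes "c \<in> B" "d \<in> B" "x \<in> fst c" "x \<in> fst d" "alternating \<alpha>"
  shows "form_subst (frame_at c x) (pull (Dtransition c d x) \<alpha>) vs = form_subst (frame_at d x) \<alpha> (map (Dtransition c d x) vs)"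
proof (rule form_subst_pull[OF assms(5)])
  show "linear (Dtransition c d x)" using linear_Dtransition assms by auto
  fix h v
  let ?e = "fibre_chart_at x"
  have e: "?e \<in> C" "x \<in> fst ?e" using fibre_chart_at assms by auto
  have D: "Dtransition c d x = (\<lambda>v. Jac c d x *v v)" "Jac c d x ** Jac d c x = mat 1" "Jac d c x ** Jac c d x = mat 1"
    using Jac_matrix[of c d x] assms by auto
  have 1: "Dtransition c ?e x = (\<lambda>v. Dtransition d ?e x (Jac c d x *v v))"
    using Dtransition_chain[of c d ?e x] D e assms by (auto simp: fun_eq_iff)
  have 2: "Dtransition ?e c x = (\<lambda>u. Jac d c x *v Dtransition ?e d x u)"
    using Dtransition_chain[of ?e d c x] Jac_matrix(1)[of d c x] e assms by (auto simp: fun_eq_iff)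
  show "(\<Sum>g\<in>UNIV. ccoef g (\<lambda>v. coord h (Dtransition c d x v)) * frame_at c x g v) = frame_at d x h (Dtransition c d x v)"
    unfolding frame_at_def 1 2 D(1)
    by (rule frame_of_right[OF linear_Dtransition linear_Dtransition jac_invertible D(2,3)]) (use e assms in auto)
qed

text \<open>The explicit form of P_t, to be identified with \<open>P_map\<close> in
  \<open>P_map_eq\<close>.\<close>

definition P_form :: "('x, 'n) form \<Rightarrow> ('x, 'n) form" where
  "P_form s = localize B (\<lambda>_. 0) (\<lambda>c x. form_subst (frame_at c x) (s c x))"

lemma pointwise_P:
  assumes "c \<in> B" "x \<in> fst c" "\<alpha> \<in> Lam std_coframe p q"
  shows "exp_vins (coframe_at C c x) p (beltrami C c x) (I_at (coframe_at B c x) p q \<alpha>)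
      = I_at (coframe_at C c x) p q (form_subst (frame_at c x) \<alpha>)"
    and "form_subst (frame_at c x) \<alpha> \<in> Lam (coframe_at C c x) p q"
proof -
  let ?d = "fibre_chart_at x"
  have d: "?d \<in> C" "x \<in> fst ?d" using fibre_chart_at assms by auto
  obtain D Di where D: "coframe_at B c x = coframe_of ((*v) D)" "D ** Di = mat 1" "Di ** D = mat 1"
    using coframe_B[OF assms(1,2)] .
  have iD: "invertible D" using matrix_inv_unique(2)[OF D(2,3)] .
  have l: "linear (Dtransition c ?d x)" "linear (Dtransition ?d c x)" using linear_Dtransition assms d by auto
  have s: "surj (Dtransition c ?d x)" using surj_Dtransition assms d by auto
  have N: "\<exists>c'. coord (True, j) = (\<lambda>v. frame_at c x (True, j) v + (\<Sum>k\<in>UNIV. c' k * Dtransition c ?d x v $ k))" for j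
    using frame_of_barred[OF l, of j] Dtransition_inverse[of c ?d x] assms d unfolding frame_at_def by fast
  note e = exp_vins_I_at[OF l(1) s jac_invertible[OF assms(1) d(1) assms(2) d(2)] iD _ _ N assms(3),
      of "jac (coframe_of (Dtransition ?d c x))"]
  show "exp_vins (coframe_at C c x) p (beltrami C c x) (I_at (coframe_at B c x) p q \<alpha>)
      = I_at (coframe_at C c x) p q (form_subst (frame_at c x) \<alpha>)"
    unfolding D(1) beltrami_def coframe_C[OF assms(1,2)] by (rule e(1)) (simp_all add: frame_at_def frame_of_def)
  show "form_subst (frame_at c x) \<alpha> \<in> Lam (coframe_at C c x) p q"
    unfolding coframe_C[OF assms(1,2)] by (rule e(2)) (simp_all add: frame_at_def frame_of_def)
qed

text \<open>The inverse in \<open>P_map\<close> is taken on the space of smooth forms, so it is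
  evaluated from the injectivity of the isomorphism there together with the membership of
  \<open>P_form s\<close>.\<close>

lemma P_map_eq:
  assumes "\<And>c x. c \<in> B \<Longrightarrow> x \<in> fst c \<Longrightarrow> s c x \<in> Lam std_coframe p q" "P_form s \<in> smooth_forms B C p q"
  shows "P_map B C p q s = P_form s"
proof -
  have inj: "inj_on (I_iso B C p q) (smooth_forms B C p q)"
  proof (rule inj_onI)
    fix \<omega> \<eta> assume *: "\<omega> \<in> smooth_forms B C p q" "\<eta> \<in> smooth_forms B C p q" "I_iso B C p q \<omega> = I_iso B C p q \<eta>"
    show "\<omega> = \<eta>"
    proof (rule ext, rule ext)
      fix c x
      show "\<omega> c x = \<eta> c x"
      proof (cases "c \<in> B \<and> x \<in> fst c")
        case False then show ?thesis using *(1,2) by (simp add: smooth_forms_zero)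
      next
        case True
        have "I_at (coframe_at C c x) p q (\<omega> c x) = I_at (coframe_at C c x) p q (\<eta> c x)"
          using fun_cong[OF fun_cong[OF *(3)], of c x] True by (simp add: I_iso_def localize_def)
        moreover have "\<omega> c x \<in> Lam (coframe_at C c x) p q" "\<eta> c x \<in> Lam (coframe_at C c x) p q"
          using smooth_forms_Lam[OF *(1), of c x] smooth_forms_Lam[OF *(2), of c x] True by simp_all
        moreover have "surj (Dtransition c (fibre_chart_at x) x)" "coframe_at C c x = coframe_of (Dtransition c (fibre_chart_at x) x)"
          using surj_Dtransition[of c "fibre_chart_at x" x] fibre_chart_at[of c x] coframe_C[of c x] True by simp_all
        ultimately show ?thesis using I_at_inj by metis
      qed
    qed
  qed
  have "exp_i_phi B C p (beltrami C) (I_iso B B p q s) = I_iso B C p q (P_form s)"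
    by (intro ext) (auto simp: exp_i_phi_def I_iso_def localize_def P_form_def pointwise_P assms)
  then show ?thesis using inv_into_f_f[OF inj assms(2)] by (simp add: P_map_def)
qed

end

section \<open>Naturality of the exterior derivative and smoothness of the local data\<close>

lemma ext_deriv_cong:
  assumes "open V" "y \<in> V" "\<And>x. x \<in> V \<Longrightarrow> \<eta> x = \<zeta> x" "diff_fam \<eta> y"
  shows "ext_deriv \<eta> y = ext_deriv \<zeta> y"
proof -
  have "frechet_derivative (\<lambda>u. \<eta> u us) (at y) = frechet_derivative (\<lambda>u. \<zeta> u us) (at y)" for us
    by (rule frechet_derivative_transform_within_open[OF _ assms(1,2)]) (use assms(3,4) in \<open>auto simp: diff_fam_def\<close>)
  then show ?thesis by (simp add: ext_deriv_def fun_eq_iff)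
qed

lemma bounded_linear_coord: "bounded_linear (coord g)"
  by (simp add: linear_conv_bounded_linear[symmetric])

lemma wirt_chain:
  assumes "\<tau> differentiable (at y)" "f differentiable (at (\<tau> y))"
  shows "wirt g (\<lambda>y. f (\<tau> y)) y = (\<Sum>h\<in>UNIV. wirt h f (\<tau> y) * wirt g (\<lambda>y. coord h (\<tau> y)) y)"
proof -
  have \<tau>: "(\<tau> has_derivative frechet_derivative \<tau> (at y)) (at y)" using assms(1) fd_works by (simp add: frechet_derivative_works)
  have coord: "wirt g (\<lambda>y. coord h (\<tau> y)) y = ccoef g (\<lambda>v. coord h (frechet_derivative \<tau> (at y) v))" for h
    unfolding wirt_def using fd_eq[OF bounded_linear.has_derivative[OF bounded_linear_coord \<tau>]] by simp
  have "frechet_derivative (\<lambda>y. f (\<tau> y)) (at y) = (\<lambda>v. frechet_derivative f (at (\<tau> y)) (frechet_derivative \<tau> (at y) v))"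
    by (rule fd_eq[OF has_derivative_compose[OF \<tau> fd_works[OF assms(2)]]])
  then show ?thesis
    unfolding coord unfolding wirt_def[of g]
    by (simp add: fd_expand[OF assms(2)] ccoef_sum ccoef_linear)
qed

text \<open>Pullback is a substitution, so the product rule applies. The terms that differentiate
  the substituted one-forms carry second derivatives of \<tau> and cancel by symmetry; the chain
  rule turns the others into the pulled-back derivative.\<close>

lemma ext_deriv_pull:
  fixes \<tau> :: "'n::finite cvec \<Rightarrow> 'n cvec"
  assumes y: "open V" "y \<in> V" and U: "open U" "\<tau> ` V \<subseteq> U" and \<tau>: "smooth_on V \<tau>"
    and \<eta>: "smooth_fam U \<eta>" "\<And>x. x \<in> U \<Longrightarrow> alternating (\<eta> x)"
  shows "ext_deriv (\<lambda>y. pull (frechet_derivative \<tau> (at y)) (\<eta> (\<tau> y))) y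
    = pull (frechet_derivative \<tau> (at y)) (ext_deriv \<eta> (\<tau> y))"
proof
  fix vs
  define a where "a y g v = coord g (frechet_derivative \<tau> (at y) v)" for y g v
  define \<tau>g where "\<tau>g g y = coord g (\<tau> y)" for g y
  have lin: "linear (frechet_derivative \<tau> (at x))" if "x \<in> V" for x
    using smooth_on_has_derivative[OF \<tau> that] has_derivative_linear by blast
  have s\<tau>g: "smooth_on V (\<tau>g g)" for g
    unfolding \<tau>g_def[abs_def] by (rule smooth_on_linear_compose[OF y(1) bounded_linear_coord \<tau>])
  have a\<tau>: "a x h v = (\<Sum>k\<in>UNIV. wirt k (\<tau>g h) x * coord k v)" if "x \<in> V" for x h v
  proof -
    have "frechet_derivative (\<tau>g h) (at x) = a x h"
      unfolding \<tau>g_def[abs_def] a_def[abs_def]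
      by (rule fd_eq[OF bounded_linear.has_derivative[OF bounded_linear_coord smooth_on_has_derivative[OF \<tau> that]]])
    then show ?thesis using fd_expand[OF smooth_on_differentiable[OF s\<tau>g that], of h v] by simp
  qed
  have da: "(\<lambda>y. a y h v) differentiable (at y)" for h v
    unfolding a_def by (rule smooth_on_differentiable[OF smooth_on_linear_compose[OF y(1) bounded_linear_coord smooth_on_derivative[OF \<tau>]] y(2)])
  have d\<eta>\<tau>: "(\<lambda>y. \<eta> (\<tau> y) us) differentiable (at y)" for us
    by (rule smooth_on_differentiable[OF smooth_on_compose[OF y(1) U(1,2) \<tau>, of "\<lambda>u. \<eta> u us"] y(2)])
      (use \<eta>(1) in \<open>simp add: smooth_fam_def\<close>)
  then have diff_fam\<eta>: "diff_fam (\<lambda>y. \<eta> (\<tau> y)) y" by (simp add: diff_fam_def)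
  have \<tau>y: "\<tau> y \<in> U" using U y by auto
  have diff_fam\<eta>': "diff_fam \<eta> (\<tau> y)" by (rule smooth_fam_diff_fam[OF \<eta>(1) \<tau>y])
  have e: "ext_deriv (\<lambda>y. pull (frechet_derivative \<tau> (at y)) (\<eta> (\<tau> y))) y = ext_deriv (\<lambda>y. form_subst (a y) (\<eta> (\<tau> y))) y"
  proof (rule ext_deriv_cong[OF y, symmetric])
    show "form_subst (a x) (\<eta> (\<tau> x)) = pull (frechet_derivative \<tau> (at x)) (\<eta> (\<tau> x))" if "x \<in> V" for x
      unfolding a_def using pull_form_subst[OF \<eta>(2) lin[OF that], of "\<tau> x"] U that by (auto simp: fun_eq_iff)
  qed (rule diff_fam_form_subst[OF da diff_fam\<eta>])
  have waa: "wirt g (\<lambda>y. a y h v) y = (\<Sum>k\<in>UNIV. wirt g (wirt k (\<tau>g h)) y * coord k v)" for g h v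
  proof -
    have d: "wirt k (\<tau>g h) differentiable (at y)" for k
      by (rule smooth_on_differentiable[OF smooth_on_wirt[OF y(1) s\<tau>g] y(2)])
    have d1: "(\<lambda>x. wirt k (\<tau>g h) x * coord k v) differentiable (at y)" for k
      by (intro differentiable_mult d differentiable_const)
    have "wirt g (\<lambda>y. a y h v) y = wirt g (\<lambda>x. \<Sum>k\<in>UNIV. wirt k (\<tau>g h) x * coord k v) y"
      by (rule wirt_cong[OF y a\<tau> da])
    then show ?thesis by (simp add: wirt_sum[OF d1] wirt_mult d)
  qed
  define X where "X h = form_subst (a y) (contr h (\<eta> (\<tau> y)))" for h
  \<comment> \<open>The substituted one-forms are the differentials of the components of \<tau>,
    hence closed.\<close>
  have z: "(\<Sum>g\<in>UNIV. wedge (one_form (coord g)) (wedge (one_form (\<lambda>v. wirt g (\<lambda>y. a y h v) y)) (X h)) vs) = 0" for h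
  proof -
    have w1: "wedge (one_form (\<lambda>v. wirt g (\<lambda>y. a y h v) y)) (X h) us
        = (\<Sum>k\<in>UNIV. wirt g (wirt k (\<tau>g h)) y * wedge (one_form (coord k)) (X h) us)" for g us
      unfolding waa by (simp add: one_form_sum one_form_linear wedge_linear)
    then have "(\<lambda>us. wedge (one_form (\<lambda>v. wirt g (\<lambda>y. a y h v) y)) (X h) us)
        = (\<lambda>us. \<Sum>k\<in>UNIV. wirt g (wirt k (\<tau>g h)) y * wedge (one_form (coord k)) (X h) us)" for g by blast
    then have "(\<Sum>g\<in>UNIV. wedge (one_form (coord g)) (wedge (one_form (\<lambda>v. wirt g (\<lambda>y. a y h v) y)) (X h)) vs)
      = (\<Sum>g\<in>UNIV. \<Sum>k\<in>UNIV. wirt g (wirt k (\<tau>g h)) y * wedge (one_form (coord g)) (wedge (one_form (coord k)) (X h)) vs)"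
      by (simp add: wedge_linear)
    also have "\<dots> = 0" by (rule wedge_symmetric_zero) (rule wirt_commute[OF y(1) s\<tau>g y(2)])
    finally show ?thesis .
  qed
  have altd: "alternating (dwirt h \<eta> (\<tau> y))" for h by (rule alternating_dwirt[OF diff_fam\<eta>' U(1) \<tau>y \<eta>(2)])
  have dwirt\<eta>: "dwirt g (\<lambda>y. \<eta> (\<tau> y)) y = (\<lambda>us. \<Sum>h\<in>UNIV. wirt g (\<tau>g h) y * dwirt h \<eta> (\<tau> y) us)" for g
  proof
    fix us
    have "wirt g (\<lambda>y. \<eta> (\<tau> y) us) y = (\<Sum>h\<in>UNIV. wirt h (\<lambda>u. \<eta> u us) (\<tau> y) * wirt g (\<lambda>y. coord h (\<tau> y)) y)"
      by (rule wirt_chain[OF smooth_on_differentiable[OF \<tau> y(2)], of "\<lambda>u. \<eta> u us"]) (use diff_fam\<eta>' in \<open>simp add: diff_fam_def\<close>)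
    then show "dwirt g (\<lambda>y. \<eta> (\<tau> y)) y us = (\<Sum>h\<in>UNIV. wirt g (\<tau>g h) y * dwirt h \<eta> (\<tau> y) us)"
      by (simp add: dwirt_def \<tau>g_def[abs_def] mult.commute)
  qed
  have "ext_deriv (\<lambda>y. form_subst (a y) (\<eta> (\<tau> y))) y vs = (\<Sum>g\<in>UNIV. wedge (one_form (coord g)) (dwirt g (\<lambda>y. form_subst (a y) (\<eta> (\<tau> y))) y) vs)"
    by (subst ext_deriv_eq[OF diff_fam_form_subst[OF da diff_fam\<eta>]]) simp
  also have "\<dots> = (\<Sum>g\<in>UNIV. (\<Sum>h\<in>UNIV. wedge (one_form (coord g)) (wedge (one_form (\<lambda>v. wirt g (\<lambda>y. a y h v) y)) (X h)) vs)
      + wedge (one_form (coord g)) (form_subst (a y) (dwirt g (\<lambda>y. \<eta> (\<tau> y)) y)) vs)"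
  proof -
    have "dwirt g (\<lambda>y. form_subst (a y) (\<eta> (\<tau> y))) y = (\<lambda>vs. (\<Sum>h\<in>UNIV. wedge (one_form (\<lambda>v. wirt g (\<lambda>y. a y h v) y)) (X h) vs)
       + form_subst (a y) (dwirt g (\<lambda>y. \<eta> (\<tau> y)) y) vs)" for g
      unfolding X_def by (rule ext) (rule dwirt_form_subst[OF da diff_fam\<eta> \<eta>(2)[OF \<tau>y]])
    then show ?thesis by (simp add: wedge_linear)
  qed
  also have "\<dots> = (\<Sum>h\<in>UNIV. \<Sum>g\<in>UNIV. wedge (one_form (coord g)) (wedge (one_form (\<lambda>v. wirt g (\<lambda>y. a y h v) y)) (X h)) vs)
      + (\<Sum>g\<in>UNIV. wedge (one_form (coord g)) (form_subst (a y) (dwirt g (\<lambda>y. \<eta> (\<tau> y)) y)) vs)"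
    unfolding sum.distrib by (intro arg_cong2[of _ _ _ _ "(+)"] refl sum.swap)
  also have "\<dots> = (\<Sum>g\<in>UNIV. wedge (one_form (coord g)) (form_subst (a y) (dwirt g (\<lambda>y. \<eta> (\<tau> y)) y)) vs)"
    by (simp add: z)
  also have "\<dots> = (\<Sum>g\<in>UNIV. \<Sum>h\<in>UNIV. wirt g (\<tau>g h) y * wedge (one_form (coord g)) (form_subst (a y) (dwirt h \<eta> (\<tau> y))) vs)"
    unfolding dwirt\<eta> by (simp add: form_subst_linear[abs_def] wedge_linear)
  also have "\<dots> = (\<Sum>h\<in>UNIV. wedge (one_form (a y h)) (form_subst (a y) (dwirt h \<eta> (\<tau> y))) vs)"
  proof -
    have "a y h = (\<lambda>v. \<Sum>k\<in>UNIV. wirt k (\<tau>g h) y * coord k v)" for h using a\<tau>[OF y(2)] by blast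
    then show ?thesis by (subst sum.swap) (simp add: one_form_sum one_form_linear wedge_linear)
  qed
  also have "\<dots> = (\<Sum>h\<in>UNIV. pull (frechet_derivative \<tau> (at y)) (wedge (one_form (coord h)) (dwirt h \<eta> (\<tau> y))) vs)"
  proof (rule sum.cong[OF refl])
    fix h
    have 1: "pull (frechet_derivative \<tau> (at y)) (dwirt h \<eta> (\<tau> y)) = form_subst (a y) (dwirt h \<eta> (\<tau> y))"
      unfolding a_def by (rule ext) (rule pull_form_subst[OF altd lin[OF y(2)]])
    have 2: "pull (frechet_derivative \<tau> (at y)) (one_form (coord h)) = one_form (a y h)"
      unfolding a_def pull_def by simp
    show "wedge (one_form (a y h)) (form_subst (a y) (dwirt h \<eta> (\<tau> y))) vs
      = pull (frechet_derivative \<tau> (at y)) (wedge (one_form (coord h)) (dwirt h \<eta> (\<tau> y))) vs"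
      unfolding pull_wedge 1 2 ..
  qed
  finally show "ext_deriv (\<lambda>y. pull (frechet_derivative \<tau> (at y)) (\<eta> (\<tau> y))) y vs
    = pull (frechet_derivative \<tau> (at y)) (ext_deriv \<eta> (\<tau> y)) vs"
    unfolding e by (simp add: ext_deriv_eq[OF diff_fam\<eta>'] pull_def)
qed

lemma smooth_fam_cong: "open S \<Longrightarrow> smooth_fam S f \<Longrightarrow> (\<And>x. x \<in> S \<Longrightarrow> f x = g x) \<Longrightarrow> smooth_fam S g"
  unfolding smooth_fam_def using smooth_on_cong[of S "\<lambda>y. f y vs" "\<lambda>y. g y vs" for vs] by simp

lemma smooth_jac:
  assumes "open V" "\<And>v. smooth_on V (\<lambda>y. T y v)"
  shows "smooth_on V (\<lambda>y. jac (coframe_of (T y)) $ k $ i)" "smooth_on V (\<lambda>y. jacbar (coframe_of (T y)) $ k $ i)"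
  unfolding jac_def jacbar_def coframe_of_def on_dz_def on_dzbar_def divide_inverse vec_lambda_beta
  by (intro smooth_on_mult smooth_on_add smooth_on_diff smooth_on_const smooth_on_component assms)+

lemma smooth_frame_of:
  assumes V: "open V" and T: "\<And>v. smooth_on V (\<lambda>y. T y v)" "\<And>v. smooth_on V (\<lambda>y. Ti y v)"
    and i: "\<And>y. y \<in> V \<Longrightarrow> invertible (jac (coframe_of (T y)))"
  shows "smooth_on V (\<lambda>y. frame_of (T y) (Ti y) g v)"
proof (cases "fst g")
  case True
  show ?thesis unfolding frame_of_def using True
    by (simp add: matrix_vector_nth, intro smooth_on_sum smooth_on_mult smooth_on_cnj smooth_jac smooth_on_component V T)
next
  case False
  show ?thesis unfolding frame_of_def using False
    by (simp add: matrix_vector_nth, intro smooth_on_sum smooth_on_mult smooth_on_matrix_inv smooth_jac smooth_on_component V T i)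
qed

lemma smooth_belt:
  assumes V: "open V" and T: "\<And>v. smooth_on V (\<lambda>y. T y v)"
    and i: "\<And>y. y \<in> V \<Longrightarrow> invertible (jac (coframe_of (T y)))"
  shows "smooth_on V (\<lambda>y. (matrix_inv (jac (coframe_of (T y))) ** jacbar (coframe_of (T y))) $ k $ j)"
  unfolding matrix_matrix_mult_def vec_lambda_beta
  by (intro smooth_on_sum smooth_on_mult smooth_on_matrix_inv smooth_jac V T i)

text \<open>In the last term the contraction takes away one dz-factor and the outer wedge puts one
  back. For p = 0 that term vanishes, which is why the case is separated.\<close>

lemma twisted_dbar_Lam:
  assumes "diff_fam s y" "open U" "y \<in> U" "\<And>x. x \<in> U \<Longrightarrow> s x \<in> Lam std_coframe p q"
  shows "twisted_dbar \<phi> s y \<in> Lam std_coframe p (Suc q)"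
proof -
  have d: "has_type std_coframe p q (dwirt g s y)" for g using dwirt_Lam[OF assms] by (simp add: Lam_iff_has_type)
  have c: "belt f j = (\<lambda>v. \<Sum>l\<in>UNIV. f $ j $ l * cnj (std_coframe l v))" for f :: "'a cmat" and j
    by (simp add: belt_def std_coframe_def fun_eq_iff)
  have i: "ins f (s y) = (\<lambda>_. 0) \<or> (\<exists>p'. p = Suc p' \<and> has_type std_coframe p' (Suc q) (ins f (s y)))" for f
  proof (cases p)
    case 0
    then have "contr (False, i) (s y) = (\<lambda>_. 0)" for i
      using has_type_contr[of p q "s y" i] assms(3,4) by (simp add: Lam_iff_has_type)
    then show ?thesis by (simp add: ins_eq)
  next
    case (Suc p')
    have "has_type std_coframe p' q (contr (False, i) (s y))" for i
      using has_type_contr[of p q "s y" i] assms(3,4) Suc by (simp add: Lam_iff_has_type)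
    then have "has_type std_coframe p' (Suc q) (ins f (s y))"
      unfolding ins_eq by (intro has_type_sum has_type_wedge_span_bar[OF _ c])
    then show ?thesis using Suc by blast
  qed
  have "has_type std_coframe p (Suc q) (wedge (one_form (coord (False, k))) (ins f (s y)))" for f k
    using i[of f] by (auto simp: coord_std_coframe wedge_zero_right[abs_def] intro: has_type_zero has_type_dz)
  then show ?thesis
    unfolding Lam_iff_has_type twisted_dbar_def
    by (intro has_type_add has_type_diff has_type_sum has_type_wedge_span_bar[OF d c]) (simp_all add: coord_std_coframe has_type_dzb d)
qed

lemma smooth_fam_twisted_dbar:
  assumes "open U" "smooth_fam U s" "\<And>i j. smooth_on U (\<lambda>y. \<phi> y $ i $ j)"
  shows "smooth_fam U (twisted_dbar \<phi> s)"
  unfolding twisted_dbar_def[abs_def]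
proof (intro smooth_fam_add smooth_fam_diff smooth_fam_sum smooth_fam_wedge smooth_fam_one_form smooth_fam_dwirt assms smooth_fam_ins)
  show "smooth_on U (\<lambda>y. coord (True, l) v)" "smooth_on U (\<lambda>y. coord (False, l) v)" for l v
    by (rule smooth_on_const[OF assms(1)])+
  show "smooth_on U (\<lambda>y. belt (\<phi> y) j v)" for j v
    unfolding belt_def by (intro smooth_on_sum smooth_on_mult smooth_on_const assms)
  show "smooth_on U (\<lambda>y. (\<chi> i l. wirt (False, k) (\<lambda>y. \<phi> y $ i $ l) y) $ i $ j)" for k i j
    by (simp add: smooth_on_wirt assms)
qed

section \<open>Dolbeault operators on forms of pure type\<close>

context two_atlases
begin

lemma exterior_d_zero: "exterior_d B (\<lambda>_ _ _. 0) = (\<lambda>_ _ _. 0)"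
  by (simp add: exterior_d_def localize_def ext_deriv_def fun_eq_iff)

lemma type_proj_self:
  assumes "\<And>c x. c \<in> B \<Longrightarrow> x \<in> fst c \<Longrightarrow> \<omega> c x \<in> Lam (coframe_at C c x) p q"
    "\<And>c x. \<not> (c \<in> B \<and> x \<in> fst c) \<Longrightarrow> \<omega> c x = (\<lambda>_. 0)"
  shows "type_proj B C p' q' \<omega> = (if p' = p \<and> q' = q then \<omega> else (\<lambda>_ _ _. 0))"
proof (rule ext, rule ext)
  fix c x
  show "type_proj B C p' q' \<omega> c x = (if p' = p \<and> q' = q then \<omega> else (\<lambda>_ _ _. 0)) c x"
  proof (cases "c \<in> B \<and> x \<in> fst c")
    case False then show ?thesis using assms(2)[of c x] by (auto simp: type_proj_def localize_def)
  next
    case True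
    have w: "coframe_at C c x = coframe_of (Dtransition c (fibre_chart_at x) x)" using True coframe_C by blast
    have s: "surj (Dtransition c (fibre_chart_at x) x)" using True fibre_chart_at[of c x] by (intro surj_Dtransition) auto
    have "type_part (coframe_of (Dtransition c (fibre_chart_at x) x)) p' q' (\<omega> c x) = (if (p', q') \<in> {(p, q)} then \<omega> c x else (\<lambda>_. 0))"
      by (rule type_part_eq[OF s]) (use assms(1)[of c x] True w in auto)
    then show ?thesis using True by (simp add: type_proj_def localize_def w)
  qed
qed

lemma type_proj_zero: "type_proj B C p q (\<lambda>_ _ _. 0) = (\<lambda>_ _ _. 0)"
  using type_proj_self[of "\<lambda>_ _ _. 0" p q p q] by simp

text \<open>On a form of type (p,q) a single summand of the double sum in \<open>delbar\<close> or
  \<open>del\<close> survives, a component of d, and any decomposition of d into pure types computes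
  it.\<close>

lemma del_delbar_part:
  assumes \<omega>: "\<And>c x. c \<in> B \<Longrightarrow> x \<in> fst c \<Longrightarrow> \<omega> c x \<in> Lam (coframe_at C c x) p q"
    "\<And>c x. \<not> (c \<in> B \<and> x \<in> fst c) \<Longrightarrow> \<omega> c x = (\<lambda>_. 0)"
    and cx: "c \<in> B" "x \<in> fst c" and F: "finite F" "\<And>k. k \<in> F \<Longrightarrow> f k \<in> Lam (coframe_at C c x) (fst k) (snd k)"
    and d: "ext_deriv (\<lambda>y. \<omega> c (chart_inv c y)) (snd c x) = (\<lambda>vs. \<Sum>k\<in>F. f k vs)"
  shows "delbar B C \<omega> c x = (if (p, Suc q) \<in> F then f (p, Suc q) else (\<lambda>_. 0))"
    and "del B C \<omega> c x = (if (Suc p, q) \<in> F then f (Suc p, q) else (\<lambda>_. 0))"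
proof -
  have w: "coframe_at C c x = coframe_of (Dtransition c (fibre_chart_at x) x)" using cx coframe_C by blast
  have s: "surj (Dtransition c (fibre_chart_at x) x)" using cx fibre_chart_at[of c x] by (intro surj_Dtransition) auto
  have tp: "type_proj B C p' q' (exterior_d B \<omega>) c x = (if (p', q') \<in> F then f (p', q') else (\<lambda>_. 0))" for p' q'
    using cx type_part_eq[OF s F(1) F(2)[unfolded w] d]
    by (simp add: type_proj_def localize_def exterior_d_def w)
  have sum0: "(\<Sum>i\<le>CARD('n). \<Sum>j\<le>CARD('n). if i = p \<and> j = q then (K::complex) else 0)
      = (if p \<le> CARD('n) \<and> q \<le> CARD('n) then K else 0)" for K
  proof -
    have "(\<Sum>i\<le>CARD('n). \<Sum>j\<le>CARD('n). if i = p \<and> j = q then K else 0)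
      = (\<Sum>i\<le>CARD('n). if i = p then (\<Sum>j\<le>CARD('n). if j = q then K else 0) else 0)"
      by (intro sum.cong refl) auto
    then show ?thesis by simp
  qed
  \<comment> \<open>Outside the summation range of \<open>delbar\<close> the component is zero
    anyway, as there are no covectors of that type.\<close>
  have z: "f (p, Suc q) = (\<lambda>_. 0)" if "\<not> (p \<le> CARD('n) \<and> q \<le> CARD('n))" "(p, Suc q) \<in> F"
    using Lam_empty[OF _ F(2)[OF that(2)]] that(1) by auto
  have z': "f (Suc p, q) = (\<lambda>_. 0)" if "\<not> (p \<le> CARD('n) \<and> q \<le> CARD('n))" "(Suc p, q) \<in> F"
    using Lam_empty[OF _ F(2)[OF that(2)]] that(1) by auto
  show "delbar B C \<omega> c x = (if (p, Suc q) \<in> F then f (p, Suc q) else (\<lambda>_. 0))"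
  proof
    fix vs
    have "delbar B C \<omega> c x vs = (\<Sum>i\<le>CARD('n). \<Sum>j\<le>CARD('n). if i = p \<and> j = q
        then (if (p, Suc q) \<in> F then f (p, Suc q) else (\<lambda>_. 0)) vs else 0)"
      unfolding delbar_def by (intro sum.cong refl) (auto simp: type_proj_self[OF \<omega>] exterior_d_zero type_proj_zero tp)
    then show "delbar B C \<omega> c x vs = (if (p, Suc q) \<in> F then f (p, Suc q) else (\<lambda>_. 0)) vs"
      unfolding sum0 using z by auto
  qed
  show "del B C \<omega> c x = (if (Suc p, q) \<in> F then f (Suc p, q) else (\<lambda>_. 0))"
  proof
    fix vs
    have "del B C \<omega> c x vs = (\<Sum>i\<le>CARD('n). \<Sum>j\<le>CARD('n). if i = p \<and> j = q
        then (if (Suc p, q) \<in> F then f (Suc p, q) else (\<lambda>_. 0)) vs else 0)"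
      unfolding del_def by (intro sum.cong refl) (auto simp: type_proj_self[OF \<omega>] exterior_d_zero type_proj_zero tp)
    then show "del B C \<omega> c x vs = (if (Suc p, q) \<in> F then f (Suc p, q) else (\<lambda>_. 0)) vs"
      unfolding sum0 using z' by auto
  qed
qed

lemma delbar_outside: "\<not> (c \<in> B \<and> x \<in> fst c) \<Longrightarrow> delbar B C \<omega> c x = (\<lambda>_. 0)"
  by (auto simp: delbar_def type_proj_def localize_def)

lemma del_outside: "\<not> (c \<in> B \<and> x \<in> fst c) \<Longrightarrow> del B C \<omega> c x = (\<lambda>_. 0)"
  by (auto simp: del_def type_proj_def localize_def)

text \<open>Transition maps within B are holomorphic, so \<open>jac\<close> is their full
  differential and hence invertible.\<close>

lemma two_atlases_B: "two_atlases B B"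
proof unfold_locales
  show "pi10_iso B B"
    unfolding pi10_iso_def
  proof (intro ballI)
    fix c d x assume *: "c \<in> B" "d \<in> B" "x \<in> fst c \<inter> fst d"
    then have "jac (dcoord c d x) = Jac c d x" using dcoord_coframe_of[of c d x] by (simp add: Jac_def)
    then show "invertible (jac (dcoord c d x))"
      using Jac_matrix(2,3)[of c d x] * matrix_inv_unique(2) by auto
  qed
qed (use inj op sm holB in blast)+

text \<open>In a holomorphic chart of X_0 the coframe is constant, so the conjugate and the unbarred
  derivative terms of d already are its two pure parts.\<close>

lemma del_delbar_B:
  assumes s: "\<And>c x. c \<in> B \<Longrightarrow> x \<in> fst c \<Longrightarrow> s c x \<in> Lam std_coframe p q"
    "\<And>c x. \<not> (c \<in> B \<and> x \<in> fst c) \<Longrightarrow> s c x = (\<lambda>_. 0)"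
    and sm: "\<And>c. c \<in> B \<Longrightarrow> smooth_fam (snd c ` fst c) (\<lambda>y. s c (chart_inv c y))"
    and cx: "c \<in> B" "x \<in> fst c"
  shows "delbar B B s c x = (\<lambda>vs. \<Sum>l\<in>UNIV. wedge (one_form (coord (True, l))) (dwirt (True, l) (\<lambda>y. s c (chart_inv c y)) (snd c x)) vs)"
    and "del B B s c x = (\<lambda>vs. \<Sum>l\<in>UNIV. wedge (one_form (coord (False, l))) (dwirt (False, l) (\<lambda>y. s c (chart_inv c y)) (snd c x)) vs)"
proof -
  interpret BB: two_atlases B B by (rule two_atlases_B)
  define U where "U = snd c ` fst c"
  have U: "open U" "snd c x \<in> U" using open_dom[of c] cx by (auto simp: U_def)
  let ?s = "\<lambda>y. s c (chart_inv c y)"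
  have diff_fam: "diff_fam ?s (snd c x)" using smooth_fam_diff_fam[OF sm[OF cx(1)]] cx by auto
  have L: "?s y \<in> Lam std_coframe p q" if "y \<in> U" for y
    using that s(1)[OF cx(1)] chart_inv_id[of c] cx by (auto simp: U_def)
  have dL: "has_type std_coframe p q (dwirt g ?s (snd c x))" for g
    using dwirt_Lam[OF diff_fam U L] by (simp add: Lam_iff_has_type)
  define R where "R b = (\<lambda>vs. \<Sum>l\<in>UNIV. wedge (one_form (coord (b, l))) (dwirt (b, l) ?s (snd c x)) vs)" for b
  have RT: "R True \<in> Lam std_coframe p (Suc q)" and RF: "R False \<in> Lam std_coframe (Suc p) q"
    unfolding R_def Lam_iff_has_type coord_std_coframe by (intro has_type_sum has_type_dz has_type_dzb dL)+
  define f where "f k = (if k = (p, Suc q) then R True else R False)" for k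
  have "ext_deriv ?s (snd c x) = (\<lambda>vs. R False vs + R True vs)"
    unfolding ext_deriv_eq[OF diff_fam] R_def sum_bool_prod ..
  also have "\<dots> = (\<lambda>vs. \<Sum>k\<in>{(p, Suc q), (Suc p, q)}. f k vs)" by (simp add: f_def add.commute)
  finally have d: "ext_deriv ?s (snd c x) = (\<lambda>vs. \<Sum>k\<in>{(p, Suc q), (Suc p, q)}. f k vs)" .
  have f: "f k \<in> Lam (coframe_at B c x) (fst k) (snd k)" if "k \<in> {(p, Suc q), (Suc p, q)}" for k
    using that RT RF by (auto simp: f_def Lam_B cx)
  have s': "s c x \<in> Lam (coframe_at B c x) p q" if "c \<in> B" "x \<in> fst c" for c x
    using s(1)[OF that] Lam_B[OF that] by simp
  note e = BB.del_delbar_part[OF s' s(2) cx _ f d]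
  show "delbar B B s c x = (\<lambda>vs. \<Sum>l\<in>UNIV. wedge (one_form (coord (True, l))) (dwirt (True, l) ?s (snd c x)) vs)"
    using e(1) by (simp add: f_def R_def)
  show "del B B s c x = (\<lambda>vs. \<Sum>l\<in>UNIV. wedge (one_form (coord (False, l))) (dwirt (False, l) ?s (snd c x)) vs)"
    using e(2) by (simp add: f_def R_def)
qed

end

section \<open>P_t in charts: smoothness, compatibility and exterior derivative\<close>

context two_atlases
begin

lemma overlap:
  assumes "c \<in> B \<union> C" "y \<in> snd c ` (fst c \<inter> fst d)"
  shows "chart_inv c y \<in> fst c" "chart_inv c y \<in> fst d" "snd c (chart_inv c y) = y" "snd d (chart_inv c y) = transition c d y"
  using assms chart_inv_id[of c] by (auto simp: transition_def)

lemma smooth_Dtransition: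
  assumes "c \<in> B \<union> C" "d \<in> B \<union> C"
  shows "smooth_on (snd c ` (fst c \<inter> fst d)) (\<lambda>y. Dtransition c d (chart_inv c y) v)"
  by (rule smooth_on_cong[OF op[OF assms] smooth_on_derivative[OF sm[OF assms], where v=v]])
    (simp add: Dtransition_def overlap(3)[OF assms(1), where d=d])

lemma smooth_Dtransition_inverse:
  assumes "c \<in> B \<union> C" "d \<in> B \<union> C"
  shows "smooth_on (snd c ` (fst c \<inter> fst d)) (\<lambda>y. Dtransition d c (chart_inv c y) v)"
proof (rule smooth_on_cong[OF op[OF assms]])
  show "smooth_on (snd c ` (fst c \<inter> fst d)) (\<lambda>y. frechet_derivative (transition d c) (at (transition c d y)) v)"
  proof (rule smooth_on_compose[OF op[OF assms] op[OF assms(2,1)] _ sm[OF assms] smooth_on_derivative[OF sm[OF assms(2,1)]]])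
    show "transition c d ` (snd c ` (fst c \<inter> fst d)) \<subseteq> snd d ` (fst d \<inter> fst c)"
      using transition_at[of c _ d] assms by auto
  qed
  show "frechet_derivative (transition d c) (at (transition c d y)) v = Dtransition d c (chart_inv c y) v"
    if "y \<in> snd c ` (fst c \<inter> fst d)" for y
    using overlap(4)[OF assms(1) that] by (simp add: Dtransition_def)
qed

text \<open>Smoothness is local, and near a point both objects can be computed in a single chart of
  C, where they are built from the differentials of a smooth transition map and its inverse.\<close>

lemma
  assumes "c \<in> B"
  shows smooth_frame_at: "smooth_on (snd c ` fst c) (\<lambda>y. frame_at c (chart_inv c y) g v)"
    and smooth_beltrami: "smooth_on (snd c ` fst c) (\<lambda>y. beltrami C c (chart_inv c y) $ i $ j)"
proof -
  have c: "c \<in> B \<union> C" using assms by simp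
  have *: "\<exists>T. open T \<and> y \<in> T \<and> smooth_on T (\<lambda>y. frame_at c (chart_inv c y) g v) \<and>
      smooth_on T (\<lambda>y. beltrami C c (chart_inv c y) $ i $ j)" if "y \<in> snd c ` fst c" for y
  proof -
    from that obtain x where x: "x \<in> fst c" "y = snd c x" by blast
    obtain d where d: "d \<in> C" "x \<in> fst d" using cover assms x by blast
    let ?V = "snd c ` (fst c \<inter> fst d)"
    have d': "d \<in> B \<union> C" using d by simp
    have V: "open ?V" by (rule op[OF c d'])
    have i: "invertible (jac (coframe_of (Dtransition c d (chart_inv c y))))" if "y \<in> ?V" for y
      using jac_invertible[OF assms d(1)] overlap[OF c that] by blast
    have "smooth_on ?V (\<lambda>y. frame_of (Dtransition c d (chart_inv c y)) (Dtransition d c (chart_inv c y)) g v)"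
      by (rule smooth_frame_of[OF V smooth_Dtransition[OF c d'] smooth_Dtransition_inverse[OF c d'] i])
    then have 1: "smooth_on ?V (\<lambda>y. frame_at c (chart_inv c y) g v)"
      by (rule smooth_on_cong[OF V]) (simp add: frame_at_eq[OF assms d(1)] overlap(1,2)[OF c])
    have "smooth_on ?V (\<lambda>y. (matrix_inv (jac (coframe_of (Dtransition c d (chart_inv c y)))) ** jacbar (coframe_of (Dtransition c d (chart_inv c y)))) $ i $ j)"
      by (rule smooth_belt[OF V smooth_Dtransition[OF c d'] i])
    then have 2: "smooth_on ?V (\<lambda>y. beltrami C c (chart_inv c y) $ i $ j)"
      by (rule smooth_on_cong[OF V]) (simp add: frame_at_eq[OF assms d(1)] overlap(1,2)[OF c])
    show ?thesis using V 1 2 x d by (intro exI[of _ ?V]) auto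
  qed
  show "smooth_on (snd c ` fst c) (\<lambda>y. frame_at c (chart_inv c y) g v)"
    "smooth_on (snd c ` fst c) (\<lambda>y. beltrami C c (chart_inv c y) $ i $ j)"
    by (rule smooth_on_local[OF open_dom[OF c]], use * in blast)+
qed

lemma P_form_at: "c \<in> B \<Longrightarrow> x \<in> fst c \<Longrightarrow> P_form s c x = form_subst (frame_at c x) (s c x)"
  by (simp add: P_form_def localize_def)

lemma P_form_outside: "\<not> (c \<in> B \<and> x \<in> fst c) \<Longrightarrow> P_form s c x = (\<lambda>_. 0)"
  by (auto simp: P_form_def localize_def)

lemma chart_inv_dom: "c \<in> B \<union> C \<Longrightarrow> y \<in> snd c ` fst c \<Longrightarrow> chart_inv c y \<in> fst c \<and> snd c (chart_inv c y) = y"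
  using chart_inv_id[of c] by auto

lemma smooth_fam_P_form:
  assumes "c \<in> B" "smooth_fam (snd c ` fst c) (\<lambda>y. s c (chart_inv c y))"
  shows "smooth_fam (snd c ` fst c) (\<lambda>y. P_form s c (chart_inv c y))"
proof -
  have U: "open (snd c ` fst c)" using open_dom assms by simp
  show ?thesis
    by (rule smooth_fam_cong[OF U smooth_fam_form_subst[OF U smooth_frame_at[OF assms(1)] assms(2)]])
      (use chart_inv_dom[of c] assms(1) in \<open>simp add: P_form_at\<close>)
qed

lemma P_form_smooth_forms:
  assumes "s \<in> smooth_forms B B p q"
  shows "P_form s \<in> smooth_forms B C p q"
proof (rule smooth_formsI)
  have L: "s c x \<in> Lam std_coframe p q" if "c \<in> B" "x \<in> fst c" for c x
    using smooth_forms_Lam[OF assms that] Lam_B[OF that] by simp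
  show "P_form s c x \<in> Lam (coframe_at C c x) p q" if "c \<in> B" "x \<in> fst c" for c x
    using pointwise_P(2)[OF that L[OF that]] that by (simp add: P_form_at)
  show "smooth_fam (snd c ` fst c) (\<lambda>y. P_form s c (chart_inv c y))" if "c \<in> B" for c
    by (rule smooth_fam_P_form[where s=s, OF that smooth_forms_smooth_fam[OF assms that]])
  show "P_form s c x = pull (Dtransition c d x) (P_form s d x)" if *: "c \<in> B" "d \<in> B" "x \<in> fst c" "x \<in> fst d" for c d x
  proof
    fix vs
    have "alternating (s d x)" using alternating_Lam[of "s d x" "\<lambda>v. v"] L[of d x] * by (simp add: std_coframe_coframe_of linear_iff)
    from frame_at_natural[OF * this, of vs] show "P_form s c x vs = pull (Dtransition c d x) (P_form s d x) vs"
      using smooth_forms_pull[OF assms *] * by (simp add: P_form_at pull_def)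
  qed
qed (simp add: P_form_outside)

lemma wirt_transition:
  assumes "c \<in> B \<union> C" "d \<in> B \<union> C" "x \<in> fst c" "x \<in> fst d"
  shows "wirt g (\<lambda>y. transition c d y $ k) (snd c x) = ccoef g (\<lambda>v. Dtransition c d x v $ k)"
  unfolding wirt_def
  using fd_eq[OF bounded_linear.has_derivative[OF bounded_linear_vec_nth transition_derivative[OF assms]]] by simp

text \<open>On the overlap with one fixed chart d of X_t the transition map serves as holomorphic
  coordinates: its Beltrami equation yields the integrability of \<phi>, and
  \<open>frame_of_barred'\<close> supplies N, so the local computation applies.\<close>

lemma ext_deriv_P_form:
  assumes L: "\<And>c x. c \<in> B \<Longrightarrow> x \<in> fst c \<Longrightarrow> s c x \<in> Lam std_coframe p q"
    and smooth: "smooth_fam (snd c ` fst c) (\<lambda>y. s c (chart_inv c y))" and c: "c \<in> B" "x \<in> fst c"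
  shows "mod_type (coframe_at C c x) p q (\<lambda>vs. ext_deriv (\<lambda>y. P_form s c (chart_inv c y)) (snd c x) vs
    - form_subst (frame_at c x) (twisted_dbar (\<lambda>y. beltrami C c (chart_inv c y)) (\<lambda>y. s c (chart_inv c y)) (snd c x)) vs)"
proof -
  define d where "d = fibre_chart_at x"
  have d: "d \<in> C" "x \<in> fst d" using fibre_chart_at[OF c] by (auto simp: d_def)
  have cB: "c \<in> B \<union> C" and dC: "d \<in> B \<union> C" using c d by auto
  define V where "V = snd c ` (fst c \<inter> fst d)"
  have V: "open V" "snd c x \<in> V" using op[OF cB dC] c d by (auto simp: V_def)
  have VU: "V \<subseteq> snd c ` fst c" by (auto simp: V_def)
  have y: "chart_inv c y \<in> fst c" "chart_inv c y \<in> fst d" "snd c (chart_inv c y) = y" if "y \<in> V" for y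
    using overlap[OF cB that[unfolded V_def]] by auto
  have x: "chart_inv c (snd c x) = x" using chart_inv_id[OF cB c(2)] .
  let ?s = "\<lambda>y. s c (chart_inv c y)" and ?\<phi> = "\<lambda>y. beltrami C c (chart_inv c y)"
  let ?a = "\<lambda>y. frame_at c (chart_inv c y)"
  let ?T = "\<lambda>y. Dtransition c d (chart_inv c y)" and ?Ti = "\<lambda>y. Dtransition d c (chart_inv c y)"
  define N where "N y = (\<chi> j k. \<Sum>i\<in>UNIV. cnj (jacbar (coframe_of (?Ti y)) $ j $ i) * jac (coframe_of (?T y)) $ i $ k)" for y
  have lin: "linear (?T y)" "linear (?Ti y)" if "y \<in> V" for y
    using linear_Dtransition[OF cB dC] linear_Dtransition[OF dC cB] y[OF that] by auto
  have inv: "invertible (jac (coframe_of (?T y)))" if "y \<in> V" for y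
    using jac_invertible[OF c(1) d(1)] y[OF that] by auto
  have ae: "?a y = frame_of (?T y) (?Ti y)" "?\<phi> y = matrix_inv (jac (coframe_of (?T y))) ** jacbar (coframe_of (?T y))" if "y \<in> V" for y
    using frame_at_eq[OF c(1) d(1)] y[OF that] by auto
  have sN: "smooth_on V (\<lambda>y. N y $ i $ j)" for i j
    unfolding N_def vec_lambda_beta V_def
    by (intro smooth_on_sum smooth_on_mult smooth_on_cnj smooth_jac smooth_Dtransition smooth_Dtransition_inverse op cB dC)
  have s\<phi>: "smooth_on V (\<lambda>y. ?\<phi> y $ i $ j)" for i j
    by (rule smooth_on_subset[OF smooth_beltrami[OF c(1)] VU])
  have sa: "smooth_on V (\<lambda>y. ?a y g v)" for g v
    by (rule smooth_on_subset[OF smooth_frame_at[OF c(1)] VU])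
  have ss: "smooth_fam V ?s" using smooth VU unfolding smooth_fam_def by (blast intro: smooth_on_subset)
  have int: "wirt (True, m) (\<lambda>y. ?\<phi> y $ i $ l) (snd c x) - (\<Sum>k\<in>UNIV. ?\<phi> (snd c x) $ k $ m * wirt (False, k) (\<lambda>y. ?\<phi> y $ i $ l) (snd c x))
       = wirt (True, l) (\<lambda>y. ?\<phi> y $ i $ m) (snd c x) - (\<Sum>k\<in>UNIV. ?\<phi> (snd c x) $ k $ l * wirt (False, k) (\<lambda>y. ?\<phi> y $ i $ m) (snd c x))" for i m l
  proof (rule beltrami_integrable[OF V sm[OF cB dC, folded V_def] s\<phi>])
    have j: "wirt g (\<lambda>y. transition c d y $ k) y = (if fst g then jacbar (coframe_of (?T y)) $ k $ snd g else jac (coframe_of (?T y)) $ k $ snd g)"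
      if "y \<in> V" for g k y
      using wirt_transition[OF cB dC y(1,2)[OF that], of g k] y(3)[OF that]
      by (simp add: jac_def jacbar_def coframe_of_def ccoef_def)
    have "(\<chi> k j. wirt (False, j) (\<lambda>y. transition c d y $ k) (snd c x)) = jac (coframe_of (?T (snd c x)))"
      by (simp add: j[OF V(2)] vec_eq_iff)
    then show "invertible (\<chi> k j. wirt (False, j) (\<lambda>y. transition c d y $ k) (snd c x))" using inv[OF V(2)] by simp
    show "wirt (True, l) (\<lambda>y. transition c d y $ k) u = (\<Sum>i\<in>UNIV. wirt (False, i) (\<lambda>y. transition c d y $ k) u * ?\<phi> u $ i $ l)"
      if u: "u \<in> V" for u k l
    proof -
      have "jac (coframe_of (?T u)) ** ?\<phi> u = jacbar (coframe_of (?T u))"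
        unfolding ae(2)[OF u] by (simp add: matrix_mul_assoc matrix_inv_works[OF inv[OF u]])
      then have "jacbar (coframe_of (?T u)) $ k $ l = (jac (coframe_of (?T u)) ** ?\<phi> u) $ k $ l" by simp
      then show ?thesis by (simp add: j[OF u] matrix_matrix_mult_def)
    qed
  qed
  have w: "\<exists>e. ?a (snd c x) (False, j) = (\<lambda>v. \<Sum>k\<in>UNIV. e k * coframe_at C c x k v)"
    "\<exists>e. ?a (snd c x) (True, j) = (\<lambda>v. \<Sum>k\<in>UNIV. e k * cnj (coframe_at C c x k v))" for j
    unfolding x frame_at_def coframe_C[OF c] by (rule frame_of_span)+
  have "mod_type (coframe_at C c x) p q (\<lambda>vs. ext_deriv (\<lambda>y. form_subst (?a y) (?s y)) (snd c x) vs
      - form_subst (?a (snd c x)) (twisted_dbar ?\<phi> ?s (snd c x)) vs)"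
  proof (rule ext_deriv_form_subst[OF V ss _ s\<phi> sN sa _ _ int w])
    show "?s u \<in> Lam std_coframe p q" if "u \<in> V" for u using L[OF c(1)] y[OF that] by blast
    show "?a u (False, j) v = coord (False, j) v + belt (?\<phi> u) j v" if "u \<in> V" for u j v
      unfolding ae[OF that] by (rule frame_of_unbarred[OF lin(1) inv]) (use that in auto)
    show "coord (True, j) v = ?a u (True, j) v + (\<Sum>k\<in>UNIV. N u $ j $ k * ?a u (False, k) v)" if "u \<in> V" for u j v
      unfolding ae[OF that] N_def vec_lambda_beta
      by (rule frame_of_barred'[OF lin Dtransition_inverse[OF cB dC] inv]) (use that y in auto)
  qed
  moreover have "ext_deriv (\<lambda>y. P_form s c (chart_inv c y)) (snd c x) = ext_deriv (\<lambda>y. form_subst (?a y) (?s y)) (snd c x)"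
  proof (rule ext_deriv_cong[OF V])
    show "diff_fam (\<lambda>y. P_form s c (chart_inv c y)) (snd c x)"
      by (rule smooth_fam_diff_fam[OF smooth_fam_P_form[where s=s, OF c(1) smooth]]) (use c in auto)
  qed (use y c in \<open>auto simp: P_form_at\<close>)
  ultimately show ?thesis by (simp add: x)
qed

text \<open>\<open>ins f\<close> is a derivation of degree zero: the sign from passing dz^j in the
  contraction cancels against the exchange of the two one-forms.\<close>

lemma ins_wedge_one_form:
  "ins f (wedge (one_form (coord (False, j))) \<beta>) = (\<lambda>vs. wedge (one_form (belt f j)) \<beta> vs + wedge (one_form (coord (False, j))) (ins f \<beta>) vs)"
proof
  fix vs
  have "ins f (wedge (one_form (coord (False, j))) \<beta>) vs = (\<Sum>i\<in>UNIV. (if i = j then wedge (one_form (belt f i)) \<beta> vs else 0)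
     - wedge (one_form (belt f i)) (wedge (one_form (coord (False, j))) (contr (False, i) \<beta>)) vs)"
    unfolding ins_eq contr_wedge_one_form by (simp add: wedge_linear) (intro sum.cong refl, auto)
  also have "\<dots> = (\<Sum>i\<in>UNIV. (if i = j then wedge (one_form (belt f i)) \<beta> vs else 0)
     + wedge (one_form (coord (False, j))) (wedge (one_form (belt f i)) (contr (False, i) \<beta>)) vs)"
    by (intro sum.cong refl) (simp add: wedge_one_form_comm[of "belt f i" for i])
  finally show "ins f (wedge (one_form (coord (False, j))) \<beta>) vs
     = wedge (one_form (belt f j)) \<beta> vs + wedge (one_form (coord (False, j))) (ins f \<beta>) vs"
    unfolding ins_eq[of f \<beta>] by (simp add: sum.distrib wedge_linear)
qed

text \<open>In the commutator of i_\<phi> and the operator \<open>del\<close>, the terms contracting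
  \<phi> with a derivative of s occur in both products and cancel. What remains is \<phi>^j wedged
  with the j-th derivative of s and the terms in which \<phi> is differentiated.\<close>

lemma delbar_minus_L10:
  assumes s: "\<And>c x. c \<in> B \<Longrightarrow> x \<in> fst c \<Longrightarrow> s c x \<in> Lam std_coframe p q"
    "\<And>c x. \<not> (c \<in> B \<and> x \<in> fst c) \<Longrightarrow> s c x = (\<lambda>_. 0)"
    and smooth: "\<And>c. c \<in> B \<Longrightarrow> smooth_fam (snd c ` fst c) (\<lambda>y. s c (chart_inv c y))"
  shows "c \<in> B \<Longrightarrow> x \<in> fst c \<Longrightarrow> (delbar B B s - L10 B (beltrami C) s) c x
      = twisted_dbar (\<lambda>y. beltrami C c (chart_inv c y)) (\<lambda>y. s c (chart_inv c y)) (snd c x)"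
    and "\<not> (c \<in> B \<and> x \<in> fst c) \<Longrightarrow> (delbar B B s - L10 B (beltrami C) s) c x = (\<lambda>_. 0)"
proof -
  interpret BB: two_atlases B B by (rule two_atlases_B)
  let ?u = "i_phi B (beltrami C) s"
  have u_at: "?u c x = ins (beltrami C c x) (s c x)" if "c \<in> B" "x \<in> fst c" for c x
    using that by (simp add: i_phi_def localize_def)
  have u_out: "?u c x = (\<lambda>_. 0)" if "\<not> (c \<in> B \<and> x \<in> fst c)" for c x
    using that by (auto simp: i_phi_def localize_def)
  \<comment> \<open>For p = 0 the form is zero, so the type (p - 1, q + 1) with p - 1 = 0 is still
    correct.\<close>
  have u_Lam: "?u c x \<in> Lam std_coframe (p - 1) (Suc q)" if "c \<in> B" "x \<in> fst c" for c x
  proof -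
    have c: "belt f j = (\<lambda>v. \<Sum>l\<in>UNIV. f $ j $ l * cnj (std_coframe l v))" for f :: "'n cmat" and j
      by (simp add: belt_def std_coframe_def fun_eq_iff)
    have "has_type std_coframe (p - 1) q (contr (False, i) (s c x))" for i
      using has_type_contr[of p q "s c x" i] s(1)[OF that] by (cases p) (auto simp: Lam_iff_has_type has_type_zero)
    then show ?thesis
      unfolding u_at[OF that] ins_eq Lam_iff_has_type by (intro has_type_sum has_type_wedge_span_bar[OF _ c])
  qed
  have u_smooth_fam: "smooth_fam (snd c ` fst c) (\<lambda>y. ?u c (chart_inv c y))" if c: "c \<in> B" for c
  proof -
    have U: "open (snd c ` fst c)" using open_dom c by simp
    show ?thesis
      by (rule smooth_fam_cong[OF U smooth_fam_ins[OF U smooth_beltrami[OF c] smooth[OF c]]])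
        (use chart_inv_dom[of c] c in \<open>simp add: u_at\<close>)
  qed
  show "(delbar B B s - L10 B (beltrami C) s) c x = (\<lambda>_. 0)" if o: "\<not> (c \<in> B \<and> x \<in> fst c)"
    using BB.delbar_outside[OF o] BB.del_outside[OF o]
    by (simp add: L10_def fun_diff_def i_phi_def localize_def o)
  assume c: "c \<in> B" "x \<in> fst c"
  let ?s = "\<lambda>y. s c (chart_inv c y)" and ?\<phi> = "\<lambda>y. beltrami C c (chart_inv c y)" and ?y = "snd c x"
  have x: "chart_inv c ?y = x" using chart_inv_id c by simp
  define U where "U = snd c ` fst c"
  have U: "open U" "?y \<in> U" using open_dom[of c] c by (auto simp: U_def)
  have diff_fam: "diff_fam ?s ?y" using smooth_fam_diff_fam[OF smooth[OF c(1)]] c by auto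
  have d\<phi>: "(\<lambda>y. ?\<phi> y $ i $ j) differentiable (at ?y)" for i j
    using smooth_on_differentiable[OF smooth_beltrami[OF c(1)]] c by auto
  let ?W = "\<lambda>g. wedge (one_form (coord g))"
  define f where "f = beltrami C c x"
  have "dwirt g (\<lambda>y. ?u c (chart_inv c y)) ?y = dwirt g (\<lambda>y. ins (?\<phi> y) (?s y)) ?y" for g
  proof
    fix vs
    show "dwirt g (\<lambda>y. ?u c (chart_inv c y)) ?y vs = dwirt g (\<lambda>y. ins (?\<phi> y) (?s y)) ?y vs"
      unfolding dwirt_def
    proof (rule wirt_cong[OF U])
      show "(\<lambda>y. ?u c (chart_inv c y) vs) differentiable (at ?y)"
        using smooth_fam_diff_fam[OF u_smooth_fam[OF c(1)], of ?y] c by (auto simp: diff_fam_def)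
    qed (use chart_inv_dom[of c] c in \<open>auto simp: u_at U_def\<close>)
  qed
  then have ddu: "dwirt g (\<lambda>y. ?u c (chart_inv c y)) ?y
      = (\<lambda>vs. ins (\<chi> i j. wirt g (\<lambda>y. ?\<phi> y $ i $ j) ?y) (s c x) vs + ins f (dwirt g ?s ?y) vs)" for g
    by (simp add: ins_eq_dwirt(1)[OF d\<phi> diff_fam] x f_def)
  have 1: "i_phi B (beltrami C) (del B B s) c x = (\<lambda>vs. \<Sum>j\<in>UNIV. wedge (one_form (belt f j)) (dwirt (False, j) ?s ?y) vs
     + ?W (False, j) (ins f (dwirt (False, j) ?s ?y)) vs)"
    using c by (simp add: i_phi_def localize_def del_delbar_B(2)[where s=s, OF s smooth c] ins_sum ins_wedge_one_form f_def)
  have 2: "del B B ?u c x = (\<lambda>vs. \<Sum>k\<in>UNIV. ?W (False, k) (ins (\<chi> i j. wirt (False, k) (\<lambda>y. ?\<phi> y $ i $ j) ?y) (s c x)) vs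
     + ?W (False, k) (ins f (dwirt (False, k) ?s ?y)) vs)"
    by (subst del_delbar_B(2)[where s="?u", OF u_Lam u_out u_smooth_fam c]) (simp_all add: ddu wedge_linear)
  have 3: "delbar B B s c x = (\<lambda>vs. \<Sum>l\<in>UNIV. ?W (True, l) (dwirt (True, l) ?s ?y) vs)"
    by (rule del_delbar_B(1)[where s=s, OF s smooth c])
  show "(delbar B B s - L10 B (beltrami C) s) c x = twisted_dbar ?\<phi> ?s ?y"
  proof
    fix vs
    have "(delbar B B s - L10 B (beltrami C) s) c x vs = delbar B B s c x vs
       - (i_phi B (beltrami C) (del B B s) c x vs - del B B ?u c x vs)"
      by (simp add: L10_def)
    also have "\<dots> = twisted_dbar ?\<phi> ?s ?y vs"
      unfolding 1 2 3 twisted_dbar_def x f_def[symmetric] by (simp add: sum.distrib)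
    finally show "(delbar B B s - L10 B (beltrami C) s) c x vs = twisted_dbar ?\<phi> ?s ?y vs" .
  qed
qed

text \<open>The error terms have no (p,q+1)-part, so that part of d (P_t s) is the substitution
  applied to s', the twisted derivative of s. To evaluate \<open>P_map\<close> at s', the form
  \<open>P_form s'\<close> must be smooth and compatible between charts; the compatibility comes
  from the naturality of d and of the type decomposition.\<close>

theorem delbar_P_map:
  assumes s: "s \<in> smooth_forms B B p q"
  shows "P_map B C p q s \<in> smooth_forms B C p q"
    and "delbar B C (P_map B C p q s) = P_map B C p (Suc q) (delbar B B s - L10 B (beltrami C) s)"
proof -
  have L: "s c x \<in> Lam std_coframe p q" if "c \<in> B" "x \<in> fst c" for c x
    using smooth_forms_Lam[OF s that] Lam_B[OF that] by simp
  have out: "s c x = (\<lambda>_. 0)" if "\<not> (c \<in> B \<and> x \<in> fst c)" for c x by (rule smooth_forms_zero[OF s that])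
  have smooth: "smooth_fam (snd c ` fst c) (\<lambda>y. s c (chart_inv c y))" if "c \<in> B" for c by (rule smooth_forms_smooth_fam[OF s that])
  have Ps: "P_form s \<in> smooth_forms B C p q" by (rule P_form_smooth_forms[OF s])
  have P: "P_map B C p q s = P_form s" by (rule P_map_eq[OF L Ps])
  show "P_map B C p q s \<in> smooth_forms B C p q" unfolding P by (rule Ps)
  define s' where "s' = delbar B B s - L10 B (beltrami C) s"
  have s': "s' c x = twisted_dbar (\<lambda>y. beltrami C c (chart_inv c y)) (\<lambda>y. s c (chart_inv c y)) (snd c x)"
    if "c \<in> B" "x \<in> fst c" for c x
    unfolding s'_def by (rule delbar_minus_L10(1)[OF L out smooth that])
  have s'L: "s' c x \<in> Lam std_coframe p (Suc q)" if c: "c \<in> B" "x \<in> fst c" for c x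
    unfolding s'[OF c]
  proof (rule twisted_dbar_Lam)
    show "diff_fam (\<lambda>y. s c (chart_inv c y)) (snd c x)" using smooth_fam_diff_fam[OF smooth] c by auto
    show "open (snd c ` fst c)" "snd c x \<in> snd c ` fst c" using open_dom[of c] c by auto
    show "s c (chart_inv c y) \<in> Lam std_coframe p q" if "y \<in> snd c ` fst c" for y
      using chart_inv_dom[of c y] that L c by auto
  qed
  have s'smf: "smooth_fam (snd c ` fst c) (\<lambda>y. s' c (chart_inv c y))" if c: "c \<in> B" for c
  proof -
    have U: "open (snd c ` fst c)" using open_dom c by simp
    show ?thesis
      by (rule smooth_fam_cong[OF U smooth_fam_twisted_dbar[OF U smooth[OF c] smooth_beltrami[OF c]]])
        (use chart_inv_dom[of c] c in \<open>simp add: s'\<close>)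
  qed
  define E where "E c x = ext_deriv (\<lambda>y. P_form s c (chart_inv c y)) (snd c x)" for c x
  \<comment> \<open>A decomposition of d (P_t s) with explicit (p,q+1)-part. F has two elements for
    q = 0, where no type (p+2, q-1) exists, and three otherwise.\<close>
  have dec: "\<exists>F f. finite F \<and> (\<forall>k\<in>F. f k \<in> Lam (coframe_at C c x) (fst k) (snd k)) \<and>
      E c x = (\<lambda>vs. \<Sum>k\<in>F. f k vs) \<and> (p, Suc q) \<in> F \<and> f (p, Suc q) = P_form s' c x"
    if c: "c \<in> B" "x \<in> fst c" for c x
  proof -
    let ?w = "coframe_at C c x"
    obtain R1 R2 where R: "(\<lambda>vs. E c x vs - P_form s' c x vs) = (\<lambda>vs. R1 vs + R2 vs)" "has_type ?w (Suc p) q R1"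
        "case q of 0 \<Rightarrow> R2 = (\<lambda>_. 0) | Suc q' \<Rightarrow> has_type ?w (Suc (Suc p)) q' R2"
      using ext_deriv_P_form[where s=s, OF L smooth[OF c(1)] c] unfolding mod_type_def E_def s'[OF c, symmetric] P_form_at[OF c] by blast
    have e: "E c x vs = P_form s' c x vs + R1 vs + R2 vs" for vs
      using fun_cong[OF R(1), of vs] by (simp add: algebra_simps)
    have PL: "P_form s' c x \<in> Lam ?w p (Suc q)"
      using pointwise_P(2)[OF c s'L[OF c]] c by (simp add: P_form_at)
    define f where "f k = (if k = (p, Suc q) then P_form s' c x else if k = (Suc p, q) then R1 else R2)" for k
    show ?thesis
    proof (cases q)
      case 0
      then have "E c x = (\<lambda>vs. \<Sum>k\<in>{(p, Suc q), (Suc p, q)}. f k vs)"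
        using R(3) by (simp add: f_def e fun_eq_iff)
      then show ?thesis
        using PL R(2) by (intro exI[of _ "{(p, Suc q), (Suc p, q)}"] exI[of _ f]) (auto simp: f_def Lam_iff_has_type)
    next
      case (Suc q')
      then have "E c x = (\<lambda>vs. \<Sum>k\<in>{(p, Suc q), (Suc p, q), (Suc (Suc p), q')}. f k vs)"
        by (simp add: f_def e fun_eq_iff)
      then show ?thesis
        using PL R(2,3) Suc
        by (intro exI[of _ "{(p, Suc q), (Suc p, q), (Suc (Suc p), q')}"] exI[of _ f]) (auto simp: f_def Lam_iff_has_type)
    qed
  qed
  have main: "delbar B C (P_form s) = P_form s'"
  proof (rule ext, rule ext)
    fix c x
    show "delbar B C (P_form s) c x = P_form s' c x"
    proof (cases "c \<in> B \<and> x \<in> fst c")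
      case False then show ?thesis by (simp add: delbar_outside P_form_outside)
    next
      case True
      then have c: "c \<in> B" "x \<in> fst c" by auto
      obtain F f where F: "finite F" "\<And>k. k \<in> F \<Longrightarrow> f k \<in> Lam (coframe_at C c x) (fst k) (snd k)"
        "E c x = (\<lambda>vs. \<Sum>k\<in>F. f k vs)" "(p, Suc q) \<in> F" "f (p, Suc q) = P_form s' c x"
        using dec[OF c] by blast
      show ?thesis
        using del_delbar_part(1)[OF smooth_forms_Lam[OF Ps] smooth_forms_zero[OF Ps] c F(1,2) F(3)[unfolded E_def]] F(4,5)
        by simp
    qed
  qed
  \<comment> \<open>Near x the representatives of \<open>P_form s\<close> in c and d differ by
    pullback along the transition map, and d commutes with pullback.\<close>
  have E_pull: "E c x = pull (Dtransition c d x) (E d x)" if *: "c \<in> B" "d \<in> B" "x \<in> fst c" "x \<in> fst d" for c d x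
  proof -
    have cB: "c \<in> B \<union> C" and dB: "d \<in> B \<union> C" using * by auto
    let ?V = "snd c ` (fst c \<inter> fst d)"
    have V: "open ?V" "snd c x \<in> ?V" using op[OF cB dB] * by auto
    have P: "P_form s c (chart_inv c y) = pull (frechet_derivative (transition c d) (at y)) (P_form s d (chart_inv d (transition c d y)))"
      if "y \<in> ?V" for y
    proof -
      note o = overlap[OF cB that]
      have "chart_inv d (transition c d y) = chart_inv c y" using chart_inv_id[OF dB o(2)] o(4) by simp
      then show ?thesis
        using smooth_forms_pull[OF Ps *(1,2) o(1,2)] o(3) by (simp add: Dtransition_def)
    qed
    have "E c x = ext_deriv (\<lambda>y. pull (frechet_derivative (transition c d) (at y)) (P_form s d (chart_inv d (transition c d y)))) (snd c x)"
      unfolding E_def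
    proof (rule ext_deriv_cong[OF V P])
      show "diff_fam (\<lambda>y. P_form s c (chart_inv c y)) (snd c x)"
        by (rule smooth_fam_diff_fam[OF smooth_forms_smooth_fam[OF Ps *(1)]]) (use * in auto)
    qed auto
    also have "\<dots> = pull (frechet_derivative (transition c d) (at (snd c x))) (ext_deriv (\<lambda>y. P_form s d (chart_inv d y)) (transition c d (snd c x)))"
    proof (rule ext_deriv_pull[OF V open_dom[OF dB] _ sm[OF cB dB] smooth_forms_smooth_fam[OF Ps *(2)]])
      show "transition c d ` ?V \<subseteq> snd d ` fst d" using transition_at[OF cB, of _ d] by auto
      show "alternating (P_form s d (chart_inv d u))" if "u \<in> snd d ` fst d" for u
      proof -
        have u: "chart_inv d u \<in> fst d" using chart_inv_dom[OF dB that] by simp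
        show ?thesis
          using smooth_forms_Lam[OF Ps *(2) u] coframe_C[OF *(2) u] fibre_chart_at[OF *(2) u] linear_Dtransition[OF dB, of "fibre_chart_at (chart_inv d u)" "chart_inv d u"] u alternating_Lam
          by auto
      qed
    qed
    finally show ?thesis using transition_at[OF cB *(3), of d] by (simp add: E_def Dtransition_def)
  qed
  have Ps': "P_form s' \<in> smooth_forms B C p (Suc q)"
  proof (rule smooth_formsI)
    show "P_form s' c x \<in> Lam (coframe_at C c x) p (Suc q)" if "c \<in> B" "x \<in> fst c" for c x
      using pointwise_P(2)[OF that s'L[OF that]] that by (simp add: P_form_at)
    show "smooth_fam (snd c ` fst c) (\<lambda>y. P_form s' c (chart_inv c y))" if "c \<in> B" for c
      by (rule smooth_fam_P_form[where s=s', OF that s'smf[OF that]])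
    \<comment> \<open>Both sides are the (p,q+1)-part of d (P_t s) in the chart c: the left one
      directly, the right one by pulling back the decomposition obtained in d.\<close>
    show "P_form s' c x = pull (Dtransition c d x) (P_form s' d x)" if *: "c \<in> B" "d \<in> B" "x \<in> fst c" "x \<in> fst d" for c d x
    proof -
      let ?e = "fibre_chart_at x"
      have e: "?e \<in> C" "x \<in> fst ?e" using fibre_chart_at[of c x] * by auto
      have sur: "surj (Dtransition c ?e x)" using * e by (intro surj_Dtransition) auto
      have w: "coframe_at C c x = coframe_of (Dtransition c ?e x)" "coframe_at C d x = coframe_of (Dtransition d ?e x)"
        using coframe_C * by auto
      have ch: "Dtransition c ?e x = (\<lambda>v. Dtransition d ?e x (Dtransition c d x v))"
        using Dtransition_chain[of c d ?e x] * e by (auto simp: fun_eq_iff)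
      obtain F f where F: "finite F" "\<And>k. k \<in> F \<Longrightarrow> f k \<in> Lam (coframe_at C c x) (fst k) (snd k)"
        "E c x = (\<lambda>vs. \<Sum>k\<in>F. f k vs)" "(p, Suc q) \<in> F" "f (p, Suc q) = P_form s' c x"
        using dec[OF *(1,3)] by blast
      obtain G g where G: "finite G" "\<And>k. k \<in> G \<Longrightarrow> g k \<in> Lam (coframe_at C d x) (fst k) (snd k)"
        "E d x = (\<lambda>vs. \<Sum>k\<in>G. g k vs)" "(p, Suc q) \<in> G" "g (p, Suc q) = P_form s' d x"
        using dec[OF *(2,4)] by blast
      have t1: "type_part (coframe_at C c x) p (Suc q) (E c x) = P_form s' c x"
        unfolding w using type_part_eq[OF sur F(1) F(2)[unfolded w] F(3), of p "Suc q"] F(4,5) by simp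
      have gp: "pull (Dtransition c d x) (g k) \<in> Lam (coframe_of (Dtransition c ?e x)) (fst k) (snd k)" if "k \<in> G" for k
      proof -
        from G(2)[OF that] obtain b where b: "b \<in> Lam std_coframe (fst k) (snd k)" "g k = pull (Dtransition d ?e x) b"
          unfolding w Lam_pull by blast
        then have "pull (Dtransition c d x) (g k) = pull (Dtransition c ?e x) b" by (simp add: pull_def ch o_def)
        then show ?thesis using b Lam_pull by blast
      qed
      have "E c x = (\<lambda>vs. \<Sum>k\<in>G. pull (Dtransition c d x) (g k) vs)"
        unfolding E_pull[OF *] G(3) by (simp add: pull_def)
      from type_part_eq[OF sur G(1) gp this, of p "Suc q"] G(4,5)
      have t2: "type_part (coframe_at C c x) p (Suc q) (E c x) = pull (Dtransition c d x) (P_form s' d x)"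
        unfolding w by simp
      show ?thesis using t1 t2 by simp
    qed
  qed (simp add: P_form_outside)
  have "P_map B C p (Suc q) s' = P_form s'" by (rule P_map_eq[OF s'L Ps'])
  then show "delbar B C (P_map B C p q s) = P_map B C p (Suc q) (delbar B B s - L10 B (beltrami C) s)"
    unfolding P main s'_def by simp
qed

end

section \<open>Holomorphic maps\<close>

lemma holo_on_smooth: "holo_on S f \<Longrightarrow> smooth_on S f"
  by (simp add: holo_on_def)

lemma holo_on_derivative:
  "holo_on S f \<Longrightarrow> x \<in> S \<Longrightarrow> frechet_derivative f (at x) (c *s v) = c *s frechet_derivative f (at x) v"
  unfolding holo_on_def by blast

lemma holo_on_subset: "holo_on S f \<Longrightarrow> T \<subseteq> S \<Longrightarrow> holo_on T f"
  unfolding holo_on_def using smooth_on_subset by blast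

lemma holo_on_cong:
  assumes "open S" "holo_on S f" "\<And>x. x \<in> S \<Longrightarrow> f x = g x" shows "holo_on S g"
  unfolding holo_on_def
proof (intro conjI ballI allI)
  show "smooth_on S g" by (rule smooth_on_cong[OF assms(1) holo_on_smooth[OF assms(2)] assms(3)])
  fix x c v assume x: "x \<in> S"
  have "frechet_derivative f (at x) = frechet_derivative g (at x)"
    by (rule frechet_derivative_transform_within_open[OF _ assms(1) x assms(3)])
      (rule smooth_on_differentiable[OF holo_on_smooth[OF assms(2)] x])
  then show "frechet_derivative g (at x) (c *s v) = c *s frechet_derivative g (at x) v"
    using holo_on_derivative[OF assms(2) x] by simp
qed

lemma holo_on_local:
  assumes "open S" "\<And>x. x \<in> S \<Longrightarrow> \<exists>T. open T \<and> x \<in> T \<and> holo_on T f"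
  shows "holo_on S f"
  unfolding holo_on_def
proof (intro conjI ballI allI)
  show "smooth_on S f" by (rule smooth_on_local[OF assms(1)]) (use assms(2) holo_on_smooth in blast)
qed (use assms(2) holo_on_derivative in blast)

lemma holo_on_compose:
  assumes "open S" "open T" "f ` S \<subseteq> T" "holo_on S f" "holo_on T g"
  shows "holo_on S (\<lambda>x. g (f x))"
  unfolding holo_on_def
proof (intro conjI ballI allI)
  show "smooth_on S (\<lambda>x. g (f x))"
    by (rule smooth_on_compose[OF assms(1-3) holo_on_smooth[OF assms(4)] holo_on_smooth[OF assms(5)]])
  fix x c v assume x: "x \<in> S"
  then have fx: "f x \<in> T" using assms(3) by auto
  have "frechet_derivative (\<lambda>x. g (f x)) (at x) = (\<lambda>v. frechet_derivative g (at (f x)) (frechet_derivative f (at x) v))"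
    by (rule fd_eq[OF has_derivative_compose[OF smooth_on_has_derivative[OF holo_on_smooth[OF assms(4)] x]
        smooth_on_has_derivative[OF holo_on_smooth[OF assms(5)] fx]]])
  then show "frechet_derivative (\<lambda>x. g (f x)) (at x) (c *s v) = c *s frechet_derivative (\<lambda>x. g (f x)) (at x) v"
    using holo_on_derivative[OF assms(4) x] holo_on_derivative[OF assms(5) fx] by simp
qed

lemma holo_on_linear:
  fixes L :: "complex ^ 'a::finite \<Rightarrow> complex ^ 'b::finite"
  assumes "open S" "linear L" "\<And>c v. L (c *s v) = c *s L v"
  shows "holo_on S L"
proof -
  have L: "bounded_linear L" using assms(2) by (simp add: linear_conv_bounded_linear)
  show ?thesis
    unfolding holo_on_def using smooth_on_linear[OF assms(1) L] fd_eq[OF bounded_linear_imp_has_derivative[OF L]] assms(3)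
    by simp
qed

lemma linear_matrix_vector: "linear (\<lambda>v. (M :: complex ^ 'a ^ 'b) *v v)"
  by (auto simp: linear_iff vec_eq_iff matrix_vector_nth sum.distrib sum_distrib_left scaleRc algebra_simps)

lemma matrix_vector_scale: "(M :: complex ^ 'a ^ 'b) *v (c *s v) = c *s (M *v v)"
  by (simp add: vec_eq_iff matrix_vector_nth sum_distrib_left algebra_simps)

lemma invertible_of_inj:
  fixes M :: "complex ^ 'n ^ 'n"
  assumes "\<And>v. M *v v = 0 \<Longrightarrow> v = 0" shows "invertible M"
proof -
  have "\<exists>B. B ** M = mat 1" using assms by (simp add: matrix_left_invertible_ker)
  then show ?thesis by (simp add: invertible_left_inverse)
qed

text \<open>The real inverse function theorem gives a differentiable inverse g whose derivative at y
  is the inverse of the derivative of f at g y. This identity raises the regularity of g order by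
  order, and the inverse of a complex matrix is complex linear.\<close>

lemma holo_inverse_function:
  fixes f :: "complex ^ 'k::finite \<Rightarrow> complex ^ 'k"
  assumes S: "open S" "x0 \<in> S" and f: "holo_on S f"
    and inj: "\<And>v. frechet_derivative f (at x0) v = 0 \<Longrightarrow> v = 0"
  obtains U V g where "open U" "U \<subseteq> S" "x0 \<in> U" "open V" "homeomorphism U V f g" "holo_on V g"
proof -
  define M where "M x = jac (coframe_of (frechet_derivative f (at x)))" for x
  have fd: "(f has_derivative frechet_derivative f (at x)) (at x)" if "x \<in> S" for x
    by (rule smooth_on_has_derivative[OF holo_on_smooth[OF f] that])
  have M: "frechet_derivative f (at x) v = M x *v v" if "x \<in> S" for x v
    unfolding M_def
    by (rule complex_linear_matrix[OF has_derivative_linear[OF fd[OF that]] holo_on_derivative[OF f that]])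
  have bl: "bounded_linear (frechet_derivative f (at x))" if "x \<in> S" for x
    using fd[OF that] has_derivative_bounded_linear by blast
  define f' where "f' x = Blinfun (frechet_derivative f (at x))" for x
  have f': "blinfun_apply (f' x) = frechet_derivative f (at x)" if "x \<in> S" for x
    unfolding f'_def by (rule bounded_linear_Blinfun_apply[OF bl[OF that]])
  have cont: "continuous_on S f'"
  proof (rule continuous_on_blinfun_componentwise)
    fix b :: "complex ^ 'k" assume "b \<in> Basis"
    have "continuous_on S (\<lambda>x. frechet_derivative f (at x) b)"
      by (rule smooth_on_continuous[OF smooth_on_derivative[OF holo_on_smooth[OF f]]])
    then show "continuous_on S (\<lambda>x. blinfun_apply (f' x) b)"
      by (rule continuous_on_eq) (simp add: f')
  qed
  have i0: "invertible (M x0)" by (rule invertible_of_inj) (use inj M[OF S(2)] in simp)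
  have bi: "bounded_linear (\<lambda>v. matrix_inv (M x0) *v v)"
    using linear_matrix_vector by (simp add: linear_conv_bounded_linear)
  have inv: "Blinfun (\<lambda>v. matrix_inv (M x0) *v v) o\<^sub>L f' x0 = id_blinfun"
    by (rule blinfun_eqI)
      (simp add: bounded_linear_Blinfun_apply[OF bi] f'[OF S(2)] M[OF S(2)] matrix_vector_mul_assoc matrix_inv_works[OF i0])
  obtain U V g g' where U: "open U" "U \<subseteq> S" "x0 \<in> U" "open V" "f x0 \<in> V" "homeomorphism U V f g"
    and g: "\<And>y. y \<in> V \<Longrightarrow> (g has_derivative (g' y)) (at y)"
    "\<And>y. y \<in> V \<Longrightarrow> g' y = Hilbert_Choice.inv (blinfun_apply (f' (g y)))"
    "\<And>y. y \<in> V \<Longrightarrow> bij (blinfun_apply (f' (g y)))"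
    by (rule inverse_function_theorem[OF S(1) _ cont S(2) inv, of f]) (use fd f' in auto)
  have gU: "g y \<in> U" if "y \<in> V" for y using U(6) that by (auto simp: homeomorphism_def)
  have i: "invertible (M x)" if "x \<in> U" for x
  proof (rule invertible_of_inj)
    fix v assume v: "M x *v v = 0"
    have fx: "f x \<in> V" "g (f x) = x" using U(6) that by (auto simp: homeomorphism_def)
    have xS: "x \<in> S" using that U by auto
    have "blinfun_apply (f' x) v = blinfun_apply (f' x) 0" using v by (simp add: f'[OF xS] M[OF xS])
    then show "v = 0" using g(3)[OF fx(1)] fx(2) bij_is_inj injD by metis
  qed
  have g': "g' y v = matrix_inv (M (g y)) *v v" if "y \<in> V" for y v
  proof -
    have gS: "g y \<in> S" using gU[OF that] U by auto
    have "blinfun_apply (f' (g y)) (matrix_inv (M (g y)) *v v) = v"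
      by (simp add: f'[OF gS] M[OF gS] matrix_vector_mul_assoc matrix_inv_works[OF i[OF gU[OF that]]])
    then show ?thesis unfolding g(2)[OF that] using g(3)[OF that] bij_is_inj inv_f_eq by metis
  qed
  have sM: "smooth_on U (\<lambda>x. matrix_inv (M x) *v v)" for v
  proof (rule smooth_on_vec[OF U(1)])
    show "smooth_on U (\<lambda>x. (matrix_inv (M x) *v v) $ j)" for j
      unfolding matrix_vector_nth M_def
      by (intro smooth_on_sum smooth_on_mult smooth_on_const smooth_on_matrix_inv smooth_jac U(1) i[unfolded M_def]
          smooth_on_derivative smooth_on_subset[OF holo_on_smooth[OF f] U(2)])
  qed
  \<comment> \<open>Bootstrapping: if g is of class C^k, so is the inverse of M (g y), which is the
    derivative of g.\<close>
  have "Ck_on k V g" for k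
  proof (induction k)
    case 0 then show ?case using U(6) by (simp add: homeomorphism_def)
  next
    case (Suc k)
    have "Ck_on k V (\<lambda>y. matrix_inv (M (g y)) *v v)" for v
      by (rule Ck_on_compose[OF U(4,1) _ Suc]) (use gU sM in \<open>auto simp: smooth_on_def\<close>)
    then have "Ck_on k V (\<lambda>y. g' y v)" for v by (rule Ck_on_cong[OF U(4), rotated]) (simp add: g')
    with g(1) show ?case using Ck_on_SucI[OF U(4), of g g' k] by blast
  qed
  then have "smooth_on V g" by (simp add: smooth_on_def)
  moreover have "frechet_derivative g (at y) (c *s v) = c *s frechet_derivative g (at y) v" if "y \<in> V" for y c v
    unfolding fd_eq[OF g(1)[OF that]] g'[OF that] by (rule matrix_vector_scale)
  ultimately have "holo_on V g" by (simp add: holo_on_def)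
  then show ?thesis using that U by blast
qed

text \<open>The given rows extend to a complex basis, and its remaining members, as many as the
  index type 'n has elements, fill the other rows.\<close>

lemma complete_rows:
  fixes r :: "'m::finite \<Rightarrow> complex ^ ('n::finite + 'm)"
  assumes ind: "\<And>c. (\<Sum>j\<in>UNIV. c j *s r j) = 0 \<Longrightarrow> (\<forall>j. c j = 0)"
  obtains M :: "complex ^ ('n + 'm) ^ ('n + 'm)" where "\<And>j. M $ Inr j = r j" "invertible M"
proof -
  have inj: "inj r"
  proof (rule injI, rule ccontr)
    fix i j assume *: "r i = r j" "i \<noteq> j"
    have "(\<Sum>k\<in>UNIV. (if k = i then 1 else if k = j then -1 else 0) *s r k)
       = (\<Sum>k\<in>UNIV. (if k = i then r i else 0) - (if k = j then r j else 0))"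
      by (intro sum.cong refl) (use * in auto)
    also have "\<dots> = 0" using * by (simp add: sum_subtractf)
    finally show False using spec[OF ind[of "\<lambda>k. if k = i then 1 else if k = j then -1 else 0"], of i] by simp
  qed
  have indep: "vec.independent (range r)"
  proof (rule vec.independent_if_scalars_zero)
    fix f x assume "(\<Sum>x\<in>range r. f x *s x) = 0" "x \<in> range r"
    then have "(\<Sum>j\<in>UNIV. f (r j) *s r j) = 0" by (simp add: sum.reindex[OF inj] o_def)
    then show "f x = 0" using ind[of "\<lambda>j. f (r j)"] \<open>x \<in> range r\<close> by auto
  qed simp
  define E where "E = vec.extend_basis (range r)"
  have E: "range r \<subseteq> E" "vec.independent E" "vec.span E = UNIV"
    unfolding E_def using vec.extend_basis_superset[OF indep] vec.independent_extend_basis[OF indep] vec.span_extend_basis[OF indep] by auto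
  have fE: "finite E" using vec.finiteI_independent[OF E(2)] .
  have "card E = CARD('n + 'm)"
    using vec.dim_eq_card[of E UNIV] E vec_dim_card[where 'a=complex and 'n="'n + 'm"] by simp
  then have "card (E - range r) = CARD('n)"
    using E(1) by (simp add: card_Diff_subset card_image[OF inj])
  then obtain b :: "'n \<Rightarrow> complex ^ ('n + 'm)" where b: "bij_betw b UNIV (E - range r)"
    using finite_same_card_bij[of "UNIV :: 'n set" "E - range r"] fE by auto
  define M where "M = (\<chi> k. case k of Inl i \<Rightarrow> b i | Inr j \<Rightarrow> r j)"
  have "invertible M"
  proof (rule invertible_of_inj)
    fix v assume v: "M *v v = 0"
    \<comment> \<open>The vectors that pair to zero with v, under the bilinear pairing, form a
      subspace containing a basis; so v pairs to zero with every axis vector.\<close>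
    have "vec.subspace {u. (\<Sum>k\<in>UNIV. u $ k * v $ k) = 0}"
      by (auto simp: vec.subspace_def sum.distrib algebra_simps simp flip: sum_distrib_left)
    moreover have "E \<subseteq> {u. (\<Sum>k\<in>UNIV. u $ k * v $ k) = 0}"
    proof
      fix u assume u: "u \<in> E"
      have "(\<Sum>k\<in>UNIV. M $ l $ k * v $ k) = 0" for l using v by (simp add: matrix_vector_nth[symmetric])
      from this[of "Inl _"] this[of "Inr _"] have 1: "(\<Sum>k\<in>UNIV. b i $ k * v $ k) = 0" "(\<Sum>k\<in>UNIV. r j $ k * v $ k) = 0" for i j
        by (simp_all add: M_def)
      show "u \<in> {u. (\<Sum>k\<in>UNIV. u $ k * v $ k) = 0}"
      proof (cases "u \<in> range r")
        case False
        then have "u \<in> range b" using u b by (auto simp: bij_betw_def)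
        then show ?thesis using 1(1) by auto
      qed (use 1(2) in auto)
    qed
    ultimately have "vec.span E \<subseteq> {u. (\<Sum>k\<in>UNIV. u $ k * v $ k) = 0}" by (intro vec.span_minimal)
    then have "(\<Sum>k\<in>UNIV. axis l 1 $ k * v $ k) = 0" for l using E(3) by auto
    moreover have "(\<Sum>k\<in>UNIV. axis l 1 $ k * v $ k) = v $ l" for l
      by (simp add: axis_def mult_if_01)
    ultimately show "v = 0" by (simp add: vec_eq_iff)
  qed
  then show ?thesis using that[of M] by (simp add: M_def)
qed

section \<open>Charts of the total space\<close>

lemma chart_onD:
  assumes "chart_on S c"
  shows "inj_on (snd c) (fst c)" "open (snd c ` fst c)" "continuous_on (fst c) (snd c)"
    "continuous_on (snd c ` fst c) (chart_inv c)" "\<And>x. x \<in> fst c \<Longrightarrow> chart_inv c (snd c x) = x"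
    "fst c \<subseteq> S"
  using assms openin_subset[of "top_of_set S" "fst c"]
  unfolding chart_on_def homeomorphism_def by (auto intro: inj_on_inverseI)

lemma open_chart_image:
  assumes "chart_on S c" "open W" shows "open (snd c ` (fst c \<inter> W))"
proof -
  note c = chart_onD[OF assms(1)]
  have "snd c ` (fst c \<inter> W) = snd c ` fst c \<inter> chart_inv c -` W"
    using c(5) by (auto simp: image_iff)
  moreover have "open (snd c ` fst c \<inter> chart_inv c -` W)"
    by (rule continuous_open_preimage[OF c(4,2) assms(2)])
  ultimately show ?thesis by simp
qed

definition emb :: "complex ^ 'n::finite \<Rightarrow> complex ^ ('n + 'm::finite)" where
  "emb u = (\<chi> k. case k of Inl i \<Rightarrow> u $ i | Inr j \<Rightarrow> 0)"

definition prj :: "complex ^ ('n::finite + 'm::finite) \<Rightarrow> complex ^ 'n" where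
  "prj v = (\<chi> i. v $ Inl i)"

lemma prj_emb [simp]: "prj (emb u) = u"
  by (simp add: prj_def emb_def vec_eq_iff)

lemma emb_prj: "(\<And>j. v $ Inr j = 0) \<Longrightarrow> emb (prj v) = v"
  by (auto simp: prj_def emb_def vec_eq_iff split: sum.split)

lemma emb_Inr [simp]: "emb u $ Inr j = 0"
  by (simp add: emb_def)

lemma linear_emb: "linear emb"
  by (auto simp: linear_iff emb_def vec_eq_iff split: sum.split)

lemma linear_prj: "linear prj"
  by (auto simp: linear_iff prj_def vec_eq_iff)

lemma emb_scale: "emb (c *s u) = c *s emb u"
  by (auto simp: emb_def vec_eq_iff split: sum.split)

lemma prj_scale: "prj (c *s u) = c *s prj u"
  by (auto simp: prj_def vec_eq_iff)

lemma bounded_linear_emb: "bounded_linear (emb :: complex ^ 'n::finite \<Rightarrow> complex ^ ('n + 'm::finite))"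
  using linear_emb by (simp add: linear_conv_bounded_linear)

lemma bounded_linear_prj: "bounded_linear (prj :: complex ^ ('n::finite + 'm::finite) \<Rightarrow> complex ^ 'n)"
  using linear_prj by (simp add: linear_conv_bounded_linear)

lemma holo_on_emb: "open S \<Longrightarrow> holo_on S emb"
  by (rule holo_on_linear[OF _ linear_emb emb_scale])

lemma holo_on_prj: "open S \<Longrightarrow> holo_on S prj"
  by (rule holo_on_linear[OF _ linear_prj prj_scale])

lemma continuous_on_emb: "continuous_on S (emb :: complex ^ 'n::finite \<Rightarrow> complex ^ ('n + 'm::finite))"
  by (rule linear_continuous_on[OF bounded_linear_emb])

definition slice_chart :: "'x set \<Rightarrow> ('x, complex ^ ('n::finite + 'm::finite)) chart \<Rightarrow> ('x, complex ^ 'n) chart" where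
  "slice_chart S e = (fst e \<inter> S, \<lambda>x. prj (snd e x))"

locale family =
  fixes A :: "('x::{t2_space,second_countable_topology},
                complex^('n::{finite,linorder} + 'm::finite)) chart set"
    and \<Delta> :: "(complex^'m) set"
    and \<pi> :: "'x \<Rightarrow> complex^'m"
    and \<sigma> :: "'x \<Rightarrow> 'x"
  assumes fam: "holomorphic_family A \<Delta> \<pi>"
    and zero: "0 \<in> \<Delta>"
    and triv: "transversely_holomorphic_trivialization A \<Delta> \<pi> \<sigma>"
begin

abbreviation "E \<equiv> max_atlas UNIV A"
abbreviation "X0 \<equiv> \<pi> -` {0}"
abbreviation "B \<equiv> slice_charts UNIV A X0"
abbreviation "C \<equiv> fibre_charts A \<pi> \<sigma>"

lemma manifold: "complex_manifold UNIV A" using fam by (simp add: holomorphic_family_def)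

lemma open_Delta: "open \<Delta>" using fam by (simp add: holomorphic_family_def)

lemma A_subset_E: "A \<subseteq> E"
  using manifold by (auto simp: complex_manifold_def max_atlas_def)

lemma A_cover: obtains a where "a \<in> A" "x \<in> fst a"
  using manifold unfolding complex_manifold_def by blast

lemma E_chart: "e \<in> E \<Longrightarrow> chart_on UNIV e"
  by (simp add: max_atlas_def)

lemma E_open: "e \<in> E \<Longrightarrow> open (fst e)"
  using E_chart by (fastforce simp: chart_on_def)

lemma E_overlap_open: "e \<in> E \<Longrightarrow> e' \<in> E \<Longrightarrow> open (snd e ` (fst e \<inter> fst e'))"
  by (rule open_chart_image[OF E_chart E_open])

lemma E_A_holo: "e \<in> E \<Longrightarrow> a \<in> A \<Longrightarrow> holo_on (snd e ` (fst e \<inter> fst a)) (transition e a)"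
   "e \<in> E \<Longrightarrow> a \<in> A \<Longrightarrow> holo_on (snd a ` (fst e \<inter> fst a)) (transition a e)"
  unfolding max_atlas_def holo_compatible_def transition_def by blast+

lemma E_inv: "e \<in> E \<Longrightarrow> x \<in> fst e \<Longrightarrow> chart_inv e (snd e x) = x"
  by (rule chart_onD(5)[OF E_chart])

lemma E_transition_at: "e \<in> E \<Longrightarrow> x \<in> fst e \<Longrightarrow> transition e e' (snd e x) = snd e' x"
  by (simp add: transition_def E_inv)

text \<open>Charts of the maximal atlas are compatible with A by definition; with each other they
  are compared through a chart of A around each point.\<close>

lemma E_holo:
  assumes "e \<in> E" "e' \<in> E" shows "holo_on (snd e ` (fst e \<inter> fst e')) (transition e e')"
proof (rule holo_on_local[OF E_overlap_open[OF assms]])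
  fix y assume "y \<in> snd e ` (fst e \<inter> fst e')"
  then obtain x where x: "x \<in> fst e" "x \<in> fst e'" "y = snd e x" by auto
  obtain a where a: "a \<in> A" "x \<in> fst a" by (rule A_cover)
  have aE: "a \<in> E" using a A_subset_E by auto
  define T where "T = snd e ` (fst e \<inter> (fst e' \<inter> fst a))"
  have T: "open T" unfolding T_def
    by (rule open_chart_image[OF E_chart[OF assms(1)]]) (intro open_Int E_open assms aE)
  have 1: "holo_on T (transition e a)" by (rule holo_on_subset[OF E_A_holo(1)[OF assms(1) a(1)]]) (auto simp: T_def)
  have "holo_on T (\<lambda>y. transition a e' (transition e a y))"
  proof (rule holo_on_compose[OF T _ _ 1 E_A_holo(2)[OF assms(2) a(1)]])
    show "open (snd a ` (fst e' \<inter> fst a))" using E_overlap_open[OF aE assms(2)] by (simp add: Int_commute)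
    show "transition e a ` T \<subseteq> snd a ` (fst e' \<inter> fst a)" using E_transition_at[OF assms(1), of _ a] by (auto simp: T_def)
  qed
  then have "holo_on T (transition e e')"
    by (rule holo_on_cong[OF T]) (auto simp: T_def E_transition_at assms aE)
  then show "\<exists>T. open T \<and> y \<in> T \<and> holo_on T (transition e e')" using T x a by (intro exI[of _ T]) (auto simp: T_def)
qed

subsection \<open>Slices\<close>

definition slice :: "'x set \<Rightarrow> ('x, complex ^ ('n + 'm)) chart \<Rightarrow> bool" where
  "slice S e \<longleftrightarrow> e \<in> E \<and> snd e ` (fst e \<inter> S) = snd e ` fst e \<inter> {v. \<forall>j. v $ Inr j = 0}"

lemma slice_charts_eq: "slice_charts UNIV A S = {slice_chart S e | e. slice S e}"
  by (auto simp: slice_charts_def slice_chart_def slice_def prj_def)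

lemma slice_E: "slice S e \<Longrightarrow> e \<in> E" by (simp add: slice_def)

lemma slice_chart_simps [simp]: "fst (slice_chart S e) = fst e \<inter> S" "snd (slice_chart S e) x = prj (snd e x)"
  by (auto simp: slice_chart_def)

lemma slice_emb:
  assumes "slice S e" "x \<in> fst e" "x \<in> S" shows "emb (prj (snd e x)) = snd e x"
proof (rule emb_prj)
  have "snd e x \<in> snd e ` fst e \<inter> {v. \<forall>j. v $ Inr j = 0}" using assms by (auto simp: slice_def)
  then show "snd e x $ Inr j = 0" for j by auto
qed

lemma slice_emb_mem:
  assumes "slice S e" "emb u \<in> snd e ` (fst e \<inter> W)"
  obtains x where "x \<in> fst e" "x \<in> S" "x \<in> W" "u = prj (snd e x)" "snd e x = emb u"
proof -
  obtain x where x: "x \<in> fst e" "x \<in> W" "emb u = snd e x" using assms(2) by auto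
  have "emb u \<in> snd e ` fst e" using assms(2) by auto
  then have "emb u \<in> snd e ` (fst e \<inter> S)" using assms(1) by (simp add: slice_def)
  then obtain x' where x': "x' \<in> fst e" "x' \<in> S" "emb u = snd e x'" by auto
  have "x = x'" using chart_onD(1)[OF E_chart[OF slice_E[OF assms(1)]]] x x' by (auto dest: inj_onD)
  then show ?thesis using that[of x] x x' prj_emb by metis
qed

text \<open>Describes the image under an induced chart as a preimage under the coordinate embedding,
  from which its openness follows by continuity.\<close>

lemma slice_image: "slice S e \<Longrightarrow> snd (slice_chart S e) ` (fst (slice_chart S e) \<inter> W) = emb -` (snd e ` (fst e \<inter> W))"
proof
  assume s: "slice S e"
  show "snd (slice_chart S e) ` (fst (slice_chart S e) \<inter> W) \<subseteq> emb -` (snd e ` (fst e \<inter> W))"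
    using slice_emb[OF s] by auto
  show "emb -` (snd e ` (fst e \<inter> W)) \<subseteq> snd (slice_chart S e) ` (fst (slice_chart S e) \<inter> W)"
  proof
    fix u assume "u \<in> emb -` (snd e ` (fst e \<inter> W))"
    then have "emb u \<in> snd e ` (fst e \<inter> W)" by simp
    then obtain x where "x \<in> fst e" "x \<in> S" "x \<in> W" "u = prj (snd e x)" using slice_emb_mem[OF s] by metis
    then show "u \<in> snd (slice_chart S e) ` (fst (slice_chart S e) \<inter> W)" by auto
  qed
qed

lemma slice_image_open:
  assumes "slice S e" "open W" shows "open (snd (slice_chart S e) ` (fst (slice_chart S e) \<inter> W))"
  unfolding slice_image[OF assms(1)]
  by (rule open_vimage[OF open_chart_image[OF E_chart[OF slice_E[OF assms(1)]] assms(2)] continuous_on_emb])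

lemma slice_inj: "slice S e \<Longrightarrow> inj_on (snd (slice_chart S e)) (fst (slice_chart S e))"
  using slice_emb chart_onD(1)[OF E_chart[OF slice_E]] by (intro inj_onI) (metis IntE inj_onD slice_chart_simps)

lemma slice_inv:
  assumes "slice S e" "x \<in> fst e" "x \<in> S"
  shows "chart_inv (slice_chart S e) (prj (snd e x)) = x"
  using inv_into_f_f[OF slice_inj[OF assms(1)], of x] assms by (simp add: chart_inv_def)

lemma slice_inv_emb:
  assumes "slice S e" "u \<in> snd (slice_chart S e) ` fst (slice_chart S e)"
  shows "chart_inv (slice_chart S e) u = chart_inv e (emb u)" "emb u \<in> snd e ` fst e"
    "chart_inv e (emb u) \<in> fst e" "chart_inv e (emb u) \<in> S"
  using assms slice_inv[OF assms(1)] slice_emb[OF assms(1)] E_inv[OF slice_E[OF assms(1)]] by auto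

lemma slice_cont:
  assumes "slice S e" shows "continuous_on (snd (slice_chart S e) ` fst (slice_chart S e)) (chart_inv (slice_chart S e))"
proof -
  have "continuous_on (snd (slice_chart S e) ` fst (slice_chart S e)) (\<lambda>u. chart_inv e (emb u))"
    by (rule continuous_on_compose2[OF chart_onD(4)[OF E_chart[OF slice_E[OF assms]]] continuous_on_emb])
      (use slice_inv_emb(2)[OF assms] in auto)
  then show ?thesis by (rule continuous_on_eq) (simp add: slice_inv_emb(1)[OF assms])
qed

text \<open>The induced transition map is the ambient one, preceded by the coordinate embedding and
  followed by the projection, all of them holomorphic.\<close>

lemma slice_holo:
  assumes "slice S e" "slice S e'"
  defines "c \<equiv> slice_chart S e" and "c' \<equiv> slice_chart S e'"
  shows "open (snd c ` (fst c \<inter> fst c'))" "holo_on (snd c ` (fst c \<inter> fst c')) (transition c c')"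
proof -
  have eq: "fst c \<inter> fst c' = fst c \<inter> fst e'" by (auto simp: c_def c'_def)
  have eE: "e \<in> E" "e' \<in> E" using assms slice_E by auto
  show op: "open (snd c ` (fst c \<inter> fst c'))"
    unfolding eq unfolding c_def by (rule slice_image_open[OF assms(1) E_open[OF eE(2)]])
  have sub: "emb ` (snd c ` (fst c \<inter> fst c')) \<subseteq> snd e ` (fst e \<inter> fst e')"
    unfolding eq unfolding c_def slice_image[OF assms(1)] by auto
  have "holo_on (snd c ` (fst c \<inter> fst c')) (\<lambda>u. transition e e' (emb u))"
    by (rule holo_on_compose[OF op E_overlap_open[OF eE] sub holo_on_emb[OF op] E_holo[OF eE]])
  from holo_on_compose[OF op open_UNIV _ this holo_on_prj[OF open_UNIV]]
  have "holo_on (snd c ` (fst c \<inter> fst c')) (\<lambda>u. prj (transition e e' (emb u)))" by simp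
  then show "holo_on (snd c ` (fst c \<inter> fst c')) (transition c c')"
    by (rule holo_on_cong[OF op])
      (auto simp: transition_def c_def c'_def slice_inv[OF assms(1)] slice_emb[OF assms(1)] E_inv[OF eE(1)])
qed

lemma pi_map: "holo_map UNIV A \<Delta> {(\<Delta>, id)} \<pi>"
  using fam unfolding holomorphic_family_def by (elim conjE)

lemma pi_in: "\<pi> x \<in> \<Delta>"
  using pi_map unfolding holo_map_def by (elim conjE) (erule subsetD, rule rangeI)

lemma pi_proper: "K \<subseteq> \<Delta> \<Longrightarrow> compact K \<Longrightarrow> compact (\<pi> -` K)"
  using fam unfolding holomorphic_family_def by (elim conjE) simp

lemma pi_submersion: "a \<in> A \<Longrightarrow> x \<in> fst a \<Longrightarrow> surj (frechet_derivative (\<pi> \<circ> chart_inv a) (at (snd a x)))"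
  using fam unfolding holomorphic_family_def by (elim conjE) (drule bspec, assumption, erule bspec)

lemma pi_holo:
  assumes "a \<in> A" shows "holo_on (snd a ` fst a) (\<pi> \<circ> chart_inv a)"
proof -
  have "\<forall>c\<in>A. \<forall>d\<in>{(\<Delta>, id)}. holo_on (snd c ` (fst c \<inter> \<pi> -` fst d)) (snd d \<circ> \<pi> \<circ> chart_inv c)"
    using pi_map unfolding holo_map_def by (elim conjE)
  from bspec[OF bspec[OF this assms] singletonI]
  have "holo_on (snd a ` (fst a \<inter> \<pi> -` \<Delta>)) (\<pi> \<circ> chart_inv a)" by simp
  moreover have "fst a \<inter> \<pi> -` \<Delta> = fst a" using pi_in by auto
  ultimately show ?thesis by simp
qed

text \<open>Adapted charts come from the holomorphic inverse function theorem: the components of \<open>\<pi>\<close>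
  are completed by linear functions to local coordinates.\<close>

lemma slice_exists:
  assumes "\<pi> p = t" obtains e where "slice (\<pi> -` {t}) e" "p \<in> fst e"
proof -
  obtain a where a: "a \<in> A" "p \<in> fst a" by (rule A_cover)
  have aE: "a \<in> E" using a A_subset_E by auto
  note ca = chart_onD[OF E_chart[OF aE]]
  define h where "h = \<pi> \<circ> chart_inv a"
  define S where "S = snd a ` fst a"
  have S: "open S" "snd a p \<in> S" using ca a by (auto simp: S_def)
  have h: "holo_on S h" unfolding h_def S_def by (rule pi_holo[OF a(1)])
  define D where "D = frechet_derivative h (at (snd a p))"
  have hd: "(h has_derivative D) (at (snd a p))" unfolding D_def by (rule smooth_on_has_derivative[OF holo_on_smooth[OF h] S(2)])
  have surj: "surj D" unfolding D_def h_def by (rule pi_submersion[OF a])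
  have linD: "linear D" using has_derivative_linear[OF hd] .
  have scD: "D (c *s v) = c *s D v" for c v unfolding D_def by (rule holo_on_derivative[OF h S(2)])
  define r where "r j = (\<chi> k. D (axis k 1) $ j)" for j
  have Dr: "D v $ j = (\<Sum>k\<in>UNIV. r j $ k * v $ k)" for v j
  proof -
    have "v = (\<Sum>k\<in>UNIV. v $ k *s axis k 1)" by (auto simp: vec_eq_iff sum_component axis_def mult_if_01)
    then have "D v = D (\<Sum>k\<in>UNIV. v $ k *s axis k 1)" by simp
    also have "\<dots> = (\<Sum>k\<in>UNIV. v $ k *s D (axis k 1))" by (simp add: linear_sum[OF linD] scD)
    finally show ?thesis by (simp add: r_def mult.commute)
  qed
  \<comment> \<open>A relation among the rows of D is a functional vanishing on its image, which is
    everything; testing it on preimages of the axis vectors gives the coefficients.\<close>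
  have ind: "\<forall>j. c j = 0" if c: "(\<Sum>j\<in>UNIV. c j *s r j) = 0" for c
  proof
    fix i
    obtain v where v: "D v = axis i 1" using surj by (metis surjD)
    have "c i = (\<Sum>j\<in>UNIV. c j * D v $ j)" by (simp add: v axis_def mult_if_01)
    also have "\<dots> = (\<Sum>k\<in>UNIV. (\<Sum>j\<in>UNIV. c j *s r j) $ k * v $ k)"
      unfolding Dr sum_distrib_left by (subst sum.swap) (simp add: sum_distrib_right mult.assoc)
    finally show "c i = 0" by (simp add: c)
  qed
  obtain K :: "complex ^ ('n + 'm) ^ ('n + 'm)" where K: "\<And>j. K $ Inr j = r j" "invertible K"
    using complete_rows[of r, OF ind] by blast
  define inr :: "complex ^ 'm \<Rightarrow> complex ^ ('n + 'm)" where "inr u = (\<chi> k. case k of Inl i \<Rightarrow> 0 | Inr j \<Rightarrow> u $ j)" for u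
  have inr: "linear inr" "\<And>c u. inr (c *s u) = c *s inr u"
    by (auto simp: linear_iff inr_def vec_eq_iff split: sum.split)
  have bl_inr: "bounded_linear inr" using inr by (simp add: linear_conv_bounded_linear)
  \<comment> \<open>The last coordinates of f are \<pi> - t, so that the fibre becomes the slice;
    the first ones are the linear functions from K, which make the derivative at p equal to
    K.\<close>
  define f where "f u = (emb (prj (K *v u)) + inr (h u)) + (- inr t)" for u
  have f_Inr: "f u $ Inr j = h u $ j - t $ j" for u j by (simp add: f_def inr_def)
  have bl_ep: "bounded_linear (\<lambda>u. emb (prj (K *v u)))"
    using linear_compose[OF linear_compose[OF linear_matrix_vector[of K] linear_prj] linear_emb]
    by (simp add: linear_conv_bounded_linear o_def)
  have fder: "(f has_derivative (\<lambda>v. emb (prj (K *v v)) + inr (frechet_derivative h (at u) v))) (at u)" if "u \<in> S" for u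
  proof -
    have "(h has_derivative frechet_derivative h (at u)) (at u)" by (rule smooth_on_has_derivative[OF holo_on_smooth[OF h] that])
    then have "(f has_derivative (\<lambda>v. (emb (prj (K *v v)) + inr (frechet_derivative h (at u) v)) + 0)) (at u)"
      unfolding f_def[abs_def]
      by (intro has_derivative_add bounded_linear_imp_has_derivative[OF bl_ep] bounded_linear.has_derivative[OF bl_inr] has_derivative_const)
    then show ?thesis by simp
  qed
  have f: "holo_on S f"
    unfolding holo_on_def
  proof (intro conjI ballI allI)
    show "smooth_on S f" unfolding f_def[abs_def]
      by (intro smooth_on_add smooth_on_linear[OF S(1) bl_ep] smooth_on_linear_compose[OF S(1) bl_inr] smooth_on_const holo_on_smooth[OF h] S(1))
    show "frechet_derivative f (at u) (c *s v) = c *s frechet_derivative f (at u) v" if "u \<in> S" for u c v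
      unfolding fd_eq[OF fder[OF that]]
      by (simp add: matrix_vector_scale prj_scale emb_scale inr holo_on_derivative[OF h that] vector_add_ldistrib)
  qed
  have fK: "frechet_derivative f (at (snd a p)) v = K *v v" for v
  proof -
    have "(emb (prj (K *v v)) + inr (D v)) $ k = (K *v v) $ k" for k
      by (cases k) (simp_all add: emb_def prj_def inr_def Dr matrix_vector_nth K)
    then show ?thesis unfolding fd_eq[OF fder[OF S(2)]] D_def[symmetric] by (simp add: vec_eq_iff)
  qed
  have inj: "v = 0" if "frechet_derivative f (at (snd a p)) v = 0" for v
    using that unfolding fK by (rule matrix_kernel[OF K(2)])
  obtain U V g where U: "open U" "U \<subseteq> S" "snd a p \<in> U" "open V" "homeomorphism U V f g" "holo_on V g"
    by (rule holo_inverse_function[OF S f inj])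
  define e where "e = ({x \<in> fst a. snd a x \<in> U}, \<lambda>x. f (snd a x))"
  have fe: "fst e = fst a \<inter> snd a -` U" "snd e = (\<lambda>x. f (snd a x))" by (auto simp: e_def)
  have imU: "snd a ` fst e = U" using U(2) by (auto simp: fe S_def)
  have ope: "open (fst e)" unfolding fe(1) by (rule continuous_open_preimage[OF ca(3) E_open[OF aE] U(1)])
  have "homeomorphism (fst a) S (snd a) (chart_inv a)"
    using E_chart[OF aE] by (simp add: chart_on_def S_def)
  from homeomorphism_of_subsets[OF this _ U(2) imU] have "homeomorphism (fst e) U (snd a) (chart_inv a)" by (auto simp: fe)
  from homeomorphism_compose[OF this U(5)] have hom: "homeomorphism (fst e) V (f \<circ> snd a) (chart_inv a \<circ> g)" .
  have imV: "snd e ` fst e = V" using hom by (auto simp: homeomorphism_def fe o_def)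
  have inje: "inj_on (snd e) (fst e)"
    by (rule inj_on_inverseI[of _ "chart_inv a \<circ> g"]) (use hom in \<open>auto simp: homeomorphism_def fe\<close>)
  have einv: "chart_inv e y = chart_inv a (g y)" if "y \<in> V" for y
  proof -
    have "(chart_inv a \<circ> g) y \<in> fst e" "snd e ((chart_inv a \<circ> g) y) = y"
      using hom that by (auto simp: homeomorphism_def fe)
    then show ?thesis using inv_into_f_f[OF inje, of "(chart_inv a \<circ> g) y"] by (simp add: chart_inv_def)
  qed
  have che: "chart_on UNIV e"
    unfolding chart_on_def
  proof (intro conjI)
    show "openin (top_of_set UNIV) (fst e)" using ope by simp
    show "open (snd e ` fst e)" using imV U(4) by simp
    show "homeomorphism (fst e) (snd e ` fst e) (snd e) (chart_inv e)"
      unfolding imV by (rule homeomorphism_cong[OF hom]) (auto simp: einv fe)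
  qed
  have gU: "g y \<in> U" if "y \<in> V" for y using U(5) that by (auto simp: homeomorphism_def)
  have gf: "g (f u) = u" if "u \<in> U" for u using U(5) that by (auto simp: homeomorphism_def)
  have "e \<in> E"
    unfolding max_atlas_def mem_Collect_eq
  proof (intro conjI ballI che)
    fix d assume d: "d \<in> A"
    have dE: "d \<in> E" using d A_subset_E by auto
    have o1: "open (snd e ` (fst e \<inter> fst d))" by (rule open_chart_image[OF che E_open[OF dE]])
    have o2: "open (snd d ` (fst e \<inter> fst d))"
      using open_chart_image[OF E_chart[OF dE] ope] by (simp add: Int_commute)
    have s1: "snd e ` (fst e \<inter> fst d) \<subseteq> V" using imV by auto
    show "holo_compatible e d"
      unfolding holo_compatible_def
    proof
      have "holo_on (snd e ` (fst e \<inter> fst d)) (\<lambda>y. transition a d (g y))"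
      proof (rule holo_on_compose[OF o1 E_overlap_open[OF aE dE] _ holo_on_subset[OF U(6) s1] E_holo[OF aE dE]])
        show "g ` (snd e ` (fst e \<inter> fst d)) \<subseteq> snd a ` (fst a \<inter> fst d)" using gf by (auto simp: fe)
      qed
      then show "holo_on (snd e ` (fst e \<inter> fst d)) (snd d \<circ> chart_inv e)"
        by (rule holo_on_cong[OF o1]) (use s1 einv in \<open>auto simp: transition_def\<close>)
      have sub: "transition d a ` (snd d ` (fst e \<inter> fst d)) \<subseteq> S" using E_transition_at[OF dE, of _ a] by (auto simp: fe S_def)
      have "holo_on (snd d ` (fst e \<inter> fst d)) (transition d a)"
        by (rule holo_on_subset[OF E_holo[OF dE aE]]) (auto simp: fe)
      from holo_on_compose[OF o2 S(1) sub this f]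
      show "holo_on (snd d ` (fst e \<inter> fst d)) (snd e \<circ> chart_inv d)"
        by (rule holo_on_cong[OF o2]) (auto simp: transition_def fe)
    qed
  qed
  moreover have "snd e ` (fst e \<inter> \<pi> -` {t}) = snd e ` fst e \<inter> {v. \<forall>j. v $ Inr j = 0}"
  proof -
    have "(\<forall>j. snd e x $ Inr j = 0) \<longleftrightarrow> \<pi> x = t" if "x \<in> fst e" for x
      using that ca(5)[of x] by (auto simp: fe f_Inr h_def vec_eq_iff)
    then show ?thesis by auto
  qed
  ultimately have "slice (\<pi> -` {t}) e" by (simp add: slice_def)
  moreover have "p \<in> fst e" using a U(3) by (simp add: fe)
  ultimately show ?thesis using that by blast
qed

subsection \<open>The trivialization\<close>

text \<open>The inverse of the trivialization: the point of X_t lying over x. The charts that X_t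
  induces on X_0 all factor through it.\<close>

definition F :: "'x \<Rightarrow> complex^'m \<Rightarrow> 'x" where
  "F x t = inv_into UNIV (\<lambda>x. (\<sigma> x, \<pi> x)) (x, t)"

lemma diffeo': "diffeo UNIV A (X0 \<times> \<Delta>) (prod_charts B \<Delta>) (\<lambda>x. (\<sigma> x, \<pi> x))"
  using triv by (simp add: transversely_holomorphic_trivialization_def)

lemma bij: "bij_betw (\<lambda>x. (\<sigma> x, \<pi> x)) UNIV (X0 \<times> \<Delta>)"
  using diffeo' by (simp add: diffeo_def)

lemma sigma_in: "\<sigma> p \<in> X0" using bij by (auto simp: bij_betw_def)

lemma F_at: "x \<in> X0 \<Longrightarrow> t \<in> \<Delta> \<Longrightarrow> \<sigma> (F x t) = x \<and> \<pi> (F x t) = t"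
  using f_inv_into_f[of "(x, t)" "\<lambda>x. (\<sigma> x, \<pi> x)" UNIV] bij unfolding bij_betw_def F_def by auto

lemma F_sigma: "F (\<sigma> p) (\<pi> p) = p"
  unfolding F_def using inv_into_f_f[of "\<lambda>x. (\<sigma> x, \<pi> x)" UNIV p] bij unfolding bij_betw_def by simp

lemma sigma_id: "x \<in> X0 \<Longrightarrow> \<sigma> x = x"
  using triv unfolding transversely_holomorphic_trivialization_def by blast

lemma F_zero: "x \<in> X0 \<Longrightarrow> F x 0 = x"
  using F_sigma[of x] sigma_id[of x] by simp

lemma sigma_cont: "continuous_on UNIV \<sigma>"
proof -
  have "continuous_on UNIV (\<lambda>x. (\<sigma> x, \<pi> x))" using diffeo' by (simp add: diffeo_def smooth_map_def)
  from continuous_on_fst[OF this] show ?thesis by simp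
qed

lemma F_cont: "continuous_on (X0 \<times> \<Delta>) (\<lambda>p. F (fst p) (snd p))"
  using diffeo' by (simp add: diffeo_def smooth_map_def F_def)

text \<open>One open set in the product of chart and parameter space, so that smoothness of F in y
  and t is joint.\<close>

definition dom :: "('x, 'n cvec) chart \<Rightarrow> 'x set \<Rightarrow> ('n cvec \<times> 'm cvec) set" where
  "dom c W = {(y, t). y \<in> snd c ` fst c \<and> t \<in> \<Delta> \<and> F (chart_inv c y) t \<in> W}"

lemma B_slice: assumes "c \<in> B" obtains e where "slice X0 e" "c = slice_chart X0 e"
  using assms unfolding slice_charts_eq by blast

lemma B_props:
  assumes "c \<in> B"
  shows "inj_on (snd c) (fst c)" "fst c \<subseteq> X0" "continuous_on (snd c ` fst c) (chart_inv c)" "open (snd c ` fst c)"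
    "x \<in> fst c \<Longrightarrow> chart_inv c (snd c x) = x"
    "y \<in> snd c ` fst c \<Longrightarrow> chart_inv c y \<in> fst c \<and> snd c (chart_inv c y) = y"
proof -
  obtain e where e: "slice X0 e" "c = slice_chart X0 e" by (rule B_slice[OF assms])
  show i: "inj_on (snd c) (fst c)" unfolding e(2) by (rule slice_inj[OF e(1)])
  show "fst c \<subseteq> X0" by (auto simp: e(2))
  show "continuous_on (snd c ` fst c) (chart_inv c)" unfolding e(2) by (rule slice_cont[OF e(1)])
  show "open (snd c ` fst c)" using slice_image_open[OF e(1) open_UNIV] by (simp add: e(2))
  show "chart_inv c (snd c x) = x" if "x \<in> fst c" for x using i that by (simp add: chart_inv_def)
  then show "y \<in> snd c ` fst c \<Longrightarrow> chart_inv c y \<in> fst c \<and> snd c (chart_inv c y) = y" by auto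
qed

lemma dom_open: assumes "c \<in> B" "open W" shows "open (dom c W)"
proof -
  let ?P = "(snd c ` fst c) \<times> \<Delta>"
  have o: "open ?P" by (intro open_Times B_props(4)[OF assms(1)] open_Delta)
  have "continuous_on ?P (\<lambda>p. (chart_inv c (fst p), snd p))"
    by (intro continuous_on_Pair continuous_on_compose2[OF B_props(3)[OF assms(1)]] continuous_on_fst continuous_on_snd continuous_on_id) auto
  from continuous_on_compose2[OF F_cont this]
  have "continuous_on ?P (\<lambda>p. F (chart_inv c (fst p)) (snd p))"
    using B_props(2,6)[OF assms(1)] by fastforce
  from continuous_open_preimage[OF this o assms(2)]
  show ?thesis by (rule back_subst[where P="open"]) (auto simp: dom_def)
qed

text \<open>Unpacks the smoothness of the inverse trivialization from the product charts of X_0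
  \<times> \<Delta>.\<close>

lemma F_smooth:
  assumes "c \<in> B" "a \<in> A"
  shows "smooth_on (dom c (fst a)) (\<lambda>p. snd a (F (chart_inv c (fst p)) (snd p)))"
proof -
  define c' where "c' = (fst c \<times> \<Delta>, map_prod (snd c) (id :: complex^'m \<Rightarrow> _))"
  have "c' \<in> prod_charts B \<Delta>" unfolding prod_charts_def c'_def using assms(1) by force
  then have s: "smooth_on (snd c' ` (fst c' \<inter> inv_into UNIV (\<lambda>x. (\<sigma> x, \<pi> x)) -` fst a))
     (snd a \<circ> inv_into UNIV (\<lambda>x. (\<sigma> x, \<pi> x)) \<circ> chart_inv c')"
    using diffeo' assms(2) unfolding diffeo_def smooth_map_def by blast
  have inj: "inj_on (snd c') (fst c')"
    using B_props(1)[OF assms(1)] by (auto simp: c'_def inj_on_def)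
  have ci: "chart_inv c' (y, t) = (chart_inv c y, t)" if "y \<in> snd c ` fst c" "t \<in> \<Delta>" for y t
    using inv_into_f_f[OF inj, of "(chart_inv c y, t)"] B_props(6)[OF assms(1) that(1)] that(2)
    by (simp add: c'_def chart_inv_def[of "(_, _)"])
  have "dom c (fst a) = snd c' ` (fst c' \<inter> inv_into UNIV (\<lambda>x. (\<sigma> x, \<pi> x)) -` fst a)"
  proof
    show "dom c (fst a) \<subseteq> snd c' ` (fst c' \<inter> inv_into UNIV (\<lambda>x. (\<sigma> x, \<pi> x)) -` fst a)"
    proof
      fix p assume "p \<in> dom c (fst a)"
      then obtain y t where p: "p = (y, t)" "y \<in> snd c ` fst c" "t \<in> \<Delta>" "F (chart_inv c y) t \<in> fst a"
        by (auto simp: dom_def)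
      then show "p \<in> snd c' ` (fst c' \<inter> inv_into UNIV (\<lambda>x. (\<sigma> x, \<pi> x)) -` fst a)"
        using B_props(6)[OF assms(1) p(2)]
        by (intro image_eqI[of _ _ "(chart_inv c y, t)"]) (auto simp: c'_def F_def)
    qed
  qed (auto simp: dom_def c'_def F_def B_props(5)[OF assms(1)])
  then have "smooth_on (dom c (fst a)) (snd a \<circ> inv_into UNIV (\<lambda>x. (\<sigma> x, \<pi> x)) \<circ> chart_inv c')"
    using s by simp
  then show ?thesis
    by (rule smooth_on_cong[OF dom_open[OF assms(1) E_open[OF subsetD[OF A_subset_E assms(2)]]]])
      (use assms A_subset_E in \<open>auto simp: dom_def ci F_def\<close>)
qed

lemma sigma_smooth:
  assumes "c \<in> B" "a \<in> A"
  shows "smooth_on (snd a ` (fst a \<inter> \<sigma> -` fst c)) (\<lambda>w. snd c (\<sigma> (chart_inv a w)))"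
    and "open (snd a ` (fst a \<inter> \<sigma> -` fst c))"
proof -
  define c' where "c' = (fst c \<times> \<Delta>, map_prod (snd c) (id :: complex^'m \<Rightarrow> _))"
  have "c' \<in> prod_charts B \<Delta>" unfolding prod_charts_def c'_def using assms(1) by force
  then have s: "smooth_on (snd a ` (fst a \<inter> (\<lambda>x. (\<sigma> x, \<pi> x)) -` fst c'))
     (snd c' \<circ> (\<lambda>x. (\<sigma> x, \<pi> x)) \<circ> chart_inv a)"
    using diffeo' assms(2) unfolding diffeo_def smooth_map_def by blast
  have aE: "a \<in> E" using assms A_subset_E by auto
  obtain e where e: "slice X0 e" "c = slice_chart X0 e" by (rule B_slice[OF assms(1)])
  have "\<sigma> -` fst c = \<sigma> -` fst e" using sigma_in by (auto simp: e(2))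
  moreover have "open (\<sigma> -` fst e)" by (rule open_vimage[OF E_open[OF slice_E[OF e(1)]] sigma_cont])
  ultimately show o: "open (snd a ` (fst a \<inter> \<sigma> -` fst c))"
    using open_chart_image[OF E_chart[OF aE]] by simp
  have "fst a \<inter> (\<lambda>x. (\<sigma> x, \<pi> x)) -` fst c' = fst a \<inter> \<sigma> -` fst c" using pi_in by (auto simp: c'_def)
  then have "smooth_on (snd a ` (fst a \<inter> \<sigma> -` fst c)) (snd c' \<circ> (\<lambda>x. (\<sigma> x, \<pi> x)) \<circ> chart_inv a)" using s by simp
  from smooth_on_linear_compose[OF o bounded_linear_fst this]
  show "smooth_on (snd a ` (fst a \<inter> \<sigma> -` fst c)) (\<lambda>w. snd c (\<sigma> (chart_inv a w)))"
    by (simp add: c'_def)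
qed

end

context family
begin

section \<open>The fibres as complex structures on the central fibre\<close>

text \<open>The common form of the charts of \<open>X\<^sub>0\<close> (with \<open>s = 0\<close>) and of the transported charts of \<open>X\<^sub>s\<close>.\<close>

definition rep :: "complex^'m \<Rightarrow> ('x, complex ^ ('n + 'm)) chart \<Rightarrow> ('x, 'n cvec) chart \<Rightarrow> bool" where
  "rep s e c \<longleftrightarrow> s \<in> \<Delta> \<and> slice (\<pi> -` {s}) e \<and> fst c = {x \<in> X0. F x s \<in> fst e} \<and>
     (\<forall>x\<in>fst c. snd c x = prj (snd e (F x s)))"

lemma repD:
  assumes "rep s e c"
  shows "s \<in> \<Delta>" "slice (\<pi> -` {s}) e" "e \<in> E" "x \<in> fst c \<longleftrightarrow> x \<in> X0 \<and> F x s \<in> fst e"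
    "x \<in> fst c \<Longrightarrow> snd c x = prj (snd e (F x s))"
    "x \<in> fst c \<Longrightarrow> emb (prj (snd e (F x s))) = snd e (F x s)"
proof -
  show 1: "s \<in> \<Delta>" "slice (\<pi> -` {s}) e" and 2: "x \<in> fst c \<longleftrightarrow> x \<in> X0 \<and> F x s \<in> fst e"
    and "x \<in> fst c \<Longrightarrow> snd c x = prj (snd e (F x s))"
    using assms by (auto simp: rep_def)
  show "e \<in> E" by (rule slice_E[OF 1(2)])
  show "emb (prj (snd e (F x s))) = snd e (F x s)" if "x \<in> fst c"
    by (rule slice_emb[OF 1(2)]) (use that 2 F_at[of x s] 1(1) in auto)
qed

lemma B_rep: assumes "c \<in> B" obtains e where "rep 0 e c"
proof -
  obtain e where e: "slice X0 e" "c = slice_chart X0 e" by (rule B_slice[OF assms])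
  have "fst c = {x \<in> X0. F x 0 \<in> fst e}" by (auto simp: e(2) F_zero)
  then have "rep 0 e c" using e(1) zero by (auto simp: rep_def e(2) F_zero)
  then show ?thesis by (rule that)
qed

lemma C_rep: assumes "t \<in> \<Delta>" "d \<in> C t" obtains e where "rep t e d"
proof -
  obtain e where e: "slice (\<pi> -` {t}) e"
    and d: "d = (\<sigma> ` (fst e \<inter> \<pi> -` {t}), (\<lambda>x. prj (snd e x)) \<circ> inv_into (\<pi> -` {t}) \<sigma>)"
    using assms(2) unfolding fibre_charts_def slice_charts_eq by (auto simp: slice_chart_def)
  have inj: "inj_on \<sigma> (\<pi> -` {t})" using F_sigma by (metis (mono_tags, lifting) inj_onI vimage_singleton_eq)
  \<comment> \<open>On X_t the inverse of \<sigma> is F(_, t), so the transported chart has the form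
    required by \<open>rep\<close>.\<close>
  have inv: "inv_into (\<pi> -` {t}) \<sigma> x = F x t" if "x \<in> X0" for x
    using inv_into_f_f[OF inj, of "F x t"] F_at[OF that assms(1)] by simp
  have "fst d = {x \<in> X0. F x t \<in> fst e}"
  proof
    show "fst d \<subseteq> {x \<in> X0. F x t \<in> fst e}" using F_sigma sigma_in by (auto simp: d)
    show "{x \<in> X0. F x t \<in> fst e} \<subseteq> fst d"
    proof
      fix x assume x: "x \<in> {x \<in> X0. F x t \<in> fst e}"
      then have "x = \<sigma> (F x t)" "F x t \<in> fst e \<inter> \<pi> -` {t}" using F_at[of x t] assms(1) by auto
      then show "x \<in> fst d" unfolding d fst_conv by (rule image_eqI)
    qed
  qed
  then show ?thesis using that[of e] e assms(1) inv by (simp add: rep_def d)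
qed

lemma rep_inj: assumes "rep s e c" shows "inj_on (snd c) (fst c)"
proof (rule inj_onI)
  fix x y assume x: "x \<in> fst c" and y: "y \<in> fst c" and eq: "snd c x = snd c y"
  note r = repD[OF assms]
  have "snd e (F x s) = snd e (F y s)" using r(5,6)[OF x] r(5,6)[OF y] eq by metis
  then have "F x s = F y s" using chart_onD(1)[OF E_chart[OF r(3)]] x y r(4) by (auto dest: inj_onD)
  then show "x = y" using F_at r(1,4) x y by metis
qed

lemma rep_inv: "rep s e c \<Longrightarrow> x \<in> fst c \<Longrightarrow> chart_inv c (snd c x) = x"
  using rep_inj by (simp add: chart_inv_def)

text \<open>Moves the image from X_0 to the fibre X_s, where \<open>slice_image_open\<close> gives
  openness.\<close>

lemma rep_image:
  assumes "rep s e c"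
  shows "snd c ` (fst c \<inter> W) = snd (slice_chart (\<pi> -` {s}) e) ` (fst (slice_chart (\<pi> -` {s}) e) \<inter> \<sigma> -` W)"
proof -
  note r = repD[OF assms]
  have "\<exists>p. p \<in> fst e \<and> \<pi> p = s \<and> \<sigma> p \<in> W \<and> snd c x = prj (snd e p)" if "x \<in> fst c" "x \<in> W" for x
    using that r(4,5)[of x] F_at[of x s] r(1) by (intro exI[of _ "F x s"]) auto
  then show ?thesis
  proof (intro set_eqI iffI)
    fix u assume L: "\<And>x. x \<in> fst c \<Longrightarrow> x \<in> W \<Longrightarrow> \<exists>p. p \<in> fst e \<and> \<pi> p = s \<and> \<sigma> p \<in> W \<and> snd c x = prj (snd e p)"
      and "u \<in> snd c ` (fst c \<inter> W)"
    then obtain x where "x \<in> fst c" "x \<in> W" "u = snd c x" by auto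
    with L show "u \<in> snd (slice_chart (\<pi> -` {s}) e) ` (fst (slice_chart (\<pi> -` {s}) e) \<inter> \<sigma> -` W)" by fastforce
  next
    fix u assume "u \<in> snd (slice_chart (\<pi> -` {s}) e) ` (fst (slice_chart (\<pi> -` {s}) e) \<inter> \<sigma> -` W)"
    then obtain p where p: "p \<in> fst e" "\<pi> p = s" "\<sigma> p \<in> W" "u = prj (snd e p)" by auto
    have "\<sigma> p \<in> fst c \<inter> W" "u = snd c (\<sigma> p)"
      using r(4,5)[of "\<sigma> p"] F_sigma[of p] sigma_in[of p] p by auto
    then show "u \<in> snd c ` (fst c \<inter> W)" by (rule image_eqI[rotated])
  qed
qed

lemma move_cont: "s \<in> \<Delta> \<Longrightarrow> continuous_on UNIV (\<lambda>p. F (\<sigma> p) s)"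
  using continuous_on_compose2[OF F_cont, of UNIV "\<lambda>p. (\<sigma> p, s)"] sigma_in sigma_cont
  by (force intro: continuous_on_Pair continuous_on_const)

lemma rep_preimage: "rep s' e' c' \<Longrightarrow> \<sigma> -` fst c' = (\<lambda>p. F (\<sigma> p) s') -` fst e'"
  by (rule set_eqI) (use repD(4) sigma_in in simp)

lemma rep_vimage_open: "rep s' e' c' \<Longrightarrow> open (\<sigma> -` fst c')"
  using rep_preimage open_vimage[OF E_open[OF repD(3)] move_cont[OF repD(1)]] by metis

lemma rep_overlap_open:
  assumes "rep s e c" "rep s' e' c'" shows "open (snd c ` (fst c \<inter> fst c'))"
  unfolding rep_image[OF assms(1)]
  by (rule slice_image_open[OF repD(2)[OF assms(1)] rep_vimage_open[OF assms(2)]])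

lemma rep_transition:
  assumes "rep s e c" "rep s' e' c'" "p \<in> fst e" "\<pi> p = s" "F (\<sigma> p) s' \<in> fst e'"
  shows "transition c c' (prj (snd e p)) = prj (snd e' (F (\<sigma> p) s'))" "\<sigma> p \<in> fst c" "\<sigma> p \<in> fst c'" "snd c (\<sigma> p) = prj (snd e p)"
proof -
  show 1: "\<sigma> p \<in> fst c" using repD(4)[OF assms(1)] assms sigma_in F_sigma[of p] by simp
  show 2: "\<sigma> p \<in> fst c'" using repD(4)[OF assms(2)] assms sigma_in by simp
  show 3: "snd c (\<sigma> p) = prj (snd e p)" using repD(5)[OF assms(1) 1] F_sigma[of p] assms(4) by simp
  show "transition c c' (prj (snd e p)) = prj (snd e' (F (\<sigma> p) s'))"
    using rep_inv[OF assms(1) 1] repD(5)[OF assms(2) 2] 3 by (simp add: transition_def)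
qed

lemma B_cover: assumes "x \<in> X0" obtains c where "c \<in> B" "x \<in> fst c"
proof -
  have "\<pi> x = 0" using assms by simp
  then obtain e where e: "slice X0 e" "x \<in> fst e" by (rule slice_exists)
  have "slice_chart X0 e \<in> B" unfolding slice_charts_eq using e(1) by blast
  then show ?thesis by (rule that) (use e(2) assms in simp)
qed

lemma C_cover: assumes "t \<in> \<Delta>" "x \<in> X0" shows "\<exists>d\<in>C t. x \<in> fst d"
proof -
  have F: "\<sigma> (F x t) = x" "\<pi> (F x t) = t" using F_at[OF assms(2,1)] by auto
  obtain e where e: "slice (\<pi> -` {t}) e" "F x t \<in> fst e" using slice_exists[OF F(2)] by metis
  have "(\<lambda>(U, z). (\<sigma> ` U, z \<circ> inv_into (\<pi> -` {t}) \<sigma>)) (slice_chart (\<pi> -` {t}) e) \<in> C t"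
    unfolding fibre_charts_def slice_charts_eq using e(1) by blast
  moreover have "x \<in> \<sigma> ` (fst e \<inter> \<pi> -` {t})" using F e(2) by (intro image_eqI[of _ _ "F x t"]) auto
  ultimately show ?thesis unfolding slice_chart_def by (intro bexI) simp_all
qed

text \<open>The trivialization is known to be smooth in charts of A and B. The transition is
  therefore factored near a point: from the fibre chart to a chart a of the total space, by \<sigma>
  into a chart c0 of X_0, by F(_, s') into a second chart a', and on to the target fibre
  chart.\<close>

lemma rep_smooth:
  assumes "rep s e c" "rep s' e' c'" shows "smooth_on (snd c ` (fst c \<inter> fst c')) (transition c c')"
proof (rule smooth_on_local[OF rep_overlap_open[OF assms]])
  fix u0 assume "u0 \<in> snd c ` (fst c \<inter> fst c')"
  then obtain x0 where x0: "x0 \<in> fst c" "x0 \<in> fst c'" "u0 = snd c x0" by auto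
  note r = repD[OF assms(1)] and r' = repD[OF assms(2)]
  have x0X: "x0 \<in> X0" and Fe: "F x0 s \<in> fst e" "F x0 s' \<in> fst e'" using r(4) r'(4) x0 by auto
  obtain c0 where c0: "c0 \<in> B" "x0 \<in> fst c0" by (rule B_cover[OF x0X])
  obtain e0 where e0: "rep 0 e0 c0" by (rule B_rep[OF c0(1)])
  obtain a where a: "a \<in> A" "F x0 s \<in> fst a" by (rule A_cover)
  obtain a' where a': "a' \<in> A" "F x0 s' \<in> fst a'" by (rule A_cover)
  have aE: "a \<in> E" "a' \<in> E" using a a' A_subset_E by auto
  \<comment> \<open>The part of the total space on which every link of this chain is
    defined.\<close>
  define W where "W = fst a \<inter> \<sigma> -` fst c0 \<inter> (\<lambda>p. F (\<sigma> p) s') -` (fst a' \<inter> fst e')"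
  define T where "T = snd (slice_chart (\<pi> -` {s}) e) ` (fst (slice_chart (\<pi> -` {s}) e) \<inter> W)"
  have "open W" unfolding W_def
    by (intro open_Int E_open aE rep_vimage_open[OF e0] open_vimage[OF _ move_cont[OF r'(1)]] r'(3))
  then have T: "open T" unfolding T_def by (rule slice_image_open[OF r(2)])
  have Tp: "\<exists>p. p \<in> fst e \<and> \<pi> p = s \<and> p \<in> W \<and> u = prj (snd e p) \<and> emb u = snd e p" if "u \<in> T" for u
    using that slice_emb[OF r(2)] by (auto simp: T_def)
  define f1 where "f1 u = transition e a (emb u)" for u
  have f1p: "f1 (prj (snd e p)) = snd a p" if "p \<in> fst e" "\<pi> p = s" for p
    using slice_emb[OF r(2), of p] that E_transition_at[OF r(3), of p a] by (simp add: f1_def)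
  have "holo_on T f1" unfolding f1_def[abs_def]
    by (rule holo_on_compose[OF T E_overlap_open[OF r(3) aE(1)] _ holo_on_emb[OF T] E_holo[OF r(3) aE(1)]])
      (use Tp in \<open>force simp: W_def\<close>)
  then have f1: "smooth_on T f1" by (rule holo_on_smooth)
  define f2 where "f2 u = snd c0 (\<sigma> (chart_inv a (f1 u)))" for u
  have f2p: "f2 (prj (snd e p)) = snd c0 (\<sigma> p)" if "p \<in> fst e" "\<pi> p = s" "p \<in> W" for p
    using that E_inv[OF aE(1), of p] by (simp add: f2_def f1p W_def)
  have f2: "smooth_on T f2" unfolding f2_def[abs_def]
    by (rule smooth_on_compose[OF T sigma_smooth(2)[OF c0(1) a(1)] _ f1 sigma_smooth(1)[OF c0(1) a(1)]])
      (use Tp f1p in \<open>force simp: W_def\<close>)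
  have f2s: "smooth_on T (\<lambda>u. (f2 u, s'))" by (rule smooth_on_Pair[OF T f2 smooth_on_const[OF T]])
  define f3 where "f3 u = snd a' (F (chart_inv c0 (fst (f2 u, s'))) (snd (f2 u, s')))" for u
  have inv0: "chart_inv c0 (snd c0 (\<sigma> p)) = \<sigma> p" if "p \<in> W" for p
    using that B_props(5)[OF c0(1)] by (simp add: W_def)
  have f3p: "f3 (prj (snd e p)) = snd a' (F (\<sigma> p) s')" if "p \<in> fst e" "\<pi> p = s" "p \<in> W" for p
    using that by (simp add: f3_def f2p inv0)
  have f3: "smooth_on T f3" unfolding f3_def[abs_def]
  proof (rule smooth_on_compose[OF T dom_open[OF c0(1) E_open[OF aE(2)]] _ f2s F_smooth[OF c0(1) a'(1)]])
    show "(\<lambda>u. (f2 u, s')) ` T \<subseteq> dom c0 (fst a')"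
    proof
      fix z assume "z \<in> (\<lambda>u. (f2 u, s')) ` T"
      then obtain p where p: "p \<in> fst e" "\<pi> p = s" "p \<in> W" "z = (f2 (prj (snd e p)), s')" using Tp by blast
      then show "z \<in> dom c0 (fst a')" using r'(1) inv0[OF p(3)] by (auto simp: dom_def f2p W_def)
    qed
  qed
  have f4: "smooth_on T (\<lambda>u. transition a' e' (f3 u))"
  proof (rule smooth_on_compose[OF T E_overlap_open[OF aE(2) r'(3)] _ f3 holo_on_smooth[OF E_holo[OF aE(2) r'(3)]]])
    show "f3 ` T \<subseteq> snd a' ` (fst a' \<inter> fst e')"
    proof
      fix z assume "z \<in> f3 ` T"
      then obtain p where p: "p \<in> fst e" "\<pi> p = s" "p \<in> W" "z = f3 (prj (snd e p))" using Tp by blast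
      then show "z \<in> snd a' ` (fst a' \<inter> fst e')" by (auto simp: f3p W_def)
    qed
  qed
  have f5: "smooth_on T (\<lambda>u. prj (transition a' e' (f3 u)))"
    by (rule smooth_on_linear_compose[OF T bounded_linear_prj f4])
  have "smooth_on T (transition c c')"
  proof (rule smooth_on_cong[OF T f5])
    fix u assume "u \<in> T"
    then obtain p where p: "p \<in> fst e" "\<pi> p = s" "p \<in> W" "u = prj (snd e p)" using Tp by blast
    have m: "F (\<sigma> p) s' \<in> fst a'" "F (\<sigma> p) s' \<in> fst e'" using p(3) by (auto simp: W_def)
    have "transition a' e' (f3 u) = snd e' (F (\<sigma> p) s')" unfolding p(4) f3p[OF p(1-3)] by (rule E_transition_at[OF aE(2) m(1)])
    then show "prj (transition a' e' (f3 u)) = transition c c' u" using rep_transition(1)[OF assms p(1,2) m(2)] p(4) by simp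
  qed
  moreover have "u0 \<in> T"
  proof -
    have F: "\<sigma> (F x0 s) = x0" "\<pi> (F x0 s) = s" using F_at[OF x0X r(1)] by auto
    then have "F x0 s \<in> fst (slice_chart (\<pi> -` {s}) e) \<inter> W" using Fe c0 a a' by (simp add: W_def)
    moreover have "u0 = snd (slice_chart (\<pi> -` {s}) e) (F x0 s)" using x0 r(5) by simp
    ultimately show ?thesis unfolding T_def by (rule image_eqI[rotated])
  qed
  ultimately show "\<exists>T. open T \<and> u0 \<in> T \<and> smooth_on T (transition c c')" using T by blast
qed

text \<open>Within one fibre, going to X_0 and back is the identity, so these transitions are those
  of the charts induced on X_s.\<close>

lemma rep_holo:
  assumes "rep s e c" "rep s e' c'" shows "holo_on (snd c ` (fst c \<inter> fst c')) (transition c c')"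
proof -
  let ?c = "slice_chart (\<pi> -` {s}) e" and ?c' = "slice_chart (\<pi> -` {s}) e'"
  note r = repD[OF assms(1)] and r' = repD[OF assms(2)]
  have m: "F (\<sigma> p) s = p" if "\<pi> p = s" for p using F_sigma[of p] that by simp
  have eq: "snd c ` (fst c \<inter> fst c') = snd ?c ` (fst ?c \<inter> fst ?c')"
  proof -
    have "fst ?c \<inter> \<sigma> -` fst c' = fst ?c \<inter> fst ?c'" by (rule set_eqI) (use sigma_in m r'(4) in auto)
    then show ?thesis unfolding rep_image[OF assms(1)] by simp
  qed
  show ?thesis
  proof (rule holo_on_cong[OF rep_overlap_open[OF assms]])
    show "holo_on (snd c ` (fst c \<inter> fst c')) (transition ?c ?c')" unfolding eq by (rule slice_holo(2)[OF r(2) r'(2)])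
    fix u assume "u \<in> snd c ` (fst c \<inter> fst c')"
    then obtain p where p: "p \<in> fst e" "\<pi> p = s" "p \<in> fst e'" "u = prj (snd e p)" unfolding eq by auto
    then show "transition ?c ?c' u = transition c c' u"
      using rep_transition(1)[OF assms p(1,2)] slice_inv[OF r(2) p(1)] by (simp add: m transition_def)
  qed
qed

lemma BC_rep: assumes "t \<in> \<Delta>" "c \<in> B \<union> C t" obtains s e where "rep s e c"
  using assms B_rep C_rep by (metis UnE)

lemma atlas_pair_fibre: assumes t: "t \<in> \<Delta>" shows "atlas_pair B (C t)"
proof
  fix c assume c: "c \<in> B \<union> C t"
  obtain s e where r: "rep s e c" by (rule BC_rep[OF t c])
  show "inj_on (snd c) (fst c)" by (rule rep_inj[OF r])
  fix d assume d: "d \<in> B \<union> C t"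
  obtain s' e' where r': "rep s' e' d" by (rule BC_rep[OF t d])
  show "open (snd c ` (fst c \<inter> fst d))" by (rule rep_overlap_open[OF r r'])
  show "smooth_on (snd c ` (fst c \<inter> fst d)) (transition c d)" by (rule rep_smooth[OF r r'])
next
  have *: "Dtransition c d x (k *s v) = k *s Dtransition c d x v" if "rep s e c" "rep s e' d" "x \<in> fst c" "x \<in> fst d" for c d x k v s e e'
    unfolding Dtransition_def by (rule holo_on_derivative[OF rep_holo[OF that(1,2)]]) (use that in auto)
  show "Dtransition c d x (k *s v) = k *s Dtransition c d x v" if "c \<in> B" "d \<in> B" "x \<in> fst c" "x \<in> fst d" for c d x k v
    using * that B_rep by metis
  show "Dtransition c d x (k *s v) = k *s Dtransition c d x v" if "c \<in> C t" "d \<in> C t" "x \<in> fst c" "x \<in> fst d" for c d x k v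
    using * that C_rep t by metis
next
  show "\<exists>d\<in>C t. x \<in> fst d" if "c \<in> B" "x \<in> fst c" for c x
    using C_cover[OF t] B_props(2) that by blast
qed

end

context family
begin

section \<open>Nondegeneracy near the central fibre\<close>

text \<open>The target carries coordinates of the total space because one chart a serves all nearby
  t, whereas charts of X_t are given for each t separately.\<close>

definition Psi :: "('x, 'n cvec) chart \<Rightarrow> ('x, complex ^ ('n + 'm)) chart \<Rightarrow> 'n cvec \<times> 'm cvec \<Rightarrow> complex ^ ('n + 'm)" where
  "Psi c a p = snd a (F (chart_inv c (fst p)) (snd p))"

definition dPsi :: "('x, 'n cvec) chart \<Rightarrow> ('x, complex ^ ('n + 'm)) chart \<Rightarrow> 'n cvec \<times> 'm cvec \<Rightarrow> 'n cvec \<Rightarrow> complex ^ ('n + 'm)" where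
  "dPsi c a p v = frechet_derivative (Psi c a) (at p) (v, 0)"

text \<open>Twice the complex linear part of the fibrewise derivative, up to the factor \<open>\<i>\<close>.\<close>

definition lin_part :: "('x, 'n cvec) chart \<Rightarrow> ('x, complex ^ ('n + 'm)) chart \<Rightarrow> 'n cvec \<times> 'm cvec \<Rightarrow> 'n cvec \<Rightarrow> complex ^ ('n + 'm)" where
  "lin_part c a p v = dPsi c a p (\<i> *s v) + \<i> *s dPsi c a p v"

lemma dom_open': "c \<in> B \<Longrightarrow> a \<in> A \<Longrightarrow> open (dom c (fst a))"
  by (rule dom_open[OF _ E_open]) (use A_subset_E in auto)

lemma Psi_smooth: "c \<in> B \<Longrightarrow> a \<in> A \<Longrightarrow> smooth_on (dom c (fst a)) (Psi c a)"
  unfolding Psi_def[abs_def] by (rule F_smooth)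

lemma Psi_derivative:
  "c \<in> B \<Longrightarrow> a \<in> A \<Longrightarrow> p \<in> dom c (fst a) \<Longrightarrow> (Psi c a has_derivative frechet_derivative (Psi c a) (at p)) (at p)"
  by (rule smooth_on_has_derivative[OF Psi_smooth])

lemma linear_dPsi:
  assumes "c \<in> B" "a \<in> A" "p \<in> dom c (fst a)" shows "linear (dPsi c a p)"
proof -
  interpret L: linear "frechet_derivative (Psi c a) (at p)" by (rule has_derivative_linear[OF Psi_derivative[OF assms]])
  show ?thesis unfolding dPsi_def[abs_def]
    by (rule linearI) (use L.add[of "(_, 0)" "(_, 0)"] L.scale[of _ "(_, 0)"] in simp_all)
qed

lemma in_dom: "c \<in> B \<Longrightarrow> x \<in> fst c \<Longrightarrow> t \<in> \<Delta> \<Longrightarrow> F x t \<in> fst a \<Longrightarrow> (snd c x, t) \<in> dom c (fst a)"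
  using B_props(5)[of c x] by (auto simp: dom_def)

text \<open>Factors the fibrewise derivative through a chart of X_t. Everything applied after
  \<open>Dtransition c d x\<close> is complex linear, so antilinear behaviour of the latter can be
  detected in a.\<close>

lemma dPsi_eq:
  assumes c: "c \<in> B" and d: "rep t e d" and a: "a \<in> A" and x: "x \<in> fst c" "x \<in> fst d" "F x t \<in> fst a"
  shows "dPsi c a (snd c x, t) v = frechet_derivative (transition e a) (at (snd e (F x t))) (emb (Dtransition c d x v))"
proof -
  note r = repD[OF d]
  obtain e0 where e0: "rep 0 e0 c" by (rule B_rep[OF c])
  have aE: "a \<in> E" using a A_subset_E by auto
  have p: "(snd c x, t) \<in> dom c (fst a)" by (rule in_dom[OF c x(1) r(1) x(3)])
  have l: "((\<lambda>y. (y, t)) has_derivative (\<lambda>v. (v, 0))) (at (snd c x))"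
    by (intro has_derivative_Pair has_derivative_ident has_derivative_const)
  from has_derivative_compose[OF this Psi_derivative[OF c a p]]
  have 1: "((\<lambda>y. Psi c a (y, t)) has_derivative dPsi c a (snd c x, t)) (at (snd c x))"
    unfolding dPsi_def[abs_def] .
  have m: "snd c x \<in> snd c ` (fst c \<inter> fst d)" using x by auto
  have "(transition c d has_derivative Dtransition c d x) (at (snd c x))"
    unfolding Dtransition_def by (rule smooth_on_has_derivative[OF rep_smooth[OF e0 d] m])
  from bounded_linear.has_derivative[OF bounded_linear_emb this]
  have 2: "((\<lambda>y. emb (transition c d y)) has_derivative (\<lambda>v. emb (Dtransition c d x v))) (at (snd c x))" .
  have tx: "emb (transition c d (snd c x)) = snd e (F x t)"
    using rep_inv[OF e0 x(1)] r(5,6)[OF x(2)] by (simp add: transition_def)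
  have Fe: "F x t \<in> fst e" using r(4) x(2) by simp
  have "(transition e a has_derivative frechet_derivative (transition e a) (at (snd e (F x t)))) (at (emb (transition c d (snd c x))))"
    unfolding tx by (rule smooth_on_has_derivative[OF holo_on_smooth[OF E_holo[OF r(3) aE]]]) (use Fe x(3) in auto)
  from has_derivative_compose[OF 2 this]
  have 3: "((\<lambda>y. transition e a (emb (transition c d y))) has_derivative
      (\<lambda>v. frechet_derivative (transition e a) (at (snd e (F x t))) (emb (Dtransition c d x v)))) (at (snd c x))" .
  have eq: "transition e a (emb (transition c d y)) = Psi c a (y, t)" if y: "y \<in> snd c ` (fst c \<inter> fst d)" for y
  proof -
    obtain z where z: "z \<in> fst c" "z \<in> fst d" "y = snd c z" using y by auto
    have iz: "chart_inv c y = z" using rep_inv[OF e0 z(1)] z(3) by simp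
    have "emb (transition c d y) = snd e (F z t)" using iz r(5,6)[OF z(2)] by (simp add: transition_def)
    moreover have "F z t \<in> fst e" using r(4) z(2) by simp
    ultimately show ?thesis using E_transition_at[OF r(3)] iz by (simp add: Psi_def)
  qed
  have "((\<lambda>y. Psi c a (y, t)) has_derivative
      (\<lambda>v. frechet_derivative (transition e a) (at (snd e (F x t))) (emb (Dtransition c d x v)))) (at (snd c x))"
    by (rule has_derivative_transform_within_open[OF 3 rep_overlap_open[OF e0 d] m eq])
  from has_derivative_unique[OF 1 this] show ?thesis by (rule fun_cong)
qed

text \<open>On a vector killed by \<open>jac\<close> the differential of the transition behaves
  antilinearly; the complex linear factors of \<open>dPsi_eq\<close> preserve this, so
  \<open>lin_part\<close> vanishes there.\<close>

lemma invertible_of_lin_part: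
  assumes t: "t \<in> \<Delta>" and c0: "c0 \<in> B" and a: "a \<in> A" and x: "x \<in> fst c0" "F x t \<in> fst a"
    and nz: "\<And>v. lin_part c0 a (snd c0 x, t) v = 0 \<Longrightarrow> v = 0"
    and c: "c \<in> B" "x \<in> fst c" and d: "d \<in> C t" "x \<in> fst d"
  shows "invertible (jac (dcoord c d x))"
proof (rule invertible_of_inj)
  interpret ap: atlas_pair B "C t" by (rule atlas_pair_fibre[OF t])
  fix v assume v: "jac (dcoord c d x) *v v = 0"
  obtain e where e: "rep t e d" by (rule C_rep[OF t d(1)])
  have U: "c \<in> B \<union> C t" "c0 \<in> B \<union> C t" "d \<in> B \<union> C t" using c c0 d by auto
  have dc: "dcoord c d x = coframe_of (Dtransition c d x)" by (rule ap.dcoord_coframe_of[OF U(1,3) c(2) d(2)])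
  have lin: "linear (Dtransition c d x)" by (rule ap.linear_Dtransition[OF U(1,3) c(2) d(2)])
  \<comment> \<open>With the linear part gone, only \<open>jacbar\<close> applied to the conjugate
    vector remains.\<close>
  have L: "Dtransition c d x (\<i> *s v) = - \<i> *s Dtransition c d x v"
  proof -
    have c: "cnjv (\<i> *s v) = (- \<i>) *s cnjv v" by (simp add: cnjv_def vec_eq_iff)
    have "Dtransition c d x (\<i> *s v) = jacbar (coframe_of (Dtransition c d x)) *v cnjv (\<i> *s v)"
      using linear_split[OF lin, of "\<i> *s v"] v by (simp add: dc matrix_vector_scale)
    also have "\<dots> = (- \<i>) *s (jacbar (coframe_of (Dtransition c d x)) *v cnjv v)" unfolding c by (rule matrix_vector_scale)
    also have "jacbar (coframe_of (Dtransition c d x)) *v cnjv v = Dtransition c d x v"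
      using linear_split[OF lin, of v] v by (simp add: dc)
    finally show ?thesis .
  qed
  \<comment> \<open>The hypothesis on \<open>lin_part\<close> concerns c0; the change from c to c0
    is complex linear and carries v to w.\<close>
  define w where "w = Dtransition c c0 x v"
  have iw: "Dtransition c c0 x (\<i> *s v) = \<i> *s w" unfolding w_def by (rule ap.holB[OF c(1) c0 c(2) x(1)])
  have ch: "Dtransition c d x u = Dtransition c0 d x (Dtransition c c0 x u)" for u by (rule ap.Dtransition_chain[OF U c(2) x(1) d(2)])
  have Lw: "Dtransition c0 d x (\<i> *s w) = - \<i> *s Dtransition c0 d x w"
    using L unfolding ch iw by (simp add: w_def)
  have re: "e \<in> E" "a \<in> E" "F x t \<in> fst e" using repD(3,4)[OF e] d(2) a A_subset_E by auto
  have sc: "frechet_derivative (transition e a) (at (snd e (F x t))) (k *s u) = k *s frechet_derivative (transition e a) (at (snd e (F x t))) u" for k u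
    by (rule holo_on_derivative[OF E_holo[OF re(1,2)]]) (use re x in auto)
  have "lin_part c0 a (snd c0 x, t) w = 0"
    unfolding lin_part_def dPsi_eq[OF c0 e a x(1) d(2) x(2)] Lw emb_scale sc by simp
  then have "w = 0" by (rule nz)
  then have "Dtransition c0 c x w = 0" using linear_0[OF ap.linear_Dtransition[OF U(2,1) x(1) c(2)]] by simp
  then show "v = 0" using ap.Dtransition_inverse[OF U(1,2) c(2) x(1), of v] by (simp add: w_def)
qed

text \<open>At t = 0 the map F is the identity, so its derivative is complex linear and injective,
  and \<open>lin_part\<close> is 2 \<i> times that derivative.\<close>

lemma lin_part_zero:
  assumes c: "c \<in> B" and a: "a \<in> A" and x: "x \<in> fst c" "x \<in> fst a" and v: "lin_part c a (snd c x, 0) v = 0"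
  shows "v = 0"
proof -
  interpret ap: atlas_pair B "C 0" by (rule atlas_pair_fibre[OF zero])
  obtain e where e: "rep 0 e c" by (rule B_rep[OF c])
  have xX: "x \<in> X0" using B_props(2)[OF c] x by auto
  have F0: "F x 0 = x" by (rule F_zero[OF xX])
  have re: "e \<in> E" "a \<in> E" "x \<in> fst e" using repD(3,4)[OF e] x a A_subset_E F0 by auto
  define K where "K = frechet_derivative (transition e a) (at (snd e x))"
  have m: "snd e x \<in> snd e ` (fst e \<inter> fst a)" "snd a x \<in> snd a ` (fst a \<inter> fst e)" using re x by auto
  have K: "(transition e a has_derivative K) (at (snd e x))"
    unfolding K_def by (rule smooth_on_has_derivative[OF holo_on_smooth[OF E_holo[OF re(1,2)]] m(1)])
  have sc: "K (k *s u) = k *s K u" for k u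
    unfolding K_def by (rule holo_on_derivative[OF E_holo[OF re(1,2)] m(1)])
  have tx: "transition e a (snd e x) = snd a x" by (rule E_transition_at[OF re(1,3)])
  define K' where "K' = frechet_derivative (transition a e) (at (snd a x))"
  have K': "(transition a e has_derivative K') (at (transition e a (snd e x)))"
    unfolding K'_def tx by (rule smooth_on_has_derivative[OF holo_on_smooth[OF E_holo[OF re(2,1)]] m(2)])
  have "((\<lambda>y. y) has_derivative (\<lambda>u. K' (K u))) (at (snd e x))"
  proof (rule has_derivative_transform_within_open[OF has_derivative_compose[OF K K'] E_overlap_open[OF re(1,2)] m(1)])
    show "transition a e (transition e a y) = y" if y: "y \<in> snd e ` (fst e \<inter> fst a)" for y
    proof -
      obtain z where z: "z \<in> fst e" "z \<in> fst a" "y = snd e z" using y by auto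
      show ?thesis unfolding z(3) E_transition_at[OF re(1) z(1)] by (rule E_transition_at[OF re(2) z(2)])
    qed
  qed
  from has_derivative_unique[OF this has_derivative_ident] have K'K: "K' (K u) = u" for u by (rule fun_cong)
  have "dPsi c a (snd c x, 0) u = K (emb u)" for u
    using dPsi_eq[OF c e a x(1,1), of u] ap.Dtransition_same[of c x u] c x F0 by (simp add: K_def)
  then have "2 *s (\<i> *s K (emb v)) = 0" using v
    by (simp add: lin_part_def emb_scale sc vec_eq_iff)
  then have "K (emb v) = 0" by (simp add: vec_eq_iff)
  then have "emb v = K' 0" using K'K[of "emb v"] by simp
  also have "K' 0 = 0" by (rule linear_0[OF has_derivative_linear[OF K']])
  finally have "prj (emb v :: complex ^ ('n + 'm)) = 0" by (simp add: linear_0[OF linear_prj])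
  then show "v = 0" by simp
qed

text \<open>Real homogeneity reduces nonvanishing to vectors of norm one.\<close>

lemma lin_part_scale:
  assumes "c \<in> B" "a \<in> A" "p \<in> dom c (fst a)" shows "lin_part c a p (r *\<^sub>R v) = r *\<^sub>R lin_part c a p v"
proof -
  have i: "\<i> *s (r *\<^sub>R u) = r *\<^sub>R (\<i> *s u)" for u :: "complex ^ 'k" by (simp add: vec_eq_iff)
  show ?thesis unfolding lin_part_def i linear_scale[OF linear_dPsi[OF assms]] by (simp add: scaleR_add_right)
qed

text \<open>Derivatives in fixed directions are continuous; expanding the moving direction h in a
  basis makes the dependence jointly continuous.\<close>

lemma dPsi_cont:
  assumes "c \<in> B" "a \<in> A" "continuous_on (dom c (fst a) \<times> (UNIV :: 'n cvec set)) h"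
  shows "continuous_on (dom c (fst a) \<times> UNIV) (\<lambda>q. dPsi c a (fst q) (h q))"
proof -
  let ?W = "dom c (fst a) \<times> (UNIV :: 'n cvec set)"
  have "continuous_on (dom c (fst a)) (\<lambda>p. frechet_derivative (Psi c a) (at p) (b, 0))" for b
    by (rule smooth_on_continuous[OF smooth_on_derivative[OF Psi_smooth[OF assms(1,2)]]])
  then have d: "continuous_on (dom c (fst a)) (\<lambda>p. dPsi c a p b)" for b by (simp add: dPsi_def)
  have "continuous_on ?W (\<lambda>q. dPsi c a (fst q) b)" for b
    by (rule continuous_on_compose2[OF d continuous_on_fst[OF continuous_on_id]]) auto
  then have "continuous_on ?W (\<lambda>q. \<Sum>b\<in>Basis. (h q \<bullet> b) *\<^sub>R dPsi c a (fst q) b)"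
    by (intro continuous_on_sum continuous_on_scaleR continuous_on_inner assms(3) continuous_on_const)
  then show ?thesis
  proof (rule continuous_on_eq)
    fix q assume "q \<in> ?W"
    then have "fst q \<in> dom c (fst a)" by auto
    note lin = linear_dPsi[OF assms(1,2) this]
    have "dPsi c a (fst q) (h q) = dPsi c a (fst q) (\<Sum>b\<in>Basis. (h q \<bullet> b) *\<^sub>R b)" by (simp add: euclidean_representation)
    then show "(\<Sum>b\<in>Basis. (h q \<bullet> b) *\<^sub>R dPsi c a (fst q) b) = dPsi c a (fst q) (h q)"
      by (simp add: linear_sum[OF lin] linear_scale[OF lin])
  qed
qed

lemma mult_i_bounded_linear: "bounded_linear (\<lambda>v. \<i> *s (v :: complex ^ 'k::finite))"
  by (rule linear_conv_bounded_linear[THEN iffD1]) (auto simp: linear_iff vec_eq_iff algebra_simps)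

lemma lin_part_cont:
  assumes "c \<in> B" "a \<in> A"
  shows "continuous_on (dom c (fst a) \<times> UNIV) (\<lambda>q. lin_part c a (fst q) (snd q))"
  unfolding lin_part_def
  by (intro continuous_on_add bounded_linear.continuous_on[OF mult_i_bounded_linear] dPsi_cont[OF assms]
      continuous_on_snd continuous_on_id)

text \<open>\<open>lin_part\<close> has no zero on the unit sphere over the point of x0 and t = 0.
  The sphere is compact, so by the tube lemma this persists over a neighbourhood in both the point
  and the parameter.\<close>

lemma local_nondegeneracy:
  assumes "x0 \<in> X0"
  obtains T N where "open T" "x0 \<in> T" "open N" "0 \<in> N" "N \<subseteq> \<Delta>"
    "\<And>t x c d. t \<in> N \<Longrightarrow> x \<in> T \<Longrightarrow> c \<in> B \<Longrightarrow> d \<in> C t \<Longrightarrow> x \<in> fst c \<Longrightarrow> x \<in> fst d \<Longrightarrow> invertible (jac (dcoord c d x))"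
proof -
  obtain c0 where c0: "c0 \<in> B" "x0 \<in> fst c0" by (rule B_cover[OF assms])
  obtain e0 where e0: "slice X0 e0" "c0 = slice_chart X0 e0" by (rule B_slice[OF c0(1)])
  obtain a where a: "a \<in> A" "x0 \<in> fst a" by (rule A_cover)
  let ?W = "dom c0 (fst a)"
  have W: "open ?W" by (rule dom_open'[OF c0(1) a(1)])
  define P where "P = (?W \<times> UNIV) \<inter> (\<lambda>q. lin_part c0 a (fst q) (snd q)) -` (- {0})"
  have "open P" unfolding P_def
    by (rule continuous_open_preimage[OF lin_part_cont[OF c0(1) a(1)]]) (auto intro: open_Times W)
  have p0: "(snd c0 x0, 0) \<in> ?W" by (rule in_dom[OF c0 zero]) (simp add: F_zero[OF assms] a)
  have "{(snd c0 x0, 0)} \<times> sphere (0 :: 'n cvec) 1 \<subseteq> P"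
    using p0 lin_part_zero[OF c0(1) a(1) c0(2) a(2)] by (fastforce simp: P_def)
  from Elementary_Topology.tube_lemma[OF compact_sphere \<open>open P\<close> this]
  obtain Y where Y: "open Y" "(snd c0 x0, 0) \<in> Y" "Y \<times> sphere (0 :: 'n cvec) 1 \<subseteq> P" by blast
  obtain N1 N2 where N: "open N1" "open N2" "(snd c0 x0, 0) \<in> N1 \<times> N2" "N1 \<times> N2 \<subseteq> Y \<inter> ?W"
    by (rule open_prod_elim[OF open_Int[OF Y(1) W] IntI[OF Y(2) p0]])
  define T where "T = fst e0 \<inter> (\<lambda>x. prj (snd e0 x)) -` N1"
  note ch = E_chart[OF slice_E[OF e0(1)]]
  show ?thesis
  proof (rule that)
    have "continuous_on (fst e0) (\<lambda>x. prj (snd e0 x))"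
      by (rule bounded_linear.continuous_on[OF bounded_linear_prj chart_onD(3)[OF ch]])
    then show "open T" unfolding T_def
      by (rule continuous_open_preimage[OF _ E_open[OF slice_E[OF e0(1)]] N(1)])
    show "x0 \<in> T" using c0(2) N(3) by (simp add: T_def e0(2))
    show "open N2" "0 \<in> N2" using N by auto
    show "N2 \<subseteq> \<Delta>" using N(3,4) by (auto simp: dom_def)
    fix t x c d assume t: "t \<in> N2" and x: "x \<in> T" and c: "c \<in> B" "x \<in> fst c" and d: "d \<in> C t" "x \<in> fst d"
    have xX: "x \<in> X0" using B_props(2)[OF c(1)] c(2) by auto
    have xc0: "x \<in> fst c0" "snd c0 x \<in> N1" using x xX by (auto simp: T_def e0(2))
    then have q: "(snd c0 x, t) \<in> Y" "(snd c0 x, t) \<in> ?W" using N(4) t by auto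
    have F: "t \<in> \<Delta>" "F x t \<in> fst a" using q(2) B_props(5)[OF c0(1) xc0(1)] by (auto simp: dom_def)
    show "invertible (jac (dcoord c d x))"
    proof (rule invertible_of_lin_part[OF F(1) c0(1) a(1) xc0(1) F(2) _ c d])
      fix v assume v: "lin_part c0 a (snd c0 x, t) v = 0"
      show "v = 0"
      proof (rule ccontr)
        assume "v \<noteq> 0"
        then have "(1 / norm v) *\<^sub>R v \<in> sphere 0 1" by simp
        then have "((snd c0 x, t), (1 / norm v) *\<^sub>R v) \<in> P" using Y(3) q(1) by blast
        then show False using v by (simp add: P_def lin_part_scale[OF c0(1) a(1) q(2)])
      qed
    qed
  qed
qed

text \<open>X_0 is compact because \<pi> is proper, so finitely many local neighbourhoods cover it,
  and the intersection of their parameter sets is still open.\<close>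

lemma nondegeneracy: "\<exists>\<Delta>'\<subseteq>\<Delta>. open \<Delta>' \<and> 0 \<in> \<Delta>' \<and> (\<forall>t\<in>\<Delta>'. pi10_iso B (C t))"
proof -
  define good where "good T N \<longleftrightarrow> open T \<and> open N \<and> 0 \<in> N \<and> N \<subseteq> \<Delta> \<and>
    (\<forall>t x c d. t \<in> N \<longrightarrow> x \<in> T \<longrightarrow> c \<in> B \<longrightarrow> d \<in> C t \<longrightarrow> x \<in> fst c \<longrightarrow> x \<in> fst d \<longrightarrow> invertible (jac (dcoord c d x)))" for T N
  have "\<exists>T N. x \<in> T \<and> good T N" if "x \<in> X0" for x
  proof -
    obtain T N where "open T" "x \<in> T" "open N" "0 \<in> N" "N \<subseteq> \<Delta>"
      "\<And>t x c d. t \<in> N \<Longrightarrow> x \<in> T \<Longrightarrow> c \<in> B \<Longrightarrow> d \<in> C t \<Longrightarrow> x \<in> fst c \<Longrightarrow> x \<in> fst d \<Longrightarrow> invertible (jac (dcoord c d x))"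
      by (rule local_nondegeneracy[OF \<open>x \<in> X0\<close>]) blast
    then show ?thesis unfolding good_def by (intro exI[of _ T] exI[of _ N]) simp
  qed
  then obtain T N where TN: "\<And>x. x \<in> X0 \<Longrightarrow> x \<in> T x \<and> good (T x) (N x)" by metis
  have "compact X0" by (rule pi_proper) (use zero in auto)
  then obtain K where K: "K \<subseteq> X0" "finite K" "X0 \<subseteq> (\<Union>x\<in>K. T x)"
    by (rule compactE_image[of X0 X0 T]) (use TN in \<open>auto simp: good_def\<close>)
  define D where "D = \<Delta> \<inter> (\<Inter>x\<in>K. N x)"
  have g: "good (T x) (N x)" if "x \<in> K" for x using TN K that by blast
  have "pi10_iso B (C t)" if t: "t \<in> D" for t
    unfolding pi10_iso_def
  proof (intro ballI)
    fix c d x assume h: "c \<in> B" "d \<in> C t" "x \<in> fst c \<inter> fst d"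
    then have "x \<in> X0" using B_props(2)[OF h(1)] by blast
    then obtain y where y: "y \<in> K" "x \<in> T y" using K(3) by blast
    have "t \<in> N y" using t y by (auto simp: D_def)
    then show "invertible (jac (dcoord c d x))" using g[OF y(1)] h y(2) unfolding good_def by blast
  qed
  moreover have "open D" unfolding D_def
    by (intro open_Int open_Delta open_INT K(2)) (use g in \<open>auto simp: good_def\<close>)
  moreover have "0 \<in> D" "D \<subseteq> \<Delta>" using zero g by (auto simp: D_def good_def)
  ultimately show ?thesis by blast
qed

lemma delbar_P:
  assumes "t \<in> \<Delta>" "pi10_iso B (C t)" "s \<in> smooth_forms B B p q"
  shows "P_map B (C t) p q s \<in> smooth_forms B (C t) p q"
    "delbar B (C t) (P_map B (C t) p q s) = P_map B (C t) p (Suc q) (delbar B B s - L10 B (beltrami (C t)) s)"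
proof -
  interpret atlas_pair B "C t" by (rule atlas_pair_fibre[OF assms(1)])
  interpret two_atlases B "C t" by unfold_locales (rule assms(2))
  show "P_map B (C t) p q s \<in> smooth_forms B (C t) p q"
    "delbar B (C t) (P_map B (C t) p q s) = P_map B (C t) p (Suc q) (delbar B B s - L10 B (beltrami (C t)) s)"
    using delbar_P_map[OF assms(3)] by auto
qed

end

theorem theorem1p2:
  fixes A :: "('x::{t2_space,second_countable_topology},
                complex^('n::{finite,linorder} + 'm::finite)) chart set"
    and \<Delta> :: "(complex^'m) set"
    and \<pi> :: "'x \<Rightarrow> complex^'m"
    and \<sigma> :: "'x \<Rightarrow> 'x"
  assumes "holomorphic_family A \<Delta> \<pi>"
    and "0 \<in> \<Delta>"
    and "transversely_holomorphic_trivialization A \<Delta> \<pi> \<sigma>"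
  shows "let B = slice_charts UNIV A (\<pi> -` {0});
             C = fibre_charts A \<pi> \<sigma>
         in (\<exists>\<Delta>'\<subseteq>\<Delta>. open \<Delta>' \<and> 0 \<in> \<Delta>' \<and> (\<forall>t\<in>\<Delta>'. pi10_iso B (C t))) \<and>
            (\<forall>t\<in>\<Delta>. pi10_iso B (C t) \<longrightarrow>
               (\<forall>p q. \<forall>s\<in>smooth_forms B B p q.
                  P_map B (C t) p q s \<in> smooth_forms B (C t) p q \<and>
                  delbar B (C t) (P_map B (C t) p q s) =
                    P_map B (C t) p (Suc q) (delbar B B s - L10 B (beltrami (C t)) s)))"
proof -
  interpret family A \<Delta> \<pi> \<sigma> by unfold_locales (rule assms)+
  show ?thesis unfolding Let_def using nondegeneracy delbar_P by blast
qed

end
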